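(* Let $G=(L\cup R,E)$ be a bipartite graph with $n$ vertices, $m$ edges and positive edge weights all at most $\mathrm{poly}(n)$. For every $\varepsilon>0$ there exists a shared-memory parallel algorithm using $O\!\left(\frac{m\log n}{\varepsilon^7}\right)$ work and $O\!\left(\frac{\log^3 n}{\varepsilon^7}\right)$ depth that computes a $(1-\varepsilon)$-approximate maximum weight bipartite matching of $G$.
   Context: A matching is a set of vertex-disjoint edges; its weight is the sum of its edge weights. A $(1-\varepsilon)$-approximate maximum weight matching has weight at least $(1-\varepsilon)$ times the maximum matching weight. Shared-memory work-depth model: work is the total number of operations performed, depth is the length of the longest chain of sequential dependencies. *)

theory Defs
  imports Complex_Main "HOL-Computational_Algebra.Polynomial"
begin

section \<open>Weighted bipartite matching\<close>

text \<open>
  The vertices are \<open>0, \<dots>, n - 1\<close>. An edge is represented by the pair of its endpoints, the one in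
  \<open>L\<close> first; since \<open>L\<close> and \<open>R\<close> are disjoint, this representation is unique and there are no parallel
  edges.
\<close>

definition bipartite_graph :: "nat \<Rightarrow> nat set \<Rightarrow> nat set \<Rightarrow> (nat \<times> nat) set \<Rightarrow> bool" where
  "bipartite_graph n L R E \<longleftrightarrow> L \<inter> R = {} \<and> L \<union> R = {..<n} \<and> E \<subseteq> L \<times> R"

definition is_matching :: "(nat \<times> nat) set \<Rightarrow> (nat \<times> nat) set \<Rightarrow> bool" where
  "is_matching E M \<longleftrightarrow> M \<subseteq> E \<and>
     (\<forall>e\<in>M. \<forall>f\<in>M. e \<noteq> f \<longrightarrow> {fst e, snd e} \<inter> {fst f, snd f} = {})"

definition matching_weight :: "(nat \<times> nat \<Rightarrow> real) \<Rightarrow> (nat \<times> nat) set \<Rightarrow> real" where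
  "matching_weight w M = (\<Sum>e\<in>M. w e)"

definition max_matching_weight :: "(nat \<times> nat) set \<Rightarrow> (nat \<times> nat \<Rightarrow> real) \<Rightarrow> real" where
  "max_matching_weight E w = Max (matching_weight w ` {M. is_matching E M})"

definition approx_max_weight_matching ::
  "real \<Rightarrow> (nat \<times> nat) set \<Rightarrow> (nat \<times> nat \<Rightarrow> real) \<Rightarrow> (nat \<times> nat) set \<Rightarrow> bool" where
  "approx_max_weight_matching \<epsilon> E w M \<longleftrightarrow>
     is_matching E M \<and> matching_weight w M \<ge> (1 - \<epsilon>) * max_matching_weight E w"


section \<open>A shared-memory work-depth machine\<close>

text \<open>
  Algorithms are programs of a fork-join language over a shared memory, with concurrent reads and
  exclusive writes. Following the word/real RAM convention there are two kinds of data: integer words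
  of \<open>b\<close> bits, used for indices and combinatorial data, and exact reals, used for weights. Reals
  admit field operations and comparisons only. They cannot be rounded to words, and no real constants
  are available except those computed from words; hence real arithmetic can neither simulate
  operations on long bit strings nor smuggle in advice.

  The shared memory consists of arrays. Array names are part of the program text, only the index
  into an array is computed. Each strand has private registers.
\<close>

datatype iexp =
    Const int
  | IReg nat
  | IAdd iexp iexp
  | ISub iexp iexp
  | IMul iexp iexp
  | IDiv iexp iexp
  | IMod iexp iexp

datatype rexp =
    RReg nat
  | OfInt iexp
  | RAdd rexp rexp
  | RSub rexp rexp
  | RMul rexp rexp
  | RDiv rexp rexp

datatype bexp =
    ILess iexp iexp
  | IEq iexp iexp
  | RLess rexp rexp
  | BNot bexp
  | BAnd bexp bexp

datatype cmd =
    Skip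
  | IAssign nat iexp
  | RAssign nat rexp
  | ILoad nat nat iexp     \<comment> \<open>target register, array, index\<close>
  | RLoad nat nat iexp
  | IStore nat iexp iexp   \<comment> \<open>array, index, value\<close>
  | RStore nat iexp rexp
  | Seq cmd cmd
  | Cond bexp cmd cmd
  | While bexp cmd
  | ParFor nat iexp cmd    \<comment> \<open>index register, number of strands, body\<close>

record regs =
  ireg :: "nat \<Rightarrow> int"
  rreg :: "nat \<Rightarrow> real"

record mem =
  imem :: "nat \<Rightarrow> nat \<Rightarrow> int"
  rmem :: "nat \<Rightarrow> nat \<Rightarrow> real"

datatype cell = ICell nat nat | RCell nat nat

definition fits :: "nat \<Rightarrow> int \<Rightarrow> bool" where
  "fits b v \<longleftrightarrow> \<bar>v\<bar> < 2 ^ b"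

fun ival :: "regs \<Rightarrow> iexp \<Rightarrow> int" where
  "ival s (Const c) = c"
| "ival s (IReg x) = ireg s x"
| "ival s (IAdd e f) = ival s e + ival s f"
| "ival s (ISub e f) = ival s e - ival s f"
| "ival s (IMul e f) = ival s e * ival s f"
| "ival s (IDiv e f) = ival s e div ival s f"
| "ival s (IMod e f) = ival s e mod ival s f"

fun rval :: "regs \<Rightarrow> rexp \<Rightarrow> real" where
  "rval s (RReg x) = rreg s x"
| "rval s (OfInt e) = of_int (ival s e)"
| "rval s (RAdd e f) = rval s e + rval s f"
| "rval s (RSub e f) = rval s e - rval s f"
| "rval s (RMul e f) = rval s e * rval s f"
| "rval s (RDiv e f) = rval s e / rval s f"

fun bval :: "regs \<Rightarrow> bexp \<Rightarrow> bool" where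
  "bval s (ILess e f) \<longleftrightarrow> ival s e < ival s f"
| "bval s (IEq e f) \<longleftrightarrow> ival s e = ival s f"
| "bval s (RLess e f) \<longleftrightarrow> rval s e < rval s f"
| "bval s (BNot c) \<longleftrightarrow> \<not> bval s c"
| "bval s (BAnd c d) \<longleftrightarrow> bval s c \<and> bval s d"

text \<open>Every word occurring in the evaluation, intermediate results included, has to fit.\<close>

fun ifits :: "nat \<Rightarrow> regs \<Rightarrow> iexp \<Rightarrow> bool" where
  "ifits b s (Const c) \<longleftrightarrow> fits b c"
| "ifits b s (IReg x) \<longleftrightarrow> fits b (ireg s x)"
| "ifits b s (IAdd e f) \<longleftrightarrow> ifits b s e \<and> ifits b s f \<and> fits b (ival s (IAdd e f))"
| "ifits b s (ISub e f) \<longleftrightarrow> ifits b s e \<and> ifits b s f \<and> fits b (ival s (ISub e f))"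
| "ifits b s (IMul e f) \<longleftrightarrow> ifits b s e \<and> ifits b s f \<and> fits b (ival s (IMul e f))"
| "ifits b s (IDiv e f) \<longleftrightarrow> ifits b s e \<and> ifits b s f \<and> fits b (ival s (IDiv e f))"
| "ifits b s (IMod e f) \<longleftrightarrow> ifits b s e \<and> ifits b s f \<and> fits b (ival s (IMod e f))"

fun rfits :: "nat \<Rightarrow> regs \<Rightarrow> rexp \<Rightarrow> bool" where
  "rfits b s (RReg x) \<longleftrightarrow> True"
| "rfits b s (OfInt e) \<longleftrightarrow> ifits b s e"
| "rfits b s (RAdd e f) \<longleftrightarrow> rfits b s e \<and> rfits b s f"
| "rfits b s (RSub e f) \<longleftrightarrow> rfits b s e \<and> rfits b s f"
| "rfits b s (RMul e f) \<longleftrightarrow> rfits b s e \<and> rfits b s f"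
| "rfits b s (RDiv e f) \<longleftrightarrow> rfits b s e \<and> rfits b s f"

fun bfits :: "nat \<Rightarrow> regs \<Rightarrow> bexp \<Rightarrow> bool" where
  "bfits b s (ILess e f) \<longleftrightarrow> ifits b s e \<and> ifits b s f"
| "bfits b s (IEq e f) \<longleftrightarrow> ifits b s e \<and> ifits b s f"
| "bfits b s (RLess e f) \<longleftrightarrow> rfits b s e \<and> rfits b s f"
| "bfits b s (BNot c) \<longleftrightarrow> bfits b s c"
| "bfits b s (BAnd c d) \<longleftrightarrow> bfits b s c \<and> bfits b s d"

text \<open>
  Programs may depend on the accuracy \<open>\<epsilon>\<close>, so the size of an expression is not a universal
  constant and every operation in it has to be charged.
\<close>

fun iops :: "iexp \<Rightarrow> nat" where
  "iops (Const c) = 0"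
| "iops (IReg x) = 0"
| "iops (IAdd e f) = 1 + iops e + iops f"
| "iops (ISub e f) = 1 + iops e + iops f"
| "iops (IMul e f) = 1 + iops e + iops f"
| "iops (IDiv e f) = 1 + iops e + iops f"
| "iops (IMod e f) = 1 + iops e + iops f"

fun rops :: "rexp \<Rightarrow> nat" where
  "rops (RReg x) = 0"
| "rops (OfInt e) = 1 + iops e"
| "rops (RAdd e f) = 1 + rops e + rops f"
| "rops (RSub e f) = 1 + rops e + rops f"
| "rops (RMul e f) = 1 + rops e + rops f"
| "rops (RDiv e f) = 1 + rops e + rops f"

fun bops :: "bexp \<Rightarrow> nat" where
  "bops (ILess e f) = 1 + iops e + iops f"
| "bops (IEq e f) = 1 + iops e + iops f"
| "bops (RLess e f) = 1 + rops e + rops f"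
| "bops (BNot c) = 1 + bops c"
| "bops (BAnd c d) = 1 + bops c + bops d"

text \<open>
  No strand may access a cell that a strand running in parallel to it writes. For such programs all
  interleavings of the strands have the same effect, so that the outcome can be computed by running
  each strand on the memory at the fork and collecting the written cells at the join.
\<close>

definition race_free :: "nat \<Rightarrow> (nat \<Rightarrow> cell set) \<Rightarrow> (nat \<Rightarrow> cell set) \<Rightarrow> bool" where
  "race_free k Rd Wr \<longleftrightarrow> (\<forall>i<k. \<forall>j<k. i \<noteq> j \<longrightarrow> Wr i \<inter> (Rd j \<union> Wr j) = {})"

definition join :: "nat \<Rightarrow> mem \<Rightarrow> (nat \<Rightarrow> mem) \<Rightarrow> (nat \<Rightarrow> cell set) \<Rightarrow> mem" where
  "join k \<mu> \<mu>' Wr = \<lparr>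
     imem = (\<lambda>a j. if \<exists>i<k. ICell a j \<in> Wr i
                    then imem (\<mu>' (THE i. i < k \<and> ICell a j \<in> Wr i)) a j else imem \<mu> a j),
     rmem = (\<lambda>a j. if \<exists>i<k. RCell a j \<in> Wr i
                    then rmem (\<mu>' (THE i. i < k \<and> RCell a j \<in> Wr i)) a j else rmem \<mu> a j)\<rparr>"

text \<open>
  \<open>exec b c (s, \<mu>) (s', \<mu>') (W, D) (Rd, Wr)\<close>: with \<open>b\<close>-bit words, the program \<open>c\<close> terminates from
  registers \<open>s\<close> and memory \<open>\<mu>\<close> in \<open>s'\<close> and \<open>\<mu>'\<close>; it performs \<open>W\<close> operations in total, the longest
  chain of sequentially dependent operations has length \<open>D\<close>, and \<open>Rd\<close> and \<open>Wr\<close> are the shared cells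
  read and written. Word overflows, negative array indices and races are errors, in the sense that
  there is no execution. Strands start with a copy of the registers of their parent, and their own
  registers are lost at the join; each strand is charged one operation for its creation.
\<close>

inductive exec ::
  "nat \<Rightarrow> cmd \<Rightarrow> regs \<times> mem \<Rightarrow> regs \<times> mem \<Rightarrow> nat \<times> nat \<Rightarrow> cell set \<times> cell set \<Rightarrow> bool" for b
where
  exec_Skip:
    "exec b Skip (s, \<mu>) (s, \<mu>) (1, 1) ({}, {})"
| exec_IAssign:
    "ifits b s e \<Longrightarrow>
     exec b (IAssign x e) (s, \<mu>) (s\<lparr>ireg := (ireg s)(x := ival s e)\<rparr>, \<mu>)
       (1 + iops e, 1 + iops e) ({}, {})"
| exec_RAssign:
    "rfits b s e \<Longrightarrow>
     exec b (RAssign x e) (s, \<mu>) (s\<lparr>rreg := (rreg s)(x := rval s e)\<rparr>, \<mu>)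
       (1 + rops e, 1 + rops e) ({}, {})"
| exec_ILoad:
    "ifits b s e \<Longrightarrow> 0 \<le> ival s e \<Longrightarrow> j = nat (ival s e) \<Longrightarrow>
     exec b (ILoad x a e) (s, \<mu>) (s\<lparr>ireg := (ireg s)(x := imem \<mu> a j)\<rparr>, \<mu>)
       (1 + iops e, 1 + iops e) ({ICell a j}, {})"
| exec_RLoad:
    "ifits b s e \<Longrightarrow> 0 \<le> ival s e \<Longrightarrow> j = nat (ival s e) \<Longrightarrow>
     exec b (RLoad x a e) (s, \<mu>) (s\<lparr>rreg := (rreg s)(x := rmem \<mu> a j)\<rparr>, \<mu>)
       (1 + iops e, 1 + iops e) ({RCell a j}, {})"
| exec_IStore:
    "ifits b s e \<Longrightarrow> 0 \<le> ival s e \<Longrightarrow> j = nat (ival s e) \<Longrightarrow> ifits b s f \<Longrightarrow>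
     exec b (IStore a e f) (s, \<mu>)
       (s, \<mu>\<lparr>imem := (imem \<mu>)(a := (imem \<mu> a)(j := ival s f))\<rparr>)
       (1 + iops e + iops f, 1 + iops e + iops f) ({}, {ICell a j})"
| exec_RStore:
    "ifits b s e \<Longrightarrow> 0 \<le> ival s e \<Longrightarrow> j = nat (ival s e) \<Longrightarrow> rfits b s f \<Longrightarrow>
     exec b (RStore a e f) (s, \<mu>)
       (s, \<mu>\<lparr>rmem := (rmem \<mu>)(a := (rmem \<mu> a)(j := rval s f))\<rparr>)
       (1 + iops e + rops f, 1 + iops e + rops f) ({}, {RCell a j})"
| exec_Seq:
    "exec b c1 \<sigma> \<sigma>1 (W1, D1) (Rd1, Wr1) \<Longrightarrow> exec b c2 \<sigma>1 \<sigma>2 (W2, D2) (Rd2, Wr2) \<Longrightarrow>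
     exec b (Seq c1 c2) \<sigma> \<sigma>2 (W1 + W2, D1 + D2) (Rd1 \<union> Rd2, Wr1 \<union> Wr2)"
| exec_If:
    "bfits b s t \<Longrightarrow> exec b (if bval s t then c1 else c2) (s, \<mu>) \<sigma>' (W, D) (Rd, Wr) \<Longrightarrow>
     exec b (Cond t c1 c2) (s, \<mu>) \<sigma>' (1 + bops t + W, 1 + bops t + D) (Rd, Wr)"
| exec_While_False:
    "bfits b s t \<Longrightarrow> \<not> bval s t \<Longrightarrow>
     exec b (While t c) (s, \<mu>) (s, \<mu>) (1 + bops t, 1 + bops t) ({}, {})"
| exec_While_True:
    "bfits b s t \<Longrightarrow> bval s t \<Longrightarrow>
     exec b c (s, \<mu>) \<sigma>1 (W1, D1) (Rd1, Wr1) \<Longrightarrow>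
     exec b (While t c) \<sigma>1 \<sigma>2 (W2, D2) (Rd2, Wr2) \<Longrightarrow>
     exec b (While t c) (s, \<mu>) \<sigma>2
       (1 + bops t + W1 + W2, 1 + bops t + D1 + D2) (Rd1 \<union> Rd2, Wr1 \<union> Wr2)"
| exec_ParFor:
    "ifits b s e \<Longrightarrow> k = nat (ival s e) \<Longrightarrow>
     (\<And>i. i < k \<Longrightarrow>
        exec b c (s\<lparr>ireg := (ireg s)(x := int i)\<rparr>, \<mu>) (s' i, \<mu>' i) (W i, D i) (Rd i, Wr i)) \<Longrightarrow>
     race_free k Rd Wr \<Longrightarrow>
     exec b (ParFor x e c) (s, \<mu>) (s, join k \<mu> \<mu>' Wr)
       (1 + iops e + (\<Sum>i<k. 1 + W i), 1 + iops e + Max (insert 0 ((\<lambda>i. 1 + D i) ` {..<k})))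
       (\<Union>i<k. Rd i, \<Union>i<k. Wr i)"

inductive_cases exec_SkipE: "exec b Skip \<sigma> \<sigma>' C F"
inductive_cases exec_IAssignE: "exec b (IAssign x e) \<sigma> \<sigma>' C F"
inductive_cases exec_RAssignE: "exec b (RAssign x e) \<sigma> \<sigma>' C F"
inductive_cases exec_ILoadE: "exec b (ILoad x a e) \<sigma> \<sigma>' C F"
inductive_cases exec_RLoadE: "exec b (RLoad x a e) \<sigma> \<sigma>' C F"
inductive_cases exec_IStoreE: "exec b (IStore a e f) \<sigma> \<sigma>' C F"
inductive_cases exec_RStoreE: "exec b (RStore a e f) \<sigma> \<sigma>' C F"
inductive_cases exec_SeqE: "exec b (Seq c d) \<sigma> \<sigma>' C F"
inductive_cases exec_IfE: "exec b (Cond t c d) \<sigma> \<sigma>' C F"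
inductive_cases exec_WhileE: "exec b (While t c) \<sigma> \<sigma>' C F"
inductive_cases exec_ParForE: "exec b (ParFor x e c) \<sigma> \<sigma>' C F"

lemma join_cong:
  assumes "\<And>i. i < k \<Longrightarrow> \<mu>1 i = \<mu>2 i" "\<And>i. i < k \<Longrightarrow> Wr1 i = Wr2 i" "race_free k Rd Wr1"
  shows "join k \<mu> \<mu>1 Wr1 = join k \<mu> \<mu>2 Wr2"
proof -
  have same: "(i < k \<and> c \<in> Wr2 i) = (i < k \<and> c \<in> Wr1 i)" for i c
    using assms(2) by auto
  have the: "\<mu>1 (THE i. i < k \<and> c \<in> Wr1 i) = \<mu>2 (THE i. i < k \<and> c \<in> Wr1 i)"
    if "\<exists>i<k. c \<in> Wr1 i" for c
  proof -
    from that obtain i where i: "i < k" "c \<in> Wr1 i" by blast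
    have "(THE i. i < k \<and> c \<in> Wr1 i) = i"
      using i assms(3) unfolding race_free_def by (intro the_equality) blast+
    then show ?thesis using assms(1) i by simp
  qed
  show ?thesis
    unfolding join_def same by (auto simp: fun_eq_iff the)
qed

text \<open>
  Executions are deterministic, so the existence of an execution with some property says that the
  program terminates and that its run has this property.
\<close>

lemma exec_deterministic:
  "exec b c \<sigma> \<sigma>1 C1 F1 \<Longrightarrow> exec b c \<sigma> \<sigma>2 C2 F2 \<Longrightarrow> \<sigma>1 = \<sigma>2 \<and> C1 = C2 \<and> F1 = F2"
proof (induction arbitrary: \<sigma>2 C2 F2 rule: exec.induct)
  case (exec_Skip s \<mu>)
  then show ?case by (auto elim: exec_SkipE)
next
  case (exec_IAssign s e x \<mu>)
  then show ?case by (auto elim: exec_IAssignE)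
next
  case (exec_RAssign s e x \<mu>)
  then show ?case by (auto elim: exec_RAssignE)
next
  case (exec_ILoad s e j x a \<mu>)
  then show ?case by (auto elim: exec_ILoadE)
next
  case (exec_RLoad s e j x a \<mu>)
  then show ?case by (auto elim: exec_RLoadE)
next
  case (exec_IStore s e j f a \<mu>)
  then show ?case by (auto elim: exec_IStoreE)
next
  case (exec_RStore s e j f a \<mu>)
  then show ?case by (auto elim: exec_RStoreE)
next
  case (exec_Seq c1 \<sigma> \<sigma>1 W1 D1 Rd1 Wr1 c2 \<sigma>2' W2 D2 Rd2 Wr2)
  show ?case
  proof -
    from exec_Seq.prems obtain \<sigma>1' W1' D1' Rd1' Wr1' W2' D2' Rd2' Wr2'
      where eqs: "C2 = (W1' + W2', D1' + D2')" "F2 = (Rd1' \<union> Rd2', Wr1' \<union> Wr2')"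
        and e1: "exec b c1 \<sigma> \<sigma>1' (W1', D1') (Rd1', Wr1')"
        and e2: "exec b c2 \<sigma>1' \<sigma>2 (W2', D2') (Rd2', Wr2')"
      by (rule exec_SeqE) (rule that)
    note d1 = exec_Seq.IH(1)[OF e1]
    with e2 have "exec b c2 \<sigma>1 \<sigma>2 (W2', D2') (Rd2', Wr2')" by simp
    from exec_Seq.IH(2)[OF this] d1 eqs show ?thesis by simp
  qed
next
  case (exec_If s t c1 c2 \<mu> \<sigma>' W D Rd Wr)
  show ?case
    using exec_If.prems by (rule exec_IfE) (auto dest!: exec_If.IH)
next
  case (exec_While_False s t c \<mu>)
  show ?case
    using exec_While_False.prems by (rule exec_WhileE) (use exec_While_False.hyps in auto)
next
  case (exec_While_True s t c \<mu> \<sigma>1 W1 D1 Rd1 Wr1 \<sigma>2' W2 D2 Rd2 Wr2)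
  show ?case
  proof -
    from exec_While_True.prems obtain \<sigma>1' W1' D1' Rd1' Wr1' W2' D2' Rd2' Wr2'
      where eqs: "C2 = (1 + bops t + W1' + W2', 1 + bops t + D1' + D2')"
          "F2 = (Rd1' \<union> Rd2', Wr1' \<union> Wr2')"
        and e1: "exec b c (s, \<mu>) \<sigma>1' (W1', D1') (Rd1', Wr1')"
        and e2: "exec b (While t c) \<sigma>1' \<sigma>2 (W2', D2') (Rd2', Wr2')"
    proof (rule exec_WhileE, goal_cases)
      case 1
      then show ?case using exec_While_True.hyps by simp
    next
      case prems: 2
      show ?case by (rule prems(1)) (use prems in simp_all)
    qed
    note d1 = exec_While_True.IH(1)[OF e1]
    with e2 have "exec b (While t c) \<sigma>1 \<sigma>2 (W2', D2') (Rd2', Wr2')" by simp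
    from exec_While_True.IH(2)[OF this] d1 eqs show ?thesis by simp
  qed
next
  case (exec_ParFor s e k c x \<mu> s' \<mu>' W D Rd Wr)
  show ?case
  proof -
    from exec_ParFor.prems obtain s0' \<mu>0' W0 D0 Rd0 Wr0
      where 1: "\<sigma>2 = (s, join k \<mu> \<mu>0' Wr0)"
          "C2 = (1 + iops e + (\<Sum>i<k. 1 + W0 i), 1 + iops e + Max (insert 0 ((\<lambda>i. 1 + D0 i) ` {..<k})))"
          "F2 = (\<Union>i<k. Rd0 i, \<Union>i<k. Wr0 i)"
        and e0: "\<And>i. i < k \<Longrightarrow>
          exec b c (s\<lparr>ireg := (ireg s)(x := int i)\<rparr>, \<mu>) (s0' i, \<mu>0' i) (W0 i, D0 i) (Rd0 i, Wr0 i)"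
    proof (rule exec_ParForE, goal_cases)
      case prems: 1
      show ?case by (rule prems(1)) (use prems exec_ParFor.hyps in simp_all)
    qed
    have eq: "\<mu>' i = \<mu>0' i \<and> W i = W0 i \<and> D i = D0 i \<and> Rd i = Rd0 i \<and> Wr i = Wr0 i"
      if "i < k" for i
      using exec_ParFor.IH[OF that e0[OF that]] by simp
    have "join k \<mu> \<mu>' Wr = join k \<mu> \<mu>0' Wr0"
      using eq exec_ParFor.hyps by (intro join_cong) auto
    moreover have "(\<Sum>i<k. 1 + W i) = (\<Sum>i<k. 1 + W0 i)"
      using eq by (intro sum.cong) auto
    moreover have "(\<lambda>i. 1 + D i) ` {..<k} = (\<lambda>i. 1 + D0 i) ` {..<k}"
      using eq by (intro image_cong) auto
    moreover have "(\<Union>i<k. Rd i) = (\<Union>i<k. Rd0 i)" "(\<Union>i<k. Wr i) = (\<Union>i<k. Wr0 i)"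
      using eq by auto
    ultimately show ?thesis using 1 by simp
  qed
qed


section \<open>Input and output\<close>

text \<open>
  The graph is given as a list of edges in arbitrary order, \<open>n\<close> and \<open>m\<close> in word array 0, the
  endpoints in \<open>L\<close> and \<open>R\<close> in word arrays 1 and 2, and the weights in real array 0. All other cells
  and all registers are initially 0. The output is the set of edges flagged with 1 in word array 3.
\<close>

definition init_regs :: regs where
  "init_regs = \<lparr>ireg = (\<lambda>_. 0), rreg = (\<lambda>_. 0)\<rparr>"

definition input_mem :: "nat \<Rightarrow> (nat \<times> nat) list \<Rightarrow> (nat \<times> nat \<Rightarrow> real) \<Rightarrow> mem" where
  "input_mem n es w = \<lparr>
     imem = (\<lambda>a j.
       if a = 0 \<and> j = 0 then int n
       else if a = 0 \<and> j = 1 then int (length es)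
       else if a = 1 \<and> j < length es then int (fst (es ! j))
       else if a = 2 \<and> j < length es then int (snd (es ! j))
       else 0),
     rmem = (\<lambda>a j. if a = 0 \<and> j < length es then w (es ! j) else 0)\<rparr>"

definition output_edges :: "(nat \<times> nat) list \<Rightarrow> mem \<Rightarrow> (nat \<times> nat) set" where
  "output_edges es \<mu> = {es ! i | i. i < length es \<and> imem \<mu> 3 i = 1}"

text \<open>Words of \<open>O(log (n + 1/\<epsilon>))\<close> bits, with the constant \<open>d\<close>.\<close>

definition word_bits :: "nat \<Rightarrow> nat \<Rightarrow> real \<Rightarrow> nat" where
  "word_bits d n \<epsilon> = d * nat \<lceil>log 2 (real n + 2 + 1 / \<epsilon>)\<rceil>"

text \<open>
  The program \<open>P\<close> computes a \<open>(1 - \<epsilon>)\<close>-approximate maximum weight matching of the given graph with at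
  most \<open>Wmax\<close> work and \<open>Dmax\<close> depth, however the edges are listed.
\<close>

definition computes_approx_mwm ::
  "nat \<Rightarrow> cmd \<Rightarrow> real \<Rightarrow> nat \<Rightarrow> (nat \<times> nat) set \<Rightarrow> (nat \<times> nat \<Rightarrow> real) \<Rightarrow> real \<Rightarrow> real \<Rightarrow> bool" where
  "computes_approx_mwm b P \<epsilon> n E w Wmax Dmax \<longleftrightarrow>
     (\<forall>es. distinct es \<and> set es = E \<longrightarrow>
       (\<exists>s' \<mu>' W D Rd Wr.
          exec b P (init_regs, input_mem n es w) (s', \<mu>') (W, D) (Rd, Wr) \<and>
          approx_max_weight_matching \<epsilon> E w (output_edges es \<mu>') \<and>
          real W \<le> Wmax \<and> real D \<le> Dmax))"

end

(*
  Let q be 6/eps, rounded up. Up to a factor 1 - 1/q, the weights are the total weight times powers of 1 - 1/q,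
  except that tiny weights are raised so that there are only O(q (q + log n)) classes; radix sort then orders
  the incident edges of every vertex by weight.

  A multiplicative weights method then finds a fractional matching in O(q^2 log n) rounds. In every round each
  vertex keeps its heaviest incident edges up to total amount 1; its price is the weight of the edge at which
  the amount exceeds 1, and an edge grows or shrinks at a rate given by its weight relative to the prices of
  its ends. The potential is a relative entropy in which each edge counts with its weight. This is what makes
  the number of rounds independent of the ratio of the largest to the smallest weight.

  The average of the rounds is scaled by a power of 2 to an integral vector of load at most 2^J and rounded to
  load 1 by halving it J times. To halve, pair up the edges with odd values at every vertex: this gives paths
  and even cycles, whose edges are alternately rounded up and down, and of the two possibilities the one
  losing no weight is taken. The initial values are rounded to multiples of a power of 2 depending on the
  degrees of the ends, so that few edges are odd in the early halvings and all halvings together handle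
  only O(q m) odd edges.
*)
theory Submission
  imports Defs
begin

text \<open>The 6 in \<open>6/eps\<close> counts losses of \<open>1/q\<close>: one from rounding
  weights to classes, one from raising tiny weights, two from the second-order term of the logarithm
  in a round of multiplicative weights, one from the initial potential, and one from the scaling
  that makes room for rounding values up. Reals of the machine cannot be turned into words, so every
  passage from weights or amounts to integers is a search by comparisons. Writes are exclusive, so
  the edges at a vertex cannot all update it; instead they occupy a segment of one sorted list of
  half-edges, sums over a segment are differences of global prefix sums, and a single distinguished
  position writes the result. The alternating rounding of a path needs a consistent choice along the
  path, which is found by pointer jumping. This costs a logarithmic factor per participating edge,
  too much if all edges took part in each of the logarithmically many halvings; hence the bound on
  the total number of odd edges. Costs are tracked with explicit constants throughout.\<close>

abbreviation seq_cmd :: "cmd \<Rightarrow> cmd \<Rightarrow> cmd" (infixr ";;" 60) where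
  "c ;; d \<equiv> Seq c d"

section \<open>Weakest preconditions\<close>

definition agree :: "cell set \<Rightarrow> mem \<Rightarrow> mem \<Rightarrow> bool" where
  "agree A \<mu> \<nu> \<longleftrightarrow> (\<forall>a j. (ICell a j \<in> A \<longrightarrow> imem \<mu> a j = imem \<nu> a j) \<and>
                        (RCell a j \<in> A \<longrightarrow> rmem \<mu> a j = rmem \<nu> a j))"

lemma exec_agree:
  "exec b c \<sigma> \<sigma>' C F \<Longrightarrow> agree (- snd F) (snd \<sigma>') (snd \<sigma>)"
proof (induction rule: exec.induct)
  case (exec_ParFor s e k c x \<mu> s' \<mu>' W D Rd Wr)
  show ?case
    unfolding agree_def snd_conv join_def by auto
qed (auto simp: agree_def)

text \<open>Every dependency chain consists of counted operations. Thanks to this, the body of a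
  parallel loop needs a work bound only.\<close>

lemma exec_depth_le_work: "exec b c \<sigma> \<sigma>' C F \<Longrightarrow> snd C \<le> fst C"
proof (induction rule: exec.induct)
  case (exec_ParFor s e k c x \<mu> s' \<mu>' W D Rd Wr)
  have "Max (insert 0 ((\<lambda>i. 1 + D i) ` {..<k})) \<le> (\<Sum>i<k. 1 + W i)"
  proof (rule Max.boundedI)
    fix a assume "a \<in> insert 0 ((\<lambda>i. 1 + D i) ` {..<k})"
    then consider "a = 0" | i where "i < k" "a = 1 + D i" by auto
    then show "a \<le> (\<Sum>i<k. 1 + W i)"
    proof cases
      case 2
      with exec_ParFor.IH[of i] have "a \<le> 1 + W i" by simp
      also have "\<dots> \<le> (\<Sum>i<k. 1 + W i)" using 2 by (intro member_le_sum) auto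
      finally show ?thesis .
    qed simp
  qed auto
  then show ?case by simp
qed auto

text \<open>A syntactic over-approximation of what may change. \<open>ParFor\<close> contributes no
  register because strands lose theirs at the join. Real registers are not tracked: no frame
  argument concerns them.\<close>

fun ivars :: "cmd \<Rightarrow> nat set" where
  "ivars (IAssign x e) = {x}"
| "ivars (ILoad x a e) = {x}"
| "ivars (Seq c d) = ivars c \<union> ivars d"
| "ivars (Cond t c d) = ivars c \<union> ivars d"
| "ivars (While t c) = ivars c"
| "ivars _ = {}"

fun iarrs :: "cmd \<Rightarrow> nat set" where
  "iarrs (IStore a e f) = {a}"
| "iarrs (Seq c d) = iarrs c \<union> iarrs d"
| "iarrs (Cond t c d) = iarrs c \<union> iarrs d"
| "iarrs (While t c) = iarrs c"
| "iarrs (ParFor x e c) = iarrs c"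
| "iarrs _ = {}"

fun rarrs :: "cmd \<Rightarrow> nat set" where
  "rarrs (RStore a e f) = {a}"
| "rarrs (Seq c d) = rarrs c \<union> rarrs d"
| "rarrs (Cond t c d) = rarrs c \<union> rarrs d"
| "rarrs (While t c) = rarrs c"
| "rarrs (ParFor x e c) = rarrs c"
| "rarrs _ = {}"

definition same :: "cmd \<Rightarrow> regs \<Rightarrow> mem \<Rightarrow> regs \<Rightarrow> mem \<Rightarrow> bool" where
  "same c s \<mu> s' \<mu>' \<longleftrightarrow> (\<forall>x. x \<notin> ivars c \<longrightarrow> ireg s' x = ireg s x) \<and>
     (\<forall>a. a \<notin> iarrs c \<longrightarrow> imem \<mu>' a = imem \<mu> a) \<and> (\<forall>a. a \<notin> rarrs c \<longrightarrow> rmem \<mu>' a = rmem \<mu> a)"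

lemma sameD:
  assumes "same c s \<mu> s' \<mu>'"
  shows "x \<notin> ivars c \<Longrightarrow> ireg s' x = ireg s x"
    "a \<notin> iarrs c \<Longrightarrow> imem \<mu>' a = imem \<mu> a" "a \<notin> rarrs c \<Longrightarrow> rmem \<mu>' a = rmem \<mu> a"
  using assms by (auto simp: same_def)

lemma exec_written_arrays:
  "exec b c \<sigma> \<sigma>' C F \<Longrightarrow> snd F \<subseteq> {ICell a j | a j. a \<in> iarrs c} \<union> {RCell a j | a j. a \<in> rarrs c}"
proof (induction rule: exec.induct)
  case (exec_If s t c1 c2 \<mu> \<sigma>' W D Rd Wr)
  then show ?case by (cases "bval s t") auto
next
  case (exec_ParFor s e k c x \<mu> s' \<mu>' W D Rd Wr)
  then show ?case by (simp add: UN_subset_iff)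
qed auto

lemma exec_ivars:
  "exec b c \<sigma> \<sigma>' C F \<Longrightarrow> x \<notin> ivars c \<Longrightarrow> ireg (fst \<sigma>') x = ireg (fst \<sigma>) x"
proof (induction rule: exec.induct)
  case (exec_If s t c1 c2 \<mu> \<sigma>' W D Rd Wr)
  then show ?case by (cases "bval s t") auto
qed auto

lemma exec_same: "exec b c (s, \<mu>) (s', \<mu>') C F \<Longrightarrow> same c s \<mu> s' \<mu>'"
  using exec_agree[of b c "(s, \<mu>)" "(s', \<mu>')" C F] exec_written_arrays[of b c "(s, \<mu>)" "(s', \<mu>')" C F]
    exec_ivars[of b c "(s, \<mu>)" "(s', \<mu>')" C F]
  unfolding same_def agree_def by (auto simp: fun_eq_iff subset_iff)

text \<open>Total correctness, since executions are deterministic. The sets \<open>RS\<close> and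
  \<open>WS\<close> bound the cells read and written, which is what race freedom of a surrounding
  \<open>ParFor\<close> requires; outside parallel loops both are \<open>UNIV\<close>.\<close>

definition wp :: "nat \<Rightarrow> cell set \<Rightarrow> cell set \<Rightarrow> cmd \<Rightarrow> (regs \<Rightarrow> mem \<Rightarrow> nat \<Rightarrow> nat \<Rightarrow> bool) \<Rightarrow>
    regs \<Rightarrow> mem \<Rightarrow> bool" where
  "wp b RS WS c Q s \<mu> \<longleftrightarrow> (\<exists>s' \<mu>' W D Rd Wr. exec b c (s, \<mu>) (s', \<mu>') (W, D) (Rd, Wr) \<and>
     Rd \<subseteq> RS \<and> Wr \<subseteq> WS \<and> Q s' \<mu>' W D)"

lemma wpI:
  "exec b c (s, \<mu>) (s', \<mu>') (W, D) (Rd, Wr) \<Longrightarrow> Rd \<subseteq> RS \<Longrightarrow> Wr \<subseteq> WS \<Longrightarrow> Q s' \<mu>' W D \<Longrightarrow>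
   wp b RS WS c Q s \<mu>"
  unfolding wp_def by blast

text \<open>The rule of consequence, enriched by the frame information \<open>same\<close>, so that
  the specification of a phase mentions only what the phase changes.\<close>

lemma wp_mono:
  assumes "wp b RS WS c Q s \<mu>"
    and "\<And>s' \<mu>' W D. Q s' \<mu>' W D \<Longrightarrow> same c s \<mu> s' \<mu>' \<Longrightarrow> Q' s' \<mu>' W D"
  shows "wp b RS WS c Q' s \<mu>"
  using assms exec_same unfolding wp_def by blast

lemma wp_Skip: "wp b RS WS Skip Q s \<mu> \<longleftrightarrow> Q s \<mu> 1 1"
  unfolding wp_def by (auto elim!: exec_SkipE intro!: exI exec.intros)

lemma wp_IAssign: "wp b RS WS (IAssign x e) Q s \<mu> \<longleftrightarrow>
    ifits b s e \<and> Q (s\<lparr>ireg := (ireg s)(x := ival s e)\<rparr>) \<mu> (1 + iops e) (1 + iops e)"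
  unfolding wp_def by (auto elim!: exec_IAssignE intro!: exI exec_IAssign)

lemma wp_RAssign: "wp b RS WS (RAssign x e) Q s \<mu> \<longleftrightarrow>
    rfits b s e \<and> Q (s\<lparr>rreg := (rreg s)(x := rval s e)\<rparr>) \<mu> (1 + rops e) (1 + rops e)"
  unfolding wp_def by (auto elim!: exec_RAssignE intro!: exI exec_RAssign)

lemma wp_ILoad: "wp b RS WS (ILoad x a e) Q s \<mu> \<longleftrightarrow>
    ifits b s e \<and> 0 \<le> ival s e \<and> ICell a (nat (ival s e)) \<in> RS \<and>
    Q (s\<lparr>ireg := (ireg s)(x := imem \<mu> a (nat (ival s e)))\<rparr>) \<mu> (1 + iops e) (1 + iops e)"
proof
  show "wp b RS WS (ILoad x a e) Q s \<mu> \<Longrightarrow> ifits b s e \<and> 0 \<le> ival s e \<and> ICell a (nat (ival s e)) \<in> RS \<and>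
    Q (s\<lparr>ireg := (ireg s)(x := imem \<mu> a (nat (ival s e)))\<rparr>) \<mu> (1 + iops e) (1 + iops e)"
    unfolding wp_def by (auto elim!: exec_ILoadE)
qed (auto intro!: wpI[OF exec_ILoad])

lemma wp_RLoad: "wp b RS WS (RLoad x a e) Q s \<mu> \<longleftrightarrow>
    ifits b s e \<and> 0 \<le> ival s e \<and> RCell a (nat (ival s e)) \<in> RS \<and>
    Q (s\<lparr>rreg := (rreg s)(x := rmem \<mu> a (nat (ival s e)))\<rparr>) \<mu> (1 + iops e) (1 + iops e)"
proof
  show "wp b RS WS (RLoad x a e) Q s \<mu> \<Longrightarrow> ifits b s e \<and> 0 \<le> ival s e \<and> RCell a (nat (ival s e)) \<in> RS \<and>
    Q (s\<lparr>rreg := (rreg s)(x := rmem \<mu> a (nat (ival s e)))\<rparr>) \<mu> (1 + iops e) (1 + iops e)"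
    unfolding wp_def by (auto elim!: exec_RLoadE)
qed (auto intro!: wpI[OF exec_RLoad])

lemma wp_IStore: "wp b RS WS (IStore a e f) Q s \<mu> \<longleftrightarrow>
    ifits b s e \<and> 0 \<le> ival s e \<and> ifits b s f \<and> ICell a (nat (ival s e)) \<in> WS \<and>
    Q s (\<mu>\<lparr>imem := (imem \<mu>)(a := (imem \<mu> a)(nat (ival s e) := ival s f))\<rparr>)
      (1 + iops e + iops f) (1 + iops e + iops f)"
proof
  show "wp b RS WS (IStore a e f) Q s \<mu> \<Longrightarrow> ifits b s e \<and> 0 \<le> ival s e \<and> ifits b s f \<and>
    ICell a (nat (ival s e)) \<in> WS \<and>
    Q s (\<mu>\<lparr>imem := (imem \<mu>)(a := (imem \<mu> a)(nat (ival s e) := ival s f))\<rparr>)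
      (1 + iops e + iops f) (1 + iops e + iops f)"
    unfolding wp_def by (auto elim!: exec_IStoreE)
qed (auto intro!: wpI[OF exec_IStore])

lemma wp_RStore: "wp b RS WS (RStore a e f) Q s \<mu> \<longleftrightarrow>
    ifits b s e \<and> 0 \<le> ival s e \<and> rfits b s f \<and> RCell a (nat (ival s e)) \<in> WS \<and>
    Q s (\<mu>\<lparr>rmem := (rmem \<mu>)(a := (rmem \<mu> a)(nat (ival s e) := rval s f))\<rparr>)
      (1 + iops e + rops f) (1 + iops e + rops f)"
proof
  show "wp b RS WS (RStore a e f) Q s \<mu> \<Longrightarrow> ifits b s e \<and> 0 \<le> ival s e \<and> rfits b s f \<and>
    RCell a (nat (ival s e)) \<in> WS \<and>
    Q s (\<mu>\<lparr>rmem := (rmem \<mu>)(a := (rmem \<mu> a)(nat (ival s e) := rval s f))\<rparr>)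
      (1 + iops e + rops f) (1 + iops e + rops f)"
    unfolding wp_def by (auto elim!: exec_RStoreE)
qed (auto intro!: wpI[OF exec_RStore])

lemma wp_Seq: "wp b RS WS (Seq c d) Q s \<mu> \<longleftrightarrow>
    wp b RS WS c (\<lambda>s' \<mu>' W D. wp b RS WS d (\<lambda>s'' \<mu>'' W' D'. Q s'' \<mu>'' (W + W') (D + D')) s' \<mu>') s \<mu>"
proof
  assume "wp b RS WS (Seq c d) Q s \<mu>"
  then obtain s'' \<mu>'' W D Rd Wr where e: "exec b (Seq c d) (s, \<mu>) (s'', \<mu>'') (W, D) (Rd, Wr)"
    and sub: "Rd \<subseteq> RS" "Wr \<subseteq> WS" and q: "Q s'' \<mu>'' W D"
    unfolding wp_def by blast
  from e show "wp b RS WS c (\<lambda>s' \<mu>' W D. wp b RS WS d (\<lambda>s'' \<mu>'' W' D'. Q s'' \<mu>'' (W + W') (D + D')) s' \<mu>') s \<mu>"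
  proof (rule exec_SeqE, goal_cases)
    case (1 \<sigma>1 W1 D1 Rd1 Wr1 W2 D2 Rd2 Wr2)
    obtain s' \<mu>' where \<sigma>1: "\<sigma>1 = (s', \<mu>')" by (cases \<sigma>1)
    have "wp b RS WS d (\<lambda>s'' \<mu>'' W' D'. Q s'' \<mu>'' (W1 + W') (D1 + D')) s' \<mu>'"
      using 1 sub q \<sigma>1 by (intro wpI[of b d s' \<mu>' s'' \<mu>'' W2 D2 Rd2 Wr2]) auto
    then show ?case
      using 1 sub q \<sigma>1 by (intro wpI[of b c s \<mu> s' \<mu>' W1 D1 Rd1 Wr1]) auto
  qed
next
  assume "wp b RS WS c (\<lambda>s' \<mu>' W D. wp b RS WS d (\<lambda>s'' \<mu>'' W' D'. Q s'' \<mu>'' (W + W') (D + D')) s' \<mu>') s \<mu>"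
  then show "wp b RS WS (Seq c d) Q s \<mu>"
    unfolding wp_def by (blast intro: exec_Seq)
qed

lemma wp_Cond: "wp b RS WS (Cond t c d) Q s \<mu> \<longleftrightarrow> bfits b s t \<and>
    (if bval s t then wp b RS WS c (\<lambda>s' \<mu>' W D. Q s' \<mu>' (1 + bops t + W) (1 + bops t + D)) s \<mu>
     else wp b RS WS d (\<lambda>s' \<mu>' W D. Q s' \<mu>' (1 + bops t + W) (1 + bops t + D)) s \<mu>)"
  (is "_ \<longleftrightarrow> ?R")
proof -
  have "wp b RS WS (Cond t c d) Q s \<mu> \<longleftrightarrow> bfits b s t \<and>
    wp b RS WS (if bval s t then c else d) (\<lambda>s' \<mu>' W D. Q s' \<mu>' (1 + bops t + W) (1 + bops t + D)) s \<mu>"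
    (is "?L \<longleftrightarrow> ?M")
  proof
    assume ?L
    then obtain s' \<mu>' W D Rd Wr where e: "exec b (Cond t c d) (s, \<mu>) (s', \<mu>') (W, D) (Rd, Wr)"
      and sub: "Rd \<subseteq> RS" "Wr \<subseteq> WS" and q: "Q s' \<mu>' W D"
      unfolding wp_def by blast
    from e show ?M
    proof (rule exec_IfE, goal_cases)
      case (1 sa \<mu>a W1 D1 Rd1 Wr1)
      then show ?case
        using sub q by (intro conjI wpI[of b _ s \<mu> s' \<mu>' W1 D1 Rd1 Wr1]) simp_all
    qed
  next
    assume ?M
    then show ?L
      unfolding wp_def by (blast intro: exec_If)
  qed
  then show ?thesis by simp
qed

lemmas wp_simps = wp_Skip wp_IAssign wp_RAssign wp_ILoad wp_RLoad wp_IStore wp_RStore wp_Seq wp_Cond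

text \<open>The invariant refers to the work and depth spent so far and to a natural number that decreases.\<close>

lemma wp_While:
  fixes I :: "nat \<Rightarrow> regs \<Rightarrow> mem \<Rightarrow> nat \<Rightarrow> nat \<Rightarrow> bool"
  assumes "I g0 s0 \<mu>0 0 0"
    and step: "\<And>g s \<mu> W D. I g s \<mu> W D \<Longrightarrow> same c s0 \<mu>0 s \<mu> \<Longrightarrow> bfits b s t \<and>
      (if bval s t then wp b RS WS c (\<lambda>s' \<mu>' W' D'. \<exists>g'<g.
           I g' s' \<mu>' (W + (1 + bops t + W')) (D + (1 + bops t + D'))) s \<mu>
       else Q s \<mu> (W + (1 + bops t)) (D + (1 + bops t)))"
  shows "wp b RS WS (While t c) Q s0 \<mu>0"
proof -
  have refl: "same c s0 \<mu>0 s0 \<mu>0" by (simp add: same_def)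
  have "wp b RS WS (While t c) (\<lambda>s' \<mu>' W' D'. Q s' \<mu>' (W + W') (D + D')) s \<mu>"
    if "I g s \<mu> W D" "same c s0 \<mu>0 s \<mu>" for g s \<mu> W D
    using that
  proof (induction g arbitrary: s \<mu> W D rule: less_induct)
    case (less g)
    note st = step[OF less.prems]
    show ?case
    proof (cases "bval s t")
      case False
      with st show ?thesis by (auto intro!: wpI[OF exec_While_False])
    next
      case True
      with st obtain s' \<mu>' W' D' Rd Wr g' where e: "exec b c (s, \<mu>) (s', \<mu>') (W', D') (Rd, Wr)"
        and sub: "Rd \<subseteq> RS" "Wr \<subseteq> WS" and g': "g' < g"
        and I: "I g' s' \<mu>' (W + (1 + bops t + W')) (D + (1 + bops t + D'))"
        unfolding wp_def by auto
      have "same c s0 \<mu>0 s' \<mu>'"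
        using exec_same[OF e] less.prems(2) by (simp add: same_def)
      from less.IH[OF g' I this] obtain s'' \<mu>'' W'' D'' Rd' Wr' where
        "exec b (While t c) (s', \<mu>') (s'', \<mu>'') (W'', D'') (Rd', Wr')" "Rd' \<subseteq> RS" "Wr' \<subseteq> WS"
        "Q s'' \<mu>'' (W + (1 + bops t + W') + W'') (D + (1 + bops t + D') + D'')"
        unfolding wp_def by blast
      with e sub st True show ?thesis
        by (intro wpI[OF exec_While_True[OF _ True e, of "(s'', \<mu>'')" W'' D'' Rd' Wr']]) (auto simp: add_ac)
    qed
  qed
  from this[OF assms(1) refl] show ?thesis by simp
qed

text \<open>Strand \<open>i\<close> owns the cells \<open>V i\<close>: it writes only there and
  reads nothing owned by others, which excludes races. The memory after the join is not computed but
  prescribed as \<open>\<nu>\<close>; every strand merely has to agree with it on its own cells. The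
  conclusion allows arbitrary access, so parallel loops are never nested.\<close>

lemma wp_ParFor:
  assumes fit: "ifits b s e" and k: "nat (ival s e) = k"
    and disj: "\<And>i j. i < k \<Longrightarrow> j < k \<Longrightarrow> i \<noteq> j \<Longrightarrow> V i \<inter> V j = {}"
    and body: "\<And>i. i < k \<Longrightarrow> wp b {c. \<forall>j<k. j \<noteq> i \<longrightarrow> c \<notin> V j} (V i) c
        (\<lambda>s' \<mu>' W D. W \<le> w \<and> agree (V i) \<mu>' \<nu>) (s\<lparr>ireg := (ireg s)(x := int i)\<rparr>) \<mu>"
    and out: "agree (- (\<Union>i<k. V i)) \<mu> \<nu>"
    and post: "\<And>W D. W \<le> 1 + iops e + k * (1 + w) \<Longrightarrow> D \<le> 2 + iops e + w \<Longrightarrow> Q s \<nu> W D"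
  shows "wp b UNIV UNIV (ParFor x e c) Q s \<mu>"
proof -
  have "\<forall>i. \<exists>s' \<mu>' W D Rd Wr. i < k \<longrightarrow>
      exec b c (s\<lparr>ireg := (ireg s)(x := int i)\<rparr>, \<mu>) (s', \<mu>') (W, D) (Rd, Wr) \<and>
      Rd \<subseteq> {c. \<forall>j<k. j \<noteq> i \<longrightarrow> c \<notin> V j} \<and> Wr \<subseteq> V i \<and> W \<le> w \<and> agree (V i) \<mu>' \<nu>"
    using body unfolding wp_def by meson
  then obtain s' \<mu>' W D Rd Wr where
    e: "\<And>i. i < k \<Longrightarrow> exec b c (s\<lparr>ireg := (ireg s)(x := int i)\<rparr>, \<mu>) (s' i, \<mu>' i) (W i, D i) (Rd i, Wr i)"
    and Rd: "\<And>i. i < k \<Longrightarrow> Rd i \<subseteq> {c. \<forall>j<k. j \<noteq> i \<longrightarrow> c \<notin> V j}"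
    and Wr: "\<And>i. i < k \<Longrightarrow> Wr i \<subseteq> V i"
    and w: "\<And>i. i < k \<Longrightarrow> W i \<le> w"
    and ag: "\<And>i. i < k \<Longrightarrow> agree (V i) (\<mu>' i) \<nu>"
    unfolding choice_iff by blast
  have rf: "race_free k Rd Wr"
    unfolding race_free_def
  proof (intro allI impI)
    fix i j assume ij: "i < k" "j < k" "i \<noteq> j"
    show "Wr i \<inter> (Rd j \<union> Wr j) = {}"
      using Rd[OF ij(2)] Wr[OF ij(1)] Wr[OF ij(2)] disj[OF ij] ij by blast
  qed
  have the: "(THE i. i < k \<and> c \<in> Wr i) = i" if "i < k" "c \<in> Wr i" for c i
    using that rf unfolding race_free_def by (intro the_equality) blast+
  \<comment> \<open>A strand need not write every cell that it owns. An unwritten cell keeps its old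
    value, and as the strand agrees with \<open>\<nu>\<close> there, so does the memory before the
    fork.\<close>
  have cov: "agree (\<Union>i<k. V i - Wr i) \<mu> \<nu>"
  proof -
    have "agree (V i - Wr i) \<mu> \<nu>" if "i < k" for i
      using exec_agree[OF e[OF that]] ag[OF that] unfolding agree_def snd_conv by (metis Compl_iff DiffD1 DiffD2)
    then show ?thesis unfolding agree_def by blast
  qed
  have "agree {c. \<not> (\<exists>i<k. c \<in> Wr i)} \<mu> \<nu>"
    using out cov unfolding agree_def by blast
  note outs = this[unfolded agree_def mem_Collect_eq]
  have "join k \<mu> \<mu>' Wr = \<nu>"
  proof (intro mem.equality ext)
    fix a j
    show "imem (join k \<mu> \<mu>' Wr) a j = imem \<nu> a j"
    proof (cases "\<exists>i<k. ICell a j \<in> Wr i")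
      case True
      then obtain i where i: "i < k" "ICell a j \<in> Wr i" by blast
      then show ?thesis using ag[OF i(1)] Wr[OF i(1)] the[OF i] by (auto simp: join_def agree_def)
    next
      case False
      with outs show ?thesis by (auto simp: join_def)
    qed
    show "rmem (join k \<mu> \<mu>' Wr) a j = rmem \<nu> a j"
    proof (cases "\<exists>i<k. RCell a j \<in> Wr i")
      case True
      then obtain i where i: "i < k" "RCell a j \<in> Wr i" by blast
      then show ?thesis using ag[OF i(1)] Wr[OF i(1)] the[OF i] by (auto simp: join_def agree_def)
    next
      case False
      with outs show ?thesis by (auto simp: join_def)
    qed
  qed simp
  with exec_ParFor[OF fit k[symmetric] e rf] have ex:
    "exec b (ParFor x e c) (s, \<mu>) (s, \<nu>)
       (1 + iops e + (\<Sum>i<k. 1 + W i), 1 + iops e + Max (insert 0 ((\<lambda>i. 1 + D i) ` {..<k})))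
       (\<Union>i<k. Rd i, \<Union>i<k. Wr i)" by simp
  have work: "(\<Sum>i<k. 1 + W i) \<le> k * (1 + w)"
    using sum_bounded_above[of "{..<k}" "\<lambda>i. 1 + W i" "1 + w"] w by simp
  have depth: "Max (insert 0 ((\<lambda>i. 1 + D i) ` {..<k})) \<le> 1 + w"
  proof (rule Max.boundedI)
    fix a assume "a \<in> insert 0 ((\<lambda>i. 1 + D i) ` {..<k})"
    then show "a \<le> 1 + w"
      using exec_depth_le_work[OF e] w by (auto intro: order_trans)
  qed auto
  show ?thesis
    by (rule wpI[OF ex]) (simp, simp, rule post, use work depth in linarith, use depth in linarith)
qed

section \<open>Prefix sums\<close>

text \<open>The frame of the upward pass of the work-efficient parallel prefix sum. The tree is
  stored in heap order, node \<open>j\<close> having the children \<open>2 * j\<close> and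
  \<open>2 * j + 1\<close>; register 10 holds the number of nodes of the current level, which is
  also the index of its first node.\<close>

definition up_sweep :: "cmd \<Rightarrow> cmd" where
  "up_sweep pf = IAssign 10 (IReg 3) ;;
     While (ILess (Const 1) (IReg 10)) (IAssign 10 (IDiv (IReg 10) (Const 2)) ;; pf)"

definition down_sweep :: "cmd \<Rightarrow> cmd" where
  "down_sweep pf = IAssign 10 (Const 1) ;;
     While (ILess (IReg 10) (IReg 3)) (pf ;; IAssign 10 (IMul (Const 2) (IReg 10)))"

definition iscan :: cmd where
  "iscan = up_sweep (ParFor 20 (IReg 10)
       (IAssign 21 (IAdd (IReg 10) (IReg 20)) ;;
        ILoad 22 4 (IMul (Const 2) (IReg 21)) ;;
        ILoad 23 4 (IAdd (IMul (Const 2) (IReg 21)) (Const 1)) ;;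
        IStore 4 (IReg 21) (IAdd (IReg 22) (IReg 23)))) ;;
     IStore 5 (Const 1) (Const 0) ;;
     down_sweep (ParFor 20 (IReg 10)
       (IAssign 21 (IAdd (IReg 10) (IReg 20)) ;;
        ILoad 22 5 (IReg 21) ;;
        ILoad 23 4 (IMul (Const 2) (IReg 21)) ;;
        IStore 5 (IMul (Const 2) (IReg 21)) (IReg 22) ;;
        IStore 5 (IAdd (IMul (Const 2) (IReg 21)) (Const 1)) (IAdd (IReg 22) (IReg 23))))"

definition rscan :: cmd where
  "rscan = up_sweep (ParFor 20 (IReg 10)
       (IAssign 21 (IAdd (IReg 10) (IReg 20)) ;;
        RLoad 22 2 (IMul (Const 2) (IReg 21)) ;;
        RLoad 23 2 (IAdd (IMul (Const 2) (IReg 21)) (Const 1)) ;;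
        RStore 2 (IReg 21) (RAdd (RReg 22) (RReg 23)))) ;;
     RStore 3 (Const 1) (OfInt (Const 0)) ;;
     down_sweep (ParFor 20 (IReg 10)
       (IAssign 21 (IAdd (IReg 10) (IReg 20)) ;;
        RLoad 22 3 (IReg 21) ;;
        RLoad 23 2 (IMul (Const 2) (IReg 21)) ;;
        RStore 3 (IMul (Const 2) (IReg 21)) (RReg 22) ;;
        RStore 3 (IAdd (IMul (Const 2) (IReg 21)) (Const 1)) (RAdd (RReg 22) (RReg 23))))"

definition tree_sum :: "(nat \<Rightarrow> 'v::comm_monoid_add) \<Rightarrow> nat \<Rightarrow> nat \<Rightarrow> nat \<Rightarrow> 'v" where
  "tree_sum f h l i = (\<Sum>t<2 ^ (h - l). f (i * 2 ^ (h - l) + t))"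

text \<open>Describes the cells left alone by strands that own the cells \<open>a + x\<close>, for
  the side condition \<open>out\<close> of \<open>wp_ParFor\<close>.\<close>

lemma ball_neq_add: "(\<forall>x\<in>{..<S}. j \<noteq> a + x) \<longleftrightarrow> j < a \<or> a + S \<le> (j::nat)"
  by (auto simp: not_less dest: bspec[where x = "j - a"])

lemma sum_split_block: "(\<Sum>t<(a::nat) + c. f t) = (\<Sum>t<a. f t) + (\<Sum>t<c. (f (a + t) :: 'v::comm_monoid_add))"
  by (induction c) (auto simp: add.assoc)

lemma tree_sum_children:
  assumes "l < h"
  shows "tree_sum f h l i = tree_sum f h (Suc l) (2 * i) + tree_sum f h (Suc l) (2 * i + 1)"
proof -
  have e: "h - l = Suc (h - Suc l)" using assms by simp
  show ?thesis
    unfolding tree_sum_def e power_Suc mult_2 sum_split_block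
    by (simp add: algebra_simps)
qed

lemma prefix_child:
  assumes "l < h"
  shows "(\<Sum>t<(2 * i + 1) * 2 ^ (h - Suc l). f t) =
    (\<Sum>t<i * 2 ^ (h - l). f t) + tree_sum f h (Suc l) (2 * i)"
proof -
  have e: "h - l = Suc (h - Suc l)" using assms by simp
  have "(2 * i + 1) * 2 ^ (h - Suc l) = i * 2 ^ (h - l) + 2 ^ (h - Suc l)"
    unfolding e by (simp add: algebra_simps)
  then show ?thesis
    by (simp only: sum_split_block tree_sum_def) (simp add: e algebra_simps)
qed

text \<open>A single number \<open>N\<close> bounds all words, so that the fitting conditions become
  linear arithmetic.\<close>

locale machine =
  fixes b :: nat and N :: int
  assumes N_less: "N < 2 ^ b"
begin

lemma fitsI: "- N \<le> v \<Longrightarrow> v \<le> N \<Longrightarrow> fits b v"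
  using N_less by (auto simp: fits_def)

lemma fitsI0: "0 \<le> v \<Longrightarrow> v \<le> N \<Longrightarrow> fits b v"
  using N_less by (auto simp: fits_def)

text \<open>Stated for an abstract \<open>get\<close>, so that integer and real scans share it. A
  level of \<open>2 ^ l\<close> nodes costs at most \<open>10 * 2 ^ l\<close> plus 5 for the loop;
  the first terms add up geometrically, hence linear work although there are \<open>h\<close>
  levels.\<close>

lemma up_sweep:
  fixes get :: "mem \<Rightarrow> nat \<Rightarrow> 'v::comm_monoid_add"
  assumes P: "ireg s 3 = 2 ^ h" and N: "4 * 2 ^ h \<le> N"
    and f: "\<And>t. t < 2 ^ h \<Longrightarrow> get \<mu> (2 ^ h + t) = f t"
    and lev: "\<And>s \<mu> l. ireg s 10 = 2 ^ l \<Longrightarrow> l < h \<Longrightarrow>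
      (\<And>i. i < 2 ^ Suc l \<Longrightarrow> get \<mu> (2 ^ Suc l + i) = tree_sum f h (Suc l) i) \<Longrightarrow>
      wp b UNIV UNIV pf (\<lambda>s' \<mu>' W D. s' = s \<and> (\<forall>j. get \<mu>' j =
          (if 2 ^ l \<le> j \<and> j < 2 ^ Suc l then get \<mu> (2 * j) + get \<mu> (2 * j + 1) else get \<mu> j)) \<and>
        W \<le> 1 + 2 ^ l * 10 \<and> D \<le> 11) s \<mu>"
  shows "wp b UNIV UNIV (up_sweep pf) (\<lambda>s' \<mu>' W D. ireg s' 3 = 2 ^ h \<and>
     (\<forall>l\<le>h. \<forall>i<2 ^ l. get \<mu>' (2 ^ l + i) = tree_sum f h l i) \<and>
     W \<le> 3 + 5 * h + 10 * 2 ^ h \<and> D \<le> 3 + 15 * h) s \<mu>"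
proof -
  have N1: "1 \<le> N" "2 \<le> N" "2 ^ h \<le> N" using N one_le_power[of "2::int" h] by linarith+
  define I where "I = (\<lambda>(l::nat) (s::regs) \<mu> W (D::nat). l \<le> h \<and> ireg s 3 = 2 ^ h \<and> ireg s 10 = 2 ^ l \<and>
    (\<forall>l'. l \<le> l' \<and> l' \<le> h \<longrightarrow> (\<forall>i<2 ^ l'. get \<mu> (2 ^ l' + i) = tree_sum f h l' i)) \<and>
    W + 5 * l + 10 * 2 ^ l \<le> 5 * h + 10 * 2 ^ h \<and> D + 15 * l \<le> 15 * h)"
  let ?c = "IAssign 10 (IDiv (IReg 10) (Const 2)) ;; pf"
  have "wp b UNIV UNIV (While (ILess (Const 1) (IReg 10)) ?c)
    (\<lambda>s' \<mu>' W' D'. ireg s' 3 = 2 ^ h \<and>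
         (\<forall>l\<le>h. \<forall>i<2 ^ l. get \<mu>' (2 ^ l + i) = tree_sum f h l i) \<and>
         1 + W' \<le> 3 + 5 * h + 10 * 2 ^ h \<and> 1 + D' \<le> 3 + 15 * h)
    (s\<lparr>ireg := (ireg s)(10 := 2 ^ h)\<rparr>) \<mu>"
  proof (rule wp_While[where I = I and ?g0.0 = h], goal_cases)
    case 1
    show ?case unfolding I_def using P f by (auto simp: tree_sum_def)
  next
    case (2 l s \<mu> W D)
    then have l: "l \<le> h" and s: "ireg s 3 = 2 ^ h" "ireg s 10 = 2 ^ l"
      and T: "\<And>l' i. l \<le> l' \<Longrightarrow> l' \<le> h \<Longrightarrow> i < 2 ^ l' \<Longrightarrow> get \<mu> (2 ^ l' + i) = tree_sum f h l' i"
      and WD: "W + 5 * l + 10 * 2 ^ l \<le> 5 * h + 10 * 2 ^ h" "D + 15 * l \<le> 15 * h"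
      unfolding I_def by blast+
    have pl: "(2::int) ^ l \<le> 2 ^ h" using l by (intro power_increasing) auto
    have pl0: "- N \<le> 2 ^ l" using N1 by (smt (verit) zero_less_power)
    show ?case
    proof (cases l)
      case 0
      with s T WD N1 show ?thesis by (auto simp: fitsI0)
    next
      case (Suc l')
      have s': "ireg (s\<lparr>ireg := (ireg s)(10 := 2 ^ l')\<rparr>) 10 = 2 ^ l'" by simp
      have "wp b UNIV UNIV pf (\<lambda>s'' \<mu>' W' D'. I l' s'' \<mu>' (Suc (Suc (Suc (Suc (W + W'))))) (Suc (Suc (Suc (Suc (D + D'))))))
         (s\<lparr>ireg := (ireg s)(10 := 2 ^ l')\<rparr>) \<mu>"
      proof (rule wp_mono[OF lev[OF s']], goal_cases)
        case 1
        then show ?case using l Suc by simp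
      next
        case (2 i)
        then show ?case using T[of "Suc l'" i] l Suc by simp
      next
        case (3 s'' \<mu>' W' D')
        have "get \<mu>' (2 ^ l'' + i) = tree_sum f h l'' i" if "l' \<le> l''" "l'' \<le> h" "i < 2 ^ l''" for l'' i
        proof (cases "l'' = l'")
          case True
          have "get \<mu>' (2 ^ l'' + i) = get \<mu> (2 ^ l + 2 * i) + get \<mu> (2 ^ l + (2 * i + 1))"
            using 3 that True Suc by (simp add: algebra_simps)
          also have "\<dots> = tree_sum f h l (2 * i) + tree_sum f h l (2 * i + 1)"
            using T[of l "2 * i"] T[of l "2 * i + 1"] that True Suc l by simp
          also have "\<dots> = tree_sum f h l'' i"
            using tree_sum_children[of l' h f i] True Suc l by simp
          finally show ?thesis .
        next
          case False
          then have "2 ^ Suc l' \<le> (2::nat) ^ l''" using that by (intro power_increasing) auto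
          with 3 T[of l'' i] that False Suc show ?thesis by simp
        qed
        with 3 s l Suc WD show ?case unfolding I_def by simp
      qed
      moreover have "1 < (2::int) ^ l" using Suc by (intro one_less_power) auto
      ultimately show ?thesis
        using s pl pl0 N1 Suc by (auto simp: wp_simps fitsI0 elim!: wp_mono intro!: exI[of _ l'])
    qed
  qed
  then show ?thesis
    unfolding up_sweep_def using P N1 by (simp add: wp_simps fitsI0)
qed

text \<open>A node receives the sum of all leaves to the left of its subtree. The left child
  inherits this value, the right child adds the sum below its sibling, which the upward pass has
  left in \<open>get\<close>.\<close>

lemma down_sweep:
  fixes get :: "mem \<Rightarrow> nat \<Rightarrow> 'v::comm_monoid_add" and get' :: "mem \<Rightarrow> nat \<Rightarrow> 'v"
  assumes P: "ireg s 3 = 2 ^ h" and N: "4 * 2 ^ h \<le> N"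
    and f: "\<And>l i. l \<le> h \<Longrightarrow> i < 2 ^ l \<Longrightarrow> get \<mu> (2 ^ l + i) = tree_sum f h l i"
    and g: "get' \<mu> 1 = 0"
    and lev: "\<And>s \<mu> l. ireg s 10 = 2 ^ l \<Longrightarrow> l < h \<Longrightarrow>
      (\<And>i. i < 2 ^ Suc l \<Longrightarrow> get \<mu> (2 ^ Suc l + i) = tree_sum f h (Suc l) i) \<Longrightarrow>
      (\<And>i. i < 2 ^ l \<Longrightarrow> get' \<mu> (2 ^ l + i) = (\<Sum>t<i * 2 ^ (h - l). f t)) \<Longrightarrow>
      wp b UNIV UNIV pf (\<lambda>s' \<mu>' W D. s' = s \<and> get \<mu>' = get \<mu> \<and>
         (\<forall>i<2 ^ l. get' \<mu>' (2 ^ Suc l + 2 * i) = get' \<mu> (2 ^ l + i) \<and>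
          get' \<mu>' (2 ^ Suc l + (2 * i + 1)) = get' \<mu> (2 ^ l + i) + get \<mu> (2 ^ Suc l + 2 * i)) \<and>
        W \<le> 1 + 2 ^ l * 12 \<and> D \<le> 13) s \<mu>"
  shows "wp b UNIV UNIV (down_sweep pf) (\<lambda>s' \<mu>' W D. get \<mu>' = get \<mu> \<and>
     (\<forall>i<2 ^ h. get' \<mu>' (2 ^ h + i) = (\<Sum>t<i. f t)) \<and>
     W \<le> 3 + 5 * h + 12 * 2 ^ h \<and> D \<le> 3 + 17 * h) s \<mu>"
proof -
  have N1: "1 \<le> N" "2 \<le> N" "2 ^ h \<le> N" "2 * 2 ^ h \<le> N" using N one_le_power[of "2::int" h] by linarith+
  define I where "I = (\<lambda>g (s::regs) \<mu>' W (D::nat). \<exists>l\<le>h. g = h - l \<and> ireg s 3 = 2 ^ h \<and> ireg s 10 = 2 ^ l \<and>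
    get \<mu>' = get \<mu> \<and> (\<forall>i<2 ^ l. get' \<mu>' (2 ^ l + i) = (\<Sum>t<i * 2 ^ (h - l). f t)) \<and>
    W \<le> 5 * l + 12 * 2 ^ l \<and> D \<le> 17 * l)"
  have "wp b UNIV UNIV (While (ILess (IReg 10) (IReg 3)) (pf ;; IAssign 10 (IMul (Const 2) (IReg 10))))
    (\<lambda>s' \<mu>' W' D'. get \<mu>' = get \<mu> \<and> (\<forall>i<2 ^ h. get' \<mu>' (2 ^ h + i) = (\<Sum>t<i. f t)) \<and>
         1 + W' \<le> 3 + 5 * h + 12 * 2 ^ h \<and> 1 + D' \<le> 3 + 17 * h)
    (s\<lparr>ireg := (ireg s)(10 := 1)\<rparr>) \<mu>"
  proof (rule wp_While[where I = I and ?g0.0 = h], goal_cases)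
    case 1
    show ?case unfolding I_def using P g by (auto intro!: exI[of _ 0])
  next
    case (2 gg s \<mu>' W D)
    then obtain l where l: "l \<le> h" "gg = h - l" and s: "ireg s 3 = 2 ^ h" "ireg s 10 = 2 ^ l"
      and G: "get \<mu>' = get \<mu>" and T: "\<And>i. i < 2 ^ l \<Longrightarrow> get' \<mu>' (2 ^ l + i) = (\<Sum>t<i * 2 ^ (h - l). f t)"
      and WD: "W \<le> 5 * l + 12 * 2 ^ l" "D \<le> 17 * l"
      unfolding I_def by blast
    have pl: "(2::int) ^ l \<le> 2 ^ h" "(2::int) * 2 ^ l \<le> 2 * 2 ^ h"
      using l by (auto intro!: power_increasing)
    then have pl0: "- N \<le> 2 ^ l" "- N \<le> 2 * 2 ^ l" "2 * 2 ^ l \<le> N" "2 ^ l \<le> N"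
      using N1 by (smt (verit) zero_less_power)+
    show ?case
    proof (cases "l = h")
      case True
      with s T WD N1 G show ?thesis by (auto simp: fitsI0)
    next
      case False
      with l have lh: "l < h" by simp
      have "wp b UNIV UNIV pf (\<lambda>s'' \<mu>'' W' D'.
           ireg s'' 10 = 2 ^ l \<and> I (h - Suc l) (s''\<lparr>ireg := (ireg s'')(10 := 2 * 2 ^ l)\<rparr>) \<mu>'' (Suc (Suc (Suc (Suc (W + W'))))) (Suc (Suc (Suc (Suc (D + D'))))))
         s \<mu>'"
      proof (rule wp_mono[OF lev[OF s(2) lh]], goal_cases)
        case (1 i)
        then show ?case using f[of "Suc l" i] lh G by simp
      next
        case (2 i)
        then show ?case using T by simp
      next
        case (3 s'' \<mu>'' W' D')
        have "get' \<mu>'' (2 ^ Suc l + i) = (\<Sum>t<i * 2 ^ (h - Suc l). f t)" if "i < 2 ^ Suc l" for i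
        proof -
          define k where "k = i div 2"
          have k: "k < 2 ^ l" using that by (auto simp: k_def)
          have e: "h - l = Suc (h - Suc l)" using lh by simp
          show ?thesis
          proof (cases "even i")
            case True
            then have i: "i = 2 * k" by (auto simp: k_def)
            from 3 k have "get' \<mu>'' (2 ^ Suc l + i) = get' \<mu>' (2 ^ l + k)" by (simp add: i)
            with T[OF k] show ?thesis by (simp add: i e mult_ac)
          next
            case False
            then have i: "i = 2 * k + 1" by (auto simp: k_def)
            from 3 k have "get' \<mu>'' (2 ^ Suc l + i) = get' \<mu>' (2 ^ l + k) + get \<mu>' (2 ^ Suc l + 2 * k)"
              by (simp only: i)
            also have "\<dots> = (\<Sum>t<k * 2 ^ (h - l). f t) + tree_sum f h (Suc l) (2 * k)"
              using T[OF k] f[of "Suc l" "2 * k"] lh k G by simp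
            also have "\<dots> = (\<Sum>t<i * 2 ^ (h - Suc l). f t)"
              using prefix_child[OF lh, where f = f and i = k] i by simp
            finally show ?thesis .
          qed
        qed
        moreover have "2 * 2 ^ l \<le> (2::nat) ^ h"
          using power_increasing[of "Suc l" h "2::nat"] lh by simp
        ultimately show ?case using 3 s lh WD G unfolding I_def
          by (auto intro!: exI[of _ "Suc l"])
      qed
      moreover have "(2::int) ^ l < 2 ^ h" using lh by simp
      moreover have "h - Suc l < gg" using l lh by simp
      ultimately show ?thesis
        using s pl0 N1 by (auto simp: wp_simps fitsI0 elim!: wp_mono intro!: exI[of _ "h - Suc l"])
    qed
  qed
  then show ?thesis
    unfolding down_sweep_def using P N1 by (simp add: wp_simps fitsI0)
qed

text \<open>For non-negative leaves all partial sums lie between 0 and the total, so bounding the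
  total keeps every intermediate word small. The scan of reals needs no such condition.\<close>

lemma wp_iscan:
  assumes P: "ireg s 3 = 2 ^ h" and N: "4 * 2 ^ h \<le> N"
    and nonneg: "\<And>t. t < 2 ^ h \<Longrightarrow> 0 \<le> imem \<mu> 4 (2 ^ h + t)"
    and total: "(\<Sum>t<2 ^ h. imem \<mu> 4 (2 ^ h + t)) \<le> N"
  shows "wp b UNIV UNIV iscan (\<lambda>s' \<mu>' W D.
     (\<forall>i<2 ^ h. imem \<mu>' 4 (2 ^ h + i) = imem \<mu> 4 (2 ^ h + i) \<and>
        imem \<mu>' 5 (2 ^ h + i) = (\<Sum>t<i. imem \<mu> 4 (2 ^ h + t))) \<and>
     W \<le> 40 * 2 ^ h \<and> D \<le> 40 * (h + 1)) s \<mu>"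
proof -
  \<comment> \<open>Extension by 0 beyond the last leaf, so that node sums and prefixes are bounded
    for all indices without range conditions.\<close>
  define f where "f t = (if t < 2 ^ h then imem \<mu> 4 (2 ^ h + t) else 0)" for t
  have f: "imem \<mu> 4 (2 ^ h + t) = f t" if "t < 2 ^ h" for t using that by (simp add: f_def)
  have f0: "0 \<le> f t" for t using nonneg by (simp add: f_def)
  have tot: "sum f A \<le> N" if "finite A" for A
  proof -
    have "sum f A = sum f (A \<inter> {..<2 ^ h})"
      using that by (intro sum.mono_neutral_right) (auto simp: f_def)
    also have "\<dots> \<le> sum f {..<2 ^ h}" using f0 by (intro sum_mono2) auto
    also have "\<dots> \<le> N" using total by (simp add: f)
    finally show ?thesis .
  qed
  have N1: "1 \<le> N" "2 \<le> N" "2 ^ h \<le> N" using N one_le_power[of "2::int" h] by linarith+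
  have tree0: "0 \<le> tree_sum f h l i" for l i
    by (simp add: tree_sum_def f0 sum_nonneg)
  have treeN: "tree_sum f h l i \<le> N" for l i
  proof -
    have "tree_sum f h l i = sum f ((+) (i * 2 ^ (h - l)) ` {..<2 ^ (h - l)})"
      unfolding tree_sum_def by (subst sum.reindex) (auto simp: inj_on_def)
    then show ?thesis using tot by simp
  qed
  have up: "wp b UNIV UNIV (up_sweep (ParFor 20 (IReg 10)
       (IAssign 21 (IAdd (IReg 10) (IReg 20)) ;;
        ILoad 22 4 (IMul (Const 2) (IReg 21)) ;;
        ILoad 23 4 (IAdd (IMul (Const 2) (IReg 21)) (Const 1)) ;;
        IStore 4 (IReg 21) (IAdd (IReg 22) (IReg 23)))))
     (\<lambda>s' \<mu>' W D. ireg s' 3 = 2 ^ h \<and>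
     (\<forall>l\<le>h. \<forall>i<2 ^ l. imem \<mu>' 4 (2 ^ l + i) = tree_sum f h l i) \<and>
     W \<le> 3 + 5 * h + 10 * 2 ^ h \<and> D \<le> 3 + 15 * h) s \<mu>"
  proof (rule up_sweep[where get = "\<lambda>\<mu>. imem \<mu> 4", OF P N f], goal_cases)
    case (2 s \<mu> l)
    define S where "S = (2::nat) ^ l"
    have sS: "ireg s 10 = int S" and lS: "2 ^ l = S" "2 ^ Suc l = 2 * S" using 2 by (auto simp: S_def)
    have "2 * S \<le> 2 ^ h" using 2(2) power_increasing[of "Suc l" h "2::nat"] by (simp add: S_def)
    then have "int (2 * S) \<le> int (2 ^ h)" by (simp only: of_nat_le_iff)
    then have SN: "8 * int S \<le> N" using N by simp
    have vals: "imem \<mu> 4 (2 * S + i) = tree_sum f h (Suc l) i" if "i < 2 * S" for i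
      using 2(3) that by (simp add: lS)
    have val: "imem \<mu> 4 (2 * S + 2 * i) + imem \<mu> 4 (Suc (2 * S + 2 * i)) = tree_sum f h l i"
      if "i < S" for i
      using vals[of "2 * i"] vals[of "2 * i + 1"] that tree_sum_children[OF 2(2), of f i] by simp
    have bnd: "0 \<le> imem \<mu> 4 (2 * S + i)" "imem \<mu> 4 (2 * S + i) \<le> N" if "i < 2 * S" for i
      using vals[OF that] tree0 treeN by simp_all
    show ?case unfolding lS
      using SN bnd(1)[of "2 * i" for i] bnd(2)[of "2 * i" for i] bnd(1)[of "2 * i + 1" for i] bnd(2)[of "2 * i + 1" for i] val tree0[of l] treeN[of l]
      by (intro wp_ParFor[where k = S and V = "\<lambda>i. {ICell 4 (S + i)}" and w = 9 and
          \<nu> = "\<mu>\<lparr>imem := (imem \<mu>)(4 := \<lambda>j. if S \<le> j \<and> j < 2 * S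
              then imem \<mu> 4 (2 * j) + imem \<mu> 4 (2 * j + 1) else imem \<mu> 4 j)\<rparr>"])
         (auto simp: sS wp_simps agree_def nat_add_distrib nat_mult_distrib ball_neq_add intro!: fitsI0)
  qed simp
  have down: "wp b UNIV UNIV (down_sweep (ParFor 20 (IReg 10)
       (IAssign 21 (IAdd (IReg 10) (IReg 20)) ;;
        ILoad 22 5 (IReg 21) ;;
        ILoad 23 4 (IMul (Const 2) (IReg 21)) ;;
        IStore 5 (IMul (Const 2) (IReg 21)) (IReg 22) ;;
        IStore 5 (IAdd (IMul (Const 2) (IReg 21)) (Const 1)) (IAdd (IReg 22) (IReg 23)))))
     (\<lambda>s' \<mu>' W D. imem \<mu>' 4 = imem \<mu>1 4 \<and>
     (\<forall>i<2 ^ h. imem \<mu>' 5 (2 ^ h + i) = (\<Sum>t<i. f t)) \<and>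
     W \<le> 3 + 5 * h + 12 * 2 ^ h \<and> D \<le> 3 + 17 * h) s1 \<mu>1"
    if "ireg s1 3 = 2 ^ h" "\<And>l i. l \<le> h \<Longrightarrow> i < 2 ^ l \<Longrightarrow> imem \<mu>1 4 (2 ^ l + i) = tree_sum f h l i"
      "imem \<mu>1 5 1 = 0" for s1 \<mu>1
  proof (rule down_sweep[where get = "\<lambda>\<mu>. imem \<mu> 4" and get' = "\<lambda>\<mu>. imem \<mu> 5", OF that(1) N that(2,3)], goal_cases)
    case (3 s \<mu> l)
    define S where "S = (2::nat) ^ l"
    have sS: "ireg s 10 = int S" and lS: "2 ^ l = S" "2 ^ Suc l = 2 * S" using 3 by (auto simp: S_def)
    have "2 * S \<le> 2 ^ h" using 3(2) power_increasing[of "Suc l" h "2::nat"] by (simp add: S_def)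
    then have "int (2 * S) \<le> int (2 ^ h)" by (simp only: of_nat_le_iff)
    then have SN: "8 * int S \<le> N" using N by simp
    have v4: "imem \<mu> 4 (2 * S + 2 * i) = tree_sum f h (Suc l) (2 * i)" if "i < S" for i
      using 3(3) that by (simp add: lS)
    have v5: "imem \<mu> 5 (S + i) = (\<Sum>t<i * 2 ^ (h - l). f t)" if "i < S" for i
      using 3(4) that by (simp add: lS)
    have b4: "0 \<le> imem \<mu> 4 (2 * S + 2 * i)" "imem \<mu> 4 (2 * S + 2 * i) \<le> N" if "i < S" for i
      using v4[OF that] tree0 treeN by simp_all
    have b5: "0 \<le> imem \<mu> 5 (S + i)" "imem \<mu> 5 (S + i) \<le> N" if "i < S" for i
      using v5[OF that] tot f0 by (simp_all add: sum_nonneg)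
    have b6: "imem \<mu> 5 (S + i) + imem \<mu> 4 (2 * S + 2 * i) \<le> N" if "i < S" for i
      using prefix_child[OF 3(2), of f i] v4[OF that] v5[OF that] tot[of "{..<(2 * i + 1) * 2 ^ (h - Suc l)}"]
      by simp
    \<comment> \<open>The second array after one level. For odd \<open>j\<close>, the parent is
      \<open>j div 2\<close> and the left sibling is \<open>j - 1\<close>.\<close>
    define g where "g j = (if j < 2 * S \<or> 4 * S \<le> j then imem \<mu> 5 j
      else if even j then imem \<mu> 5 (j div 2) else imem \<mu> 5 (j div 2) + imem \<mu> 4 (j - 1))" for j
    have g1: "g (2 * S + 2 * i) = imem \<mu> 5 (S + i)" if "i < S" for i
      using that by (simp add: g_def)
    have g2: "g (Suc (2 * S + 2 * i)) = imem \<mu> 5 (S + i) + imem \<mu> 4 (2 * S + 2 * i)" if "i < S" for i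
      using that by (simp add: g_def)
    have g3: "g j = imem \<mu> 5 j" if "\<forall>i<S. j \<noteq> 2 * S + 2 * i \<and> j \<noteq> Suc (2 * S + 2 * i)" for j
      using that[rule_format, of "j div 2 - S"] by (auto simp: g_def) presburger+
    show ?case unfolding lS
      using SN b4 b5 b6 g1 g2
      by (intro wp_ParFor[where k = S and V = "\<lambda>i. {ICell 5 (2 * S + 2 * i), ICell 5 (Suc (2 * S + 2 * i))}"
            and w = 11 and \<nu> = "\<mu>\<lparr>imem := (imem \<mu>)(5 := g)\<rparr>"])
         (auto simp: sS wp_simps agree_def nat_add_distrib nat_mult_distrib g3 intro!: fitsI0, presburger?)
  qed simp_all
  have h: "h < 2 ^ h" by simp
  show ?thesis
    unfolding iscan_def wp_Seq
  proof (rule wp_mono[OF up], goal_cases)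
    case (1 s1 \<mu>1 W1 D1)
    have leaf: "imem \<mu>1 4 (2 ^ h + i) = imem \<mu> 4 (2 ^ h + i)" if "i < 2 ^ h" for i
      using 1 that f[OF that] by (auto simp: tree_sum_def)
    have g0: "imem \<mu>1 4 (2 ^ l + i) = tree_sum f h l i" if "l \<le> h" "i < 2 ^ l" for l i
      using 1 that by blast
    have "wp b UNIV UNIV (down_sweep (ParFor 20 (IReg 10)
       (IAssign 21 (IAdd (IReg 10) (IReg 20)) ;;
        ILoad 22 5 (IReg 21) ;;
        ILoad 23 4 (IMul (Const 2) (IReg 21)) ;;
        IStore 5 (IMul (Const 2) (IReg 21)) (IReg 22) ;;
        IStore 5 (IAdd (IMul (Const 2) (IReg 21)) (Const 1)) (IAdd (IReg 22) (IReg 23)))))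
      (\<lambda>s' \<mu>' W D.
         (\<forall>i<2 ^ h. imem \<mu>' 4 (2 ^ h + i) = imem \<mu> 4 (2 ^ h + i) \<and>
            imem \<mu>' 5 (2 ^ h + i) = (\<Sum>t<i. imem \<mu> 4 (2 ^ h + t))) \<and>
         W1 + (1 + W) \<le> 40 * 2 ^ h \<and> D1 + (1 + D) \<le> 40 * (h + 1)) s1
      (\<mu>1\<lparr>imem := (imem \<mu>1)(5 := (imem \<mu>1 5)(1 := 0))\<rparr>)"
    proof (rule wp_mono[OF down], goal_cases)
      case (4 s' \<mu>' W D)
      have "W1 \<le> 3 + 5 * h + 10 * 2 ^ h" "D1 \<le> 3 + 15 * h"
        "W \<le> 3 + 5 * h + 12 * 2 ^ h" "D \<le> 3 + 17 * h"
        using 4 1 by simp_all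
      then have "W1 + (1 + W) \<le> 40 * 2 ^ h" "D1 + (1 + D) \<le> 40 * (h + 1)"
        using h by (linarith, simp)
      with 4 1 leaf f show ?case by auto
    qed (use 1 g0 in auto)
    then show ?case
      unfolding wp_IStore using N1 by (auto simp: fitsI0 add.assoc)
  qed
qed

lemma wp_rscan:
  assumes P: "ireg s 3 = 2 ^ h" and N: "4 * 2 ^ h \<le> N"
  shows "wp b UNIV UNIV rscan (\<lambda>s' \<mu>' W D.
     (\<forall>i<2 ^ h. rmem \<mu>' 2 (2 ^ h + i) = rmem \<mu> 2 (2 ^ h + i) \<and>
        rmem \<mu>' 3 (2 ^ h + i) = (\<Sum>t<i. rmem \<mu> 2 (2 ^ h + t))) \<and>
     W \<le> 40 * 2 ^ h \<and> D \<le> 40 * (h + 1)) s \<mu>"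
proof -
  define f where "f t = (if t < 2 ^ h then rmem \<mu> 2 (2 ^ h + t) else 0)" for t
  have f: "rmem \<mu> 2 (2 ^ h + t) = f t" if "t < 2 ^ h" for t using that by (simp add: f_def)
  have N1: "1 \<le> N" "2 \<le> N" "2 ^ h \<le> N" using N one_le_power[of "2::int" h] by linarith+
  have up: "wp b UNIV UNIV (up_sweep (ParFor 20 (IReg 10)
       (IAssign 21 (IAdd (IReg 10) (IReg 20)) ;;
        RLoad 22 2 (IMul (Const 2) (IReg 21)) ;;
        RLoad 23 2 (IAdd (IMul (Const 2) (IReg 21)) (Const 1)) ;;
        RStore 2 (IReg 21) (RAdd (RReg 22) (RReg 23)))))
     (\<lambda>s' \<mu>' W D. ireg s' 3 = 2 ^ h \<and>
     (\<forall>l\<le>h. \<forall>i<2 ^ l. rmem \<mu>' 2 (2 ^ l + i) = tree_sum f h l i) \<and>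
     W \<le> 3 + 5 * h + 10 * 2 ^ h \<and> D \<le> 3 + 15 * h) s \<mu>"
  proof (rule up_sweep[where get = "\<lambda>\<mu>. rmem \<mu> 2", OF P N f], goal_cases)
    case (2 s \<mu> l)
    define S where "S = (2::nat) ^ l"
    have sS: "ireg s 10 = int S" and lS: "2 ^ l = S" "2 ^ Suc l = 2 * S" using 2 by (auto simp: S_def)
    have "2 * S \<le> 2 ^ h" using 2(2) power_increasing[of "Suc l" h "2::nat"] by (simp add: S_def)
    then have "int (2 * S) \<le> int (2 ^ h)" by (simp only: of_nat_le_iff)
    then have SN: "8 * int S \<le> N" using N by simp
    show ?case unfolding lS
      using SN
      by (intro wp_ParFor[where k = S and V = "\<lambda>i. {RCell 2 (S + i)}" and w = 9 and
          \<nu> = "\<mu>\<lparr>rmem := (rmem \<mu>)(2 := \<lambda>j. if S \<le> j \<and> j < 2 * S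
              then rmem \<mu> 2 (2 * j) + rmem \<mu> 2 (2 * j + 1) else rmem \<mu> 2 j)\<rparr>"])
         (auto simp: sS wp_simps agree_def nat_add_distrib nat_mult_distrib ball_neq_add intro!: fitsI0)
  qed simp
  have down: "wp b UNIV UNIV (down_sweep (ParFor 20 (IReg 10)
       (IAssign 21 (IAdd (IReg 10) (IReg 20)) ;;
        RLoad 22 3 (IReg 21) ;;
        RLoad 23 2 (IMul (Const 2) (IReg 21)) ;;
        RStore 3 (IMul (Const 2) (IReg 21)) (RReg 22) ;;
        RStore 3 (IAdd (IMul (Const 2) (IReg 21)) (Const 1)) (RAdd (RReg 22) (RReg 23)))))
     (\<lambda>s' \<mu>' W D. rmem \<mu>' 2 = rmem \<mu>1 2 \<and>
     (\<forall>i<2 ^ h. rmem \<mu>' 3 (2 ^ h + i) = (\<Sum>t<i. f t)) \<and>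
     W \<le> 3 + 5 * h + 12 * 2 ^ h \<and> D \<le> 3 + 17 * h) s1 \<mu>1"
    if "ireg s1 3 = 2 ^ h" "\<And>l i. l \<le> h \<Longrightarrow> i < 2 ^ l \<Longrightarrow> rmem \<mu>1 2 (2 ^ l + i) = tree_sum f h l i"
      "rmem \<mu>1 3 1 = 0" for s1 \<mu>1
  proof (rule down_sweep[where get = "\<lambda>\<mu>. rmem \<mu> 2" and get' = "\<lambda>\<mu>. rmem \<mu> 3", OF that(1) N that(2,3)], goal_cases)
    case (3 s \<mu> l)
    define S where "S = (2::nat) ^ l"
    have sS: "ireg s 10 = int S" and lS: "2 ^ l = S" "2 ^ Suc l = 2 * S" using 3 by (auto simp: S_def)
    have "2 * S \<le> 2 ^ h" using 3(2) power_increasing[of "Suc l" h "2::nat"] by (simp add: S_def)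
    then have "int (2 * S) \<le> int (2 ^ h)" by (simp only: of_nat_le_iff)
    then have SN: "8 * int S \<le> N" using N by simp
    define g where "g j = (if j < 2 * S \<or> 4 * S \<le> j then rmem \<mu> 3 j
      else if even j then rmem \<mu> 3 (j div 2) else rmem \<mu> 3 (j div 2) + rmem \<mu> 2 (j - 1))" for j
    have g1: "g (2 * S + 2 * i) = rmem \<mu> 3 (S + i)" if "i < S" for i
      using that by (simp add: g_def)
    have g2: "g (Suc (2 * S + 2 * i)) = rmem \<mu> 3 (S + i) + rmem \<mu> 2 (2 * S + 2 * i)" if "i < S" for i
      using that by (simp add: g_def)
    have g3: "g j = rmem \<mu> 3 j" if "\<forall>i<S. j \<noteq> 2 * S + 2 * i \<and> j \<noteq> Suc (2 * S + 2 * i)" for j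
      using that[rule_format, of "j div 2 - S"] by (auto simp: g_def) presburger+
    show ?case unfolding lS
      using SN g1 g2
      by (intro wp_ParFor[where k = S and V = "\<lambda>i. {RCell 3 (2 * S + 2 * i), RCell 3 (Suc (2 * S + 2 * i))}"
            and w = 11 and \<nu> = "\<mu>\<lparr>rmem := (rmem \<mu>)(3 := g)\<rparr>"])
         (auto simp: sS wp_simps agree_def nat_add_distrib nat_mult_distrib g3 intro!: fitsI0, presburger?)
  qed simp_all
  have h: "h < 2 ^ h" by simp
  show ?thesis
    unfolding rscan_def wp_Seq
  proof (rule wp_mono[OF up], goal_cases)
    case (1 s1 \<mu>1 W1 D1)
    have leaf: "rmem \<mu>1 2 (2 ^ h + i) = rmem \<mu> 2 (2 ^ h + i)" if "i < 2 ^ h" for i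
      using 1 that f[OF that] by (auto simp: tree_sum_def)
    have g0: "rmem \<mu>1 2 (2 ^ l + i) = tree_sum f h l i" if "l \<le> h" "i < 2 ^ l" for l i
      using 1 that by blast
    have "wp b UNIV UNIV (down_sweep (ParFor 20 (IReg 10)
       (IAssign 21 (IAdd (IReg 10) (IReg 20)) ;;
        RLoad 22 3 (IReg 21) ;;
        RLoad 23 2 (IMul (Const 2) (IReg 21)) ;;
        RStore 3 (IMul (Const 2) (IReg 21)) (RReg 22) ;;
        RStore 3 (IAdd (IMul (Const 2) (IReg 21)) (Const 1)) (RAdd (RReg 22) (RReg 23)))))
      (\<lambda>s' \<mu>' W D.
         (\<forall>i<2 ^ h. rmem \<mu>' 2 (2 ^ h + i) = rmem \<mu> 2 (2 ^ h + i) \<and>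
            rmem \<mu>' 3 (2 ^ h + i) = (\<Sum>t<i. rmem \<mu> 2 (2 ^ h + t))) \<and>
         W1 + (2 + W) \<le> 40 * 2 ^ h \<and> D1 + (2 + D) \<le> 40 * (h + 1)) s1
      (\<mu>1\<lparr>rmem := (rmem \<mu>1)(3 := (rmem \<mu>1 3)(1 := 0))\<rparr>)"
    proof (rule wp_mono[OF down], goal_cases)
      case (4 s' \<mu>' W D)
      have "W1 \<le> 3 + 5 * h + 10 * 2 ^ h" "D1 \<le> 3 + 15 * h"
        "W \<le> 3 + 5 * h + 12 * 2 ^ h" "D \<le> 3 + 17 * h"
        using 4 1 by simp_all
      then have "W1 + (2 + W) \<le> 40 * 2 ^ h" "D1 + (2 + D) \<le> 40 * (h + 1)"
        using h by (linarith, simp)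
      with 4 1 leaf f show ?case by auto
    qed (use 1 g0 in auto)
    then show ?case
      unfolding wp_RStore using N1 by (auto simp: fitsI0 add.assoc)
  qed
qed

end

section \<open>Half-edges\<close>

text \<open>
  Edges are numbered \<open>0, \<dots>, m - 1\<close>. The half-edge \<open>h < 2 * m\<close> belongs to the edge \<open>h mod m\<close>; it is the
  end of this edge in \<open>L\<close> if \<open>h < m\<close> and the end in \<open>R\<close> otherwise.
\<close>

locale half_edges =
  fixes n m :: nat and vt :: "nat \<Rightarrow> nat"
  assumes m_pos: "0 < m"
    and vt_less: "h < 2 * m \<Longrightarrow> vt h < n"
    and sides: "e < m \<Longrightarrow> e' < m \<Longrightarrow> vt e \<noteq> vt (m + e')"
begin

definition halves :: "nat \<Rightarrow> nat set" where
  "halves v = {h. h < 2 * m \<and> vt h = v}"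

definition load :: "(nat \<Rightarrow> 'a::comm_monoid_add) \<Rightarrow> nat \<Rightarrow> 'a" where
  "load f v = (\<Sum>h\<in>halves v. f (h mod m))"

text \<open>An end in \<open>L\<close> never equals an end in \<open>R\<close> by
  \<open>sides\<close>, so only ends on the same side are compared.\<close>

definition matching_idx :: "nat set \<Rightarrow> bool" where
  "matching_idx M \<longleftrightarrow> M \<subseteq> {..<m} \<and>
     (\<forall>e\<in>M. \<forall>e'\<in>M. e \<noteq> e' \<longrightarrow> vt e \<noteq> vt e' \<and> vt (m + e) \<noteq> vt (m + e'))"

lemma finite_halves [simp]: "finite (halves v)"
  by (simp add: halves_def)

lemma sum_halves: "(\<Sum>h<2 * m. F h) = (\<Sum>e<m. F e + F (m + e))" for F :: "nat \<Rightarrow> 'a::comm_monoid_add"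
proof -
  have "{..<2 * m} = {..<m} \<union> (+) m ` {..<m}"
    by (auto simp: lessThan_atLeast0 image_add_atLeastLessThan)
  moreover have "sum F ((+) m ` {..<m}) = (\<Sum>e<m. F (m + e))"
    by (subst sum.reindex) auto
  moreover have "{..<m} \<inter> (+) m ` {..<m} = {}" by auto
  ultimately show ?thesis
    by (simp add: sum.union_disjoint sum.distrib)
qed

lemma sum_by_vertex: "(\<Sum>v<n. \<Sum>h\<in>halves v. F h) = (\<Sum>h<2 * m. F h)"
  for F :: "nat \<Rightarrow> 'a::comm_monoid_add"
proof -
  have "(\<Sum>v<n. sum F {h \<in> {..<2 * m}. vt h = v}) = sum F {..<2 * m}"
    by (rule sum.group) (auto simp: vt_less)
  moreover have "halves v = {h \<in> {..<2 * m}. vt h = v}" for v by (auto simp: halves_def)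
  ultimately show ?thesis by simp
qed

text \<open>The ends of the edges of a matching are pairwise distinct vertices, so every price is
  counted at most once. This is the weak duality by which prices bound the weight of a
  matching.\<close>

lemma sum_price_matching:
  fixes p :: "nat \<Rightarrow> real"
  assumes "matching_idx M" "\<And>v. v < n \<Longrightarrow> 0 \<le> p v"
  shows "(\<Sum>e\<in>M. p (vt e) + p (vt (m + e))) \<le> (\<Sum>v<n. p v)"
proof -
  let ?S = "M \<union> (+) m ` M"
  have M: "M \<subseteq> {..<m}" "finite M" using assms(1) finite_subset by (auto simp: matching_idx_def)
  have "inj_on vt ?S"
  proof (rule inj_onI)
    fix h k assume hk: "h \<in> ?S" "k \<in> ?S" "vt h = vt k"
    have lt: "e < m" if "e \<in> M" for e using that M by auto
    from hk(1,2) show "h = k"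
      using hk(3) assms(1) sides[OF lt lt] sides[OF lt lt, symmetric]
      by (elim UnE imageE) (simp_all add: matching_idx_def, blast+)
  qed
  moreover have "sum (\<lambda>h. p (vt h)) ((+) m ` M) = (\<Sum>e\<in>M. p (vt (m + e)))"
    by (subst sum.reindex) auto
  ultimately have "(\<Sum>e\<in>M. p (vt e) + p (vt (m + e))) = sum p (vt ` ?S)"
  proof -
    have "M \<inter> (+) m ` M = {}" using M by auto
    with \<open>inj_on vt ?S\<close> \<open>sum (\<lambda>h. p (vt h)) ((+) m ` M) = _\<close> M show ?thesis
      by (simp add: sum.reindex sum.union_disjoint sum.distrib o_def)
  qed
  also have "\<dots> \<le> sum p {..<n}"
  proof (rule sum_mono2)
    have "h < 2 * m" if "h \<in> ?S" for h using that M(1) by auto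
    then show "vt ` ?S \<subseteq> {..<n}" using vt_less by blast
  qed (use assms(2) in auto)
  finally show ?thesis .
qed

end

section \<open>Multiplicative weights\<close>

text \<open>
  The position \<open>i0\<close> at which the accumulated amount exceeds 1 determines the price \<open>p\<close> of a vertex; what
  comes later is cut off.
\<close>

lemma truncation:
  fixes X W :: "nat \<Rightarrow> real"
  assumes X: "\<And>i. s \<le> i \<Longrightarrow> i < t \<Longrightarrow> 0 \<le> X i"
    and W0: "\<And>i. s \<le> i \<Longrightarrow> i < t \<Longrightarrow> 0 \<le> W i"
    and mono: "\<And>i j. s \<le> i \<Longrightarrow> i \<le> j \<Longrightarrow> j < t \<Longrightarrow> W j \<le> W i"
    and a: "\<And>i. a i = (\<Sum>k = s..<i. X k)"
    and y: "\<And>i. s \<le> i \<Longrightarrow> i < t \<Longrightarrow> y i = min 1 (a (Suc i)) - min 1 (a i)"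
    and p: "(\<exists>i. s \<le> i \<and> i < t \<and> a i \<le> 1 \<and> 1 < a (Suc i) \<and> p = W i) \<or> (a t \<le> 1 \<and> p = 0)"
    and st: "s \<le> t"
  shows "p + (\<Sum>i = s..<t. W i * (X i - y i)) \<le> (\<Sum>i = s..<t. X i * min (W i) p)"
    "(\<Sum>i = s..<t. y i) \<le> 1"
proof -
  have step: "a (Suc i) = a i + X i" if "s \<le> i" for i using that a by simp
  have "a i \<le> a j" if "i \<le> j" "j \<le> t" for i j
    unfolding a using that X by (intro sum_mono2) auto
  note amono = this
  have sumy: "(\<Sum>i = s..<t. y i) = min 1 (a t)"
  proof -
    have "(\<Sum>i = s..<t. y i) = (\<Sum>i = s..<t. min 1 (a (Suc i)) - min 1 (a i))" by (simp add: y)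
    also have "\<dots> = min 1 (a t) - min 1 (a s)"
      using sum_Suc_diff'[of s t "\<lambda>i. min 1 (a i)"] st by simp
    finally show ?thesis using a[of s] by simp
  qed
  then show "(\<Sum>i = s..<t. y i) \<le> 1" by simp
  from p show "p + (\<Sum>i = s..<t. W i * (X i - y i)) \<le> (\<Sum>i = s..<t. X i * min (W i) p)"
  proof (elim disjE exE conjE)
    assume "a t \<le> 1" "p = 0"
    moreover have "y i = X i" if "s \<le> i" "i < t" for i
      using that amono[of i t] amono[of "Suc i" t] \<open>a t \<le> 1\<close> step[of i] y[of i] by simp
    ultimately show ?thesis using X W0 by (simp add: sum_nonneg)
  next
    fix j assume j: "s \<le> j" "j < t" "a j \<le> 1" "1 < a (Suc j)" "p = W j"
    \<comment> \<open>Before \<open>j\<close> nothing is cut and \<open>p \<le> W i\<close>; at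
      \<open>j\<close> the price is the weight; after \<open>j\<close> everything is cut and
      \<open>W i \<le> p\<close>. Since the kept amounts sum to exactly 1, the left sides add up to
      \<open>p\<close>.\<close>
    have "p * y i \<le> X i * min (W i) p - W i * (X i - y i)" if i: "s \<le> i" "i < t" for i
    proof -
      consider "i < j" | "i = j" | "j < i" by linarith
      then show ?thesis
      proof cases
        case 1
        then have "y i = X i" "p \<le> W i"
          using i j amono[of i j] amono[of "Suc i" j] step[of i] y[of i] mono by simp_all
        then show ?thesis by (simp add: algebra_simps)
      next
        case 2
        then show ?thesis using j by (simp add: algebra_simps)
      next
        case 3
        then have "y i = 0" "W i \<le> p"
          using i j amono[of "Suc j" i] amono[of "Suc j" "Suc i"] y[of i] mono by simp_all
        then show ?thesis by (simp add: algebra_simps)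
      qed
    qed
    then have "(\<Sum>i = s..<t. p * y i) \<le> (\<Sum>i = s..<t. X i * min (W i) p - W i * (X i - y i))"
      by (intro sum_mono) auto
    moreover have "(\<Sum>i = s..<t. p * y i) = p"
      using sumy amono[of "Suc j" t] j by (simp flip: sum_distrib_left)
    ultimately show ?thesis by (simp add: sum_subtractf)
  qed
qed

text \<open>Up to sign and the constant \<open>sum w M\<close>, this is the unnormalised relative
  entropy of the indicator of \<open>M\<close> with respect to \<open>x\<close>, each edge counted
  with its weight.\<close>

definition potential :: "nat \<Rightarrow> (nat \<Rightarrow> real) \<Rightarrow> nat set \<Rightarrow> (nat \<Rightarrow> real) \<Rightarrow> real" where
  "potential m w M x = (\<Sum>e\<in>M. w e * ln (x e)) - (\<Sum>e<m. w e * x e)"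

context half_edges
begin

text \<open>The reduced cost of \<open>e\<close> under the prices \<open>p\<close>, relative to its
  weight. Capping each price at the weight of the edge keeps the rate in
  \<open>[-1, 1]\<close>.\<close>

definition reduced :: "(nat \<Rightarrow> real) \<Rightarrow> (nat \<Rightarrow> real) \<Rightarrow> nat \<Rightarrow> real" where
  "reduced w p e = 1 - min 1 (p (vt e) / w e) - min 1 (p (vt (m + e)) / w e)"

text \<open>
  One step of multiplicative weights. The rates \<open>reduced w p\<close> lie in \<open>[-1, 1]\<close> although the weights may
  differ arbitrarily: this is why the entropy weighted by \<open>w\<close> makes the number of steps
  independent of the weights.
\<close>

lemma potential_step:
  fixes w x y p :: "nat \<Rightarrow> real" and q :: nat
  assumes q: "2 \<le> q" and M: "matching_idx M"
    and w: "\<And>e. e < m \<Longrightarrow> 0 < w e" and x: "\<And>e. e < m \<Longrightarrow> 0 < x e"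
    and y: "\<And>h. h < 2 * m \<Longrightarrow> y h \<le> x (h mod m)"
    and p0: "\<And>v. v < n \<Longrightarrow> 0 \<le> p v"
    and p: "\<And>v. v < n \<Longrightarrow> p v + (\<Sum>h\<in>halves v. w (h mod m) * (x (h mod m) - y h))
        \<le> (\<Sum>h\<in>halves v. x (h mod m) * min (w (h mod m)) (p v))"
  shows "(1 - 2 / q) * sum w M \<le> real q * (potential m w M (\<lambda>e. x e * (1 + reduced w p e / q))
      - potential m w M x) + (\<Sum>e<m. w e * min (y e) (y (m + e)))"
    and "\<And>e. e < m \<Longrightarrow> 0 < x e * (1 + reduced w p e / q)"
proof -
  let ?r = "reduced w p" and ?z = "\<lambda>e. min (y e) (y (m + e))"
  have M': "M \<subseteq> {..<m}" "finite M" using M finite_subset by (auto simp: matching_idx_def)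
  have pe: "0 \<le> p (vt e)" "0 \<le> p (vt (m + e))" if "e < m" for e
    using that p0 vt_less by simp_all
  have r: "\<bar>?r e\<bar> \<le> 1" if "e < m" for e
  proof -
    have "0 \<le> min 1 (p (vt e) / w e)" "0 \<le> min 1 (p (vt (m + e)) / w e)"
      using pe[OF that] w[OF that] by simp_all
    moreover have "min 1 (p (vt e) / w e) \<le> 1" "min 1 (p (vt (m + e)) / w e) \<le> 1" by simp_all
    ultimately show ?thesis unfolding reduced_def by linarith
  qed
  have rq: "\<bar>?r e / q\<bar> \<le> 1 / 2" if "e < m" for e
  proof -
    have "\<bar>?r e\<bar> / q \<le> 1 / 2" using r[OF that] q by (intro frac_le) auto
    then show ?thesis by simp
  qed
  show pos: "0 < x e * (1 + ?r e / q)" if "e < m" for e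
    by (intro mult_pos_pos x that) (use rq[OF that] in linarith)
  have wr: "w e * ?r e = w e - min (w e) (p (vt e)) - min (w e) (p (vt (m + e)))" if "e < m" for e
    using w[OF that] by (simp add: reduced_def algebra_simps min_def field_simps)
  have "(\<Sum>e<m. w e * ?r e * x e) = (\<Sum>e<m. w e * x e)
      - (\<Sum>e<m. x e * min (w e) (p (vt e)) + x e * min (w e) (p (vt (m + e))))"
    by (simp add: wr algebra_simps sum.distrib sum_subtractf)
  also have "(\<Sum>e<m. x e * min (w e) (p (vt e)) + x e * min (w e) (p (vt (m + e))))
      = (\<Sum>h<2 * m. x (h mod m) * min (w (h mod m)) (p (vt h)))"
    unfolding sum_halves by simp
  also have "\<dots> = (\<Sum>v<n. \<Sum>h\<in>halves v. x (h mod m) * min (w (h mod m)) (p v))"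
    unfolding sum_by_vertex[symmetric] by (intro sum.cong refl) (auto simp: halves_def)
  finally have A: "(\<Sum>e<m. w e * ?r e * x e) = (\<Sum>e<m. w e * x e)
     - (\<Sum>v<n. \<Sum>h\<in>halves v. x (h mod m) * min (w (h mod m)) (p v))" .
  have "(\<Sum>v<n. p v) + (\<Sum>h<2 * m. w (h mod m) * (x (h mod m) - y h))
     = (\<Sum>v<n. p v + (\<Sum>h\<in>halves v. w (h mod m) * (x (h mod m) - y h)))"
    unfolding sum_by_vertex[symmetric] by (simp add: sum.distrib)
  also have "\<dots> \<le> (\<Sum>v<n. \<Sum>h\<in>halves v. x (h mod m) * min (w (h mod m)) (p v))"
    using p by (intro sum_mono) auto
  finally have B: "(\<Sum>e<m. w e * ?r e * x e) \<le> (\<Sum>e<m. w e * x e) - (\<Sum>v<n. p v)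
      - (\<Sum>h<2 * m. w (h mod m) * (x (h mod m) - y h))"
    using A by linarith
  \<comment> \<open>What an edge loses by keeping the smaller of the amounts at its two ends is at
    most the sum of the losses at both ends.\<close>
  have "(\<Sum>e<m. w e * (x e - ?z e)) \<le> (\<Sum>e<m. w e * (x e - y e) + w e * (x e - y (m + e)))"
  proof (intro sum_mono)
    fix e assume "e \<in> {..<m}"
    then have e: "e < m" by simp
    have "x e - ?z e \<le> (x e - y e) + (x e - y (m + e))"
      using y[of e] y[of "m + e"] e by (auto simp: min_def)
    from mult_left_mono[OF this, of "w e"] w[OF e]
    show "w e * (x e - ?z e) \<le> w e * (x e - y e) + w e * (x e - y (m + e))"
      by (simp only: distrib_left)
  qed
  also have "\<dots> = (\<Sum>h<2 * m. w (h mod m) * (x (h mod m) - y h))"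
    unfolding sum_halves by simp
  finally have C: "(\<Sum>e<m. w e * ?r e * x e) \<le> (\<Sum>e<m. w e * ?z e) - (\<Sum>v<n. p v)"
    using B by (simp add: sum_subtractf algebra_simps)
  have "(\<Sum>e\<in>M. w e) - (\<Sum>v<n. p v) \<le> (\<Sum>e\<in>M. w e) - (\<Sum>e\<in>M. p (vt e) + p (vt (m + e)))"
    using sum_price_matching[OF M p0] by simp
  also have "\<dots> = (\<Sum>e\<in>M. w e - (p (vt e) + p (vt (m + e))))" by (simp add: sum_subtractf)
  also have "\<dots> \<le> (\<Sum>e\<in>M. w e * ?r e)"
    using M' by (intro sum_mono) (auto simp: wr dest!: subsetD)
  finally have D: "sum w M - (\<Sum>e<m. w e * ?z e) \<le> (\<Sum>e\<in>M. w e * ?r e) - (\<Sum>e<m. w e * ?r e * x e)"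
    using C by simp
  \<comment> \<open>The bound \<open>t - 2 * t\<^sup>2 \<le> ln (1 + t)\<close> for \<open>t\<close>
    of absolute value at most 1/2. The quadratic term, multiplied by \<open>q\<close> in the end, is
    the loss of \<open>2 / q\<close>.\<close>
  have ln: "w e * ln (x e) + w e * (?r e / q - 2 / q\<^sup>2) \<le> w e * ln (x e * (1 + ?r e / q))" if "e < m" for e
  proof -
    have "\<bar>ln (1 + ?r e / q) - ?r e / q\<bar> \<le> 2 * (?r e / q)\<^sup>2"
      using rq[OF that] by (rule abs_ln_one_plus_x_minus_x_bound)
    moreover have "(?r e / q)\<^sup>2 \<le> 1 / q\<^sup>2"
      using r[OF that] by (simp add: power_divide divide_right_mono abs_square_le_1)
    ultimately have "?r e / q - 2 / q\<^sup>2 \<le> ln (1 + ?r e / q)" by (simp add: abs_le_iff)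
    moreover have "ln (x e * (1 + ?r e / q)) = ln (x e) + ln (1 + ?r e / q)"
      by (intro ln_mult_pos x that) (use rq[OF that] in linarith)
    ultimately show ?thesis using w[OF that] by (simp flip: distrib_left)
  qed
  have "(\<Sum>e\<in>M. w e * ln (x e)) + (\<Sum>e\<in>M. w e * (?r e / q - 2 / q\<^sup>2)) \<le> (\<Sum>e\<in>M. w e * ln (x e * (1 + ?r e / q)))"
    unfolding sum.distrib[symmetric] using M' ln by (intro sum_mono) (auto dest!: subsetD)
  moreover have "(\<Sum>e\<in>M. w e * (?r e / q - 2 / q\<^sup>2)) = (\<Sum>e\<in>M. w e * ?r e) / q - 2 / q\<^sup>2 * sum w M"
    by (simp add: algebra_simps sum_subtractf sum_divide_distrib sum_distrib_right)
  moreover have "(\<Sum>e<m. w e * (x e * (1 + ?r e / q))) = (\<Sum>e<m. w e * x e) + (\<Sum>e<m. w e * ?r e * x e) / q"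
    by (simp add: algebra_simps sum.distrib sum_divide_distrib)
  ultimately have "((\<Sum>e\<in>M. w e * ?r e) - (\<Sum>e<m. w e * ?r e * x e)) / q - 2 / q\<^sup>2 * sum w M
      \<le> potential m w M (\<lambda>e. x e * (1 + ?r e / q)) - potential m w M x"
    by (simp add: potential_def diff_divide_distrib)
  then have *: "real q * (((\<Sum>e\<in>M. w e * ?r e) - (\<Sum>e<m. w e * ?r e * x e)) / q - 2 / q\<^sup>2 * sum w M)
      \<le> real q * (potential m w M (\<lambda>e. x e * (1 + ?r e / q)) - potential m w M x)"
    by (intro mult_left_mono) auto
  have "((\<Sum>e\<in>M. w e * ?r e) - (\<Sum>e<m. w e * ?r e * x e)) - 2 / q * sum w M
      \<le> real q * (potential m w M (\<lambda>e. x e * (1 + ?r e / q)) - potential m w M x)"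
  proof -
    have "real q * (S / q - 2 / q\<^sup>2 * s) = S - 2 / q * s" for S s :: real
      using q by (simp add: field_simps power2_eq_square)
    with * show ?thesis by metis
  qed
  with D show "(1 - 2 / q) * sum w M \<le> real q * (potential m w M (\<lambda>e. x e * (1 + ?r e / q))
      - potential m w M x) + (\<Sum>e<m. w e * ?z e)"
    by (simp add: left_diff_distrib)
qed

text \<open>As \<open>ln t - t \<le> -1\<close>, the potential never exceeds
  \<open>- sum w M\<close>. At the uniform start it is at least
  \<open>- (ln m + 1) * sum w M\<close>, since no edge is heavier than \<open>M\<close>. So the
  total gain is at most \<open>h * sum w M\<close>, and after the factor \<open>q\<close> this is a
  \<open>1 / q\<close> fraction of \<open>q * q * h\<close> rounds.\<close>

lemma potential_final:
  fixes w x Z :: "nat \<Rightarrow> real" and q h :: nat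
  assumes q: "2 \<le> q" and h: "m \<le> 2 ^ h" "0 < h" and M: "matching_idx M"
    and w: "\<And>e. e < m \<Longrightarrow> 0 < w e" "\<And>e. e < m \<Longrightarrow> w e \<le> sum w M"
    and x: "\<And>e. e < m \<Longrightarrow> 0 < x e"
    and inv: "real (q * q * h) * ((1 - 2 / q) * sum w M) \<le>
      real q * (potential m w M x - potential m w M (\<lambda>e. 1 / m)) + (\<Sum>e<m. w e * Z e)"
  shows "real (q * q * h) * ((1 - 3 / q) * sum w M) \<le> (\<Sum>e<m. w e * Z e)"
proof -
  have M': "M \<subseteq> {..<m}" "finite M" using M finite_subset by (auto simp: matching_idx_def)
  have w0: "0 \<le> sum w M" using w(1) M' by (intro sum_nonneg) (auto dest!: subsetD intro: less_imp_le)
  have "potential m w M x \<le> (\<Sum>e\<in>M. w e * ln (x e)) - (\<Sum>e\<in>M. w e * x e)"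
    unfolding potential_def using M' w(1) x
    by (intro diff_left_mono sum_mono2) (auto intro: less_imp_le)
  also have "\<dots> = (\<Sum>e\<in>M. w e * (ln (x e) - x e))" by (simp add: sum_subtractf algebra_simps)
  also have "\<dots> \<le> (\<Sum>e\<in>M. w e * (-1))"
  proof (intro sum_mono mult_left_mono)
    fix e assume "e \<in> M"
    then have e: "e < m" using M' by auto
    show "ln (x e) - x e \<le> -1" using ln_le_minus_one[OF x[OF e]] by simp
    show "0 \<le> w e" using w(1)[OF e] by simp
  qed
  also have "\<dots> = - sum w M" by (simp add: sum_negf)
  finally have "potential m w M x \<le> - sum w M" .
  moreover have "(\<Sum>e<m. w e * (1 / m)) \<le> sum w M"
  proof -
    have "(\<Sum>e<m. w e * (1 / m)) \<le> (\<Sum>e<m. sum w M * (1 / m))"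
      using w by (intro sum_mono mult_right_mono) auto
    then show ?thesis using m_pos by simp
  qed
  moreover have "potential m w M (\<lambda>e. 1 / m) = - (ln m * sum w M) - (\<Sum>e<m. w e * (1 / m))"
    using m_pos by (simp add: potential_def ln_div sum_distrib_right sum_negf mult.commute)
  ultimately have "potential m w M x - potential m w M (\<lambda>e. 1 / m) \<le> ln m * sum w M"
    by linarith
  also have "\<dots> \<le> real h * sum w M"
  proof (rule mult_right_mono[OF _ w0])
    have "ln (real m) \<le> ln (2 ^ h)"
      using h m_pos by (subst ln_le_cancel_iff) (auto simp flip: of_nat_power of_nat_le_iff)
    also have "\<dots> \<le> real h" using ln_2_less_1 by (simp add: ln_realpow mult_left_le)
    finally show "ln (real m) \<le> real h" .
  qed
  finally have "real q * (potential m w M x - potential m w M (\<lambda>e. 1 / m)) \<le> real q * (real h * sum w M)"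
    by (intro mult_left_mono) auto
  moreover have "real (q * q * h) * ((1 - 3 / q) * sum w M) =
      real (q * q * h) * ((1 - 2 / q) * sum w M) - real q * (real h * sum w M)"
    using q by (simp add: field_simps)
  ultimately show ?thesis using inv by linarith
qed

end

section \<open>Counting\<close>

text \<open>The rank function of \<open>p\<close>: restricted to the indices satisfying
  \<open>p\<close>, it is an order-preserving bijection onto an initial segment. It describes
  compaction, radix sort and segment bounds alike.\<close>

definition cnt :: "(nat \<Rightarrow> bool) \<Rightarrow> nat \<Rightarrow> nat" where
  "cnt p i = card {k. k < i \<and> p k}"

lemma cnt_0 [simp]: "cnt p 0 = 0"
  by (simp add: cnt_def)

lemma cnt_Suc: "cnt p (Suc i) = cnt p i + (if p i then 1 else 0)"
proof -
  have "{k. k < Suc i \<and> p k} = (if p i then insert i {k. k < i \<and> p k} else {k. k < i \<and> p k})"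
    by (auto simp: less_Suc_eq)
  then show ?thesis by (simp add: cnt_def)
qed

lemma cnt_sum: "(\<Sum>k<i. if p k then 1 else 0 :: int) = int (cnt p i)"
  by (induction i) (auto simp: cnt_Suc)

lemma cnt_mono: "i \<le> j \<Longrightarrow> cnt p i \<le> cnt p j"
  unfolding cnt_def by (intro card_mono) auto

lemma cnt_le: "cnt p i \<le> i"
  using card_mono[of "{..<i}" "{k. k < i \<and> p k}"] by (auto simp: cnt_def)

lemma cnt_less: "p i \<Longrightarrow> i < j \<Longrightarrow> cnt p i < cnt p j"
  using cnt_mono[of "Suc i" j p] by (simp add: cnt_Suc)

lemma cnt_not: "cnt (\<lambda>k. \<not> p k) i = i - cnt p i"
proof -
  have "cnt (\<lambda>k. \<not> p k) i + cnt p i = i" by (induction i) (auto simp: cnt_Suc)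
  then show ?thesis by simp
qed

lemma cnt_inj: "p i \<Longrightarrow> p j \<Longrightarrow> cnt p i = cnt p j \<Longrightarrow> i = j"
  by (cases i j rule: linorder_cases) (auto dest: cnt_less[of p])

lemma cnt_surj: "c < cnt p i \<Longrightarrow> \<exists>k<i. p k \<and> cnt p k = c"
proof (induction i)
  case (Suc i)
  then show ?case
    by (cases "c < cnt p i") (auto simp: cnt_Suc less_Suc_eq split: if_splits)
qed simp

lemma sum_over_cnt: "(\<Sum>k\<in>{k. i \<le> k \<and> k < j \<and> p k}. F (cnt p k)) = (\<Sum>c = cnt p i..<cnt p j. F c)"
proof (rule sum.reindex_bij_betw)
  show "bij_betw (cnt p) {k. i \<le> k \<and> k < j \<and> p k} {cnt p i..<cnt p j}"
  proof (rule bij_betw_imageI)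
    show "inj_on (cnt p) {k. i \<le> k \<and> k < j \<and> p k}" by (auto simp: inj_on_def intro: cnt_inj)
    show "cnt p ` {k. i \<le> k \<and> k < j \<and> p k} = {cnt p i..<cnt p j}"
    proof (intro equalityI subsetI)
      fix c assume "c \<in> {cnt p i..<cnt p j}"
      then obtain k where "k < j" "p k" "cnt p k = c" "cnt p i \<le> c" using cnt_surj[of c p j] by auto
      moreover from this have "i \<le> k" using cnt_less[of p k i] by (cases "k < i") auto
      ultimately show "c \<in> cnt p ` {k. i \<le> k \<and> k < j \<and> p k}" by auto
    qed (auto intro: cnt_mono cnt_less)
  qed
qed

text \<open>Consecutive pairs cancel, so the sum is 0 or equals its last term.\<close>

lemma alternating_sum:
  fixes f :: "nat \<Rightarrow> int"
  assumes "\<And>k. 2 * k + 1 < L \<Longrightarrow> f (2 * k + 1) = - f (2 * k)" "\<And>k. k < L \<Longrightarrow> \<bar>f k\<bar> \<le> 1"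
  shows "\<bar>\<Sum>k<L. f k\<bar> \<le> 1"
  using assms
proof (induction L rule: less_induct)
  case (less L)
  have "L = 0 \<or> L = 1 \<or> L = (L - 2) + 2" by linarith
  then consider "L = 0" | "L = 1" | L' where "L = L' + 2" by blast
  then show ?case
  proof cases
    case 3
    show ?thesis
    proof (cases "even L'")
      case True
      then obtain k where "L' = 2 * k" by blast
      with 3 less.prems(1)[of k] have "(\<Sum>k<L. f k) = (\<Sum>k<L'. f k)" by simp
      with less.IH[of L'] less.prems 3 show ?thesis by simp
    next
      case False
      then obtain k where k: "L' = 2 * k + 1" using oddE by blast
      with 3 less.prems(1)[of k] have "(\<Sum>k<L. f k) = (\<Sum>k<2 * k. f k) + f (2 * k + 2)" by simp
      moreover have "even (2 * k)" by simp
      moreover have "(\<Sum>k<2 * k'. f k) = 0" if "2 * k' \<le> L" for k'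
        using that by (induction k') (use less.prems(1) in \<open>auto\<close>)
      ultimately show ?thesis using less.prems(2)[of "2 * k + 2"] 3 k by simp
    qed
  qed (use less.prems(2)[of 0] in auto)
qed

section \<open>Two-colouring of paths and even cycles\<close>

text \<open>
  A node is an edge together with a direction; \<open>O\<close> reverses the direction and \<open>V\<close> passes, at the tail of
  a node, to the paired edge (or to the node itself if there is none). Walking along \<open>nx\<close>, we follow a path
  to its end or go around a cycle. The least key met on the way is the same for all nodes of this walk, as
  ends of paths have smaller keys than other nodes, and it distinguishes the two directions.
\<close>

locale pairing =
  fixes A :: nat and V O' :: "nat \<Rightarrow> nat"
  assumes V_less: "c < A \<Longrightarrow> V c < A" and V_V: "c < A \<Longrightarrow> V (V c) = c"
    and O_less: "c < A \<Longrightarrow> O' c < A" and O_O: "c < A \<Longrightarrow> O' (O' c) = c"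
    and O_neq: "c < A \<Longrightarrow> O' c \<noteq> c"
begin

definition stuck :: "nat \<Rightarrow> bool" where "stuck c \<longleftrightarrow> V (O' c) = O' c"

text \<open>At the end of a path the walk stays where it is. This makes all iterates defined, so
  that pointer jumping needs no test for the end.\<close>

definition nx :: "nat \<Rightarrow> nat" where "nx c = (if stuck c then c else V (O' c))"

definition key :: "nat \<Rightarrow> nat" where "key c = (if stuck c then c else c + A)"

definition leader :: "nat \<Rightarrow> nat" where "leader c = Min ((\<lambda>i. key ((nx ^^ i) c)) ` {..<A})"

lemma nx_less: "c < A \<Longrightarrow> nx c < A"
  by (simp add: nx_def V_less O_less)

lemma iter_less: "c < A \<Longrightarrow> (nx ^^ i) c < A"
  by (induction i) (auto simp: nx_less)

lemma key_inj: "c < A \<Longrightarrow> d < A \<Longrightarrow> key c = key d \<Longrightarrow> c = d"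
  by (auto simp: key_def split: if_splits)

lemma nx_inj: "c < A \<Longrightarrow> d < A \<Longrightarrow> \<not> stuck c \<Longrightarrow> \<not> stuck d \<Longrightarrow> nx c = nx d \<Longrightarrow> c = d"
  unfolding nx_def by (metis O_O O_less V_V)

lemma stuck_iter: "stuck c \<Longrightarrow> (nx ^^ i) c = c"
  by (induction i) (auto simp: nx_def)

lemma iter_diff: "i \<le> k \<Longrightarrow> (nx ^^ k) c = (nx ^^ (k - i)) ((nx ^^ i) c)"
  using funpow_add[of "k - i" i nx] by simp

text \<open>By the pigeonhole principle an iterate recurs within \<open>A\<close> steps, after which
  nothing new is met. Any \<open>r\<close> from \<open>A\<close> on is allowed because pointer
  jumping stops at a power of 2.\<close>

lemma iter_image:
  assumes "c < A" "A \<le> r"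
  shows "(\<lambda>i. (nx ^^ i) c) ` {..<r} = range (\<lambda>i. (nx ^^ i) c)"
proof -
  let ?f = "\<lambda>i. (nx ^^ i) c"
  have "\<not> inj_on ?f {..A}"
  proof
    assume "inj_on ?f {..A}"
    moreover have "?f ` {..A} \<subseteq> {..<A}" using iter_less[OF assms(1)] by auto
    ultimately have "card {..A} \<le> card {..<A}" by (intro card_inj_on_le) auto
    then show False by simp
  qed
  then obtain i j where ij: "i < j" "j \<le> A" "?f i = ?f j"
    unfolding inj_on_def by (metis atMost_iff linorder_neqE_nat)
  have per: "?f (i + k) = ?f (j + k)" for k using ij(3) by (induction k) auto
  have "?f k \<in> ?f ` {..<r}" for k
  proof (induction k rule: less_induct)
    case (less k)
    show ?case
    proof (cases "k < j")
      case True
      then show ?thesis using ij assms by auto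
    next
      case False
      then have "?f k = ?f (i + (k - j))" using per[of "k - j"] by simp
      moreover have "i + (k - j) < k" using ij False by simp
      ultimately show ?thesis using less by metis
    qed
  qed
  then show ?thesis by auto
qed

lemma leader_eq:
  assumes "c < A" "A \<le> r"
  shows "leader c = Min ((\<lambda>i. key ((nx ^^ i) c)) ` {..<r})"
proof -
  have "(\<lambda>i. key ((nx ^^ i) c)) ` S = key ` (\<lambda>i. (nx ^^ i) c) ` S" for S by (simp add: image_image)
  then show ?thesis
    using iter_image[OF assms] iter_image[OF assms(1) order_refl] by (simp add: leader_def)
qed

lemma leader_le: "c < A \<Longrightarrow> leader c \<le> key ((nx ^^ i) c)"
  using leader_eq[of c "max A (Suc i)"] by (auto intro!: Min_le)

lemma leader_attained:
  assumes "c < A" obtains i where "leader c = key ((nx ^^ i) c)"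
proof -
  have "leader c \<in> (\<lambda>i. key ((nx ^^ i) c)) ` {..<A}"
    unfolding leader_def using assms by (intro Min_in) auto
  then show ?thesis using that by auto
qed

text \<open>If the walk gets stuck, its end has a key below \<open>A\<close>, less than all other
  keys met, and the walk from \<open>nx c\<close> has the same end. Otherwise the walk is a cycle
  through \<open>c\<close>, so the walk from \<open>nx c\<close> visits the same nodes.\<close>

lemma leader_nx:
  assumes c: "c < A"
  shows "leader (nx c) = leader c"
proof -
  note nc = nx_less[OF c]
  have ge: "leader c \<le> leader (nx c)"
  proof -
    obtain i where "leader (nx c) = key ((nx ^^ i) (nx c))" using leader_attained[OF nc] .
    then show ?thesis using leader_le[OF c, of "Suc i"] by (simp add: funpow_swap1)
  qed
  show ?thesis
  proof (cases "\<exists>k. stuck ((nx ^^ k) c)")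
    case True
    then obtain k where k: "stuck ((nx ^^ k) c)" by blast
    let ?t = "(nx ^^ k) c"
    have "leader (nx c) \<le> key ((nx ^^ k) (nx c))" by (rule leader_le[OF nc])
    also have "(nx ^^ k) (nx c) = nx ?t" by (simp add: funpow_swap1)
    also have "nx ?t = ?t" using k by (simp add: nx_def)
    also have "key ?t \<le> leader c"
    proof -
      obtain i where i: "leader c = key ((nx ^^ i) c)" using leader_attained[OF c] .
      show ?thesis
      proof (cases "stuck ((nx ^^ i) c)")
        case True
        have "(nx ^^ i) c = ?t"
        proof (cases "i \<le> k")
          case le: True
          then have "?t = (nx ^^ (k - i)) ((nx ^^ i) c)" by (rule iter_diff)
          then show ?thesis using stuck_iter[OF True] by simp
        next
          case False
          then have "(nx ^^ i) c = (nx ^^ (i - k)) ?t" by (intro iter_diff) simp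
          then show ?thesis using stuck_iter[OF k] by simp
        qed
        then show ?thesis using i by simp
      next
        case False
        then show ?thesis using i k iter_less[OF c, of k] by (simp add: key_def)
      qed
    qed
    finally show ?thesis using ge by simp
  next
    case False
    then have ns: "\<not> stuck ((nx ^^ k) c)" for k by blast
    \<comment> \<open>A repetition exists by the pigeonhole principle, and injectivity of
      \<open>nx\<close> on nodes that are not stuck moves it back to the start.\<close>
    have "\<exists>k. c = (nx ^^ Suc k) c"
    proof -
      let ?f = "\<lambda>i. (nx ^^ i) c"
      have "\<not> inj_on ?f {..A}"
      proof
        assume "inj_on ?f {..A}"
        moreover have "?f ` {..A} \<subseteq> {..<A}" using iter_less[OF c] by auto
        ultimately have "card {..A} \<le> card {..<A}" by (intro card_inj_on_le) auto
        then show False by simp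
      qed
      then obtain i j where ij: "i < j" "?f i = ?f j"
        unfolding inj_on_def by (metis linorder_neqE_nat)
      then obtain k where "j = Suc (i + k)" using less_imp_Suc_add by blast
      with ij have "?f i = ?f (i + Suc k)" by simp
      then have "?f 0 = ?f (Suc k)"
      proof (induction i)
        case (Suc i)
        have "nx (?f i) = nx (?f (i + Suc k))" using Suc.prems by simp
        then have "?f i = ?f (i + Suc k)"
          using nx_inj[OF iter_less[OF c] iter_less[OF c] ns ns] by blast
        then show ?case by (rule Suc.IH)
      qed simp
      then show ?thesis by auto
    qed
    then obtain k where k: "c = (nx ^^ Suc k) c" by blast
    obtain i where i: "leader c = key ((nx ^^ i) c)" using leader_attained[OF c] .
    have "(nx ^^ i) c = (nx ^^ (i + k)) (nx c)"
    proof -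
      have "(nx ^^ i) c = (nx ^^ i) ((nx ^^ Suc k) c)" by (rule arg_cong[OF k])
      also have "\<dots> = (nx ^^ (i + k)) (nx c)" by (simp add: funpow_add funpow_swap1)
      finally show ?thesis .
    qed
    then have "leader (nx c) \<le> leader c" using leader_le[OF nc, of "i + k"] i by simp
    with ge show ?thesis by simp
  qed
qed

text \<open>A shortest walk from \<open>d\<close> to its reversal would be a palindrome: its node at
  distance \<open>i\<close> from the end reverses the node at distance \<open>i\<close> from the
  start. In the middle there would be a node equal to its own reversal, or one that is stuck
  although the walk goes on.\<close>

lemma no_reversal:
  assumes d: "d < A"
  shows "(nx ^^ k) d \<noteq> O' d"
proof
  assume "(nx ^^ k) d = O' d"
  define l where "l = (LEAST k. (nx ^^ k) d = O' d)"
  let ?a = "\<lambda>i. (nx ^^ i) d"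
  have l: "?a l = O' d" unfolding l_def by (rule LeastI) fact
  have least: "?a i \<noteq> O' d" if "i < l" for i using not_less_Least that unfolding l_def by blast
  have ns: "\<not> stuck (?a i)" if "i < l" for i
  proof
    assume "stuck (?a i)"
    moreover have "?a l = (nx ^^ (l - i)) (?a i)" using that by (intro iter_diff) simp
    ultimately have "?a l = ?a i" using stuck_iter by simp
    with l least[OF that] show False by simp
  qed
  have st: "?a (Suc i) = V (O' (?a i))" if "i < l" for i using ns[OF that] by (simp add: nx_def)
  have sym: "?a (l - i) = O' (?a i)" if "i \<le> l" for i
    using that
  proof (induction i)
    case 0
    then show ?case using l by simp
  next
    case (Suc i)
    then have "?a (Suc (l - Suc i)) = O' (?a i)" by (simp add: Suc_diff_Suc)
    then have "V (O' (?a (l - Suc i))) = O' (?a i)" using st[of "l - Suc i"] Suc.prems by simp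
    then have "O' (?a (l - Suc i)) = V (O' (?a i))"
      using V_V[OF O_less[OF iter_less[OF d, of "l - Suc i"]]] by simp
    then have "O' (?a (l - Suc i)) = ?a (Suc i)" using st[of i] Suc.prems by simp
    then show ?case using O_O[OF iter_less[OF d, of "l - Suc i"]] by simp
  qed
  show False
  proof (cases "even l")
    case True
    then obtain j where "l = 2 * j" by blast
    then have "?a j = O' (?a j)" using sym[of j] by simp
    then show False using O_neq[OF iter_less[OF d, of j]] by simp
  next
    case False
    then obtain j where j: "l = 2 * j + 1" using oddE by blast
    then have "?a (Suc j) = O' (?a j)" using sym[of j] by (simp add: Suc_diff_le)
    then have "stuck (?a j)" using st[of j] j by (simp add: stuck_def)
    then show False using ns[of j] j by simp
  qed
qed

text \<open>Keys are injective, so equal leaders mean that the walks in both directions share a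
  node. Going backwards from it by injectivity of \<open>nx\<close>, or dropping idle steps at a
  stuck node, one of the two starting points is reached by the other walk, against
  \<open>no_reversal\<close>.\<close>

lemma leader_reverse:
  assumes c: "c < A"
  shows "leader (O' c) \<noteq> leader c"
proof
  assume eq: "leader (O' c) = leader c"
  obtain i where "leader c = key ((nx ^^ i) c)" using leader_attained[OF c] .
  moreover obtain j where "leader (O' c) = key ((nx ^^ j) (O' c))" using leader_attained[OF O_less[OF c]] .
  ultimately have "(nx ^^ i) c = (nx ^^ j) (O' c)"
    using eq key_inj iter_less[OF c] iter_less[OF O_less[OF c]] by metis
  then show False
  proof (induction "i + j" arbitrary: i j rule: less_induct)
    case less
    show False
    proof (cases "i = 0 \<or> j = 0")
      case True
      then show False
        using less.prems no_reversal[OF O_less[OF c], of j] no_reversal[OF c, of i] O_O[OF c] by auto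
    next
      case False
      then obtain i' j' where ij: "i = Suc i'" "j = Suc j'" by (metis not0_implies_Suc)
      let ?a = "(nx ^^ i') c" and ?b = "(nx ^^ j') (O' c)"
      have e: "nx ?a = nx ?b" using less.prems ij by simp
      consider "stuck ?a" | "stuck ?b" | "?a = ?b"
        using nx_inj[OF iter_less[OF c] iter_less[OF O_less[OF c]] _ _ e] by blast
      then show False
      proof cases
        case 1
        then have "(nx ^^ i') c = (nx ^^ j) (O' c)" using e ij by (simp add: nx_def)
        then show False using less.hyps[of i' j] ij by simp
      next
        case 2
        then have "(nx ^^ i) c = (nx ^^ j') (O' c)" using e ij by (simp add: nx_def)
        then show False using less.hyps[of i j'] ij by simp
      next
        case 3
        then show False using less.hyps[of i' j'] ij by simp
      qed
    qed
  qed
qed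

text \<open>The walk from \<open>O' c\<close> goes to \<open>V c\<close> in one step. Passing from a
  node to its paired node therefore exchanges the leaders of the two directions, and with them the
  colour.\<close>

lemma leader_pair:
  assumes c: "c < A" "V c \<noteq> c"
  shows "leader (V c) = leader (O' c)" "leader (O' (V c)) = leader c"
proof -
  have "nx (O' c) = V c" using c O_O[OF c(1)] by (simp add: nx_def stuck_def)
  then show "leader (V c) = leader (O' c)" using leader_nx[OF O_less[OF c(1)]] by simp
  have "nx (O' (V c)) = c"
    using c O_O[OF V_less[OF c(1)]] V_V[OF c(1)] by (simp add: nx_def stuck_def)
  then show "leader (O' (V c)) = leader c" using leader_nx[OF O_less[OF V_less[OF c(1)]]] by simp
qed

end

section \<open>Rounding by halving\<close>

text \<open>Only the grouping of the half-edges by vertex matters for rounding; the order by weight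
  within a segment is added in \<open>sorted_run\<close>.\<close>

locale sorted_halves = half_edges +
  fixes od st en :: "nat \<Rightarrow> nat"
  assumes od_bij: "bij_betw od {..<2 * m} {..<2 * m}"
    and seg: "i < 2 * m \<Longrightarrow> vt (od i) = v \<longleftrightarrow> st v \<le> i \<and> i < en v"
    and st_le: "st v \<le> en v" and en_le: "en v \<le> 2 * m"
begin

lemma od_less: "i < 2 * m \<Longrightarrow> od i < 2 * m"
  using od_bij by (auto dest: bij_betwE)

lemma od_inj: "i < 2 * m \<Longrightarrow> j < 2 * m \<Longrightarrow> od i = od j \<Longrightarrow> i = j"
  using od_bij by (auto simp: bij_betw_def inj_on_def)

lemma od_surj: "h < 2 * m \<Longrightarrow> \<exists>i<2 * m. od i = h"
  using bij_betw_imp_surj_on[OF od_bij] by (metis imageE lessThan_iff)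

lemma halves_od: "halves v = od ` {st v..<en v}"
proof (intro equalityI subsetI)
  fix h assume "h \<in> halves v"
  then have "h < 2 * m" "vt h = v" by (auto simp: halves_def)
  then show "h \<in> od ` {st v..<en v}" using od_surj[of h] seg[of _ v] by force
next
  fix h assume "h \<in> od ` {st v..<en v}"
  then show "h \<in> halves v" using en_le[of v] seg[of _ v] od_less by (auto simp: halves_def)
qed

lemma inj_od_seg: "inj_on od {st v..<en v}"
  using en_le[of v] by (auto simp: inj_on_def intro: od_inj)

lemma sum_halves_od: "(\<Sum>h\<in>halves v. F h) = (\<Sum>i = st v..<en v. F (od i))"
  by (simp add: halves_od sum.reindex[OF inj_od_seg])

lemma card_halves: "card (halves v) = en v - st v"
  by (simp add: halves_od card_image[OF inj_od_seg])

lemma od_mod: "i < 2 * m \<Longrightarrow> od i mod m < m"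
  using m_pos by simp

end

text \<open>The involution exchanging \<open>L + 2 * k\<close> and \<open>L + 2 * k + 1\<close>; in
  an interval of odd length the last element is its own partner.\<close>

definition pair_in :: "nat \<Rightarrow> nat \<Rightarrow> nat \<Rightarrow> nat" where
  "pair_in L U c = (if even (c - L) then if c + 1 < U then c + 1 else c else c - 1)"

lemma pair_in:
  assumes "L \<le> c" "c < U"
  shows "L \<le> pair_in L U c" "pair_in L U c < U" "pair_in L U (pair_in L U c) = c"
proof -
  obtain r where r: "c = L + r" using assms le_Suc_ex by blast
  have "L \<le> pair_in L U c \<and> pair_in L U c < U \<and> pair_in L U (pair_in L U c) = c"
  proof (cases "even r")
    case True
    then show ?thesis using assms by (auto simp: r pair_in_def)
  next
    case False
    then obtain k where "r = 2 * k + 1" using oddE by blast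
    then show ?thesis using assms by (auto simp: r pair_in_def)
  qed
  then show "L \<le> pair_in L U c" "pair_in L U c < U" "pair_in L U (pair_in L U c) = c" by blast+
qed

text \<open>The instance of \<open>pairing\<close>: nodes are the ranks, in sorted order, of the
  half-edges whose edge has an odd value. \<open>opp\<close> is the other half of the edge,
  \<open>partner\<close> pairs neighbouring ranks at a vertex.\<close>

locale halving = sorted_halves +
  fixes X :: "nat \<Rightarrow> nat"
begin

definition act :: "nat \<Rightarrow> bool" where "act i \<longleftrightarrow> odd (X (od i mod m))"

definition HA :: nat where "HA = cnt act (2 * m)"

definition ps :: "nat \<Rightarrow> nat" where "ps c = (SOME i. i < 2 * m \<and> act i \<and> cnt act i = c)"

definition hc :: "nat \<Rightarrow> nat" where "hc c = od (ps c)"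

definition pos :: "nat \<Rightarrow> nat" where "pos h = (SOME i. i < 2 * m \<and> od i = h)"

definition cix :: "nat \<Rightarrow> nat" where "cix h = cnt act (pos h)"

definition opp :: "nat \<Rightarrow> nat" where "opp c = cix ((hc c + m) mod (2 * m))"

definition lo :: "nat \<Rightarrow> nat" where "lo v = cnt act (st v)"

definition hi :: "nat \<Rightarrow> nat" where "hi v = cnt act (en v)"

definition partner :: "nat \<Rightarrow> nat" where
  "partner c = pair_in (lo (vt (hc c))) (hi (vt (hc c))) c"

lemma ps: assumes "c < HA" shows "ps c < 2 * m" "act (ps c)" "cnt act (ps c) = c"
  using someI_ex[OF cnt_surj[OF assms[unfolded HA_def]]] unfolding ps_def by auto

lemma ps_cnt: "i < 2 * m \<Longrightarrow> act i \<Longrightarrow> ps (cnt act i) = i"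
  using ps[of "cnt act i"] cnt_less[of act i "2 * m"] by (auto simp: HA_def intro: cnt_inj)

lemma pos: assumes "h < 2 * m" shows "pos h < 2 * m" "od (pos h) = h"
  using someI_ex[OF od_surj[OF assms]] unfolding pos_def by auto

lemma pos_od: "i < 2 * m \<Longrightarrow> pos (od i) = i"
  using pos[OF od_less] od_inj by blast

lemma hc_less: "c < HA \<Longrightarrow> hc c < 2 * m"
  unfolding hc_def using ps od_less by blast

lemma hc_odd: "c < HA \<Longrightarrow> odd (X (hc c mod m))"
  using ps(2) by (simp add: hc_def act_def)

lemma cix_less: "h < 2 * m \<Longrightarrow> odd (X (h mod m)) \<Longrightarrow> cix h < HA"
  unfolding cix_def HA_def using pos[of h] by (intro cnt_less) (auto simp: act_def)

lemma hc_cix: "h < 2 * m \<Longrightarrow> odd (X (h mod m)) \<Longrightarrow> hc (cix h) = h"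
  unfolding cix_def hc_def using pos[of h] by (simp add: ps_cnt act_def)

lemma cix_hc: "c < HA \<Longrightarrow> cix (hc c) = c"
  unfolding cix_def hc_def using ps by (simp add: pos_od)

lemma cix_od: "i < 2 * m \<Longrightarrow> cix (od i) = cnt act i"
  unfolding cix_def by (simp add: pos_od)

lemma hc_cnt: "i < 2 * m \<Longrightarrow> act i \<Longrightarrow> hc (cnt act i) = od i"
  unfolding hc_def by (simp add: ps_cnt)

lemma other_mod: "h < 2 * m \<Longrightarrow> (h + m) mod (2 * m) mod m = h mod m"
  by (simp add: mod_mod_cancel)

lemma other_eq: "h < 2 * m \<Longrightarrow> (h + m) mod (2 * m) = (if h < m then h + m else h - m)"
  by (auto simp: mod_if)

lemma vt_hc: "c < HA \<Longrightarrow> vt (hc c) = v \<longleftrightarrow> lo v \<le> c \<and> c < hi v"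
proof
  assume c: "c < HA"
  note p = ps[OF c]
  show "lo v \<le> c \<and> c < hi v" if "vt (hc c) = v"
    using that seg[OF p(1), of v] cnt_mono[of "st v" "ps c" act] cnt_less[of act "ps c" "en v"] p
    by (simp add: hc_def lo_def hi_def)
  show "vt (hc c) = v" if "lo v \<le> c \<and> c < hi v"
  proof -
    have "\<not> ps c < st v" using that cnt_less[where p = act, OF p(2), of "st v"] p by (auto simp: lo_def)
    moreover have "ps c < en v" using that cnt_mono[of "en v" "ps c" act] p by (force simp: hi_def)
    ultimately show ?thesis using seg[OF p(1), of v] by (simp add: hc_def)
  qed
qed

lemma hi_le: "hi v \<le> HA"
  unfolding hi_def HA_def using en_le by (rule cnt_mono)

lemma partner_props:
  assumes "c < HA"
  shows "partner c < HA" "vt (hc (partner c)) = vt (hc c)" "partner (partner c) = c"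
proof -
  let ?v = "vt (hc c)"
  have c: "lo ?v \<le> c" "c < hi ?v" using vt_hc[OF assms, of ?v] by simp_all
  have p: "lo ?v \<le> partner c" "partner c < hi ?v"
    using pair_in[OF c] by (simp_all add: partner_def)
  show *: "partner c < HA" using p hi_le[of ?v] by simp
  show v: "vt (hc (partner c)) = ?v" using vt_hc[OF *, of ?v] p by simp
  show "partner (partner c) = c"
    unfolding partner_def[of "partner c"] v unfolding partner_def by (rule pair_in(3)[OF c])
qed

lemma opp_props:
  assumes "c < HA"
  shows "opp c < HA" "opp (opp c) = c" "opp c \<noteq> c" "hc (opp c) = (hc c + m) mod (2 * m)"
proof -
  let ?h = "(hc c + m) mod (2 * m)"
  have h: "?h < 2 * m" "odd (X (?h mod m))" using m_pos hc_odd[OF assms] other_mod[OF hc_less[OF assms]] by auto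
  show 1: "opp c < HA" unfolding opp_def using cix_less[OF h] .
  show 2: "hc (opp c) = ?h" unfolding opp_def using hc_cix[OF h] .
  have "(?h + m) mod (2 * m) = hc c" using other_eq[OF hc_less[OF assms]] hc_less[OF assms] m_pos by (auto simp: mod_if)
  then show "opp (opp c) = c" unfolding opp_def[of "opp c"] 2 using cix_hc[OF assms] by simp
  have "?h \<noteq> hc c" using other_eq[OF hc_less[OF assms]] m_pos by (auto split: if_splits)
  with 2 show "opp c \<noteq> c" by auto
qed

sublocale pairing HA partner opp
  using partner_props opp_props by unfold_locales blast+

definition col :: "nat \<Rightarrow> bool" where "col e \<longleftrightarrow> leader (cix e) < leader (cix (m + e))"

text \<open>Here bipartiteness enters. Paired half-edges share a vertex and so lie on the same side,
  hence the colours of both edges compare leaders in the same orientation, whereas by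
  \<open>leader_pair\<close> the two leaders are exchanged.\<close>

lemma col_partner:
  assumes c: "c < HA" "partner c \<noteq> c"
  shows "col (hc (partner c) mod m) \<longleftrightarrow> \<not> col (hc c mod m)"
proof -
  let ?d = "partner c"
  note d = partner_props[OF c(1)]
  note lp = leader_pair[OF c]
  have ne: "leader (opp c) \<noteq> leader c" using leader_reverse[OF c(1)] .
  note hh = hc_less[OF c(1)] hc_less[OF d(1)]
  have other: "cix ((hc x + m) mod (2 * m)) = opp x" for x by (simp add: opp_def)
  show ?thesis
  proof (cases "hc c < m")
    case True
    have "hc ?d < m"
    proof (rule ccontr)
      assume "\<not> hc ?d < m"
      then have "hc ?d - m < m" "m + (hc ?d - m) = hc ?d" using hh m_pos by linarith+
      then show False using sides[OF True, of "hc ?d - m"] d(2) by simp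
    qed
    then show ?thesis
      using True lp ne other[of c] other[of ?d] cix_hc[OF c(1)] cix_hc[OF d(1)]
        other_eq[OF hh(1)] other_eq[OF hh(2)] by (auto simp: col_def add.commute)
  next
    case False
    have F: "\<not> hc ?d < m"
    proof
      assume "hc ?d < m"
      moreover have "hc c - m < m" "m + (hc c - m) = hc c" using False hh m_pos by linarith+
      ultimately show False using sides[of "hc ?d" "hc c - m"] d(2) by simp
    qed
    have md: "hc c mod m = hc c - m" "hc ?d mod m = hc ?d - m"
      using False F hh by (auto simp: le_mod_geq)
    show ?thesis
      using False F lp ne other[of c] other[of ?d] cix_hc[OF c(1)] cix_hc[OF d(1)]
        other_eq[OF hh(1)] other_eq[OF hh(2)] by (auto simp: col_def md)
  qed
qed

definition rounded :: "bool \<Rightarrow> nat \<Rightarrow> nat" where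
  "rounded s e = (X e + (if odd (X e) \<and> (col e \<longleftrightarrow> s) then 1 else 0)) div 2"

definition sgn_of :: "bool \<Rightarrow> nat \<Rightarrow> int" where
  "sgn_of s e = (if odd (X e) then if col e \<longleftrightarrow> s then 1 else -1 else 0)"

lemma rounded: "2 * int (rounded s e) = int (X e) + sgn_of s e"
  unfolding rounded_def sgn_of_def by (auto elim!: evenE oddE)

text \<open>The odd half-edges at \<open>v\<close> have the consecutive ranks from
  \<open>lo v\<close> to \<open>hi v\<close>, and paired ones have opposite signs.\<close>

lemma sgn_sum_vertex: "\<bar>\<Sum>h\<in>halves v. sgn_of s (h mod m)\<bar> \<le> 1"
proof -
  let ?g = "\<lambda>c. sgn_of s (hc c mod m)"
  have "(\<Sum>h\<in>halves v. sgn_of s (h mod m)) = (\<Sum>i = st v..<en v. sgn_of s (od i mod m))"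
    by (rule sum_halves_od)
  also have "\<dots> = (\<Sum>i\<in>{k. st v \<le> k \<and> k < en v \<and> act k}. sgn_of s (od i mod m))"
    by (rule sum.mono_neutral_right) (auto simp: act_def sgn_of_def)
  also have "\<dots> = (\<Sum>i\<in>{k. st v \<le> k \<and> k < en v \<and> act k}. ?g (cnt act i))"
    using en_le[of v] by (intro sum.cong refl) (auto simp: hc_cnt)
  also have "\<dots> = (\<Sum>c = lo v..<hi v. ?g c)"
    unfolding lo_def hi_def by (rule sum_over_cnt)
  also have "\<dots> = (\<Sum>k<hi v - lo v. ?g (lo v + k))"
    using sum.atLeastLessThan_shift_0[of ?g "lo v" "hi v"] by (simp add: atLeast0LessThan add.commute)
  finally have e: "(\<Sum>h\<in>halves v. sgn_of s (h mod m)) = (\<Sum>k<hi v - lo v. ?g (lo v + k))" .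
  show ?thesis
    unfolding e
  proof (rule alternating_sum)
    fix k assume k: "2 * k + 1 < hi v - lo v"
    let ?c = "lo v + 2 * k"
    have c: "?c < HA" using k hi_le[of v] by simp
    have v: "vt (hc ?c) = v" using vt_hc[OF c, of v] k by simp
    have p: "partner ?c = Suc ?c" using k by (simp add: partner_def pair_in_def v)
    have "odd (X (hc ?c mod m))" "odd (X (hc (Suc ?c) mod m))"
      using hc_odd[OF c] hc_odd[OF partner_props(1)[OF c]] p by simp_all
    then show "?g (lo v + (2 * k + 1)) = - ?g (lo v + 2 * k)"
      using col_partner[OF c] p by (simp add: sgn_of_def)
  qed (simp add: sgn_of_def)
qed

text \<open>Twice the new load is at most \<open>2 * C + 1\<close>, and loads are integers.\<close>

lemma load_rounded:
  assumes "load X v \<le> 2 * C"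
  shows "load (rounded s) v \<le> C"
proof -
  have "2 * int (load (rounded s) v) = int (load X v) + (\<Sum>h\<in>halves v. sgn_of s (h mod m))"
    by (simp add: load_def sum_distrib_left rounded sum.distrib)
  then show ?thesis using sgn_sum_vertex[of s v] assms by linarith
qed

text \<open>The last sum changes its sign with \<open>s\<close> by \<open>sgn_of_not\<close>, so for
  one of the two choices no weight is lost relative to the halved load bound.\<close>

lemma weight_rounded:
  fixes w :: "nat \<Rightarrow> real"
  shows "2 * (\<Sum>e<m. w e * real (rounded s e)) =
    (\<Sum>e<m. w e * real (X e)) + (\<Sum>e<m. w e * real_of_int (sgn_of s e))"
proof -
  have "2 * real (rounded s e) = real (X e) + real_of_int (sgn_of s e)" for e
    using arg_cong[OF rounded[of s e], of real_of_int] by simp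
  then have "2 * (w e * real (rounded s e)) = w e * real (X e) + w e * real_of_int (sgn_of s e)" for e
    by (metis (no_types) distrib_left mult.left_commute)
  then show ?thesis by (simp add: sum_distrib_left sum.distrib)
qed

lemma sgn_of_not: "sgn_of (\<not> s) e = - sgn_of s e"
  by (simp add: sgn_of_def)

lemma sum_act: "HA = 2 * card {e. e < m \<and> odd (X e)}"
proof -
  have "int HA = (\<Sum>i<2 * m. if act i then 1 else 0)" by (simp add: HA_def cnt_sum)
  also have "\<dots> = (\<Sum>i<2 * m. if odd (X (od i mod m)) then 1 else 0)" by (simp add: act_def)
  also have "\<dots> = (\<Sum>h<2 * m. if odd (X (h mod m)) then 1 else 0)"
    by (rule sum.reindex_bij_betw[OF od_bij])
  also have "\<dots> = 2 * (\<Sum>e<m. if odd (X e) then 1 else 0)"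
    unfolding sum_halves by (simp add: sum_distrib_left)
  also have "\<dots> = 2 * int (card {e. e < m \<and> odd (X e)})"
    using cnt_sum[of "\<lambda>e. odd (X e)" m] by (simp add: cnt_def)
  finally show ?thesis by simp
qed

end

section \<open>Load of the initial integral vector and the total number of odd edges\<close>

context half_edges
begin

definition deg :: "nat \<Rightarrow> nat" where "deg v = card (halves v)"

lemma sum_deg: "(\<Sum>v<n. deg v) = 2 * m"
  using sum_by_vertex[of "\<lambda>_. 1::nat"] by (simp add: deg_def)

lemma deg_pos: "h < 2 * m \<Longrightarrow> 0 < deg (vt h)"
  by (auto simp: deg_def card_gt_0_iff halves_def)

text \<open>Rounding up to a multiple of \<open>2 ^ (J - a e)\<close> adds at most
  \<open>2 ^ J / (q * deg v)\<close> per edge at \<open>v\<close>, thus at most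
  \<open>2 ^ J / q\<close> in total, which is the room left by the factor
  \<open>1 - 1 / q\<close>.\<close>

lemma load_initial:
  fixes z :: "nat \<Rightarrow> real" and y a :: "nat \<Rightarrow> nat" and q J :: nat
  assumes q: "0 < q" and z0: "\<And>e. e < m \<Longrightarrow> 0 \<le> z e"
    and z: "load z v \<le> 1"
    and a: "\<And>h. h < 2 * m \<Longrightarrow> q * deg (vt h) \<le> 2 ^ a (h mod m)" "\<And>e. e < m \<Longrightarrow> a e \<le> J"
    and y: "\<And>e. e < m \<Longrightarrow> real (y e) \<le> z e * (1 - 1 / q) * 2 ^ a e"
    and X: "\<And>e. e < m \<Longrightarrow> X e = (y e + 1) * 2 ^ (J - a e)"
  shows "load X v \<le> 2 ^ J"
proof (cases "halves v = {}")
  case True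
  then show ?thesis by (simp add: load_def)
next
  case False
  then have dv: "0 < deg v" by (simp add: deg_def card_gt_0_iff)
  have "real (X (h mod m)) \<le> 2 ^ J * (1 - 1 / q) * z (h mod m) + 2 ^ J / (q * deg v)" if "h \<in> halves v" for h
  proof -
    let ?e = "h mod m"
    have h: "h < 2 * m" "vt h = v" "?e < m" using that m_pos by (auto simp: halves_def)
    have J: "(2::real) ^ J = 2 ^ (J - a ?e) * 2 ^ a ?e" using a(2)[OF h(3)] by (simp flip: power_add)
    have "real (q * deg v) \<le> real (2 ^ a ?e)" using a(1)[OF h(1)] h(2) by (simp only: of_nat_le_iff)
    then have "2 ^ J / 2 ^ a ?e \<le> 2 ^ J / real (q * deg v)"
      using q dv by (intro divide_left_mono mult_pos_pos) auto
    then have 2: "(2::real) ^ (J - a ?e) \<le> 2 ^ J / (q * deg v)" by (simp add: J)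
    have "real (X ?e) = real (y ?e) * 2 ^ (J - a ?e) + 2 ^ (J - a ?e)"
      by (simp add: X[OF h(3)] algebra_simps)
    also have "\<dots> \<le> (z ?e * (1 - 1 / q) * 2 ^ a ?e) * 2 ^ (J - a ?e) + 2 ^ J / (q * deg v)"
      using y[OF h(3)] 2 by (intro add_mono mult_right_mono) auto
    finally show ?thesis by (simp add: J mult_ac)
  qed
  then have "real (load X v) \<le> (\<Sum>h\<in>halves v. 2 ^ J * (1 - 1 / q) * z (h mod m) + 2 ^ J / (q * deg v))"
    unfolding load_def of_nat_sum by (intro sum_mono) auto
  also have "\<dots> = 2 ^ J * (1 - 1 / q) * load z v + 2 ^ J / q"
    using dv False by (simp add: sum.distrib load_def deg_def flip: sum_distrib_left)
  also have "\<dots> \<le> 2 ^ J * (1 - 1 / q) * 1 + 2 ^ J / q"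
    using z q by (intro add_mono mult_left_mono mult_nonneg_nonneg) auto
  also have "\<dots> = 2 ^ J" by (simp add: algebra_simps)
  finally have "real (load X v) \<le> real (2 ^ J)" by simp
  then show ?thesis by (simp only: of_nat_le_iff)
qed

text \<open>A potential for the number of odd edges when all loads are at most \<open>C\<close>.
  Capping by the degree makes the total independent of the initial load bound.\<close>

definition budget :: "nat \<Rightarrow> nat \<Rightarrow> nat" where
  "budget q C = (\<Sum>v<n. 4 * min C (2 * q * deg v))"

lemma budget_le: "budget q C \<le> 16 * q * m"
proof -
  have "budget q C \<le> (\<Sum>v<n. 8 * q * deg v)"
    unfolding budget_def by (intro sum_mono) simp
  also have "\<dots> = 8 * q * (\<Sum>v<n. deg v)" by (simp add: sum_distrib_left)
  finally show ?thesis by (simp add: sum_deg)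
qed

text \<open>An odd edge has value at least 1 and is charged to an end with
  \<open>2 * C \<le> 2 * q * deg v\<close>. The load of such a vertex is at most
  \<open>2 * C\<close>, and its term in the budget falls from \<open>8 * C\<close> to
  \<open>4 * C\<close>, which pays twice that load.\<close>

lemma odd_card_le:
  fixes X :: "nat \<Rightarrow> nat"
  assumes ld: "\<And>v. v < n \<Longrightarrow> load X v \<le> 2 * C"
    and odd: "\<And>e. e < m \<Longrightarrow> odd (X e) \<Longrightarrow> \<exists>h. h < 2 * m \<and> h mod m = e \<and> 2 * C \<le> 2 * q * deg (vt h)"
  shows "2 * card {e. e < m \<and> odd (X e)} + budget q C \<le> budget q (2 * C)"
proof -
  let ?P = "\<lambda>v. 2 * C \<le> 2 * q * deg v"
  have "card {e. e < m \<and> odd (X e)} = (\<Sum>e<m. if odd (X e) then 1 else 0)"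
    by (subst sum.inter_filter[symmetric]) (auto intro!: arg_cong[of _ _ card])
  also have "\<dots> \<le> (\<Sum>e<m. (if ?P (vt e) then X e else 0) + (if ?P (vt (m + e)) then X e else 0))"
  proof (intro sum_mono)
    fix e assume "e \<in> {..<m}"
    then have e: "e < m" by simp
    show "(if odd (X e) then 1 else 0) \<le> (if ?P (vt e) then X e else 0) + (if ?P (vt (m + e)) then X e else 0)"
    proof (cases "odd (X e)")
      case True
      then obtain h where h: "h < 2 * m" "h mod m = e" "?P (vt h)" using odd[OF e] by blast
      then have "h = e \<or> h = m + e" by (cases "h < m") (auto simp: le_mod_geq)
      with h True show ?thesis by (auto dest: odd_pos)
    qed simp
  qed
  also have "\<dots> = (\<Sum>h<2 * m. if ?P (vt h) then X (h mod m) else 0)"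
    unfolding sum_halves by (intro sum.cong refl) auto
  also have "\<dots> = (\<Sum>v<n. \<Sum>h\<in>halves v. if ?P v then X (h mod m) else 0)"
    unfolding sum_by_vertex[symmetric] by (intro sum.cong refl) (auto simp: halves_def)
  also have "\<dots> = (\<Sum>v<n. if ?P v then load X v else 0)"
    unfolding load_def by (intro sum.cong refl) auto
  finally have "2 * card {e. e < m \<and> odd (X e)} + budget q C
      \<le> (\<Sum>v<n. 2 * (if ?P v then load X v else 0) + 4 * min C (2 * q * deg v))"
    by (simp add: budget_def sum.distrib flip: sum_distrib_left)
  also have "\<dots> \<le> budget q (2 * C)"
    unfolding budget_def using ld by (intro sum_mono) (force simp: min_def)
  finally show ?thesis .
qed

end

section \<open>Radix sort\<close>

text \<open>The target of position \<open>i\<close> in the stable partition that puts the elements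
  without \<open>p\<close> first; \<open>H - cnt p H\<close> is their number.\<close>

definition radix_pos :: "(nat \<Rightarrow> bool) \<Rightarrow> nat \<Rightarrow> nat \<Rightarrow> nat" where
  "radix_pos p H i = (if p i then (H - cnt p H) + cnt p i else i - cnt p i)"

lemma radix_pos_less: "i < H \<Longrightarrow> radix_pos p H i < H"
  using cnt_less[of p i H] cnt_le[of p H] cnt_le[of p i]
  by (auto simp: radix_pos_def)

lemma radix_pos_mono:
  assumes "i < j" "j < H" "p j \<or> \<not> p i"
  shows "radix_pos p H i < radix_pos p H j"
proof -
  have "i - cnt p i < H - cnt p H" if "\<not> p i"
    using cnt_less[of "\<lambda>k. \<not> p k" i H] that assms by (simp add: cnt_not)
  moreover have "i - cnt p i < j - cnt p j" if "\<not> p i"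
    using cnt_less[of "\<lambda>k. \<not> p k" i j] that assms by (simp add: cnt_not)
  ultimately show ?thesis using assms cnt_less[of p i j] by (auto simp: radix_pos_def)
qed

lemma radix_pos_bits:
  assumes "i < H" "j < H" "p j" "\<not> p i"
  shows "radix_pos p H i < radix_pos p H j"
  using cnt_less[of "\<lambda>k. \<not> p k" i H] assms by (simp add: cnt_not radix_pos_def)

lemma radix_pos_inj: "inj_on (radix_pos p H) {..<H}"
proof (rule inj_onI)
  fix i j assume ij: "i \<in> {..<H}" "j \<in> {..<H}" "radix_pos p H i = radix_pos p H j"
  have "\<not> i < j"
  proof
    assume "i < j"
    then show False
      using ij radix_pos_mono[of i j H p] radix_pos_bits[of j H i p] by (cases "p j \<or> \<not> p i") auto
  qed
  moreover have "\<not> j < i"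
  proof
    assume "j < i"
    then show False
      using ij radix_pos_mono[of j i H p] radix_pos_bits[of i H j p] by (cases "p i \<or> \<not> p j") auto
  qed
  ultimately show "i = j" by simp
qed

lemma radix_pos_bij: "bij_betw (radix_pos p H) {..<H} {..<H}"
  using radix_pos_inj[of p H] radix_pos_less[of _ H p]
  by (intro bij_betw_imageI endo_inj_surj) auto

definition sorted_mod :: "nat \<Rightarrow> (nat \<Rightarrow> nat) \<Rightarrow> nat \<Rightarrow> (nat \<Rightarrow> nat) \<Rightarrow> bool" where
  "sorted_mod H k r od \<longleftrightarrow> (\<forall>i j. i < j \<longrightarrow> j < H \<longrightarrow> k (od i) mod r \<le> k (od j) mod r)"

text \<open>One pass of least-significant-digit radix sort: elements with different bits are
  separated, those with equal bits keep their order by stability.\<close>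

lemma radix_pass:
  fixes k :: "nat \<Rightarrow> nat"
  assumes bij: "bij_betw od {..<H} {..<H}" and sorted: "sorted_mod H k r od" and r: "0 < r"
    and new: "\<And>i. i < H \<Longrightarrow> od' (radix_pos (\<lambda>i. odd (k (od i) div r)) H i) = od i"
  shows "bij_betw od' {..<H} {..<H}" "sorted_mod H k (2 * r) od'"
proof -
  define p where "p i = odd (k (od i) div r)" for i
  let ?f = "radix_pos p H"
  have surj: "\<exists>i<H. ?f i = c" if "c < H" for c
    using bij_betw_imp_surj_on[OF radix_pos_bij[of p H]] that by (metis imageE lessThan_iff)
  have new': "od' (?f i) = od i" if "i < H" for i
    using new[OF that] unfolding p_def[abs_def] by simp
  show "bij_betw od' {..<H} {..<H}"
  proof (rule bij_betw_imageI)
    show "inj_on od' {..<H}"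
    proof (rule inj_onI)
      fix c d assume cd: "c \<in> {..<H}" "d \<in> {..<H}" "od' c = od' d"
      then obtain i j where ij: "i < H" "j < H" "?f i = c" "?f j = d"
        using surj[of c] surj[of d] by auto
      with cd new'[of i] new'[of j] have "od i = od j" by simp
      then show "c = d" using ij bij by (auto simp: bij_betw_def inj_on_def)
    qed
    have "od' ` {..<H} = od' ` ?f ` {..<H}" using radix_pos_bij[of p H] by (simp add: bij_betw_def)
    also have "\<dots> = od ` {..<H}" using new' by (auto simp: image_iff)
    finally show "od' ` {..<H} = {..<H}" using bij by (simp add: bij_betw_def)
  qed
  \<comment> \<open>One more binary digit of the key, which is the bit tested by
    \<open>p\<close>.\<close>
  have split: "k (od i) mod (2 * r) = k (od i) mod r + (if p i then r else 0)" for i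
    using mod_mult2_eq[of "k (od i)" r 2] by (simp add: p_def mult.commute odd_iff_mod_2_eq_one)
  show "sorted_mod H k (2 * r) od'"
    unfolding sorted_mod_def
  proof (intro allI impI)
    fix c d assume cd: "c < d" "d < H"
    then obtain i j where ij: "i < H" "j < H" "?f i = c" "?f j = d"
      using surj[of c] surj[of d] by auto
    have "od' c = od i" "od' d = od j" using new' ij by auto
    moreover have "\<not> (p i \<and> \<not> p j)" using radix_pos_bits[of j H i p] ij cd by auto
    moreover have "i \<le> j" if "p i = p j"
      using radix_pos_mono[of j i H p] ij cd that by (cases "j < i") auto
    moreover have "k (od i) mod r \<le> k (od j) mod r" if "i \<le> j"
      using sorted that ij by (cases "i = j") (auto simp: sorted_mod_def)
    ultimately show "k (od' c) mod (2 * r) \<le> k (od' d) mod (2 * r)"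
      by (cases "p i"; cases "p j") (auto simp: split intro: trans_le_add2 mod_le_divisor[OF r])
  qed
qed

section \<open>The phases of the program\<close>

definition load_weights :: cmd where
  "load_weights = ParFor 20 (IReg 1) (RLoad 20 0 (IReg 20) ;; RStore 2 (IAdd (IReg 3) (IReg 20)) (RReg 20))"

text \<open>The class is found by multiplying the total weight, in real register 10, by
  \<open>1 - 1 / q\<close> until it is at most the weight of the edge. The second test stops this at
  the threshold of the total weight divided by \<open>q * m * m\<close>, which bounds the number of
  classes.\<close>

definition class_loop :: "nat \<Rightarrow> cmd" where
  "class_loop q = While (BAnd (RLess (RReg 20) (RReg 21))
       (RLess (RReg 10) (RMul (RReg 21) (RMul (OfInt (Const q)) (RMul (OfInt (IReg 1)) (OfInt (IReg 1)))))))
     (RAssign 21 (RDiv (RMul (RReg 21) (OfInt (Const (int q - 1)))) (OfInt (Const q))) ;;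
      IAssign 21 (IAdd (IReg 21) (Const 1)))"

definition classify :: "nat \<Rightarrow> cmd" where
  "classify q = ParFor 20 (IReg 1)
     (RLoad 20 0 (IReg 20) ;; RAssign 21 (RReg 10) ;; IAssign 21 (Const 0) ;; class_loop q ;;
      RStore 1 (IReg 20) (RReg 21) ;; IStore 6 (IReg 20) (IReg 21))"

text \<open>The key has the vertex as its leading digit and the class as its last digit in base
  \<open>M\<close>, kept in register 5. As larger classes mean smaller weights, increasing keys list
  the edges at a vertex by decreasing weight.\<close>

definition make_keys :: "nat \<Rightarrow> cmd" where
  "make_keys q = IAssign 5 (IMul (Const q) (IAdd (IAdd (Const q) (IMul (Const 2) (IReg 4))) (Const 1))) ;;
     ParFor 20 (IReg 2)
      (Cond (ILess (IReg 20) (IReg 1)) (ILoad 21 1 (IReg 20)) (ILoad 21 2 (ISub (IReg 20) (IReg 1))) ;;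
       ILoad 22 6 (IMod (IReg 20) (IReg 1)) ;;
       IStore 10 (IReg 20) (IReg 21) ;;
       IStore 7 (IReg 20) (IAdd (IMul (IReg 21) (IReg 5)) (IReg 22)) ;;
       IStore 8 (IReg 20) (IReg 20))"

text \<open>
  Registers 0 to 4 hold \<open>n\<close>, \<open>m\<close>, \<open>2 * m\<close>, \<open>P\<close> and \<open>h\<close>. Prefix sums are computed in binary trees with \<open>P = 2 ^ h\<close>
  leaves, whose leaf \<open>i\<close> is stored at index \<open>P + i\<close> and whose root at index 1; word arrays 4 and 5 and real
  arrays 2 and 3 are such trees. Real array 1 holds the rounded weights and word array 6 their classes; arrays
  8, 10, 12 and 13 hold the sorted order of the half-edges, their vertices, and the first and last
  position of each vertex in this order; array 3 holds the integral vector that is rounded.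
\<close>

locale run = half_edges n m vt + machine b N
  for n m :: nat and vt :: "nat \<Rightarrow> nat" and b :: nat and N :: int +
  fixes q h P :: nat
  assumes q: "2 \<le> q" and P_eq: "P = 2 ^ h" and P_gt: "2 * m < P" and P_le: "P \<le> 4 * m"
    and N_P: "4 * int P \<le> N" and N_q: "8 * int q * int q * int P \<le> N"
    and N_key: "2 * int n * (int q * (int q + 2 * int h + 1)) \<le> N"
    and N_q4: "16 * int q * int q * int h \<le> N"
begin

text \<open>A bound for the number of weight classes: the factor \<open>1 - 1 / q\<close> at least
  halves within \<open>q\<close> steps, and the range to cover is below
  \<open>2 ^ (q + 2 * h)\<close>.\<close>

definition M :: nat where "M = q * (q + 2 * h + 1)"

definition base :: "regs \<Rightarrow> bool" where
  "base s \<longleftrightarrow> ireg s 0 = int n \<and> ireg s 1 = int m \<and> ireg s 2 = 2 * int m \<and> ireg s 3 = int P \<and> ireg s 4 = int h"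

lemma baseD:
  assumes "base s"
  shows "ireg s 0 = int n" "ireg s (Suc 0) = int m" "ireg s 2 = 2 * int m" "ireg s 3 = int P" "ireg s 4 = int h"
  using assms by (auto simp: base_def)

lemma n_pos: "0 < n"
  using vt_less[of 0] m_pos by simp

lemma h_pos: "0 < h"
  using P_eq P_gt m_pos by (cases h) auto

lemma h_less_P: "h < P"
  by (simp add: P_eq)

lemma bounds: "1 \<le> N" "2 \<le> N" "int q \<le> N" "int m \<le> N" "2 * int m \<le> N" "int P \<le> N" "2 * int m < int P"
  "4 * int P \<le> N" "int n \<le> N" "int h \<le> N" "int M \<le> N" "2 * (int n * int M) \<le> N"
proof -
  show 1: "4 * int P \<le> N" "2 * int m < int P" using N_P P_gt by simp_all
  then show "1 \<le> N" "2 \<le> N" "int m \<le> N" "2 * int m \<le> N" "int P \<le> N" by linarith+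
  show "int h \<le> N" using 1 h_less_P by linarith
  have "int q * 1 \<le> int q * (8 * int q * int P)"
  proof (intro mult_left_mono)
    have "0 < 8 * int q * int P" using q P_gt by simp
    then show "1 \<le> 8 * int q * int P" by linarith
  qed simp
  then show "int q \<le> N" using N_q by (simp add: mult_ac)
  show nM: "2 * (int n * int M) \<le> N" using N_key by (simp add: M_def algebra_simps)
  have "0 < M" using q by (simp add: M_def)
  then have "1 * int M \<le> int n * int M" "int n * 1 \<le> int n * int M"
    using n_pos by (intro mult_right_mono mult_left_mono; simp)+
  then show "int M \<le> N" "int n \<le> N" using nM by linarith+
qed

lemma wp_load_weights:
  assumes s: "base s"
  shows "wp b UNIV UNIV load_weights (\<lambda>s' \<mu>' W D. s' = s \<and>
     (\<forall>i<m. rmem \<mu>' 2 (P + i) = rmem \<mu> 0 i) \<and> W \<le> 10 * P \<and> D \<le> 10) s \<mu>"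
  unfolding load_weights_def
  using bounds(6-8) P_gt
  by (intro wp_ParFor[where k = m and V = "\<lambda>i. {RCell 2 (P + i)}" and w = 4 and
        \<nu> = "\<mu>\<lparr>rmem := (rmem \<mu>)(2 := \<lambda>j. if P \<le> j \<and> j < P + m then rmem \<mu> 0 (j - P) else rmem \<mu> 2 j)\<rparr>"])
     (simp_all add: baseD[OF s] wp_simps agree_def nat_add_distrib ball_neq_add, auto intro!: fitsI0)

text \<open>From \<open>q < 2 ^ q\<close> and \<open>m < 2 ^ h\<close>, the quotient
  \<open>k div q\<close> is less than \<open>q + 2 * h\<close>.\<close>

lemma class_exponent:
  assumes "2 ^ (k div q) < q * m\<^sup>2" shows "Suc k < M"
proof -
  have "m < 2 ^ h" using P_eq P_gt by simp
  then have "m\<^sup>2 < (2 ^ h)\<^sup>2" by (intro power_strict_mono) auto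
  then have "q * m\<^sup>2 < 2 ^ q * 2 ^ (2 * h)"
    using q by (intro mult_strict_mono) (auto simp: power_even_eq)
  then have "(2::nat) ^ (k div q) < 2 ^ (q + 2 * h)" using assms by (simp add: power_add)
  then have "k div q < q + 2 * h" by simp
  then have "q * (k div q + 1) \<le> q * (q + 2 * h)" by (intro mult_left_mono) auto
  moreover have "k mod q < q" using q by simp
  moreover have "k = q * (k div q) + k mod q" by simp
  ultimately have "Suc k \<le> q * (q + 2 * h)" by (simp only: distrib_left mult_1_right)
  also have "\<dots> < M" using q by (simp add: M_def)
  finally show ?thesis .
qed

text \<open>The \<open>q\<close>-th power of \<open>1 - 1 / q\<close> is at most
  \<open>exp (- 1)\<close>, hence at most 1/2.\<close>

lemma class_decay: "2 ^ (k div q) * (1 - 1 / real q) ^ k \<le> 1"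
proof -
  let ?c = "1 - 1 / real q"
  have c: "0 \<le> ?c" "?c \<le> 1" using q by (simp_all add: field_simps)
  have "2 * ?c ^ q \<le> 1"
  proof -
    have "?c \<le> exp (- (1 / real q))" using exp_ge_add_one_self[of "- (1 / real q)"] by simp
    then have "?c ^ q \<le> exp (- (1 / real q)) ^ q" using c by (intro power_mono) auto
    also have "\<dots> = exp (- 1)" using q by (simp flip: exp_of_nat_mult)
    also have "\<dots> \<le> 1 / 2" using exp_ge_add_one_self[of 1] by (simp add: exp_minus field_simps)
    finally show ?thesis by simp
  qed
  then have "(2 * ?c ^ q) ^ (k div q) \<le> 1" using c by (intro power_le_one) auto
  moreover have "?c ^ (k mod q) \<le> 1" using c by (intro power_le_one) auto
  ultimately have "(2 * ?c ^ q) ^ (k div q) * ?c ^ (k mod q) \<le> 1 * 1"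
    using c by (intro mult_mono) auto
  moreover have "?c ^ k = (?c ^ q) ^ (k div q) * ?c ^ (k mod q)"
    by (simp flip: power_mult power_add)
  ultimately show ?thesis by (simp add: power_mult_distrib mult.assoc)
qed

text \<open>While the loop runs the current value exceeds \<open>w e\<close>, so one more factor
  leaves at least \<open>(1 - 1 / q) * w e\<close>. The final alternative reflects the two ways to
  stop: either the weight has not been raised, or it has become negligible.\<close>

lemma wp_classify:
  assumes s: "base s" and S: "rreg s 10 = S" and S0: "0 < S"
    and w: "\<And>e. e < m \<Longrightarrow> rmem \<mu> 0 e = w e" "\<And>e. e < m \<Longrightarrow> 0 < w e" "\<And>e. e < m \<Longrightarrow> w e \<le> S"
  shows "wp b UNIV UNIV (classify q) (\<lambda>s' \<mu>' W D. s' = s \<and>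
     (\<forall>e<m. \<exists>k<M. imem \<mu>' 6 e = int k \<and> rmem \<mu>' 1 e = S * (1 - 1 / q) ^ k \<and>
        (1 - 1 / q) * w e \<le> rmem \<mu>' 1 e \<and>
        (rmem \<mu>' 1 e \<le> w e \<or> rmem \<mu>' 1 e * (real q * (real m * real m)) \<le> S)) \<and>
     W \<le> (60 * M + 40) * P \<and> D \<le> 60 * M + 40) s \<mu>"
proof -
  let ?c = "1 - 1 / real q"
  have c: "0 < ?c" "?c < 1" using q by (simp_all add: field_simps)
  let ?t = "\<lambda>k e. w e < S * ?c ^ k \<and> S < S * ?c ^ k * (real q * (real m * real m))"
  have tM: "Suc k < M" if "?t k e" for k e
  proof -
    have "1 < ?c ^ k * (real q * (real m * real m))" using that S0 by (simp add: mult.assoc)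
    then have "2 ^ (k div q) * 1 < 2 ^ (k div q) * (?c ^ k * (real q * (real m * real m)))"
      by (intro mult_strict_left_mono) auto
    also have "\<dots> = (2 ^ (k div q) * ?c ^ k) * (real q * (real m * real m))" by (simp only: mult.assoc)
    also have "\<dots> \<le> 1 * (real q * (real m * real m))"
      using class_decay by (intro mult_right_mono) auto
    finally have "real (2 ^ (k div q)) < real (q * m\<^sup>2)" by (simp add: power2_eq_square)
    then show ?thesis by (intro class_exponent) (simp only: of_nat_less_iff)
  qed
  \<comment> \<open>\<open>?t k e\<close> is the loop test after \<open>k\<close> iterations; by
    \<open>tM\<close> it fails for \<open>k = M\<close> at the latest.\<close>
  define kk where "kk e = (LEAST k. \<not> ?t k e)" for e
  have kk: "\<not> ?t (kk e) e" for e
    unfolding kk_def by (rule LeastI[of _ M]) (use tM[of e M] in auto)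
  have kk_less: "?t k e" if "k < kk e" for k e using that not_less_Least unfolding kk_def by blast
  have kkM: "kk e < M" for e
  proof (cases "kk e")
    case 0
    then show ?thesis using q by (simp add: M_def)
  next
    case (Suc k)
    then show ?thesis using tM[OF kk_less[of k e]] by simp
  qed
  define \<nu> where "\<nu> = \<mu>\<lparr>imem := (imem \<mu>)(6 := \<lambda>j. if j < m then int (kk j) else imem \<mu> 6 j),
      rmem := (rmem \<mu>)(1 := \<lambda>j. if j < m then S * ?c ^ kk j else rmem \<mu> 1 j)\<rparr>"
  have "wp b UNIV UNIV (classify q) (\<lambda>s' \<mu>' W D. s' = s \<and> \<mu>' = \<nu> \<and>
     W \<le> (60 * M + 40) * P \<and> D \<le> 60 * M + 40) s \<mu>"
    unfolding classify_def
  proof (rule wp_ParFor[where k = m and V = "\<lambda>i. {RCell 1 i, ICell 6 i}" and w = "60 * M + 30" and \<nu> = \<nu>], goal_cases)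
    case (4 i)
    note [simp] = baseD[OF s] S
    define I where "I = (\<lambda>g (s'::regs) \<mu>' W (D::nat). \<exists>k\<le>kk i. g = kk i - k \<and> \<mu>' = \<mu> \<and> ireg s' 20 = int i \<and>
       ireg s' 1 = int m \<and> ireg s' 21 = int k \<and>
       rreg s' 10 = S \<and> rreg s' 20 = w i \<and> rreg s' 21 = S * ?c ^ k \<and> W \<le> k * 30)"
    have loop: "wp b RS WS (class_loop q)
      (\<lambda>s' \<mu>' W D. \<mu>' = \<mu> \<and> ireg s' 20 = int i \<and> ireg s' 21 = int (kk i) \<and>
         rreg s' 21 = S * ?c ^ kk i \<and> W \<le> 30 * M + 20) s1 \<mu>"
      if "ireg s1 20 = int i" "ireg s1 1 = int m" "ireg s1 21 = 0" "rreg s1 10 = S" "rreg s1 20 = w i"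
        "rreg s1 21 = S" for RS WS s1
      unfolding class_loop_def
    proof (rule wp_While[where I = I and ?g0.0 = "kk i"], goal_cases)
      case 1
      show ?case using that by (auto simp: I_def)
    next
      case (2 g s' \<mu>' W D)
      then obtain k where k: "k \<le> kk i" "g = kk i - k" "\<mu>' = \<mu>" "ireg s' 20 = int i"
        "ireg s' 1 = int m" "ireg s' 21 = int k"
        "rreg s' 10 = S" "rreg s' 20 = w i" "rreg s' 21 = S * ?c ^ k" "W \<le> k * 30"
        unfolding I_def by blast
      have kN: "int k + 1 \<le> N" using k(1) kkM[of i] bounds(11) by linarith
      have c': "S * ?c ^ k * (real q - 1) / real q = S * (?c * ?c ^ k)"
        using q by (simp add: field_simps)
      show ?case
      proof (cases "k = kk i")
        case True
        with kk[of i] kkM[of i] k bounds(1-7) show ?thesis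
          by (auto simp: fitsI0)
      next
        case False
        then have lt: "?t k i" using k kk_less[of k i] by simp
        have "I (g - 1) (s'\<lparr>rreg := (rreg s')(21 := S * (?c * ?c ^ k)), ireg := (ireg s')(21 := int k + 1)\<rparr>) \<mu> W' D'"
          if "W' \<le> k * 30 + 30" for W' D'
          unfolding I_def using k False that by (intro exI[of _ "Suc k"]) auto
        then show ?thesis
          using lt k False bounds kN q by (auto simp: wp_simps fitsI0 c' intro!: exI[of _ "g - 1"])
      qed
    qed
    show ?case
      using 4 bounds(1,4,11) w(1)[OF 4] kkM[of i]
      by (auto simp: wp_simps fitsI0 agree_def \<nu>_def intro!: wp_mono[OF loop])
  next
    case (6 W D)
    have "m * (60 * M + 31) \<le> P * (60 * M + 31)" using P_gt by (intro mult_right_mono) auto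
    then have "1 + iops (IReg 1) + m * (1 + (60 * M + 30)) \<le> (60 * M + 40) * P"
      using P_gt by (simp add: algebra_simps)
    then show ?case using 6 by simp
  qed (use bounds(4) in \<open>auto simp: baseD[OF s] fitsI0 agree_def \<nu>_def\<close>)
  then show ?thesis
  proof (rule wp_mono)
    fix s' \<mu>' W D
    assume "s' = s \<and> \<mu>' = \<nu> \<and> W \<le> (60 * M + 40) * P \<and> D \<le> 60 * M + 40"
    moreover have "?c * w e \<le> S * ?c ^ kk e" if "e < m" for e
    proof (cases "kk e")
      case 0
      have "?c * w e \<le> w e"
        by (intro mult_left_le_one_le) (use c w(2)[OF that] in \<open>auto intro: less_imp_le\<close>)
      then show ?thesis using w(3)[OF that] 0 by simp
    next
      case (Suc k)
      then show ?thesis using kk_less[of k e] c mult_left_mono[of "w e" "S * ?c ^ k" ?c]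
        by (simp add: mult.left_commute)
    qed
    moreover have "S * ?c ^ kk e \<le> w e \<or> S * ?c ^ kk e * (real q * (real m * real m)) \<le> S" for e
      using kk[of e] by auto
    ultimately show "s' = s \<and> (\<forall>e<m. \<exists>k<M. imem \<mu>' 6 e = int k \<and> rmem \<mu>' 1 e = S * ?c ^ k \<and>
        ?c * w e \<le> rmem \<mu>' 1 e \<and>
        (rmem \<mu>' 1 e \<le> w e \<or> rmem \<mu>' 1 e * (real q * (real m * real m)) \<le> S)) \<and>
      W \<le> (60 * M + 40) * P \<and> D \<le> 60 * M + 40"
      using kkM by (auto simp: \<nu>_def)
  qed
qed

lemma wp_make_keys:
  assumes s: "base s"
    and v: "\<And>e. e < m \<Longrightarrow> imem \<mu> 1 e = int (vt e)" "\<And>e. e < m \<Longrightarrow> imem \<mu> 2 e = int (vt (m + e))"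
    and k: "\<And>e. e < m \<Longrightarrow> imem \<mu> 6 e = int (k e)" "\<And>e. e < m \<Longrightarrow> k e < M"
  shows "wp b UNIV UNIV (make_keys q) (\<lambda>s' \<mu>' W D. base s' \<and> ireg s' 5 = int M \<and>
     (\<forall>h<2 * m. imem \<mu>' 10 h = int (vt h) \<and> imem \<mu>' 7 h = int (vt h * M + k (h mod m)) \<and> imem \<mu>' 8 h = int h) \<and>
     W \<le> 30 * P \<and> D \<le> 30) s \<mu>"
proof -
  have M1: "int q * (int q + 2 * int h + 1) = int M" by (simp add: M_def algebra_simps)
  have "1 * (int q + 2 * int h + 1) \<le> int q * (int q + 2 * int h + 1)"
    using q by (intro mult_right_mono) auto
  then have "int q + 2 * int h + 1 \<le> int M" by (simp only: M1 mult_1)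
  then have le: "int q + 2 * int h + 1 \<le> N" using bounds(11) by linarith
  have vM: "int (vt i) * int M + int (k (i mod m)) \<le> N" if "i < 2 * m" for i
  proof -
    have "vt i * M + k (i mod m) \<le> vt i * M + M" using k(2)[of "i mod m"] m_pos by simp
    also have "\<dots> = (vt i + 1) * M" by simp
    also have "\<dots> \<le> n * M" using vt_less[OF that] by (intro mult_right_mono) auto
    finally have "int (vt i * M + k (i mod m)) \<le> int (n * M)" by (simp only: of_nat_le_iff)
    then have "int (vt i) * int M + int (k (i mod m)) \<le> int n * int M" by simp
    moreover have "0 \<le> int n * int M" by simp
    ultimately show ?thesis using bounds(12) by linarith
  qed
  have vN: "int (vt i) \<le> N" "int (vt i) * int M \<le> N" if "i < 2 * m" for i
    using vt_less[OF that] bounds(9) vM[OF that] by auto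
  have v': "imem \<mu> 2 (i - m) = int (vt i)" if "\<not> i < m" "i < 2 * m" for i
    using v(2)[of "i - m"] that by simp
  have md: "int i mod int m = int (i mod m)" for i by (simp add: zmod_int)
  have mN: "int (i mod m) \<le> N" for i using mod_less_divisor[OF m_pos, of i] bounds(4) by linarith
  have nt: "nat (int i - int m) = i - m" if "\<not> i < m" for i using that by simp
  have kM: "k (i mod m) < M" "imem \<mu> 6 (i mod m) = int (k (i mod m))" for i
    using k m_pos by simp_all
  have kN: "int (k (i mod m)) \<le> N" for i using kM(1)[of i] bounds(11) by linarith
  have small: "int (k i) \<le> N" "int (vt i) * int M + int (k i) \<le> N" if "i < m" for i
    using kN[of i] vM[of i] that by simp_all
  show ?thesis
    unfolding make_keys_def wp_Seq wp_IAssign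
  proof (intro conjI, goal_cases)
    case 1
    show ?case using bounds le M1 by (simp add: baseD[OF s] fitsI0)
  next
    case 2
    show ?case
      using bounds(1,4-7,11) P_gt
      by (intro wp_ParFor[where k = "2 * m" and V = "\<lambda>i. {ICell 10 i, ICell 7 i, ICell 8 i}" and w = 13 and
        \<nu> = "\<mu>\<lparr>imem := (imem \<mu>)(10 := \<lambda>j. if j < 2 * m then int (vt j) else imem \<mu> 10 j,
           7 := \<lambda>j. if j < 2 * m then int (vt j * M + k (j mod m)) else imem \<mu> 7 j,
           8 := \<lambda>j. if j < 2 * m then int j else imem \<mu> 8 j)\<rparr>"])
        (simp_all add: baseD[OF s] wp_simps agree_def M1 fitsI0 v[unfolded One_nat_def] v' k(1) md mN nt small kM vM vN kN,
         auto simp: base_def baseD[OF s] M1 fitsI0 v[unfolded One_nat_def] v' k(1) md mN nt small kM vM vN kN less_imp_le)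
  qed
qed

end

section \<open>Sorting the half-edges and locating the segments of the vertices on the
  machine\<close>

definition key_bits :: cmd where
  "key_bits = ParFor 20 (IReg 2) (ILoad 21 8 (IReg 20) ;; ILoad 21 7 (IReg 21) ;;
     IStore 4 (IAdd (IReg 3) (IReg 20)) (IMod (IDiv (IReg 21) (IReg 6)) (Const 2)))"

definition scatter :: cmd where
  "scatter = ParFor 20 (IReg 2) (ILoad 21 4 (IAdd (IReg 3) (IReg 20)) ;; ILoad 22 5 (IAdd (IReg 3) (IReg 20)) ;;
     ILoad 23 8 (IReg 20) ;;
     Cond (IEq (IReg 21) (Const 1))
       (IStore 9 (IAdd (ISub (IReg 2) (IReg 8)) (IReg 22)) (IReg 23))
       (IStore 9 (ISub (IReg 20) (IReg 22)) (IReg 23)))"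

definition copy_back :: cmd where
  "copy_back = ParFor 20 (IReg 2) (ILoad 21 9 (IReg 20) ;; IStore 8 (IReg 20) (IReg 21))"

definition sort_pass :: cmd where
  "sort_pass = key_bits ;; iscan ;; ILoad 8 5 (IAdd (IReg 3) (IReg 2)) ;; scatter ;; copy_back"

definition sort_halves :: cmd where
  "sort_halves = IAssign 6 (Const 1) ;; IAssign 7 (IMul (IReg 0) (IReg 5)) ;;
     While (ILess (IReg 6) (IReg 7)) (sort_pass ;; IAssign 6 (IMul (Const 2) (IReg 6)))"

text \<open>Array 11 holds vertices increased by 1, shifted by one position, so that the zeros at
  indices 0 and \<open>2 * m + 1\<close> differ from all entries and act as sentinels. A position is
  the first or last of its vertex iff its entry differs from that of its left or right neighbour,
  and only these positions write.\<close>

definition segments :: cmd where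
  "segments = ParFor 20 (IReg 2) (ILoad 21 8 (IReg 20) ;; ILoad 21 10 (IReg 21) ;;
      IStore 11 (IAdd (IReg 20) (Const 1)) (IAdd (IReg 21) (Const 1))) ;;
     ParFor 20 (IReg 2) (ILoad 21 11 (IReg 20) ;; ILoad 22 11 (IAdd (IReg 20) (Const 1)) ;;
      ILoad 23 11 (IAdd (IReg 20) (Const 2)) ;;
      Cond (IEq (IReg 21) (IReg 22)) Skip (IStore 12 (ISub (IReg 22) (Const 1)) (IReg 20)) ;;
      Cond (IEq (IReg 22) (IReg 23)) Skip (IStore 13 (ISub (IReg 22) (Const 1)) (IAdd (IReg 20) (Const 1))))"

text \<open>Bookkeeping for loops that are charged \<open>c\<close> per iteration; the constant cost
  after the loop is charged as one further iteration.\<close>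

lemma loop_cost:
  fixes W c e k L :: nat
  assumes "W \<le> c * e" "k \<le> c"
  shows "W + k \<le> c * Suc e" "e \<le> L \<Longrightarrow> W + k \<le> c * (L + 1)"
proof -
  show 1: "W + k \<le> c * Suc e" using assms by simp
  show "W + k \<le> c * (L + 1)" if "e \<le> L"
    using order_trans[OF 1 mult_le_mono2[of "Suc e" "L + 1" c]] that by simp
qed

lemma cnt_initial:
  assumes "\<And>i j. i \<le> j \<Longrightarrow> j < H \<Longrightarrow> p j \<Longrightarrow> p i" "i < H"
  shows "p i \<longleftrightarrow> i < cnt p H"
proof
  assume "p i"
  then have "{..i} \<subseteq> {k. k < H \<and> p k}" using assms by auto
  then have "card {..i} \<le> cnt p H" unfolding cnt_def by (intro card_mono) auto
  then show "i < cnt p H" by simp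
next
  assume i: "i < cnt p H"
  show "p i"
  proof (rule ccontr)
    assume "\<not> p i"
    then have "{k. k < H \<and> p k} \<subseteq> {..<i}" using assms(1)[of i] by (auto simp: not_less[symmetric])
    then have "cnt p H \<le> card {..<i}" unfolding cnt_def by (intro card_mono) auto
    with i show False by simp
  qed
qed

context run
begin

lemma base_iscan: "same iscan s \<mu> s' \<mu>' \<Longrightarrow> base s \<Longrightarrow> base s'"
  unfolding same_def iscan_def up_sweep_def down_sweep_def base_def by simp

lemma base_rscan: "same rscan s \<mu> s' \<mu>' \<Longrightarrow> base s \<Longrightarrow> base s'"
  unfolding same_def rscan_def up_sweep_def down_sweep_def base_def by simp

text \<open>The padding leaves are 0, so the total is at most \<open>2 * m\<close> and fits. All
  phases that use this tree preserve the zeros.\<close>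

lemma wp_count:
  assumes s: "base s" and p: "\<And>i. i < 2 * m \<Longrightarrow> imem \<mu> 4 (P + i) = (if p i then 1 else 0)"
    and z: "\<And>t. 2 * m \<le> t \<Longrightarrow> t < P \<Longrightarrow> imem \<mu> 4 (P + t) = 0"
  shows "wp b UNIV UNIV iscan (\<lambda>s' \<mu>' W D. (\<forall>t<P. imem \<mu>' 4 (P + t) = imem \<mu> 4 (P + t)) \<and>
     (\<forall>i\<le>2 * m. imem \<mu>' 5 (P + i) = int (cnt p i)) \<and> W \<le> 40 * P \<and> D \<le> 40 * (h + 1)) s \<mu>"
proof -
  have ab: "(\<Sum>t<i. imem \<mu> 4 (P + t)) = int (cnt p i)" if "i \<le> 2 * m" for i
    using that p by (simp flip: cnt_sum)
  have "(\<Sum>t<P. imem \<mu> 4 (P + t)) = (\<Sum>t<2 * m. imem \<mu> 4 (P + t))"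
    using z P_gt by (intro sum.mono_neutral_right) auto
  also have "\<dots> \<le> N" using ab[of "2 * m"] cnt_le[of p "2 * m"] bounds(5) by simp
  finally have tot: "(\<Sum>t<2 ^ h. imem \<mu> 4 (2 ^ h + t)) \<le> N" by (simp only: P_eq)
  have nn: "0 \<le> imem \<mu> 4 (2 ^ h + t)" if "t < 2 ^ h" for t
    using p[of t] z[of t] that by (cases "t < 2 * m") (auto simp: P_eq)
  have P': "ireg s 3 = 2 ^ h" using baseD(4)[OF s] unfolding P_eq by simp
  have N': "4 * 2 ^ h \<le> N" using N_P by (simp add: P_eq)
  show ?thesis
    by (rule wp_mono[OF wp_iscan[OF P' N' nn tot]]) (use ab P_gt in \<open>auto simp: P_eq[symmetric]\<close>)
qed

lemma wp_key_bits:
  assumes s: "base s" and r: "ireg s 6 = int r" "0 < r" "int r \<le> N"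
    and od: "\<And>i. i < 2 * m \<Longrightarrow> imem \<mu> 8 i = int (od i)" "\<And>i. i < 2 * m \<Longrightarrow> od i < 2 * m"
    and key: "\<And>h. h < 2 * m \<Longrightarrow> imem \<mu> 7 h = int (key h)" "\<And>h. h < 2 * m \<Longrightarrow> int (key h) \<le> N"
  shows "wp b UNIV UNIV key_bits (\<lambda>s' \<mu>' W D. s' = s \<and>
     (\<forall>i<2 * m. imem \<mu>' 4 (P + i) = (if odd (key (od i) div r) then 1 else 0)) \<and>
     (\<forall>t\<ge>2 * m. imem \<mu>' 4 (P + t) = imem \<mu> 4 (P + t)) \<and> W \<le> 10 * P \<and> D \<le> 12) s \<mu>"
proof -
  have bit: "int (key x) div int r mod 2 = (if odd (key x div r) then 1 else 0)" for x
  proof -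
    have "int (key x) div int r mod 2 = int (key x div r mod 2)" by (simp add: zdiv_int zmod_int)
    then show ?thesis by (simp add: odd_iff_mod_2_eq_one)
  qed
  have dv: "0 \<le> int (key x) div int r" "int (key x) div int r \<le> N" if "x < 2 * m" for x
    using key(2)[OF that] by (auto simp: zdiv_int[symmetric] intro: order_trans[OF _ key(2)[OF that]])
  have odN: "int (od i) \<le> N" if "i < 2 * m" for i
    using od(2)[OF that] bounds(5) by linarith
  show ?thesis
    unfolding key_bits_def using bounds(1,2,5-8) P_gt
    by (intro wp_ParFor[where k = "2 * m" and V = "\<lambda>i. {ICell 4 (P + i)}" and w = 8 and
        \<nu> = "\<mu>\<lparr>imem := (imem \<mu>)(4 := \<lambda>j. if P \<le> j \<and> j < P + 2 * m
          then if odd (key (od (j - P)) div r) then 1 else 0 else imem \<mu> 4 j)\<rparr>"])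
      (simp_all add: baseD[OF s] wp_simps agree_def nat_add_distrib ball_neq_add od key r bit dv odN,
       auto simp: dv bit odN od key r intro!: fitsI0)
qed

text \<open>Since \<open>radix_pos\<close> is a permutation of the positions, the writes are
  exclusive and the resulting array can be described by its inverse.\<close>

lemma wp_scatter:
  assumes s: "base s" and r8: "ireg s 8 = int (cnt p (2 * m))"
    and p: "\<And>i. i < 2 * m \<Longrightarrow> imem \<mu> 4 (P + i) = (if p i then 1 else 0)"
    and c: "\<And>i. i < 2 * m \<Longrightarrow> imem \<mu> 5 (P + i) = int (cnt p i)"
    and od: "\<And>i. i < 2 * m \<Longrightarrow> imem \<mu> 8 i = int (od i)" "\<And>i. i < 2 * m \<Longrightarrow> od i < 2 * m"
  shows "wp b UNIV UNIV scatter (\<lambda>s' \<mu>' W D. s' = s \<and>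
     (\<forall>i<2 * m. imem \<mu>' 9 (radix_pos p (2 * m) i) = int (od i)) \<and> W \<le> 20 * P \<and> D \<le> 20) s \<mu>"
proof -
  let ?f = "radix_pos p (2 * m)"
  define g where "g j = od (inv_into {..<2 * m} ?f j)" for j
  have g: "g (?f i) = od i" if "i < 2 * m" for i
    using that radix_pos_inj[of p "2 * m"] by (simp add: g_def)
  have inj: "?f i = ?f j \<longleftrightarrow> i = j" if "i < 2 * m" "j < 2 * m" for i j
    using radix_pos_inj[of p "2 * m"] that by (auto simp: inj_on_def)
  have surj: "\<not> j < 2 * m" if "\<forall>i\<in>{..<2 * m}. j \<noteq> ?f i" for j
    using bij_betw_imp_surj_on[OF radix_pos_bij[of p "2 * m"]] that by (metis imageE lessThan_iff)
  have f1: "2 * int m - int (cnt p (2 * m)) + int (cnt p i) = int (?f i)" if "p i" for i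
    using that cnt_le[of p "2 * m"] by (simp add: radix_pos_def of_nat_diff)
  have f2: "int i - int (cnt p i) = int (?f i)" if "\<not> p i" for i
    using that cnt_le[of p i] by (simp add: radix_pos_def of_nat_diff)
  have fN: "int (?f i) \<le> N" if "i < 2 * m" for i
    using radix_pos_less[OF that, of p] bounds(5) by linarith
  have odN: "int (od i) \<le> N" if "i < 2 * m" for i
    using od(2)[OF that] bounds(5) by linarith
  have cN: "int (cnt p i) \<le> N" if "i \<le> 2 * m" for i
    using cnt_le[of p i] that bounds(5) by linarith
  have cl: "int (cnt p (2 * m)) \<le> 2 * int m" using cnt_le[of p "2 * m"] by linarith
  have d0: "0 \<le> 2 * int m - int (cnt p (2 * m))" "2 * int m - int (cnt p (2 * m)) \<le> N"
    using cnt_le[of p "2 * m"] bounds(5) by linarith+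
  show ?thesis
    unfolding scatter_def using bounds(1,2,5-8) P_gt
    by (intro wp_ParFor[where k = "2 * m" and V = "\<lambda>i. {ICell 9 (?f i)}" and w = 12 and
        \<nu> = "\<mu>\<lparr>imem := (imem \<mu>)(9 := \<lambda>j. if j < 2 * m then int (g j) else imem \<mu> 9 j)\<rparr>"])
      (simp_all add: baseD[OF s] wp_simps agree_def nat_add_distrib od p c r8 f1 f2 inj radix_pos_less g,
       auto simp: od p c r8 f1 f2 fN odN cN d0 g cl cnt_le radix_pos_less intro!: fitsI0 dest!: surj)
qed

lemma wp_copy_back:
  assumes s: "base s" and od: "\<And>i. i < 2 * m \<Longrightarrow> imem \<mu> 9 i = int (od i)" "\<And>i. i < 2 * m \<Longrightarrow> od i < 2 * m"
  shows "wp b UNIV UNIV copy_back (\<lambda>s' \<mu>' W D. s' = s \<and>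
     (\<forall>i<2 * m. imem \<mu>' 8 i = int (od i)) \<and> W \<le> 10 * P \<and> D \<le> 10) s \<mu>"
proof -
  have odN: "int (od i) \<le> N" if "i < 2 * m" for i
    using od(2)[OF that] bounds(5) by linarith
  show ?thesis
    unfolding copy_back_def using bounds(1,2,5-8) P_gt
    by (intro wp_ParFor[where k = "2 * m" and V = "\<lambda>i. {ICell 8 i}" and w = 4 and
        \<nu> = "\<mu>\<lparr>imem := (imem \<mu>)(8 := \<lambda>j. if j < 2 * m then int (od j) else imem \<mu> 8 j)\<rparr>"])
      (simp_all add: baseD[OF s] wp_simps agree_def od, auto simp: odN od intro!: fitsI0)
qed

lemma wp_sort_pass:
  assumes s: "base s" and r: "ireg s 6 = int r" "0 < r" "int r \<le> N"
    and od: "\<And>i. i < 2 * m \<Longrightarrow> imem \<mu> 8 i = int (od i)" "bij_betw od {..<2 * m} {..<2 * m}"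
    and key: "\<And>h. h < 2 * m \<Longrightarrow> imem \<mu> 7 h = int (key h)" "\<And>h. h < 2 * m \<Longrightarrow> int (key h) \<le> N"
    and sorted: "sorted_mod (2 * m) key r od"
    and z: "\<And>t. 2 * m \<le> t \<Longrightarrow> t < P \<Longrightarrow> imem \<mu> 4 (P + t) = 0"
  shows "wp b UNIV UNIV sort_pass (\<lambda>s' \<mu>' W D.
     (\<exists>od'. (\<forall>i<2 * m. imem \<mu>' 8 i = int (od' i)) \<and> bij_betw od' {..<2 * m} {..<2 * m} \<and>
        sorted_mod (2 * m) key (2 * r) od') \<and>
     (\<forall>t. 2 * m \<le> t \<and> t < P \<longrightarrow> imem \<mu>' 4 (P + t) = 0) \<and> W \<le> 90 * P \<and> D \<le> 90 * (h + 1)) s \<mu>"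
proof -
  have odl: "od i < 2 * m" if "i < 2 * m" for i using od(2) that by (auto dest: bij_betwE)
  let ?p = "\<lambda>i. odd (key (od i) div r)"
  show ?thesis
    unfolding sort_pass_def wp_Seq
  proof (rule wp_mono[OF wp_key_bits[OF s r od(1) odl key]], goal_cases)
    case (5 s1 \<mu>1 W1 D1)
    note 1 = 5(1)
    have sm1: "imem \<mu>1 7 = imem \<mu> 7" "imem \<mu>1 8 = imem \<mu> 8"
      using 5(2) unfolding same_def key_bits_def by simp_all
    have b1: "base s1" using 1 s by simp
    show ?case
    proof (rule wp_mono[OF wp_count[OF b1, of \<mu>1 ?p]], goal_cases)
      case (3 s2 \<mu>2 W2 D2)
      note b2 = base_iscan[OF 3(2) b1]
      note 2 = 3(1)
      have sm2: "imem \<mu>2 7 = imem \<mu> 7" "imem \<mu>2 8 = imem \<mu> 8"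
        using 3(2) sm1 unfolding same_def iscan_def up_sweep_def down_sweep_def by simp_all
      let ?s3 = "s2\<lparr>ireg := (ireg s2)(8 := int (cnt ?p (2 * m)))\<rparr>"
      have b3: "base ?s3" using b2 by (simp add: base_def)
      have "nat (int P + 2 * int m) = P + 2 * m" by simp
      then have ld: "imem \<mu>2 5 (nat (int P + 2 * int m)) = int (cnt ?p (2 * m))" using 2 by simp
      have p2: "imem \<mu>2 4 (P + i) = (if ?p i then 1 else 0)" if "i < 2 * m" for i
        using 1 2 that P_gt by simp
      have "wp b UNIV UNIV scatter (\<lambda>s4 \<mu>4 W4 D4. wp b UNIV UNIV copy_back (\<lambda>s' \<mu>' W5 D5.
        (\<exists>od'. (\<forall>i<2 * m. imem \<mu>' 8 i = int (od' i)) \<and> bij_betw od' {..<2 * m} {..<2 * m} \<and>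
          sorted_mod (2 * m) key (2 * r) od') \<and>
        (\<forall>t. 2 * m \<le> t \<and> t < P \<longrightarrow> imem \<mu>' 4 (P + t) = 0) \<and>
        W1 + (W2 + (2 + (W4 + W5))) \<le> 90 * P \<and> D1 + (D2 + (2 + (D4 + D5))) \<le> 90 * (h + 1)) s4 \<mu>4) ?s3 \<mu>2"
      proof (rule wp_mono[OF wp_scatter[where p = ?p and od = od, OF b3 _ p2]], goal_cases)
        case (6 s4 \<mu>4 W4 D4)
        note 4 = 6(1)
        have b4: "base s4" using 4 b3 by simp
        have sm4: "imem \<mu>4 4 = imem \<mu>2 4" using 6(2) unfolding same_def scatter_def by simp
        define od' where "od' c = nat (imem \<mu>4 9 c)" for c
        have od'1: "od' (radix_pos ?p (2 * m) i) = od i" if "i < 2 * m" for i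
          using 4 that by (simp add: od'_def)
        note rp = radix_pass[OF od(2) sorted r(2) od'1]
        have od'2: "imem \<mu>4 9 c = int (od' c)" if "c < 2 * m" for c
        proof -
          have "c \<in> radix_pos ?p (2 * m) ` {..<2 * m}"
            using bij_betw_imp_surj_on[OF radix_pos_bij[of ?p "2 * m"]] that by simp
          then obtain i where "i < 2 * m" "radix_pos ?p (2 * m) i = c" by auto
          then show ?thesis using 4 by (auto simp: od'_def)
        qed
        have od'3: "od' i < 2 * m" if "i < 2 * m" for i using rp(1) that by (auto dest: bij_betwE)
        show ?case
        proof (rule wp_mono[OF wp_copy_back[OF b4 od'2 od'3]], goal_cases)
          case (3 s5 \<mu>5 W5 D5)
          have "imem \<mu>5 4 = imem \<mu>2 4" using 3(2) sm4 unfolding same_def copy_back_def by simp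
          then have "imem \<mu>5 4 (P + t) = 0" if "2 * m \<le> t" "t < P" for t
            using 1 2 z that by simp
          moreover have "W1 + (W2 + (2 + (W4 + W5))) \<le> 90 * P" using 1 2 4 3(1) P_gt by linarith
          moreover have "D1 + (D2 + (2 + (D4 + D5))) \<le> 90 * (h + 1)" using 1 2 4 3(1) by simp
          ultimately show ?case using rp 3(1) by (intro conjI exI[of _ od'] allI impI) simp_all
        qed simp_all
      qed (use 2 od odl sm2 in auto)
      then show ?case
        unfolding wp_ILoad wp_Seq using b2 bounds ld by (simp add: baseD[OF b2] fitsI0 add.assoc)
    qed (use 1 z in auto)
  qed auto
qed

text \<open>After \<open>e\<close> passes the order is sorted by the last \<open>e\<close> bits of
  the keys. The loop ends once \<open>2 ^ e\<close> reaches \<open>n * M\<close>, when taking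
  remainders changes no key; \<open>L\<close> bounds the number of passes.\<close>

lemma wp_sort_halves:
  assumes s: "base s" and r5: "ireg s 5 = int M" and L: "n * M \<le> 2 ^ L"
    and key: "\<And>h. h < 2 * m \<Longrightarrow> imem \<mu> 7 h = int (key h)" "\<And>h. h < 2 * m \<Longrightarrow> key h < n * M"
    and id: "\<And>i. i < 2 * m \<Longrightarrow> imem \<mu> 8 i = int i"
    and z: "\<And>t. 2 * m \<le> t \<Longrightarrow> t < P \<Longrightarrow> imem \<mu> 4 (P + t) = 0"
  shows "wp b UNIV UNIV sort_halves (\<lambda>s' \<mu>' W D. base s' \<and>
     (\<exists>od. (\<forall>i<2 * m. imem \<mu>' 8 i = int (od i)) \<and> bij_betw od {..<2 * m} {..<2 * m} \<and>
        (\<forall>i j. i < j \<longrightarrow> j < 2 * m \<longrightarrow> key (od i) \<le> key (od j))) \<and>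
     (\<forall>t. 2 * m \<le> t \<and> t < P \<longrightarrow> imem \<mu>' 4 (P + t) = 0) \<and>
     W \<le> 100 * P * (L + 1) \<and> D \<le> 100 * (h + 1) * (L + 1)) s \<mu>"
proof -
  have nM: "2 * int (n * M) \<le> N" using bounds(12) by simp
  then have nM': "int (n * M) \<le> N" by linarith
  have nM0: "0 < n * M" using n_pos q by (simp add: M_def)
  have keyN: "int (key h) \<le> N" if "h < 2 * m" for h
    using key(2)[OF that] nM' by linarith
  define K where "K = (\<lambda>e od (s::regs) (\<mu>'::mem) W (D::nat). e \<le> L \<and> base s \<and> 2 ^ e \<le> 2 * (n * M) \<and>
     ireg s 6 = int (2 ^ e) \<and> ireg s 7 = int (n * M) \<and>
     (\<forall>i<2 * m. imem \<mu>' 8 i = int (od i)) \<and> bij_betw od {..<2 * m} {..<2 * m} \<and>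
     sorted_mod (2 * m) key (2 ^ e) od \<and>
     (\<forall>t. 2 * m \<le> t \<and> t < P \<longrightarrow> imem \<mu>' 4 (P + t) = 0) \<and>
     W \<le> 100 * P * e \<and> D \<le> 100 * (h + 1) * e)"
  define I where "I = (\<lambda>g (s::regs) (\<mu>'::mem) W (D::nat). \<exists>e od. g = L - e \<and> K e od s \<mu>' W D)"
  let ?s = "s\<lparr>ireg := (ireg s)(6 := 1, 7 := int (n * M))\<rparr>"
  have "wp b UNIV UNIV (While (ILess (IReg 6) (IReg 7)) (sort_pass ;; IAssign 6 (IMul (Const 2) (IReg 6))))
    (\<lambda>s' \<mu>' W D. base s' \<and>
     (\<exists>od. (\<forall>i<2 * m. imem \<mu>' 8 i = int (od i)) \<and> bij_betw od {..<2 * m} {..<2 * m} \<and>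
        (\<forall>i j. i < j \<longrightarrow> j < 2 * m \<longrightarrow> key (od i) \<le> key (od j))) \<and>
     (\<forall>t. 2 * m \<le> t \<and> t < P \<longrightarrow> imem \<mu>' 4 (P + t) = 0) \<and>
     1 + (2 + W) \<le> 100 * P * (L + 1) \<and> 1 + (2 + D) \<le> 100 * (h + 1) * (L + 1)) ?s \<mu>"
  proof (rule wp_While[where I = I and ?g0.0 = L], goal_cases)
    case 1
    have "sorted_mod (2 * m) key 1 (\<lambda>i. i)" "bij_betw (\<lambda>i. i) {..<2 * m} {..<2 * m}"
      by (simp_all add: sorted_mod_def bij_betw_def)
    then have "K 0 (\<lambda>i. i) ?s \<mu> 0 0"
      unfolding K_def using s id z nM0 by (auto simp: base_def)
    then show ?case unfolding I_def by (intro exI[of _ 0] exI[of _ "\<lambda>i. i"]) simp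
  next
    case (2 g s1 \<mu>1 W D)
    then obtain e od where ge: "g = L - e" and K: "K e od s1 \<mu>1 W D"
      unfolding I_def by blast
    then have e: "e \<le> L" "g = L - e" "base s1" "2 ^ e \<le> 2 * (n * M)" "ireg s1 6 = int (2 ^ e)" "ireg s1 7 = int (n * M)"
      and od: "\<And>i. i < 2 * m \<Longrightarrow> imem \<mu>1 8 i = int (od i)" "bij_betw od {..<2 * m} {..<2 * m}"
        "sorted_mod (2 * m) key (2 ^ e) od"
      and z1: "\<And>t. 2 * m \<le> t \<Longrightarrow> t < P \<Longrightarrow> imem \<mu>1 4 (P + t) = 0"
      and WD: "W \<le> 100 * P * e" "D \<le> 100 * (h + 1) * e"
      unfolding K_def by simp_all
    have key1: "imem \<mu>1 7 h = int (key h)" if "h < 2 * m" for h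
      using 2(2) key(1)[OF that]
      unfolding same_def sort_pass_def key_bits_def iscan_def up_sweep_def down_sweep_def scatter_def copy_back_def
      by simp
    have odl: "od i < 2 * m" if "i < 2 * m" for i using od(2) that by (auto dest: bij_betwE)
    have eN: "int (2 ^ e) \<le> N"
    proof -
      have "int (2 ^ e) \<le> int (2 * (n * M))" using e(4) by (simp only: of_nat_le_iff)
      then show ?thesis using nM by simp
    qed
    show ?case
    proof (cases "n * M \<le> 2 ^ e")
      case True
      have srt: "key (od i) \<le> key (od j)" if "i < j" "j < 2 * m" for i j
      proof -
        have "key (od i) mod 2 ^ e \<le> key (od j) mod 2 ^ e" using od(3) that by (simp add: sorted_mod_def)
        then show ?thesis using key(2)[OF odl[of i]] key(2)[OF odl[of j]] that True by simp
      qed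
      have T: "\<not> int (2 ^ e) < int (n * M)" using True by (simp only: of_nat_less_iff not_less)
      have "W + 5 \<le> 100 * P * (L + 1)" "D + 5 \<le> 100 * (h + 1) * (L + 1)"
        by (rule loop_cost(2)[OF WD(1) _ e(1)], use P_gt in simp) (rule loop_cost(2)[OF WD(2) _ e(1)], simp)
      then have "1 + (2 + (W + 2)) \<le> 100 * P * (L + 1)" "1 + (2 + (D + 2)) \<le> 100 * (h + 1) * (L + 1)"
        by linarith+
      with T show ?thesis
        using e od(1,2) z1 nM' eN srt by (auto simp: fitsI0 simp del: of_nat_power of_nat_mult)
    next
      case False
      have eL: "e < L"
      proof (rule ccontr)
        assume "\<not> e < L"
        then have "(2::nat) ^ L \<le> 2 ^ e" by (intro power_increasing) auto
        then show False using False L by linarith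
      qed
      have T: "int (2 ^ e) < int (n * M)" using False by (simp only: of_nat_less_iff not_le)
      have e2: "int (2 * 2 ^ e) \<le> N" using T nM by simp
      have "wp b UNIV UNIV sort_pass (\<lambda>s2 \<mu>2 W2 D2. ireg s2 6 = int (2 ^ e) \<and>
         I (L - Suc e) (s2\<lparr>ireg := (ireg s2)(6 := 2 * int (2 ^ e))\<rparr>) \<mu>2
           (W + (2 + (W2 + 2))) (D + (2 + (D2 + 2)))) s1 \<mu>1"
      proof (rule wp_mono[OF wp_sort_pass[OF e(3,5) _ eN od(1,2) key1 keyN od(3) z1]], goal_cases)
        case prems: (7 s2 \<mu>2 W2 D2)
        have sm: "ireg s2 x = ireg s1 x" if "x < 8" for x
          using prems(2) that unfolding same_def sort_pass_def key_bits_def iscan_def up_sweep_def down_sweep_def scatter_def copy_back_def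
          by simp
        have "W2 + 4 \<le> 100 * P" "D2 + 4 \<le> 100 * (h + 1)" using prems(1) P_gt by simp_all
        then have "W + (W2 + 4) \<le> 100 * P * Suc e" "D + (D2 + 4) \<le> 100 * (h + 1) * Suc e"
          using loop_cost(1)[OF WD(1)] loop_cost(1)[OF WD(2)] by blast+
        then have WD': "W + (2 + (W2 + 2)) \<le> 100 * P * Suc e" "D + (2 + (D2 + 2)) \<le> 100 * (h + 1) * Suc e"
          by linarith+
        have b2: "base (s2\<lparr>ireg := (ireg s2)(6 := 2 * int (2 ^ e))\<rparr>)"
          using e(3) sm by (simp add: base_def)
        have "2 ^ Suc e \<le> 2 * (n * M)" using False by simp
        from prems(1) obtain od' where od': "\<forall>i<2 * m. imem \<mu>2 8 i = int (od' i)"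
          "bij_betw od' {..<2 * m} {..<2 * m}" "sorted_mod (2 * m) key (2 * 2 ^ e) od'" by blast
        then have "K (Suc e) od' (s2\<lparr>ireg := (ireg s2)(6 := 2 * int (2 ^ e))\<rparr>) \<mu>2
           (W + (2 + (W2 + 2))) (D + (2 + (D2 + 2)))"
          unfolding K_def using prems(1) eL sm e(6) b2 WD' \<open>2 ^ Suc e \<le> 2 * (n * M)\<close> by simp
        then have "I (L - Suc e) (s2\<lparr>ireg := (ireg s2)(6 := 2 * int (2 ^ e))\<rparr>) \<mu>2
           (W + (2 + (W2 + 2))) (D + (2 + (D2 + 2)))"
          unfolding I_def by blast
        then show ?case using sm e(5) by simp
      qed (auto simp: P_gt)
      moreover have "L - Suc e < g" using e eL by simp
      ultimately show ?thesis
        unfolding wp_Seq wp_IAssign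
        using T e nM' eN e2 bounds(2) by (auto simp: fitsI0 simp del: of_nat_power of_nat_mult elim!: wp_mono intro!: exI[of _ "L - Suc e"])
    qed
  qed
  then show ?thesis
    unfolding sort_halves_def wp_Seq wp_IAssign
    using bounds(1,9,11) nM' r5 by (simp add: baseD[OF s] fitsI0 add.assoc)
qed

end

lemma ball_neq_Suc: "(\<forall>x\<in>{..<S}. j \<noteq> Suc x) \<longleftrightarrow> j = 0 \<or> S < j"
  by (cases j) auto

context run
begin

definition seg_start :: "(nat \<Rightarrow> nat) \<Rightarrow> nat \<Rightarrow> nat" where
  "seg_start od v = cnt (\<lambda>i. vt (od i) < v) (2 * m)"

definition seg_end :: "(nat \<Rightarrow> nat) \<Rightarrow> nat \<Rightarrow> nat" where
  "seg_end od v = cnt (\<lambda>i. vt (od i) \<le> v) (2 * m)"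

lemma sorted_halves_seg:
  assumes bij: "bij_betw od {..<2 * m} {..<2 * m}"
    and mono: "\<And>i j. i < j \<Longrightarrow> j < 2 * m \<Longrightarrow> vt (od i) \<le> vt (od j)"
  shows "sorted_halves n m vt od (seg_start od) (seg_end od)"
proof
  have m: "vt (od i) \<le> vt (od j)" if "i \<le> j" "j < 2 * m" for i j
    using mono[of i j] that by (cases "i = j") auto
  fix i v assume i: "i < 2 * m"
  have "vt (od i) < v \<longleftrightarrow> i < seg_start od v"
    unfolding seg_start_def by (rule cnt_initial) (use m i in \<open>auto intro: le_less_trans\<close>)
  moreover have "vt (od i) \<le> v \<longleftrightarrow> i < seg_end od v"
    unfolding seg_end_def by (rule cnt_initial) (use m i in \<open>auto intro: order_trans\<close>)
  ultimately show "vt (od i) = v \<longleftrightarrow> seg_start od v \<le> i \<and> i < seg_end od v" by linarith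
next
  fix v
  show "seg_start od v \<le> seg_end od v"
    unfolding seg_start_def seg_end_def cnt_def by (intro card_mono) auto
  show "seg_end od v \<le> 2 * m" unfolding seg_end_def by (rule cnt_le)
qed (use bij in simp)

lemma wp_segments:
  assumes s: "base s" and so: "sorted_halves n m vt od st en"
    and od: "\<And>i. i < 2 * m \<Longrightarrow> imem \<mu> 8 i = int (od i)"
    and v: "\<And>h. h < 2 * m \<Longrightarrow> imem \<mu> 10 h = int (vt h)"
    and z: "imem \<mu> 11 0 = 0" "imem \<mu> 11 (2 * m + 1) = 0"
  shows "wp b UNIV UNIV segments (\<lambda>s' \<mu>' W D. s' = s \<and>
     (\<forall>h<2 * m. imem \<mu>' 12 (vt h) = int (st (vt h)) \<and> imem \<mu>' 13 (vt h) = int (en (vt h))) \<and>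
     W \<le> 50 * P \<and> D \<le> 50) s \<mu>"
proof -
  interpret sorted_halves n m vt od st en by (rule so)
  have odN: "int (od i) \<le> N" if "i < 2 * m" for i
    using od_less[OF that] bounds(5) by linarith
  have vN: "int (vt h) + 1 \<le> N" "int (vt h) \<le> N" if "h < 2 * m" for h
    using vt_less[OF that] bounds(9) by linarith+
  define A where "A j = (if 1 \<le> j \<and> j \<le> 2 * m then int (vt (od (j - 1))) + 1 else imem \<mu> 11 j)" for j
  let ?\<mu> = "\<mu>\<lparr>imem := (imem \<mu>)(11 := A)\<rparr>"
  have A1: "A (Suc i) = int (vt (od i)) + 1" if "i < 2 * m" for i
    using that by (simp add: A_def)
  have iseg: "st (vt (od i)) \<le> i" "i < en (vt (od i))" if "i < 2 * m" for i
    using seg[OF that] by blast+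
  have A0: "A i = A (Suc i) \<longleftrightarrow> i \<noteq> st (vt (od i))" if i: "i < 2 * m" for i
  proof (cases i)
    case 0
    then show ?thesis using i z(1) A1[of 0] seg[of 0 "vt (od 0)"] by (simp add: A_def)
  next
    case (Suc k)
    then have k: "k < 2 * m" using i by simp
    have "A i = A (Suc i) \<longleftrightarrow> vt (od k) = vt (od i)" using A1[OF k] A1[OF i] Suc by simp
    also have "\<dots> \<longleftrightarrow> st (vt (od i)) \<le> k \<and> k < en (vt (od i))" by (rule seg[OF k])
    also have "\<dots> \<longleftrightarrow> i \<noteq> st (vt (od i))" using iseg[OF i] Suc by auto
    finally show ?thesis .
  qed
  have A2: "A (Suc i) = A (Suc (Suc i)) \<longleftrightarrow> Suc i \<noteq> en (vt (od i))" if i: "i < 2 * m" for i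
  proof (cases "Suc i < 2 * m")
    case True
    have "A (Suc i) = A (Suc (Suc i)) \<longleftrightarrow> vt (od (Suc i)) = vt (od i)" using A1[OF True] A1[OF i] by auto
    also have "\<dots> \<longleftrightarrow> st (vt (od i)) \<le> Suc i \<and> Suc i < en (vt (od i))" by (rule seg[OF True])
    also have "\<dots> \<longleftrightarrow> Suc i \<noteq> en (vt (od i))" using iseg[OF i] by auto
    finally show ?thesis .
  next
    case False
    then have "Suc i = 2 * m" using i by simp
    moreover have "en (vt (od i)) = Suc i" using iseg[OF i] en_le[of "vt (od i)"] \<open>Suc i = 2 * m\<close> by simp
    ultimately show ?thesis using A1[OF i] z(2) by (simp add: A_def)
  qed
  have AN: "0 \<le> A i \<and> A i \<le> N" if "i \<le> 2 * m + 1" for i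
    using that vN[OF od_less[of "i - 1"]] z bounds(1)
    by (cases "i = 0 \<or> i = 2 * m + 1") (auto simp: A_def)
  let ?V = "\<lambda>i. (if i = st (vt (od i)) then {ICell 12 (vt (od i))} else {}) \<union>
    (if Suc i = en (vt (od i)) then {ICell 13 (vt (od i))} else {})"
  define used where "used v \<longleftrightarrow> (\<exists>h<2 * m. vt h = v)" for v
  have used: "used (vt (od i))" if "i < 2 * m" for i using od_less[OF that] by (auto simp: used_def)
  \<comment> \<open>Every vertex that occurs has a first and a last position, so the cells in which
    \<open>?\<nu>\<close> differs are all owned by some strand.\<close>
  have usedD: "\<exists>i<2 * m. i = st (vt (od i)) \<and> vt (od i) = v" "\<exists>i<2 * m. Suc i = en (vt (od i)) \<and> vt (od i) = v"
    if "used v" for v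
  proof -
    obtain k where k: "k < 2 * m" "vt (od k) = v" using \<open>used v\<close> od_surj unfolding used_def by blast
    then have sk: "st v \<le> k" "k < en v" using seg by blast+
    then have "vt (od (st v)) = v" using seg[of "st v" v] k by simp
    then show "\<exists>i<2 * m. i = st (vt (od i)) \<and> vt (od i) = v" using sk k by (intro exI[of _ "st v"]) auto
    have "vt (od (en v - 1)) = v" using seg[of "en v - 1" v] sk en_le[of v] by simp
    then show "\<exists>i<2 * m. Suc i = en (vt (od i)) \<and> vt (od i) = v"
      using sk en_le[of v] by (intro exI[of _ "en v - 1"]) auto
  qed
  let ?\<nu> = "?\<mu>\<lparr>imem := (imem ?\<mu>)(12 := \<lambda>v. if used v then int (st v) else imem \<mu> 12 v,
     13 := \<lambda>v. if used v then int (en v) else imem \<mu> 13 v)\<rparr>"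
  have one: "wp b UNIV UNIV (ParFor 20 (IReg 2) (ILoad 21 8 (IReg 20) ;; ILoad 21 10 (IReg 21) ;;
      IStore 11 (IAdd (IReg 20) (Const 1)) (IAdd (IReg 21) (Const 1))))
    (\<lambda>s' \<mu>' W D. s' = s \<and> \<mu>' = ?\<mu> \<and> W \<le> 10 * P \<and> D \<le> 10) s \<mu>"
    using bounds(1,2,5-8) P_gt
    by (intro wp_ParFor[where k = "2 * m" and V = "\<lambda>i. {ICell 11 (Suc i)}" and w = 6 and \<nu> = ?\<mu>])
      (simp_all add: baseD[OF s] wp_simps agree_def nat_add_distrib od v od_less A1 ball_neq_Suc,
       auto simp: vN odN od_less A1 od v A_def intro!: fitsI0)
  have two: "wp b UNIV UNIV (ParFor 20 (IReg 2) (ILoad 21 11 (IReg 20) ;; ILoad 22 11 (IAdd (IReg 20) (Const 1)) ;;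
      ILoad 23 11 (IAdd (IReg 20) (Const 2)) ;;
      Cond (IEq (IReg 21) (IReg 22)) Skip (IStore 12 (ISub (IReg 22) (Const 1)) (IReg 20)) ;;
      Cond (IEq (IReg 22) (IReg 23)) Skip (IStore 13 (ISub (IReg 22) (Const 1)) (IAdd (IReg 20) (Const 1)))))
    (\<lambda>s' \<mu>' W D. s' = s \<and> \<mu>' = ?\<nu> \<and> W \<le> 25 * P \<and> D \<le> 25) s ?\<mu>"
  proof (rule wp_ParFor[where k = "2 * m" and V = ?V and w = 18 and \<nu> = ?\<nu>], goal_cases)
    case (3 i j)
    have "vt (od i) \<noteq> vt (od j)" if "i = st (vt (od i))" "j = st (vt (od j))" using that 3 by auto
    moreover have "vt (od i) \<noteq> vt (od j)" if "Suc i = en (vt (od i))" "Suc j = en (vt (od j))" using that 3 by auto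
    ultimately show ?case by auto
  next
    case (4 i)
    have b: "A i \<le> N" "0 \<le> A i" "A (Suc (Suc i)) \<le> N" "0 \<le> A (Suc (Suc i))"
      using AN[of i] AN[of "Suc (Suc i)"] 4 by simp_all
    have e: "int i + 1 = int (Suc i)" "int i + 2 = int (Suc (Suc i))" by simp_all
    show ?case
      using 4 bounds(1,2,5-8) P_gt b A0[OF 4] A1[OF 4] A2[OF 4] vN[OF od_less[OF 4]] used[OF 4]
      by (auto simp: wp_simps agree_def e simp del: of_nat_Suc intro!: fitsI0)
  next
    case 5
    show ?case
      unfolding agree_def using usedD by (auto split: if_splits)
  qed (use bounds P_gt in \<open>auto simp: baseD[OF s] fitsI0\<close>)
  show ?thesis
    unfolding segments_def wp_Seq
  proof (rule wp_mono[OF one])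
    fix s1 \<mu>1 and W1 D1 :: nat assume "s1 = s \<and> \<mu>1 = ?\<mu> \<and> W1 \<le> 10 * P \<and> D1 \<le> 10"
    then have 1: "s1 = s" "\<mu>1 = ?\<mu>" "W1 \<le> 10 * P" "D1 \<le> 10" by auto
    show "wp b UNIV UNIV (ParFor 20 (IReg 2) (ILoad 21 11 (IReg 20) ;; ILoad 22 11 (IAdd (IReg 20) (Const 1)) ;;
      ILoad 23 11 (IAdd (IReg 20) (Const 2)) ;;
      Cond (IEq (IReg 21) (IReg 22)) Skip (IStore 12 (ISub (IReg 22) (Const 1)) (IReg 20)) ;;
      Cond (IEq (IReg 22) (IReg 23)) Skip (IStore 13 (ISub (IReg 22) (Const 1)) (IAdd (IReg 20) (Const 1)))))
      (\<lambda>s' \<mu>' W D. s' = s \<and>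
     (\<forall>h<2 * m. imem \<mu>' 12 (vt h) = int (st (vt h)) \<and> imem \<mu>' 13 (vt h) = int (en (vt h))) \<and>
     W1 + W \<le> 50 * P \<and> D1 + D \<le> 50) s1 \<mu>1"
      unfolding 1(1,2) by (rule wp_mono[OF two]) (use 1(3,4) in \<open>auto simp: used_def\<close>)
  qed
qed

end

section \<open>Multiplicative weights on the machine\<close>

definition mwu_init :: "nat \<Rightarrow> cmd" where
  "mwu_init q = ParFor 20 (IReg 1) (RStore 4 (IReg 20) (RDiv (OfInt (Const 1)) (OfInt (IReg 1))))"

text \<open>Puts the amounts in sorted order as leaves for the scan. The first position of each
  segment resets the price of its vertex, which keeps the writes exclusive.\<close>

definition mwu_leaves :: cmd where
  "mwu_leaves = ParFor 20 (IReg 2)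
     (ILoad 21 8 (IReg 20) ;; ILoad 22 10 (IReg 21) ;; ILoad 23 12 (IReg 22) ;;
      RLoad 20 4 (IMod (IReg 21) (IReg 1)) ;; RStore 2 (IAdd (IReg 3) (IReg 20)) (RReg 20) ;;
      Cond (IEq (IReg 23) (IReg 20)) (RStore 7 (IReg 22) (OfInt (Const 0))) Skip)"

text \<open>The amount before a position within its segment is a difference of two global prefix
  sums. The unique position at which the amount passes 1 sets the price; elsewhere the price stays
  0.\<close>

definition mwu_truncate :: cmd where
  "mwu_truncate = ParFor 20 (IReg 2)
     (ILoad 21 8 (IReg 20) ;; ILoad 22 10 (IReg 21) ;; ILoad 23 12 (IReg 22) ;;
      RLoad 20 2 (IAdd (IReg 3) (IReg 20)) ;; RLoad 21 3 (IAdd (IReg 3) (IReg 20)) ;;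
      RLoad 22 3 (IAdd (IReg 3) (IReg 23)) ;; RAssign 21 (RSub (RReg 21) (RReg 22)) ;;
      RAssign 22 (RAdd (RReg 21) (RReg 20)) ;;
      Cond (RLess (OfInt (Const 1)) (RReg 22))
        (Cond (RLess (OfInt (Const 1)) (RReg 21))
          (RStore 6 (IReg 21) (OfInt (Const 0)))
          (RStore 6 (IReg 21) (RSub (OfInt (Const 1)) (RReg 21)) ;;
           RLoad 23 1 (IMod (IReg 21) (IReg 1)) ;; RStore 7 (IReg 22) (RReg 23)))
        (RStore 6 (IReg 21) (RReg 20)))"

definition mwu_update :: "nat \<Rightarrow> cmd" where
  "mwu_update q = ParFor 20 (IReg 1)
     (ILoad 21 1 (IReg 20) ;; ILoad 22 2 (IReg 20) ;; RLoad 20 7 (IReg 21) ;; RLoad 21 7 (IReg 22) ;;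
      RLoad 22 1 (IReg 20) ;;
      Cond (RLess (RReg 20) (RReg 22)) (RAssign 20 (RDiv (RReg 20) (RReg 22))) (RAssign 20 (OfInt (Const 1))) ;;
      Cond (RLess (RReg 21) (RReg 22)) (RAssign 21 (RDiv (RReg 21) (RReg 22))) (RAssign 21 (OfInt (Const 1))) ;;
      RLoad 23 6 (IReg 20) ;; RLoad 24 6 (IAdd (IReg 1) (IReg 20)) ;;
      Cond (RLess (RReg 24) (RReg 23)) (RAssign 23 (RReg 24)) Skip ;;
      RLoad 24 5 (IReg 20) ;; RStore 5 (IReg 20) (RAdd (RReg 24) (RReg 23)) ;;
      RLoad 24 4 (IReg 20) ;;
      RStore 4 (IReg 20) (RMul (RReg 24) (RAdd (OfInt (Const 1))
        (RDiv (RSub (RSub (OfInt (Const 1)) (RReg 20)) (RReg 21)) (OfInt (Const q))))))"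

definition mwu_step :: "nat \<Rightarrow> cmd" where
  "mwu_step q = mwu_leaves ;; rscan ;; mwu_truncate ;; mwu_update q"

text \<open>Array 5 accumulates the amounts kept at both ends. Register 9 preserves the number of
  rounds, by which they are divided later, while register 8 counts down.\<close>

definition mwu :: "nat \<Rightarrow> cmd" where
  "mwu q = mwu_init q ;; IAssign 9 (IMul (IMul (Const q) (Const q)) (IReg 4)) ;; IAssign 8 (IReg 9) ;;
     While (ILess (Const 0) (IReg 8)) (mwu_step q ;; IAssign 8 (ISub (IReg 8) (Const 1)))"

locale sorted_run = run n m vt b N q h P + sorted_halves n m vt od st en
  for n m :: nat and vt :: "nat \<Rightarrow> nat" and b :: nat and N :: int and q h P :: nat
    and od st en :: "nat \<Rightarrow> nat" +
  fixes w :: "nat \<Rightarrow> real"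
  assumes w_pos: "e < m \<Longrightarrow> 0 < w e"
    and w_mono: "st v \<le> i \<Longrightarrow> i \<le> j \<Longrightarrow> j < en v \<Longrightarrow> w (od j mod m) \<le> w (od i mod m)"
begin

text \<open>The part of the memory that all later phases only read. Segment bounds are known only
  for vertices that have an edge.\<close>

definition static :: "mem \<Rightarrow> bool" where
  "static \<mu> \<longleftrightarrow> (\<forall>e<m. imem \<mu> 1 e = int (vt e) \<and> imem \<mu> 2 e = int (vt (m + e)) \<and> rmem \<mu> 1 e = w e) \<and>
     (\<forall>i<2 * m. imem \<mu> 8 i = int (od i)) \<and>
     (\<forall>h<2 * m. imem \<mu> 10 h = int (vt h) \<and> imem \<mu> 12 (vt h) = int (st (vt h)) \<and>
        imem \<mu> 13 (vt h) = int (en (vt h)))"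

lemma staticD:
  assumes "static \<mu>"
  shows "e < m \<Longrightarrow> imem \<mu> (Suc 0) e = int (vt e)" "e < m \<Longrightarrow> imem \<mu> 2 e = int (vt (m + e))"
    "e < m \<Longrightarrow> rmem \<mu> (Suc 0) e = w e" "i < 2 * m \<Longrightarrow> imem \<mu> 8 i = int (od i)"
    "g < 2 * m \<Longrightarrow> imem \<mu> 10 g = int (vt g)" "g < 2 * m \<Longrightarrow> imem \<mu> 12 (vt g) = int (st (vt g))"
    "g < 2 * m \<Longrightarrow> imem \<mu> 13 (vt g) = int (en (vt g))"
  using assms by (auto simp: static_def)

lemma static_cong:
  assumes "static \<mu>" "imem \<mu>' 1 = imem \<mu> 1" "imem \<mu>' 2 = imem \<mu> 2" "imem \<mu>' 8 = imem \<mu> 8"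
    "imem \<mu>' 10 = imem \<mu> 10" "imem \<mu>' 12 = imem \<mu> 12" "imem \<mu>' 13 = imem \<mu> 13" "rmem \<mu>' 1 = rmem \<mu> 1"
  shows "static \<mu>'"
  using assms by (simp add: static_def)

lemma od_mod_nat: "int x mod int m = int (x mod m)"
  by (simp add: zmod_int)

lemma sizes:
  "i < 2 * m \<Longrightarrow> int (od i) \<le> N" "g < 2 * m \<Longrightarrow> int (vt g) \<le> N" "int (x mod m) \<le> N"
  "int (st v) \<le> N" "int (en v) \<le> N" "int P + int (st v) \<le> N" "int P + int (en v) \<le> N"
proof -
  show "int (od i) \<le> N" if "i < 2 * m" using od_less[OF that] bounds(5) by linarith
  show "int (vt g) \<le> N" if "g < 2 * m" using vt_less[OF that] bounds(9) by linarith
  show "int (x mod m) \<le> N" using mod_less_divisor[OF m_pos, of x] bounds(4) by linarith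
  have "int (st v) \<le> 2 * int m" "int (en v) \<le> 2 * int m" using st_le[of v] en_le[of v] by linarith+
  then show "int (st v) \<le> N" "int (en v) \<le> N" "int P + int (st v) \<le> N" "int P + int (en v) \<le> N"
    using bounds(5,7,8) by linarith+
qed

lemma seg_od: "i < 2 * m \<Longrightarrow> st (vt (od i)) \<le> i" "i < 2 * m \<Longrightarrow> i < en (vt (od i))"
  using seg[of i "vt (od i)"] by auto

lemma st_od: assumes "g < 2 * m" shows "st (vt g) < 2 * m" "vt (od (st (vt g))) = vt g"
proof -
  obtain i where i: "i < 2 * m" "od i = g" using od_surj[OF assms] by blast
  then show 1: "st (vt g) < 2 * m" using seg_od[of i] en_le[of "vt g"] by simp
  show "vt (od (st (vt g))) = vt g" using seg[OF 1, of "vt g"] seg_od[of i] i by simp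
qed

definition pos_of :: "nat \<Rightarrow> nat" where "pos_of g = inv_into {..<2 * m} od g"

lemma pos_of_od: "i < 2 * m \<Longrightarrow> pos_of (od i) = i"
  unfolding pos_of_def using od_bij by (auto simp: bij_betw_def)

lemma wp_mwu_leaves:
  assumes s: "base s" and st: "static \<mu>" and x: "\<And>e. e < m \<Longrightarrow> rmem \<mu> 4 e = x e"
  shows "wp b UNIV UNIV mwu_leaves (\<lambda>s' \<mu>' W D. s' = s \<and>
     (\<forall>i<2 * m. rmem \<mu>' 2 (P + i) = x (od i mod m)) \<and> (\<forall>h<2 * m. rmem \<mu>' 7 (vt h) = 0) \<and>
     W \<le> 20 * P \<and> D \<le> 20) s \<mu>"
proof -
  define used where "used v \<longleftrightarrow> (\<exists>h<2 * m. vt h = v)" for v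
  have used: "used (vt (od i))" if "i < 2 * m" for i using od_less[OF that] by (auto simp: used_def)
  let ?V = "\<lambda>i. {RCell 2 (P + i)} \<union> (if st (vt (od i)) = i then {RCell 7 (vt (od i))} else {})"
  let ?\<nu> = "\<mu>\<lparr>rmem := (rmem \<mu>)(2 := \<lambda>j. if P \<le> j \<and> j < P + 2 * m then x (od (j - P) mod m) else rmem \<mu> 2 j,
       7 := \<lambda>v. if used v then 0 else rmem \<mu> 7 v)\<rparr>"
  have "wp b UNIV UNIV mwu_leaves (\<lambda>s' \<mu>' W D. s' = s \<and> \<mu>' = ?\<nu> \<and> W \<le> 20 * P \<and> D \<le> 20) s \<mu>"
    unfolding mwu_leaves_def
  proof (rule wp_ParFor[where k = "2 * m" and V = ?V and w = 14 and \<nu> = ?\<nu>], goal_cases)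
    case (3 i j)
    have "vt (od i) \<noteq> vt (od j)" if "st (vt (od i)) = i" "st (vt (od j)) = j" using that 3 by auto
    then show ?case using 3 by auto
  next
    case (4 i)
    show ?case
      using 4 bounds(1,2,5-8) P_gt used[OF 4] od_mod[OF 4]
      by (auto simp: baseD[OF s] wp_simps agree_def nat_add_distrib staticD[OF st] od_less od_mod_nat sizes x
          intro!: fitsI0)
  next
    case 5
    have "\<exists>i<2 * m. st (vt (od i)) = i \<and> vt (od i) = v" if "used v" for v
      using that st_od unfolding used_def by metis
    then show ?case
      unfolding agree_def by (auto split: if_splits simp: ball_neq_add)
  qed (use bounds P_gt in \<open>auto simp: baseD[OF s] fitsI0\<close>)
  then show ?thesis by (rule wp_mono) (auto simp: used_def)
qed

definition pre :: "(nat \<Rightarrow> real) \<Rightarrow> nat \<Rightarrow> real" where "pre x i = (\<Sum>t<i. x (od t mod m))"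

definition before :: "(nat \<Rightarrow> real) \<Rightarrow> nat \<Rightarrow> real" where "before x i = pre x i - pre x (st (vt (od i)))"

definition marginal :: "(nat \<Rightarrow> real) \<Rightarrow> nat \<Rightarrow> bool" where
  "marginal x i \<longleftrightarrow> before x i \<le> 1 \<and> 1 < before x i + x (od i mod m)"

definition kept :: "(nat \<Rightarrow> real) \<Rightarrow> nat \<Rightarrow> real" where
  "kept x i = (if 1 < before x i + x (od i mod m) then if 1 < before x i then 0 else 1 - before x i
     else x (od i mod m))"

definition price :: "(nat \<Rightarrow> real) \<Rightarrow> nat \<Rightarrow> real" where
  "price x v = (if \<exists>i<2 * m. marginal x i \<and> vt (od i) = v
     then w (od (SOME i. i < 2 * m \<and> marginal x i \<and> vt (od i) = v) mod m) else 0)"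

lemma before_eq: assumes "i < 2 * m" "vt (od i) = v" shows "before x i = (\<Sum>k = st v..<i. x (od k mod m))"
proof -
  have "{..<i} = {..<st v} \<union> {st v..<i}" using seg_od[OF assms(1)] assms(2) by auto
  moreover have "{..<st v} \<inter> {st v..<i} = {}" by auto
  ultimately show ?thesis
    unfolding before_def pre_def assms(2) by (simp add: sum.union_disjoint)
qed

text \<open>Amounts are positive, so once the accumulated amount exceeds 1 it does so for the rest
  of the segment. Hence the price is well defined and has a single writer.\<close>

lemma marginal_unique:
  assumes x: "\<And>e. e < m \<Longrightarrow> 0 < x e" and i: "i < 2 * m" "j < 2 * m" "marginal x i" "marginal x j" "vt (od i) = vt (od j)"
  shows "i = j"
proof -
  have "\<not> i < j" if ij: "i < 2 * m" "j < 2 * m" "marginal x i" "marginal x j" "vt (od i) = vt (od j)" for i j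
  proof
    assume lt: "i < j"
    have "before x i + x (od i mod m) = (\<Sum>k = st (vt (od i))..<Suc i. x (od k mod m))"
      using before_eq[OF ij(1) refl] seg_od[OF ij(1)] by simp
    also have "\<dots> \<le> (\<Sum>k = st (vt (od i))..<j. x (od k mod m))"
      using lt m_pos x by (intro sum_mono2) (auto intro: less_imp_le)
    also have "\<dots> = before x j" using before_eq[OF ij(2) ij(5)[symmetric]] by simp
    finally show False using ij(3,4) by (simp add: marginal_def)
  qed
  from this[of i j] this[of j i] i show ?thesis by (metis linorder_neqE_nat)
qed

lemma price_marginal:
  assumes "\<And>e. e < m \<Longrightarrow> 0 < x e" "i < 2 * m" "marginal x i"
  shows "price x (vt (od i)) = w (od i mod m)"
proof -
  let ?P = "\<lambda>j. j < 2 * m \<and> marginal x j \<and> vt (od j) = vt (od i)"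
  have "?P i" using assms by simp
  then have "?P (SOME j. ?P j)" by (rule someI)
  then have "(SOME j. ?P j) = i"
    using marginal_unique[where x = x and i = "SOME j. ?P j" and j = i] assms by blast
  then show ?thesis using \<open>?P i\<close> unfolding price_def by auto
qed

lemma wp_mwu_truncate:
  assumes s: "base s" and st: "static \<mu>" and x0: "\<And>e. e < m \<Longrightarrow> 0 < x e"
    and x: "\<And>i. i < 2 * m \<Longrightarrow> rmem \<mu> 2 (P + i) = x (od i mod m)"
    and pr: "\<And>i. i \<le> 2 * m \<Longrightarrow> rmem \<mu> 3 (P + i) = pre x i"
    and z: "\<And>h. h < 2 * m \<Longrightarrow> rmem \<mu> 7 (vt h) = 0"
  shows "wp b UNIV UNIV mwu_truncate (\<lambda>s' \<mu>' W D. s' = s \<and>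
     (\<forall>i<2 * m. rmem \<mu>' 6 (od i) = kept x i) \<and> (\<forall>h<2 * m. rmem \<mu>' 7 (vt h) = price x (vt h)) \<and>
     W \<le> 40 * P \<and> D \<le> 40) s \<mu>"
proof -
  let ?V = "\<lambda>i. {RCell 6 (od i)} \<union> (if marginal x i then {RCell 7 (vt (od i))} else {})"
  let ?mg = "\<lambda>v. \<exists>i<2 * m. marginal x i \<and> vt (od i) = v"
  let ?\<nu> = "\<mu>\<lparr>rmem := (rmem \<mu>)(6 := \<lambda>h. if h < 2 * m then kept x (pos_of h) else rmem \<mu> 6 h,
       7 := \<lambda>v. if ?mg v then price x v else rmem \<mu> 7 v)\<rparr>"
  have "wp b UNIV UNIV mwu_truncate (\<lambda>s' \<mu>' W D. s' = s \<and> \<mu>' = ?\<nu> \<and> W \<le> 40 * P \<and> D \<le> 40) s \<mu>"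
    unfolding mwu_truncate_def
  proof (rule wp_ParFor[where k = "2 * m" and V = ?V and w = 30 and \<nu> = ?\<nu>], goal_cases)
    case (3 i j)
    have "od i \<noteq> od j" using 3 od_inj by blast
    moreover have "vt (od i) \<noteq> vt (od j)" if "marginal x i" "marginal x j"
      using that 3 marginal_unique[where x = x and i = i and j = j] x0 by blast
    ultimately show ?case by auto
  next
    case (4 i)
    have st2: "st (vt (od i)) \<le> 2 * m" using seg_od(1)[OF 4] 4 by simp
    have mg: "marginal x i \<longleftrightarrow> 1 < before x i + x (od i mod m) \<and> \<not> 1 < before x i"
      by (auto simp: marginal_def)
    have pm: "price x (vt (od i)) = w (od i mod m)" if "1 < before x i + x (od i mod m)" "\<not> 1 < before x i"
      using price_marginal[OF x0 4] mg that by simp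
    have ex: "\<exists>j<2 * m. marginal x j \<and> vt (od j) = vt (od i)" if "1 < before x i + x (od i mod m)" "\<not> 1 < before x i"
      using mg that 4 by auto
    have ld: "rmem \<mu> 3 (P + i) = pre x i" "rmem \<mu> 3 (P + st (vt (od i))) = pre x (st (vt (od i)))"
      "pre x i - pre x (st (vt (od i))) = before x i"
      using pr 4 st2 by (simp_all add: before_def)
    have "int i \<le> N" "int P + int i \<le> N" using 4 bounds(5,7,8) by linarith+
    note iN = this bounds(6,4,1)
    note [simp] = baseD[OF s] staticD[OF st] od_mod_nat od_less[OF 4] od_mod[OF 4] x[OF 4] ld pos_of_od[OF 4]
      sizes(1)[OF 4] sizes(2)[OF od_less[OF 4]] sizes(3-7) 4
    have nt: "nat (int P + int i) = P + i" "nat (int P + int (st (vt (od i)))) = P + st (vt (od i))" by simp_all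
    consider "\<not> 1 < before x i + x (od i mod m)" | "1 < before x i + x (od i mod m)" "1 < before x i"
      | "1 < before x i + x (od i mod m)" "\<not> 1 < before x i" by blast
    then show ?case
    proof cases
      case 1
      then have "\<not> marginal x i" "kept x i = x (od i mod m)" by (simp_all add: mg kept_def)
      with 1 iN show ?thesis by (simp add: wp_simps agree_def nt fitsI0)
    next
      case 2
      then have "\<not> marginal x i" "kept x i = 0" by (simp_all add: mg kept_def)
      with 2 iN show ?thesis by (simp add: wp_simps agree_def nt fitsI0)
    next
      case 3
      then have "marginal x i" "kept x i = 1 - before x i" by (simp_all add: mg kept_def)
      with 3 iN show ?thesis
        apply (simp add: wp_simps nt fitsI0 del: not_less)
        apply (simp add: agree_def pm[OF 3] eqTrueI[OF ex[OF 3]] del: not_less)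
        done
    qed
  next
    case 5
    have "\<not> c < 2 * m" if "\<forall>i<2 * m. c \<noteq> od i" for c using that od_surj by blast
    then show ?case
      unfolding agree_def by (auto split: if_splits)
  qed (use bounds P_gt in \<open>auto simp: baseD[OF s] fitsI0\<close>)
  then show ?thesis
    by (rule wp_mono) (use z in \<open>auto simp: pos_of_od od_less price_def\<close>)
qed

lemma wp_mwu_update:
  assumes s: "base s" and st: "static \<mu>"
    and x: "\<And>e. e < m \<Longrightarrow> rmem \<mu> 4 e = x e" and Z: "\<And>e. e < m \<Longrightarrow> rmem \<mu> 5 e = Z e"
    and y: "\<And>h. h < 2 * m \<Longrightarrow> rmem \<mu> 6 h = y h" and p: "\<And>h. h < 2 * m \<Longrightarrow> rmem \<mu> 7 (vt h) = p (vt h)"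
  shows "wp b UNIV UNIV (mwu_update q) (\<lambda>s' \<mu>' W D. s' = s \<and>
     (\<forall>e<m. rmem \<mu>' 5 e = Z e + min (y e) (y (m + e)) \<and> rmem \<mu>' 4 e = x e * (1 + reduced w p e / q)) \<and>
     W \<le> 60 * P \<and> D \<le> 60) s \<mu>"
proof -
  have mn: "min 1 (a / w e) = (if a < w e then a / w e else 1)" if "e < m" for a e
    using w_pos[OF that] by (auto simp: min_def field_simps)
  let ?\<nu> = "\<mu>\<lparr>rmem := (rmem \<mu>)(5 := \<lambda>e. if e < m then Z e + min (y e) (y (m + e)) else rmem \<mu> 5 e,
       4 := \<lambda>e. if e < m then x e * (1 + reduced w p e / q) else rmem \<mu> 4 e)\<rparr>"
  have "wp b UNIV UNIV (mwu_update q) (\<lambda>s' \<mu>' W D. s' = s \<and> \<mu>' = ?\<nu> \<and> W \<le> 60 * P \<and> D \<le> 60) s \<mu>"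
    unfolding mwu_update_def
  proof (rule wp_ParFor[where k = m and V = "\<lambda>e. {RCell 5 e, RCell 4 e}" and w = 50 and \<nu> = ?\<nu>], goal_cases)
    case (4 i)
    then have i: "i < 2 * m" "m + i < 2 * m" by simp_all
    have nt: "nat (int m + int i) = m + i" by simp
    have "int i \<le> N" "int m + int i \<le> N" using 4 bounds(5) by linarith+
    note iN = this bounds(4,1,3)
    note [simp] = baseD[OF s] staticD(1-3)[OF st 4] x[OF 4] Z[OF 4] y[OF i(1)] y[OF i(2)] p[OF i(1)] p[OF i(2)]
      sizes(2)[OF i(1)] sizes(2)[OF i(2)] 4 nt
    have r: "reduced w p i = 1 - (if p (vt i) < w i then p (vt i) / w i else 1) - (if p (vt (m + i)) < w i then p (vt (m + i)) / w i else 1)"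
      by (simp add: reduced_def mn[OF 4])
    show ?case
      by (cases "p (vt i) < w i"; cases "p (vt (m + i)) < w i"; cases "y (m + i) < y i")
        (use iN in \<open>simp_all add: wp_simps agree_def fitsI0 r min_def\<close>)
  qed (use bounds P_gt in \<open>auto simp: baseD[OF s] fitsI0 agree_def\<close>)
  then show ?thesis by (rule wp_mono) auto
qed

end

context sorted_run
begin

text \<open>An instance of \<open>truncation\<close> on the segment of \<open>v\<close>, where
  weights are non-increasing. If no position is marginal, induction along the segment shows that the
  total amount is at most 1, in accordance with the price 0.\<close>

lemma truncated_vertex:
  assumes x0: "\<And>e. e < m \<Longrightarrow> 0 < x e" and y: "\<And>i. i < 2 * m \<Longrightarrow> y (od i) = kept x i"
  shows "price x v + (\<Sum>g\<in>halves v. w (g mod m) * (x (g mod m) - y g))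
        \<le> (\<Sum>g\<in>halves v. x (g mod m) * min (w (g mod m)) (price x v))"
    "(\<Sum>g\<in>halves v. y g) \<le> 1"
proof -
  define a where "a i = (\<Sum>k = st v..<i. x (od k mod m))" for i
  have sv: "i < 2 * m" "vt (od i) = v" if "st v \<le> i" "i < en v" for i
    using that en_le[of v] seg[of i v] by auto
  have b: "before x i = a i" "before x i + x (od i mod m) = a (Suc i)" if "st v \<le> i" "i < en v" for i
    using before_eq[OF sv[OF that]] that by (simp_all add: a_def)
  have x0': "0 < x (od i mod m)" for i using x0 m_pos by simp
  have am: "a i \<le> a j" if "i \<le> j" for i j
    unfolding a_def using that x0' by (intro sum_mono2) (auto intro: less_imp_le)
  have kept: "kept x i = min 1 (a (Suc i)) - min 1 (a i)" if "st v \<le> i" "i < en v" for i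
    using b[OF that] am[of i "Suc i"] by (auto simp: kept_def min_def)
  have p: "(\<exists>i. st v \<le> i \<and> i < en v \<and> a i \<le> 1 \<and> 1 < a (Suc i) \<and> price x v = w (od i mod m)) \<or>
     (a (en v) \<le> 1 \<and> price x v = 0)"
  proof (cases "\<exists>i. st v \<le> i \<and> i < en v \<and> marginal x i")
    case True
    then obtain i where i: "st v \<le> i" "i < en v" "marginal x i" by blast
    have "price x v = w (od i mod m)" using price_marginal[where x = x and i = i] x0 i sv[OF i(1,2)] by simp
    then show ?thesis using i b[OF i(1,2)] by (auto simp: marginal_def)
  next
    case False
    have "a j \<le> 1" if "st v \<le> j" "j \<le> en v" for j
      using that
    proof (induction j rule: dec_induct)
      case base
      then show ?case by (simp add: a_def)
    next
      case (step j)
      then have "\<not> marginal x j" using False by auto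
      then show ?case using step b[of j] by (simp add: marginal_def)
    qed
    then have "a (en v) \<le> 1" using st_le by simp
    moreover have "price x v = 0"
      unfolding price_def using False seg by auto
    ultimately show ?thesis by blast
  qed
  note tr = truncation[where s = "st v" and t = "en v" and X = "\<lambda>i. x (od i mod m)"
      and W = "\<lambda>i. w (od i mod m)" and a = a and y = "kept x" and p = "price x v"]
  have w0: "0 \<le> w (od i mod m)" for i using w_pos[of "od i mod m"] m_pos by simp
  have T: "price x v + (\<Sum>i = st v..<en v. w (od i mod m) * (x (od i mod m) - kept x i))
      \<le> (\<Sum>i = st v..<en v. x (od i mod m) * min (w (od i mod m)) (price x v))"
    "(\<Sum>i = st v..<en v. kept x i) \<le> 1"
    by (rule tr[OF less_imp_le[OF x0'] w0 w_mono[of v] a_def kept p st_le]; assumption)+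
  have e: "(\<Sum>i = st v..<en v. F (y (od i)) i) = (\<Sum>i = st v..<en v. F (kept x i) i)" for F :: "real \<Rightarrow> nat \<Rightarrow> real"
    using y sv by (intro sum.cong) auto
  show "price x v + (\<Sum>g\<in>halves v. w (g mod m) * (x (g mod m) - y g))
        \<le> (\<Sum>g\<in>halves v. x (g mod m) * min (w (g mod m)) (price x v))"
    unfolding sum_halves_od using T(1) e[of "\<lambda>z i. w (od i mod m) * (x (od i mod m) - z)"] by simp
  show "(\<Sum>g\<in>halves v. y g) \<le> 1"
    unfolding sum_halves_od using T(2) e[of "\<lambda>z i. z"] by simp
qed

lemma kept_bounds:
  assumes "\<And>e. e < m \<Longrightarrow> 0 < x e" "i < 2 * m"
  shows "0 \<le> kept x i" "kept x i \<le> x (od i mod m)"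
proof -
  have "0 < x (od i mod m)" using assms m_pos by simp
  then show "0 \<le> kept x i" "kept x i \<le> x (od i mod m)" by (auto simp: kept_def)
qed

lemma price_nonneg: "0 \<le> price x v"
  using w_pos[of "_ mod m"] m_pos by (auto simp: price_def intro: less_imp_le)

text \<open>The increment \<open>z\<close> is the smaller of the amounts kept at the two ends, so
  its load is at most the amount kept at the vertex. The inequality holds for all \<open>M\<close>
  at once: the matching is a parameter of the analysis and not of the program.\<close>

lemma wp_mwu_step:
  assumes s: "base s" and st: "static \<mu>" and x0: "\<And>e. e < m \<Longrightarrow> 0 < x e"
    and x: "\<And>e. e < m \<Longrightarrow> rmem \<mu> 4 e = x e" and Z: "\<And>e. e < m \<Longrightarrow> rmem \<mu> 5 e = Z e"
  shows "wp b UNIV UNIV (mwu_step q) (\<lambda>s' \<mu>' W D. base s' \<and> static \<mu>' \<and>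
     (\<exists>x' z. (\<forall>e<m. rmem \<mu>' 4 e = x' e \<and> 0 < x' e \<and> rmem \<mu>' 5 e = Z e + z e \<and> 0 \<le> z e) \<and>
        (\<forall>v. load z v \<le> 1) \<and>
        (\<forall>M. matching_idx M \<longrightarrow> (1 - 2 / q) * sum w M \<le>
           real q * (potential m w M x' - potential m w M x) + (\<Sum>e<m. w e * z e))) \<and>
     W \<le> 160 * P \<and> D \<le> 160 * (h + 1)) s \<mu>"
  unfolding mwu_step_def wp_Seq
proof (rule wp_mono[OF wp_mwu_leaves[OF s st x]], goal_cases)
  case (2 s1 \<mu>1 W1 D1)
  note sm1 = sameD[OF 2(2)[unfolded mwu_leaves_def]]
  have b1: "base s1" using 2(1) s by simp
  have st1: "static \<mu>1" by (rule static_cong[OF st]) (rule sm1; simp)+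
  have P1: "ireg s1 3 = 2 ^ h" using baseD(4)[OF b1] unfolding P_eq by simp
  have N1: "4 * 2 ^ h \<le> N" using N_P by (simp add: P_eq)
  note 1 = 2
  show ?case
  proof (rule wp_mono[OF wp_rscan[OF P1 N1]], goal_cases)
    case (1 s2 \<mu>2 W2 D2)
    note A = 1(1)[folded P_eq]
    note sm2 = sameD[OF 1(2)[unfolded rscan_def up_sweep_def down_sweep_def]]
    have b2: "base s2" using base_rscan[OF 1(2) b1] .
    have st2: "static \<mu>2" by (rule static_cong[OF st1]) (rule sm2; simp)+
    have 7: "rmem \<mu>2 7 = rmem \<mu>1 7" "rmem \<mu>2 4 = rmem \<mu>1 4" "rmem \<mu>2 5 = rmem \<mu>1 5" by (rule sm2; simp)+
    have 45: "rmem \<mu>1 4 = rmem \<mu> 4" "rmem \<mu>1 5 = rmem \<mu> 5" by (rule sm1; simp)+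
    have pr: "rmem \<mu>2 3 (P + i) = pre x i" if "i \<le> 2 * m" for i
    proof -
      have "rmem \<mu>2 3 (P + i) = (\<Sum>t<i. rmem \<mu>1 2 (P + t))" using A that P_gt by simp
      also have "\<dots> = pre x i" unfolding pre_def using 2(1) that by (intro sum.cong) auto
      finally show ?thesis .
    qed
    have lf: "rmem \<mu>2 2 (P + i) = x (od i mod m)" if "i < 2 * m" for i
      using A 2(1) that P_gt by simp
    have z7: "rmem \<mu>2 7 (vt g) = 0" if "g < 2 * m" for g using 2(1) that 7 by simp
    show ?case
    proof (rule wp_mono[OF wp_mwu_truncate[OF b2 st2 x0 lf pr z7]], goal_cases)
      case (5 s3 \<mu>3 W3 D3)
      note sm3 = sameD[OF 5(2)[unfolded mwu_truncate_def]]
      have b3: "base s3" using 5(1) b2 by simp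
      have st3: "static \<mu>3" by (rule static_cong[OF st2]) (rule sm3; simp)+
      have 453: "rmem \<mu>3 4 = rmem \<mu>2 4" "rmem \<mu>3 5 = rmem \<mu>2 5" by (rule sm3; simp)+
      have x3: "rmem \<mu>3 4 e = x e" if "e < m" for e using x[OF that] 453 7 45 by simp
      have Z3: "rmem \<mu>3 5 e = Z e" if "e < m" for e using Z[OF that] 453 7 45 by simp
      define y where "y = rmem \<mu>3 6"
      have y: "y (od i) = kept x i" if "i < 2 * m" for i using 5(1) that by (simp add: y_def)
      have y0: "0 \<le> y g" "y g \<le> x (g mod m)" if g: "g < 2 * m" for g
      proof -
        obtain i where i: "i < 2 * m" "od i = g" using od_surj[OF g] by blast
        show "0 \<le> y g" "y g \<le> x (g mod m)" using y[OF i(1)] kept_bounds[where x = x and i = i] x0 i by auto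
      qed
      have p3: "rmem \<mu>3 7 (vt g) = price x (vt g)" if "g < 2 * m" for g using 5(1) that by simp
      show ?case
      proof (rule wp_mono[OF wp_mwu_update[OF b3 st3 x3 Z3 _ p3, of y]], goal_cases)
        case (5 s4 \<mu>4 W4 D4)
        note sm4 = sameD[OF 5(2)[unfolded mwu_update_def]]
        have b4: "base s4" using 5(1) b3 by simp
        have st4: "static \<mu>4" by (rule static_cong[OF st3]) (rule sm4; simp)+
        define x' where "x' = (\<lambda>e. x e * (1 + reduced w (price x) e / real q))"
        define z where "z e = min (y e) (y (m + e))" for e
        have stp: "(1 - 2 / real q) * sum w M \<le> real q * (potential m w M x' - potential m w M x) + (\<Sum>e<m. w e * z e)"
          and x'0: "\<And>e. e < m \<Longrightarrow> 0 < x' e" if "matching_idx M" for M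
          using potential_step[where x = x and y = y and p = "price x", OF q that w_pos x0 y0(2) price_nonneg
              truncated_vertex(1)[where x = x and y = y, OF x0 y]]
          unfolding x'_def z_def by blast+
        \<comment> \<open>Positivity of the new amounts does not involve \<open>M\<close>; the empty
          matching serves to extract it.\<close>
        have "matching_idx {}" by (simp add: matching_idx_def)
        note x'0 = x'0[OF this]
        have ld: "load z v \<le> 1" for v
        proof -
          have "load z v \<le> (\<Sum>g\<in>halves v. y g)"
            unfolding load_def
          proof (rule sum_mono)
            fix g assume "g \<in> halves v"
            then have "g < 2 * m" by (simp add: halves_def)
            then have "g = g mod m \<or> g = m + g mod m" by (cases "g < m") (auto simp: le_mod_geq)
            then show "z (g mod m) \<le> y g" unfolding z_def by (metis min.cobounded1 min.cobounded2)
          qed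
          also have "\<dots> \<le> 1" using truncated_vertex(2)[where x = x and y = y, OF x0 y] by blast
          finally show ?thesis .
        qed
        have z0: "0 \<le> z e" if "e < m" for e using y0(1)[of e] y0(1)[of "m + e"] that by (simp add: z_def)
        have c: "\<forall>e<m. rmem \<mu>4 4 e = x' e \<and> 0 < x' e \<and> rmem \<mu>4 5 e = Z e + z e \<and> 0 \<le> z e"
          using 5(1) x'0 z0 by (simp add: x'_def z_def)
        have W: "W1 + (W2 + (W3 + W4)) \<le> 160 * P" and D: "D1 + (D2 + (D3 + D4)) \<le> 160 * (h + 1)"
          using 2(1) A \<open>s3 = s2 \<and> _\<close> 5(1) by simp_all
        show ?case
          using b4 st4 c ld stp W D by (intro conjI exI[of _ x'] exI[of _ z]) auto
      qed (use y_def in simp_all)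
    qed simp_all
  qed
qed simp_all

lemma wp_mwu_init:
  assumes s: "base s"
  shows "wp b UNIV UNIV (mwu_init q) (\<lambda>s' \<mu>' W D. s' = s \<and> (\<forall>e<m. rmem \<mu>' 4 e = 1 / m) \<and>
     W \<le> 10 * P \<and> D \<le> 10) s \<mu>"
  unfolding mwu_init_def
  using bounds(1,4,7,8) P_gt
  by (intro wp_ParFor[where k = m and V = "\<lambda>i. {RCell 4 i}" and w = 5 and
        \<nu> = "\<mu>\<lparr>rmem := (rmem \<mu>)(4 := \<lambda>j. if j < m then 1 / m else rmem \<mu> 4 j)\<rparr>"])
     (simp_all add: baseD[OF s] wp_simps agree_def, auto intro!: fitsI0)

lemma load_add: "load (\<lambda>e. f e + g e) v = load f v + load g v"
  by (simp add: load_def sum.distrib)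

definition T :: nat where "T = q * q * h"

text \<open>Adding up the inequalities of the rounds telescopes the potential, and
  \<open>potential_final\<close> disposes of what remains. The accumulated \<open>Z\<close> is
  \<open>T\<close> times the average of the rounds.\<close>

lemma wp_mwu:
  assumes s: "base s" and st: "static \<mu>" and Z0: "\<And>e. e < m \<Longrightarrow> rmem \<mu> 5 e = 0"
  shows "wp b UNIV UNIV (mwu q) (\<lambda>s' \<mu>' W D. base s' \<and> static \<mu>' \<and> ireg s' 9 = int T \<and>
     (\<exists>Z. (\<forall>e<m. rmem \<mu>' 5 e = Z e \<and> 0 \<le> Z e) \<and> (\<forall>v. load Z v \<le> real T) \<and>
        (\<forall>M. matching_idx M \<longrightarrow> (\<forall>e<m. w e \<le> sum w M) \<longrightarrow>
           real T * ((1 - 3 / q) * sum w M) \<le> (\<Sum>e<m. w e * Z e))) \<and>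
     W \<le> 200 * P * (T + 1) \<and> D \<le> 200 * (h + 1) * (T + 1)) s \<mu>"
proof -
  have TN: "16 * int T \<le> N" using N_q4 by (simp add: T_def)
  then have TN1: "int T \<le> N" by linarith
  have qq: "int q * int q \<le> int T"
  proof -
    have "q * q * 1 \<le> q * q * h" using h_pos by (intro mult_left_mono) auto
    then show ?thesis unfolding T_def by (simp flip: of_nat_mult)
  qed
  define K where "K = (\<lambda>t x Z (s::regs) (\<mu>::mem) W (D::nat). t \<le> T \<and> base s \<and> static \<mu> \<and> ireg s 9 = int T \<and>
     ireg s 8 = int T - int t \<and>
     (\<forall>e<m. rmem \<mu> 4 e = x e \<and> 0 < x e \<and> rmem \<mu> 5 e = Z e \<and> 0 \<le> Z e) \<and>
     (\<forall>v. load Z v \<le> real t) \<and>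
     (\<forall>M. matching_idx M \<longrightarrow> real t * ((1 - 2 / q) * sum w M) \<le>
        real q * (potential m w M x - potential m w M (\<lambda>e. 1 / m)) + (\<Sum>e<m. w e * Z e)) \<and>
     W \<le> 200 * P * t \<and> D \<le> 200 * (h + 1) * t)"
  define I where "I = (\<lambda>g (s::regs) (\<mu>::mem) W (D::nat). \<exists>t x Z. g = T - t \<and> K t x Z s \<mu> W D)"
  have loop: "wp b UNIV UNIV (While (ILess (Const 0) (IReg 8)) (mwu_step q ;; IAssign 8 (ISub (IReg 8) (Const 1))))
    (\<lambda>s' \<mu>' W D. base s' \<and> static \<mu>' \<and> ireg s' 9 = int T \<and>
     (\<exists>Z. (\<forall>e<m. rmem \<mu>' 5 e = Z e \<and> 0 \<le> Z e) \<and> (\<forall>v. load Z v \<le> real T) \<and>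
        (\<forall>M. matching_idx M \<longrightarrow> (\<forall>e<m. w e \<le> sum w M) \<longrightarrow>
           real T * ((1 - 3 / q) * sum w M) \<le> (\<Sum>e<m. w e * Z e))) \<and>
     W + 15 * P \<le> 200 * P * (T + 1) \<and> D + 30 \<le> 200 * (h + 1) * (T + 1)) s0 \<mu>0"
    if s0: "base s0" "ireg s0 9 = int T" "ireg s0 8 = int T" and \<mu>0: "static \<mu>0"
      "\<And>e. e < m \<Longrightarrow> rmem \<mu>0 4 e = 1 / m" "\<And>e. e < m \<Longrightarrow> rmem \<mu>0 5 e = 0" for s0 \<mu>0
  proof (rule wp_While[where I = I and ?g0.0 = T], goal_cases)
    case 1
    have "K 0 (\<lambda>e. 1 / m) (\<lambda>e. 0) s0 \<mu>0 0 0"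
      unfolding K_def using s0 \<mu>0 m_pos by (simp add: load_def)
    then show ?case unfolding I_def by (intro exI[of _ 0] exI[of _ "\<lambda>e. 1 / m"] exI[of _ "\<lambda>e. 0"]) simp
  next
    case (2 g s1 \<mu>1 W D)
    then obtain t x Z where gt: "g = T - t" and K: "K t x Z s1 \<mu>1 W D"
      unfolding I_def by blast
    then have t: "t \<le> T" "base s1" "static \<mu>1" "ireg s1 9 = int T" "ireg s1 8 = int T - int t"
      and x: "\<And>e. e < m \<Longrightarrow> rmem \<mu>1 4 e = x e" "\<And>e. e < m \<Longrightarrow> 0 < x e"
      and Z: "\<And>e. e < m \<Longrightarrow> rmem \<mu>1 5 e = Z e" "\<And>e. e < m \<Longrightarrow> 0 \<le> Z e"
      and ld: "\<And>v. load Z v \<le> real t"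
      and pot: "\<And>M. matching_idx M \<Longrightarrow> real t * ((1 - 2 / q) * sum w M) \<le>
        real q * (potential m w M x - potential m w M (\<lambda>e. 1 / m)) + (\<Sum>e<m. w e * Z e)"
      and WD: "W \<le> 200 * P * t" "D \<le> 200 * (h + 1) * t"
      unfolding K_def by simp_all
    show ?case
    proof (cases "t = T")
      case True
      have "real T * ((1 - 3 / q) * sum w M) \<le> (\<Sum>e<m. w e * Z e)"
        if M: "matching_idx M" "\<forall>e<m. w e \<le> sum w M" for M
      proof -
        have m2: "m \<le> 2 ^ h" using P_gt P_eq by simp
        show ?thesis
          unfolding T_def
          by (rule potential_final[OF q m2 h_pos M(1) w_pos _ x(2)])
             (use M pot[OF M(1)] True in \<open>simp_all add: T_def\<close>)
      qed
      moreover have "W + (15 * P + 2) \<le> 200 * P * (T + 1)" "D + 32 \<le> 200 * (h + 1) * (T + 1)"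
        by (rule loop_cost(2)[OF WD(1) _ t(1)], use P_gt in simp) (rule loop_cost(2)[OF WD(2) _ t(1)], simp)
      ultimately show ?thesis
        using t Z ld True bounds(1) by (auto simp: fitsI0)
    next
      case False
      have tN: "int T - int t \<le> N" "0 \<le> int T - int t" "0 < int T - int t" using t(1) TN1 False by linarith+
      have "wp b UNIV UNIV (mwu_step q) (\<lambda>s2 \<mu>2 W2 D2. ireg s2 8 = int T - int t \<and>
          I (T - Suc t) (s2\<lparr>ireg := (ireg s2)(8 := int T - int t - 1)\<rparr>) \<mu>2 (W + (2 + (W2 + 2))) (D + (2 + (D2 + 2)))) s1 \<mu>1"
      proof (rule wp_mono[OF wp_mwu_step[OF t(2,3) x(2,1) Z(1)]], goal_cases)
        case (4 s2 \<mu>2 W2 D2)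
        from 4(1) obtain x' z where x': "\<And>e. e < m \<Longrightarrow> rmem \<mu>2 4 e = x' e" "\<And>e. e < m \<Longrightarrow> 0 < x' e"
          "\<And>e. e < m \<Longrightarrow> rmem \<mu>2 5 e = Z e + z e" "\<And>e. e < m \<Longrightarrow> 0 \<le> z e"
          and ldz: "\<And>v. load z v \<le> 1"
          and stp: "\<And>M. matching_idx M \<Longrightarrow> (1 - 2 / q) * sum w M \<le>
             real q * (potential m w M x' - potential m w M x) + (\<Sum>e<m. w e * z e)" by blast
        have b2: "base s2" "static \<mu>2" "W2 \<le> 160 * P" "D2 \<le> 160 * (h + 1)" using 4(1) by simp_all
        have sm: "ireg s2 8 = ireg s1 8" "ireg s2 9 = ireg s1 9"
          using sameD(1)[OF 4(2)] by (simp_all add: mwu_step_def mwu_leaves_def rscan_def up_sweep_def down_sweep_def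
              mwu_truncate_def mwu_update_def)
        have "W2 + 4 \<le> 200 * P" "D2 + 4 \<le> 200 * (h + 1)" using b2 P_gt by simp_all
        then have "W + (W2 + 4) \<le> 200 * P * Suc t" "D + (D2 + 4) \<le> 200 * (h + 1) * Suc t"
          using loop_cost(1)[OF WD(1)] loop_cost(1)[OF WD(2)] by blast+
        then have WD': "W + (2 + (W2 + 2)) \<le> 200 * P * Suc t" "D + (2 + (D2 + 2)) \<le> 200 * (h + 1) * Suc t"
          by linarith+
        have pot': "real (Suc t) * ((1 - 2 / q) * sum w M) \<le>
            real q * (potential m w M x' - potential m w M (\<lambda>e. 1 / m)) + (\<Sum>e<m. w e * (Z e + z e))"
          if "matching_idx M" for M
          using pot[OF that] stp[OF that] by (simp add: distrib_left distrib_right sum.distrib right_diff_distrib)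
        have "K (Suc t) x' (\<lambda>e. Z e + z e) (s2\<lparr>ireg := (ireg s2)(8 := int T - int t - 1)\<rparr>) \<mu>2
          (W + (2 + (W2 + 2))) (D + (2 + (D2 + 2)))"
          unfolding K_def
        proof (intro conjI allI impI, goal_cases)
          case 1 then show ?case using t(1) False by simp
        next
          case 2 then show ?case using b2 by (simp add: base_def)
        next
          case (10 v) then show ?case using ld[of v] ldz[of v] by (simp add: load_add)
        next
          case (11 M) then show ?case by (rule pot')
        qed (use b2 sm t x' Z(2) WD' in \<open>simp_all\<close>)
        then show ?case unfolding I_def using sm t(5) by auto
      qed simp_all
      moreover have "T - Suc t < g" using gt t(1) False by simp
      ultimately show ?thesis
        unfolding wp_Seq wp_IAssign
        using t tN bounds(1) by (auto simp: fitsI0 elim!: wp_mono intro!: exI[of _ "T - Suc t"] fitsI)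
    qed
  qed
  show ?thesis
    unfolding mwu_def wp_Seq wp_IAssign
  proof (rule wp_mono[OF wp_mwu_init[OF s]], goal_cases)
    case (1 s1 \<mu>1 W1 D1)
    note sm1 = sameD[OF 1(2)[unfolded mwu_init_def]]
    have s1: "s1 = s" using 1(1) by simp
    have st1: "static \<mu>1" by (rule static_cong[OF st]) (rule sm1; simp)+
    have 5: "rmem \<mu>1 5 = rmem \<mu> 5" by (rule sm1; simp)
    let ?s = "s\<lparr>ireg := (ireg s)(9 := int T, 8 := int T)\<rparr>"
    have b: "base ?s" using s by (simp add: base_def)
    have T': "int q * int q * int h = int T" by (simp add: T_def)
    have W1: "W1 \<le> 10 * P" "D1 \<le> 10" using 1(1) by simp_all
    show ?case
      using bounds(3,10) qq TN1 s1
      by (simp add: baseD[OF s] fitsI0 T' order_trans[OF qq TN1],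
          intro wp_mono[OF loop[OF b _ _ st1]]) (use 1(1) 5 Z0 W1 P_gt in \<open>auto simp: s1\<close>)
  qed
qed

end

section \<open>From the fractional matching to an integral vector of bounded load\<close>

definition cap :: "nat \<Rightarrow> cmd" where
  "cap q = IAssign 5 (Const 1) ;;
     While (ILess (IReg 5) (IMul (Const q) (IReg 2))) (IAssign 5 (IMul (Const 2) (IReg 5)))"

definition scale_loop :: "nat \<Rightarrow> cmd" where
  "scale_loop q = IAssign 26 (Const 1) ;;
     While (ILess (IReg 26) (IMul (Const q) (IReg 24))) (IAssign 26 (IMul (Const 2) (IReg 26)))"

text \<open>Computes the integer part of a real by deciding its binary digits from the top, as reals
  can only be compared.\<close>

definition digit_loop :: cmd where
  "digit_loop = While (ILess (Const 0) (IReg 28))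
     (Cond (RLess (RReg 20) (OfInt (IAdd (IReg 27) (IReg 28)))) Skip (IAssign 27 (IAdd (IReg 27) (IReg 28))) ;;
      IAssign 28 (IDiv (IReg 28) (Const 2)))"

text \<open>With \<open>2 ^ a\<close> in register 26, the stored value is the integer part of the
  average amount times \<open>(1 - 1 / q) * 2 ^ a\<close>, plus 1, and then brought to the common
  scale \<open>2 ^ J\<close>. Adding 1 rounds up, so that no weight is lost beyond the factor
  \<open>1 - 1 / q\<close>.\<close>

definition scale_digits :: "nat \<Rightarrow> cmd" where
  "scale_digits q = scale_loop q ;;
      RLoad 20 5 (IReg 20) ;;
      RAssign 20 (RMul (RDiv (RMul (RReg 20) (OfInt (Const (int q - 1)))) (RMul (OfInt (IReg 9)) (OfInt (Const q))))
        (OfInt (IReg 26))) ;;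
      IAssign 27 (Const 0) ;; IAssign 28 (IReg 26) ;; digit_loop ;;
      IStore 3 (IReg 20) (IMul (IAdd (IReg 27) (Const 1)) (IDiv (IReg 5) (IReg 26)))"

definition discretize :: "nat \<Rightarrow> cmd" where
  "discretize q = ParFor 20 (IReg 1)
     (ILoad 21 1 (IReg 20) ;; ILoad 22 12 (IReg 21) ;; ILoad 23 13 (IReg 21) ;; IAssign 24 (ISub (IReg 23) (IReg 22)) ;;
      ILoad 21 2 (IReg 20) ;; ILoad 22 12 (IReg 21) ;; ILoad 23 13 (IReg 21) ;; IAssign 25 (ISub (IReg 23) (IReg 22)) ;;
      Cond (ILess (IReg 24) (IReg 25)) (IAssign 24 (IReg 25)) Skip ;;
      scale_digits q)"

context run
begin

text \<open>The number of halvings. As no degree exceeds \<open>2 * m\<close>, the common scale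
  \<open>2 ^ J\<close> is a multiple of the scale \<open>2 ^ sc e\<close> of every edge.\<close>

definition J :: nat where "J = (LEAST j. q * (2 * m) \<le> 2 ^ j)"

lemma J: "q * (2 * m) \<le> 2 ^ J"
  unfolding J_def by (rule LeastI[of _ "q * (2 * m)"]) simp

lemma J_less: "j < J \<Longrightarrow> 2 ^ j < q * (2 * m)"
  using not_less_Least[of j] unfolding J_def by fastforce

lemma J_bound: "2 ^ J \<le> 2 * (q * (2 * m))" "2 ^ J \<le> 2 * q * P" "J \<le> q + h"
proof -
  show 1: "2 ^ J \<le> 2 * (q * (2 * m))"
  proof (cases J)
    case 0
    then show ?thesis using q m_pos by simp
  next
    case (Suc j)
    have "2 * 2 ^ j \<le> 2 * (q * (2 * m))" using J_less[of j] Suc by (intro mult_left_mono less_imp_le) auto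
    then show ?thesis using Suc by simp
  qed
  have "q * (2 * m) < q * P" using P_gt q by simp
  with 1 show "2 ^ J \<le> 2 * q * P" by linarith
  have "J < Suc (q + h)"
  proof (rule ccontr)
    assume "\<not> J < Suc (q + h)"
    then have "(2::nat) ^ (Suc (q + h)) \<le> 2 ^ J" by (intro power_increasing) auto
    also have "\<dots> \<le> 2 * (q * (2 * m))" by (rule 1)
    also have "q * (2 * m) < 2 ^ q * 2 ^ h" using P_gt q by (intro mult_strict_mono) (auto simp: P_eq)
    then have "2 * (q * (2 * m)) < 2 * (2 ^ q * 2 ^ h)" by (rule mult_strict_left_mono) simp
    finally show False by (simp add: power_add)
  qed
  then show "J \<le> q + h" by simp
qed

lemma JN: "4 * int (2 ^ J) \<le> N" "int q * (2 * int m) \<le> N" "int (2 ^ J) \<le> N" "2 * int (2 ^ J) \<le> N"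
proof -
  have "int (2 ^ J) \<le> int (2 * q * P)" using J_bound(2) by (simp only: of_nat_le_iff)
  then have "4 * int (2 ^ J) \<le> 8 * int q * int P * 1" by (simp add: mult_ac)
  also have "\<dots> \<le> 8 * int q * int P * int q" using q by (intro mult_left_mono) auto
  also have "\<dots> \<le> N" using N_q by (simp add: mult_ac)
  finally show 1: "4 * int (2 ^ J) \<le> N" .
  have "0 \<le> int (2 ^ J)" by simp
  with 1 show 2: "int (2 ^ J) \<le> N" "2 * int (2 ^ J) \<le> N" by linarith+
  have "int (q * (2 * m)) \<le> int (2 ^ J)" using J by (simp only: of_nat_le_iff)
  then show "int q * (2 * int m) \<le> N" using 2 by simp
qed

text \<open>Shared by \<open>cap\<close> and \<open>scale_loop\<close>. The exponent
  \<open>L\<close> is the least one that suffices, and the register never exceeds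
  \<open>2 ^ L\<close>, which is why it fits.\<close>

lemma wp_double:
  assumes bnd: "int q * int y \<le> N" "int y \<le> N" and L: "q * y \<le> 2 ^ L" "\<And>j. j < L \<Longrightarrow> 2 ^ j < q * y"
    and LN: "int (2 ^ L) \<le> N" and r: "r \<noteq> r'" "ireg s r = 1" "ireg s r' = int y"
  shows "wp b RS WS (While (ILess (IReg r) (IMul (Const q) (IReg r'))) (IAssign r (IMul (Const 2) (IReg r))))
     (\<lambda>s' \<mu>' W D. s' = s\<lparr>ireg := (ireg s)(r := int (2 ^ L))\<rparr> \<and> \<mu>' = \<mu> \<and> W \<le> 5 * L + 3 \<and> D \<le> 5 * L + 3) s \<mu>"
proof -
  define I where "I = (\<lambda>g (s'::regs) (\<mu>'::mem) W D. \<exists>j\<le>L. g = L - j \<and> s' = s\<lparr>ireg := (ireg s)(r := int (2 ^ j))\<rparr> \<and>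
     \<mu>' = \<mu> \<and> W \<le> 5 * j \<and> D \<le> 5 * j)"
  show ?thesis
  proof (rule wp_While[where I = I and ?g0.0 = L], goal_cases)
    case 1
    show ?case unfolding I_def using r by (intro exI[of _ 0]) (auto simp: fun_upd_idem)
  next
    case (2 g s' \<mu>' W D)
    then obtain j where j: "j \<le> L" "g = L - j" "s' = s\<lparr>ireg := (ireg s)(r := int (2 ^ j))\<rparr>" "\<mu>' = \<mu>"
      "W \<le> 5 * j" "D \<le> 5 * j" unfolding I_def by blast
    have jN: "int (2 ^ j) \<le> N"
    proof -
      have "(2::nat) ^ j \<le> 2 ^ L" using j(1) by (intro power_increasing) auto
      then have "int (2 ^ j) \<le> int (2 ^ L)" by (simp only: of_nat_le_iff)
      then show ?thesis using LN by linarith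
    qed
    have b1: "int q \<le> N" "2 \<le> N" using bounds by simp_all
    show ?case
    proof (cases "j = L")
      case True
      have "\<not> int (2 ^ L) < int (q * y)" using L(1) by (simp only: of_nat_less_iff not_less)
      then show ?thesis
        using j True r bnd jN b1 by (auto simp: fitsI0 simp del: of_nat_power)
    next
      case False
      then have "int (2 ^ j) < int (q * y)" using L(2)[of j] j(1) by (simp only: of_nat_less_iff)
      moreover have "2 * int (2 ^ j) \<le> N"
      proof -
        have "(2::nat) ^ Suc j \<le> 2 ^ L" using j(1) False by (intro power_increasing) auto
        then have "int (2 ^ Suc j) \<le> int (2 ^ L)" by (simp only: of_nat_le_iff)
        then show ?thesis using LN by simp
      qed
      moreover have "I (L - Suc j) (s\<lparr>ireg := (ireg s)(r := 2 * int (2 ^ j))\<rparr>) \<mu> (W + 5) (D + 5)"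
        unfolding I_def using j False by (intro exI[of _ "Suc j"]) auto
      moreover have "L - Suc j < g" using j False by simp
      ultimately show ?thesis
        using j r bnd jN b1
        by (auto simp: wp_simps fitsI0 eval_nat_numeral simp del: of_nat_power intro!: exI[of _ "L - Suc j"])
    qed
  qed
qed

lemma wp_cap:
  assumes s: "base s"
  shows "wp b UNIV UNIV (cap q) (\<lambda>s' \<mu>' W D. base s' \<and> ireg s' 5 = int (2 ^ J) \<and> ireg s' 9 = ireg s 9 \<and> \<mu>' = \<mu> \<and>
     W \<le> 5 * J + 5 \<and> D \<le> 5 * J + 5) s \<mu>"
proof -
  let ?s = "s\<lparr>ireg := (ireg s)(5 := 1)\<rparr>"
  have "wp b UNIV UNIV (While (ILess (IReg 5) (IMul (Const q) (IReg 2))) (IAssign 5 (IMul (Const 2) (IReg 5))))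
     (\<lambda>s' \<mu>' W D. s' = ?s\<lparr>ireg := (ireg ?s)(5 := int (2 ^ J))\<rparr> \<and> \<mu>' = \<mu> \<and> W \<le> 5 * J + 3 \<and> D \<le> 5 * J + 3) ?s \<mu>"
    using J J_less JN bounds(5) by (intro wp_double[where y = "2 * m"]) (auto simp: baseD[OF s] simp del: of_nat_power)
  then show ?thesis
    unfolding cap_def wp_Seq wp_IAssign using bounds(1) s
    by (auto simp: fitsI0 base_def simp del: of_nat_power elim!: wp_mono)
qed

text \<open>With \<open>2 ^ i\<close> the next digit to try, the partial value \<open>y\<close>
  satisfies \<open>y \<le> R\<close> and \<open>R < y + 2 * 2 ^ i\<close>. Starting at
  \<open>2 ^ a\<close> costs one idle step, since \<open>R < 2 ^ a\<close>; the loop ends when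
  halving the digit 1 gives 0.\<close>

lemma wp_digits:
  assumes R: "rreg s 20 = R" "0 \<le> R" "R < 2 ^ a" and r: "ireg s 27 = 0" "ireg s 28 = int (2 ^ a)"
    and aN: "2 * int (2 ^ a) \<le> N"
  shows "wp b RS WS digit_loop (\<lambda>s' \<mu>' W D. \<mu>' = \<mu> \<and> (\<forall>x<27. ireg s' x = ireg s x) \<and>
     (\<exists>y::nat. ireg s' 27 = int y \<and> real y \<le> R \<and> R < real y + 1) \<and> W \<le> 15 * a + 20) s \<mu>"
proof -
  define I where "I = (\<lambda>g (s'::regs) (\<mu>'::mem) W (D::nat). \<exists>y. \<mu>' = \<mu> \<and> (\<forall>x<27. ireg s' x = ireg s x) \<and> rreg s' 20 = R \<and>
     ireg s' 27 = int y \<and> real y \<le> R \<and> g \<le> a + 1 \<and>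
     (g = 0 \<longrightarrow> ireg s' 28 = 0 \<and> R < real y + 1) \<and>
     (\<forall>i. g = Suc i \<longrightarrow> ireg s' 28 = int (2 ^ i) \<and> R < real y + 2 * 2 ^ i) \<and> W + 15 * g \<le> 15 * a + 15)"
  show ?thesis
    unfolding digit_loop_def
  proof (rule wp_While[where I = I and ?g0.0 = "a + 1"], goal_cases)
    case 1
    show ?case unfolding I_def using R r by (intro exI[of _ 0]) auto
  next
    case (2 g s' \<mu>' W D)
    then obtain y where y: "\<mu>' = \<mu>" "\<forall>x<27. ireg s' x = ireg s x" "rreg s' 20 = R"
     "ireg s' 27 = int y" "real y \<le> R" "g \<le> a + 1"
     "g = 0 \<Longrightarrow> ireg s' 28 = 0 \<and> R < real y + 1"
     "\<And>i. g = Suc i \<Longrightarrow> ireg s' 28 = int (2 ^ i) \<and> R < real y + 2 * 2 ^ i" "W + 15 * g \<le> 15 * a + 15"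
      unfolding I_def by blast
    have "real y < 2 ^ a" using y(5) R(3) by linarith
    then have ya: "y < 2 ^ a" by simp
    then have "int y < int (2 ^ a)" by (simp only: of_nat_less_iff)
    then have yN: "int y \<le> N" using aN by linarith
    have b1: "0 \<le> N" "2 \<le> N" using bounds by simp_all
    show ?case
    proof (cases g)
      case 0
      then show ?thesis using y b1 by (auto simp: fitsI0 intro!: exI[of _ y])
    next
      case (Suc i)
      then have i: "ireg s' 28 = int (2 ^ i)" "R < real y + 2 * 2 ^ i" "i \<le> a" using y by auto
      have "(2::nat) ^ i \<le> 2 ^ a" using i(3) by (intro power_increasing) auto
      then have "int (2 ^ i) \<le> int (2 ^ a)" by (simp only: of_nat_le_iff)
      then have iN: "int (2 ^ i) \<le> N" "int y + int (2 ^ i) \<le> N" "int (2 ^ i) div 2 \<le> N" "0 \<le> int (2 ^ i) div 2"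
        using aN \<open>int y < int (2 ^ a)\<close> by linarith+
      have i0: "0 < int (2 ^ i)" by simp
      define y' where "y' = (if R < real y + 2 ^ i then y else y + 2 ^ i)"
      have y': "real y' \<le> R" "R < real y' + 2 ^ i"
        using y(5) i(2) by (auto simp: y'_def)
      have I': "I i s2 \<mu> W2 D2" if "\<forall>x<27. ireg s2 x = ireg s x" "rreg s2 20 = R" "ireg s2 27 = int y'"
        "ireg s2 28 = int (2 ^ i) div 2" "W2 \<le> W + 15" for s2 W2 D2
        unfolding I_def using that y' i(3) y(9) Suc
        by (intro exI[of _ y']) (cases i; auto)
      have eqc: "R < real_of_int (int y + int (2 ^ i)) \<longleftrightarrow> R < real y + 2 ^ i" by simp
      show ?thesis
        using i y iN yN i0 b1 I' Suc
        by (auto simp: wp_simps fitsI0 eqc y'_def simp del: of_nat_power of_int_add intro!: exI[of _ i])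
    qed
  qed
qed

end

context sorted_run
begin

lemma deg_eq: "deg v = en v - st v"
  by (simp add: deg_def card_halves)

lemma deg_le: "deg v \<le> 2 * m"
  using en_le[of v] by (simp add: deg_eq)

definition mdeg :: "nat \<Rightarrow> nat" where "mdeg e = max (deg (vt e)) (deg (vt (m + e)))"

text \<open>
  The value of \<open>e\<close> will be a multiple of \<open>2 ^ (J - sc e)\<close>. Hence it cannot become odd before the load has
  been reduced to \<open>2 ^ sc e\<close>, which is at most \<open>2 * q\<close> times the degree of one of its ends.
\<close>

definition sc :: "nat \<Rightarrow> nat" where "sc e = (LEAST a. q * mdeg e \<le> 2 ^ a)"

lemma sc: "q * mdeg e \<le> 2 ^ sc e" "sc e \<le> J" "j < sc e \<Longrightarrow> 2 ^ j < q * mdeg e"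
proof -
  have "q * mdeg e \<le> q * (2 * m)" using deg_le by (intro mult_left_mono) (auto simp: mdeg_def)
  then have 1: "q * mdeg e \<le> 2 ^ J" using J by linarith
  show "q * mdeg e \<le> 2 ^ sc e" unfolding sc_def using 1 by (rule LeastI)
  show "sc e \<le> J" unfolding sc_def using 1 by (rule Least_le)
  show "2 ^ j < q * mdeg e" if "j < sc e" using not_less_Least that unfolding sc_def by fastforce
qed

text \<open>By minimality \<open>2 ^ sc e\<close> is less than twice \<open>q * mdeg e\<close>; if
  \<open>sc e = 0\<close>, the bound holds because degrees of ends are positive.\<close>

lemma sc_witness:
  assumes "e < m" shows "\<exists>g<2 * m. g mod m = e \<and> 2 ^ sc e \<le> 2 * q * deg (vt g)"
proof -
  have "\<exists>g. (g = e \<or> g = m + e) \<and> mdeg e = deg (vt g)" unfolding mdeg_def max_def by auto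
  then obtain g where g: "g = e \<or> g = m + e" "mdeg e = deg (vt g)" by blast
  have g': "g < 2 * m" "g mod m = e" using g(1) assms by auto
  have "2 ^ sc e \<le> 2 * (q * mdeg e)"
  proof (cases "sc e")
    case 0
    have "0 < q * mdeg e" using q deg_pos[OF g'(1)] g(2) by simp
    then show ?thesis using 0 by simp
  next
    case (Suc j)
    have "2 * 2 ^ j \<le> 2 * (q * mdeg e)" using sc(3)[of j e] Suc by (intro mult_left_mono less_imp_le) auto
    then show ?thesis using Suc by simp
  qed
  then show ?thesis using g' g(2) by (intro exI[of _ g]) (simp add: mult.assoc)
qed

text \<open>Rounding up yields the lower bound on \<open>X\<close>, and \<open>load_initial\<close>
  shows that the loads stay within \<open>2 ^ J\<close> nevertheless. The divisibility is what later
  limits the number of odd edges.\<close>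

lemma wp_discretize:
  assumes s: "base s" and st: "static \<mu>" and r: "ireg s 5 = int (2 ^ J)" "ireg s 9 = int T"
    and Z: "\<And>e. e < m \<Longrightarrow> rmem \<mu> 5 e = Z e" "\<And>e. e < m \<Longrightarrow> 0 \<le> Z e" "\<And>v. load Z v \<le> real T"
  shows "wp b UNIV UNIV (discretize q) (\<lambda>s' \<mu>' W D. s' = s \<and>
     (\<exists>X. (\<forall>e<m. imem \<mu>' 3 e = int (X e) \<and> 2 ^ (J - sc e) dvd X e \<and>
          2 ^ J * ((1 - 1 / q) * (Z e / T)) \<le> real (X e)) \<and>
        (\<forall>v. load X v \<le> 2 ^ J)) \<and>
     W \<le> (40 * J + 90) * P \<and> D \<le> 40 * J + 90) s \<mu>"
proof -
  have T0: "0 < T" using q h_pos by (simp add: T_def)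
  have "16 * int T \<le> N" using N_q4 by (simp add: T_def)
  then have TN: "int T \<le> N" by linarith
  define z where "z e = Z e / T" for e
  have z0: "0 \<le> z e" if "e < m" for e using Z(2)[OF that] by (simp add: z_def)
  have ldz: "load z v \<le> 1" for v
  proof -
    have "load z v = load Z v / T" by (simp add: load_def z_def sum_divide_distrib)
    also have "\<dots> \<le> 1" using Z(3)[of v] T0 by simp
    finally show ?thesis .
  qed
  have z1: "z e \<le> 1" if e: "e < m" for e
  proof -
    have "z (e mod m) \<le> load z (vt e)"
      unfolding load_def using e m_pos z0 by (intro member_le_sum) (auto simp: halves_def)
    then show ?thesis using ldz[of "vt e"] e by simp
  qed
  have q1: "0 < 1 - 1 / real q" "1 - 1 / real q < 1" using q by (simp_all add: field_simps)
  define R where "R e = z e * (1 - 1 / q) * 2 ^ sc e" for e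
  have R0: "0 \<le> R e" if "e < m" for e using z0[OF that] q1 by (simp add: R_def)
  have R1: "R e < 2 ^ sc e" if "e < m" for e
  proof -
    have "z e * (1 - 1 / q) \<le> 1 * (1 - 1 / q)" using z1[OF that] q1 by (intro mult_right_mono) auto
    also have "\<dots> < 1" using q1 by simp
    finally show ?thesis by (simp add: R_def)
  qed
  have Req: "Z e * (real q - 1) / (real T * real q) * 2 ^ sc e = R e" for e
    using q T0 by (simp add: R_def z_def field_simps)
  define y where "y e = nat \<lfloor>R e\<rfloor>" for e
  have yR: "real (y e) \<le> R e" "R e < real (y e) + 1" if "e < m" for e
    using R0[OF that] by (simp_all add: y_def)
  have yu: "y' = y e" if "real y' \<le> R e" "R e < real y' + 1" "e < m" for y' e
    using that yR[OF that(3)] by linarith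
  define X where "X e = (y e + 1) * 2 ^ (J - sc e)" for e
  have ya: "y e + 1 \<le> 2 ^ sc e" if "e < m" for e
  proof -
    have "real (y e) < 2 ^ sc e" using yR(1)[OF that] R1[OF that] by linarith
    then have "y e < 2 ^ sc e" by simp
    then show ?thesis by simp
  qed
  have XJ: "X e \<le> 2 ^ J" if "e < m" for e
  proof -
    have "X e \<le> 2 ^ sc e * 2 ^ (J - sc e)" unfolding X_def using ya[OF that] by (intro mult_right_mono) auto
    also have "\<dots> = 2 ^ J" using sc(2)[of e] by (simp flip: power_add)
    finally show ?thesis .
  qed
  have dv: "int (2 ^ J) div int (2 ^ sc e) = int (2 ^ (J - sc e))" for e
    using sc(2)[of e] by (simp add: power_diff flip: zdiv_int of_nat_power)
  let ?\<nu> = "\<mu>\<lparr>imem := (imem \<mu>)(3 := \<lambda>j. if j < m then int (X j) else imem \<mu> 3 j)\<rparr>"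
  have "wp b UNIV UNIV (discretize q) (\<lambda>s' \<mu>' W D. s' = s \<and> \<mu>' = ?\<nu> \<and>
     W \<le> (40 * J + 90) * P \<and> D \<le> 40 * J + 90) s \<mu>"
    unfolding discretize_def
  proof (rule wp_ParFor[where k = m and V = "\<lambda>i. {ICell 3 i}" and w = "40 * J + 80" and \<nu> = ?\<nu>], goal_cases)
    case (4 i)
    let ?RS = "{c. \<forall>j<m. j \<noteq> i \<longrightarrow> c \<noteq> ICell 3 j}"
    have i: "i < 2 * m" "m + i < 2 * m" using 4 by simp_all
    have dg: "int (en (vt g)) - int (st (vt g)) = int (deg (vt g))" for g
      using st_le[of "vt g"] by (simp add: deg_eq of_nat_diff)
    have dgN: "int (deg v) \<le> N" for v using deg_le[of v] bounds(5) by linarith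
    have iN: "int i \<le> N" using 4 bounds(4) by linarith
    have pJ: "int (2 ^ sc i) \<le> int (2 ^ J)"
    proof -
      have "(2::nat) ^ sc i \<le> 2 ^ J" using sc(2)[of i] by (intro power_increasing) auto
      then show ?thesis by (simp only: of_nat_le_iff)
    qed
    have aN: "int (2 ^ sc i) \<le> N" "2 * int (2 ^ sc i) \<le> N" using pJ JN by linarith+
    have qdN: "int q * int (mdeg i) \<le> N"
    proof -
      have "int (q * mdeg i) \<le> int (2 ^ sc i)" using sc(1)[of i] by (simp only: of_nat_le_iff)
      then show ?thesis using aN by simp
    qed
    have mdN: "int (mdeg i) \<le> N" using dgN by (simp add: mdeg_def max_def)
    have mx: "(if int (deg (vt i)) < int (deg (vt (m + i))) then int (deg (vt (m + i))) else int (deg (vt i))) = int (mdeg i)"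
      by (simp add: mdeg_def)
    have store: "wp b ?RS {ICell 3 i} (IStore 3 (IReg 20) (IMul (IAdd (IReg 27) (Const 1)) (IDiv (IReg 5) (IReg 26))))
        (\<lambda>s' \<mu>' W D. W0 + W \<le> 40 * J + 80 \<and> agree {ICell 3 i} \<mu>' ?\<nu>) s1 \<mu>"
      if s1: "ireg s1 20 = int i" "ireg s1 27 = int (y i)" "ireg s1 5 = int (2 ^ J)" "ireg s1 26 = int (2 ^ sc i)"
        "W0 \<le> 40 * J + 70" for s1 W0
    proof -
      have "int (y i + 1) \<le> int (2 ^ sc i)" using ya[OF 4] by (simp only: of_nat_le_iff)
      then have a: "int (y i) \<le> N" "int (y i) + 1 \<le> N" using aN by simp_all
      have b: "int (2 ^ (J - sc i)) \<le> N"
      proof -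
        have "(2::nat) ^ (J - sc i) \<le> 2 ^ J" by (intro power_increasing) auto
        then have "int (2 ^ (J - sc i)) \<le> int (2 ^ J)" by (simp only: of_nat_le_iff)
        then show ?thesis using JN by linarith
      qed
      have c: "(int (y i) + 1) * int (2 ^ (J - sc i)) = int (X i)" by (simp add: X_def algebra_simps)
      have "int (X i) \<le> int (2 ^ J)" using XJ[OF 4] by (simp only: of_nat_le_iff)
      then have d: "int (X i) \<le> N" using JN by linarith
      show ?thesis
        unfolding wp_IStore using s1 4 iN a b d JN(3) aN(1) bounds(1)
        by (simp add: agree_def dv c fitsI0 del: of_nat_power)
    qed
    have rest: "wp b ?RS {ICell 3 i} (RLoad 20 5 (IReg 20) ;;
      RAssign 20 (RMul (RDiv (RMul (RReg 20) (OfInt (Const (int q - 1)))) (RMul (OfInt (IReg 9)) (OfInt (Const q))))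
        (OfInt (IReg 26))) ;;
      IAssign 27 (Const 0) ;; IAssign 28 (IReg 26) ;; digit_loop ;;
      IStore 3 (IReg 20) (IMul (IAdd (IReg 27) (Const 1)) (IDiv (IReg 5) (IReg 26))))
        (\<lambda>s' \<mu>' W D. W0 + W \<le> 40 * J + 80 \<and> agree {ICell 3 i} \<mu>' ?\<nu>) s1 \<mu>"
      if s1: "ireg s1 20 = int i" "ireg s1 5 = int (2 ^ J)" "ireg s1 9 = int T" "ireg s1 26 = int (2 ^ sc i)"
        "W0 \<le> 5 * J + 35" for s1 W0
    proof -
      have qN: "0 \<le> int q - 1" "int q - 1 \<le> N" "int q \<le> N" "0 \<le> N" using q bounds(1,3) by linarith+
      have rq: "real_of_int (int q - 1) = real q - 1" by simp
      have val: "Z i * (real q - 1) * real (2 ^ sc i) / (real T * real q) = R i" using Req[of i] by simp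
      show ?thesis
        unfolding wp_Seq wp_RLoad wp_RAssign wp_IAssign
        using s1 4 iN TN aN qN Z(1)[OF 4]
      proof (simp add: fitsI0 rq val del: of_nat_power, intro wp_mono[OF wp_digits[where R = "R i" and a = "sc i"]], goal_cases)
        case (7 s' \<mu>' W D)
        then obtain y' where y': "ireg s' 27 = int y'" "real y' \<le> R i" "R i < real y' + 1" by blast
        then have "y' = y i" using yu 4 by blast
        then show ?case
          using store[of s' "W0 + (12 + W)"] y' 7 sc(2)[of i] s1
          by (auto simp: add_ac simp del: of_nat_power elim!: wp_mono)
      qed (use R0[OF 4] R1[OF 4] in \<open>simp_all del: of_nat_power\<close>)
    qed
    have scl: "wp b ?RS {ICell 3 i} (scale_digits q)
        (\<lambda>s' \<mu>' W D. W0 + W \<le> 40 * J + 80 \<and> agree {ICell 3 i} \<mu>' ?\<nu>) s1 \<mu>"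
      if s1: "ireg s1 20 = int i" "ireg s1 5 = int (2 ^ J)" "ireg s1 9 = int T" "ireg s1 24 = int (mdeg i)"
        "W0 \<le> 30" for s1 W0
    proof -
      let ?s = "s1\<lparr>ireg := (ireg s1)(26 := 1)\<rparr>"
      have "wp b ?RS {ICell 3 i} (While (ILess (IReg 26) (IMul (Const q) (IReg 24))) (IAssign 26 (IMul (Const 2) (IReg 26))))
         (\<lambda>s' \<mu>' W D. s' = ?s\<lparr>ireg := (ireg ?s)(26 := int (2 ^ sc i))\<rparr> \<and> \<mu>' = \<mu> \<and> W \<le> 5 * sc i + 3 \<and> D \<le> 5 * sc i + 3) ?s \<mu>"
        using sc(1)[of i] sc(3)[of _ i] aN qdN mdN s1(4)
        by (intro wp_double[where y = "mdeg i"]) (auto simp del: of_nat_power)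
      then have dbl: "wp b ?RS {ICell 3 i} (While (ILess (IReg 26) (IMul (Const q) (IReg 24))) (IAssign 26 (IMul (Const 2) (IReg 26))))
         (\<lambda>s' \<mu>' W' D'. wp b ?RS {ICell 3 i} (RLoad 20 5 (IReg 20) ;;
      RAssign 20 (RMul (RDiv (RMul (RReg 20) (OfInt (Const (int q - 1)))) (RMul (OfInt (IReg 9)) (OfInt (Const q))))
        (OfInt (IReg 26))) ;;
      IAssign 27 (Const 0) ;; IAssign 28 (IReg 26) ;; digit_loop ;;
      IStore 3 (IReg 20) (IMul (IAdd (IReg 27) (Const 1)) (IDiv (IReg 5) (IReg 26))))
        (\<lambda>s'' \<mu>'' W D. W0 + (1 + W' + W) \<le> 40 * J + 80 \<and> agree {ICell 3 i} \<mu>'' ?\<nu>) s' \<mu>') ?s \<mu>"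
      proof (rule wp_mono)
        fix s' \<mu>' and W' D' :: nat
        assume A: "s' = ?s\<lparr>ireg := (ireg ?s)(26 := int (2 ^ sc i))\<rparr> \<and> \<mu>' = \<mu> \<and> W' \<le> 5 * sc i + 3 \<and> D' \<le> 5 * sc i + 3"
        then have "W0 + (1 + W') \<le> 5 * J + 35" using s1(5) sc(2)[of i] by linarith
        then show "wp b ?RS {ICell 3 i} (RLoad 20 5 (IReg 20) ;;
      RAssign 20 (RMul (RDiv (RMul (RReg 20) (OfInt (Const (int q - 1)))) (RMul (OfInt (IReg 9)) (OfInt (Const q))))
        (OfInt (IReg 26))) ;;
      IAssign 27 (Const 0) ;; IAssign 28 (IReg 26) ;; digit_loop ;;
      IStore 3 (IReg 20) (IMul (IAdd (IReg 27) (Const 1)) (IDiv (IReg 5) (IReg 26))))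
        (\<lambda>s'' \<mu>'' W D. W0 + (1 + W' + W) \<le> 40 * J + 80 \<and> agree {ICell 3 i} \<mu>'' ?\<nu>) s' \<mu>'"
          using rest[of s' "W0 + (1 + W')"] A s1 by (simp add: add.assoc del: of_nat_power)
      qed
      show ?thesis
        unfolding scale_digits_def wp_Seq scale_loop_def
        using dbl bounds(1) unfolding wp_Seq
        by (simp add: wp_IAssign fitsI0 add.assoc)
    qed
    have sizes': "int (deg v) \<le> N" "int (en v) - int (st v) = int (deg v)" for v
      using dgN[of v] st_le[of v] by (simp_all add: deg_eq of_nat_diff)
    note [simp] = baseD[OF s] staticD(1,2)[OF st 4] staticD(6,7)[OF st i(1)] staticD(6,7)[OF st i(2)]
      sizes(2)[OF i(1)] sizes(2)[OF i(2)] sizes(4,5) sizes' iN 4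
    have cases: "deg (vt i) < deg (vt (m + i)) \<Longrightarrow> mdeg i = deg (vt (m + i))"
      "\<not> deg (vt i) < deg (vt (m + i)) \<Longrightarrow> mdeg i = deg (vt i)"
      by (simp_all add: mdeg_def)
    show ?case
      using r
      by (cases "deg (vt i) < deg (vt (m + i))")
        (simp_all add: wp_Seq wp_ILoad wp_IAssign wp_Cond wp_Skip fitsI0 del: of_nat_power,
         (rule wp_mono[OF scl[of _ 25]]; simp add: cases del: of_nat_power)+)
  next
    case (6 W D)
    have "m * (40 * J + 81) \<le> P * (40 * J + 81)" using P_gt by (intro mult_right_mono) auto
    then have "1 + iops (IReg 1) + m * (1 + (40 * J + 80)) \<le> (40 * J + 90) * P"
      using P_gt by (simp add: algebra_simps)
    then show ?case using 6 by simp
  qed (use bounds(4) in \<open>auto simp: baseD[OF s] fitsI0 agree_def\<close>)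
  then show ?thesis
  proof (rule wp_mono)
    fix s' \<mu>' and W D :: nat
    assume A: "s' = s \<and> \<mu>' = ?\<nu> \<and> W \<le> (40 * J + 90) * P \<and> D \<le> 40 * J + 90"
    have ld: "load X v \<le> 2 ^ J" for v
    proof (rule load_initial[where q = q and z = z and y = y and a = sc])
      show "q * deg (vt g) \<le> 2 ^ sc (g mod m)" if g: "g < 2 * m" for g
      proof -
        have "g = g mod m \<or> g = m + g mod m" using g by (cases "g < m") (auto simp: le_mod_geq)
        then have "deg (vt g) \<le> mdeg (g mod m)" unfolding mdeg_def by (metis max.cobounded1 max.cobounded2)
        then have "q * deg (vt g) \<le> q * mdeg (g mod m)" by (rule mult_le_mono2)
        then show ?thesis using sc(1)[of "g mod m"] by linarith
      qed
    qed (use q z0 ldz yR sc in \<open>auto simp: X_def R_def\<close>)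
    have lb: "2 ^ J * ((1 - 1 / q) * (Z e / T)) \<le> real (X e)" if "e < m" for e
    proof -
      have "2 ^ J * ((1 - 1 / q) * (Z e / T)) = R e * 2 ^ (J - sc e)"
        using sc(2)[of e] by (simp add: R_def z_def mult_ac flip: power_add)
      also have "\<dots> \<le> (real (y e) + 1) * 2 ^ (J - sc e)" using yR(2)[OF that] by (intro mult_right_mono) auto
      also have "\<dots> = real (X e)" by (simp add: X_def algebra_simps)
      finally show ?thesis .
    qed
    show "s' = s \<and> (\<exists>X. (\<forall>e<m. imem \<mu>' 3 e = int (X e) \<and> 2 ^ (J - sc e) dvd X e \<and>
          2 ^ J * ((1 - 1 / q) * (Z e / T)) \<le> real (X e)) \<and>
        (\<forall>v. load X v \<le> 2 ^ J)) \<and> W \<le> (40 * J + 90) * P \<and> D \<le> 40 * J + 90"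
      using A ld lb by (intro conjI exI[of _ X]) (auto simp: X_def)
  qed
qed

end

section \<open>One halving on the machine\<close>

definition odd_bits :: cmd where
  "odd_bits = ParFor 20 (IReg 2) (ILoad 21 8 (IReg 20) ;; ILoad 22 3 (IMod (IReg 21) (IReg 1)) ;;
     IStore 4 (IAdd (IReg 3) (IReg 20)) (IMod (IReg 22) (Const 2)))"

text \<open>Half-edges of odd edges receive consecutive ranks: array 14 leads from a rank to its
  half-edge, array 15 back, and array 16 to the rank of its partner, found from the ranks at the
  bounds of the segment.\<close>

definition compact :: cmd where
  "compact = ParFor 20 (IReg 2) (ILoad 21 4 (IAdd (IReg 3) (IReg 20)) ;;
     Cond (IEq (IReg 21) (Const 1))
      (ILoad 21 8 (IReg 20) ;; ILoad 22 5 (IAdd (IReg 3) (IReg 20)) ;;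
       IStore 14 (IReg 22) (IReg 21) ;; IStore 15 (IReg 21) (IReg 22) ;;
       ILoad 23 10 (IReg 21) ;; ILoad 24 12 (IReg 23) ;; ILoad 24 5 (IAdd (IReg 3) (IReg 24)) ;;
       ILoad 25 13 (IReg 23) ;; ILoad 25 5 (IAdd (IReg 3) (IReg 25)) ;;
       Cond (IEq (IMod (ISub (IReg 22) (IReg 24)) (Const 2)) (Const 0))
         (Cond (ILess (IAdd (IReg 22) (Const 1)) (IReg 25))
           (IStore 16 (IReg 22) (IAdd (IReg 22) (Const 1))) (IStore 16 (IReg 22) (IReg 22)))
         (IStore 16 (IReg 22) (ISub (IReg 22) (Const 1))))
      Skip)"

text \<open>Register 21 becomes the rank of the other half and register 22 its partner. If they
  coincide, the path ends here and the node links to itself, with the smaller kind of key.\<close>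

definition links :: cmd where
  "links = ParFor 20 (IReg 6) (ILoad 21 14 (IReg 20) ;;
     ILoad 21 15 (IMod (IAdd (IReg 21) (IReg 1)) (IReg 2)) ;; ILoad 22 16 (IReg 21) ;;
     Cond (IEq (IReg 21) (IReg 22))
       (IStore 17 (IReg 20) (IReg 20) ;; IStore 18 (IReg 20) (IReg 20))
       (IStore 17 (IReg 20) (IReg 22) ;; IStore 18 (IReg 20) (IAdd (IReg 20) (IReg 6))))"

text \<open>Pointer doubling with minima. Strands read the links of other nodes, so the results go
  to the auxiliary arrays 19 and 20 and are copied by \<open>jump_back\<close> afterwards.\<close>

definition jump :: cmd where
  "jump = ParFor 20 (IReg 6) (ILoad 21 17 (IReg 20) ;; ILoad 22 17 (IReg 21) ;; IStore 19 (IReg 20) (IReg 22) ;;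
     ILoad 22 18 (IReg 20) ;; ILoad 23 18 (IReg 21) ;;
     Cond (ILess (IReg 22) (IReg 23)) (IStore 20 (IReg 20) (IReg 22)) (IStore 20 (IReg 20) (IReg 23)))"

definition jump_back :: cmd where
  "jump_back = ParFor 20 (IReg 6) (ILoad 21 19 (IReg 20) ;; IStore 17 (IReg 20) (IReg 21) ;;
     ILoad 21 20 (IReg 20) ;; IStore 18 (IReg 20) (IReg 21))"

definition find_leaders :: cmd where
  "find_leaders = IAssign 7 (Const 1) ;;
     While (ILess (IReg 7) (IReg 6)) (jump ;; jump_back ;; IAssign 7 (IMul (Const 2) (IReg 7)))"

definition signs :: cmd where
  "signs = ParFor 20 (IReg 1) (ILoad 21 3 (IReg 20) ;;
     Cond (IEq (IMod (IReg 21) (Const 2)) (Const 1))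
      (ILoad 23 15 (IReg 20) ;; ILoad 23 18 (IReg 23) ;; ILoad 24 15 (IAdd (IReg 1) (IReg 20)) ;; ILoad 24 18 (IReg 24) ;;
       RLoad 20 1 (IReg 20) ;;
       Cond (ILess (IReg 23) (IReg 24))
         (IStore 21 (IReg 20) (Const 1) ;; RStore 2 (IAdd (IReg 3) (IReg 20)) (RReg 20))
         (IStore 21 (IReg 20) (Const 0) ;; RStore 2 (IAdd (IReg 3) (IReg 20)) (RSub (OfInt (Const 0)) (RReg 20))))
      (IStore 21 (IReg 20) (Const 0) ;; RStore 2 (IAdd (IReg 3) (IReg 20)) (OfInt (Const 0))))"

definition halve :: cmd where
  "halve = ParFor 20 (IReg 1) (ILoad 21 3 (IReg 20) ;; ILoad 22 21 (IReg 20) ;;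
     Cond (BAnd (IEq (IMod (IReg 21) (Const 2)) (Const 1)) (IEq (IReg 22) (IReg 8)))
       (IStore 3 (IReg 20) (IDiv (IAdd (IReg 21) (Const 1)) (Const 2)))
       (IStore 3 (IReg 20) (IDiv (IReg 21) (Const 2))))"

text \<open>The prefix sum at leaf \<open>m\<close> is the signed weight of all edges, whatever the
  later leaves contain. Its sign decides in register 8 which colour is rounded up.\<close>

definition level :: cmd where
  "level = odd_bits ;; iscan ;; ILoad 6 5 (IAdd (IReg 3) (IReg 2)) ;; compact ;; links ;; find_leaders ;; signs ;;
     rscan ;; RLoad 10 3 (IAdd (IReg 3) (IReg 1)) ;;
     Cond (RLess (RReg 10) (OfInt (Const 0))) (IAssign 8 (Const 0)) (IAssign 8 (Const 1)) ;; halve"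

text \<open>As a congruence rule this confines the simplifier to the state, leaving program and
  postcondition of pending goals alone.\<close>

lemma wp_weak_cong: "s = s' \<Longrightarrow> \<mu> = \<mu>' \<Longrightarrow> wp b RS WS c Q s \<mu> = wp b RS WS c Q s' \<mu>'"
  by simp

locale level_run = sorted_run n m vt b N q h P od st en w + halving n m vt od st en X
  for n m :: nat and vt :: "nat \<Rightarrow> nat" and b :: nat and N :: int and q h P :: nat
    and od st en :: "nat \<Rightarrow> nat" and w :: "nat \<Rightarrow> real" and X :: "nat \<Rightarrow> nat" +
  assumes X_N: "e < m \<Longrightarrow> int (X e) + 1 \<le> N"
begin

lemma int_odd: "int x mod 2 = (if odd x then 1 else 0)"
proof -
  have "int x mod 2 = int (x mod 2)" by (simp add: zmod_int)
  then show ?thesis by (simp add: odd_iff_mod_2_eq_one)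
qed

lemma HA_le: "HA \<le> 2 * m"
  unfolding HA_def by (rule cnt_le)

lemma cN: "c < HA \<Longrightarrow> int c + int HA \<le> N" "c < HA \<Longrightarrow> int c + 1 \<le> N" "c < HA \<Longrightarrow> int c \<le> N" "int HA \<le> N"
  using HA_le bounds(7,8) by linarith+

lemma wp_odd_bits:
  assumes s: "base s" and st: "static \<mu>" and X: "\<And>e. e < m \<Longrightarrow> imem \<mu> 3 e = int (X e)"
  shows "wp b UNIV UNIV odd_bits (\<lambda>s' \<mu>' W D. s' = s \<and>
     (\<forall>i<2 * m. imem \<mu>' 4 (P + i) = (if act i then 1 else 0)) \<and>
     (\<forall>t\<ge>2 * m. imem \<mu>' 4 (P + t) = imem \<mu> 4 (P + t)) \<and> W \<le> 12 * P \<and> D \<le> 12) s \<mu>"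
proof -
  have XN: "int (X e) \<le> N" if "e < m" for e using X_N[OF that] by linarith
  show ?thesis
    unfolding odd_bits_def using bounds(1,2,4,5-8) P_gt
    by (intro wp_ParFor[where k = "2 * m" and V = "\<lambda>i. {ICell 4 (P + i)}" and w = 8 and
        \<nu> = "\<mu>\<lparr>imem := (imem \<mu>)(4 := \<lambda>j. if P \<le> j \<and> j < P + 2 * m
          then if act (j - P) then 1 else 0 else imem \<mu> 4 j)\<rparr>"])
      (simp_all add: baseD[OF s] wp_simps agree_def nat_add_distrib ball_neq_add staticD[OF st] od_mod_nat od_mod X
         int_odd act_def,
       auto simp: sizes XN od_mod od_less intro!: fitsI0)
qed

lemma wp_compact:
  assumes s: "base s" and st: "static \<mu>"
    and a: "\<And>i. i < 2 * m \<Longrightarrow> imem \<mu> 4 (P + i) = (if act i then 1 else 0)"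
    and c: "\<And>i. i \<le> 2 * m \<Longrightarrow> imem \<mu> 5 (P + i) = int (cnt act i)"
  shows "wp b UNIV UNIV compact (\<lambda>s' \<mu>' W D. s' = s \<and>
     (\<forall>c<HA. imem \<mu>' 14 c = int (hc c) \<and> imem \<mu>' 16 c = int (partner c)) \<and>
     (\<forall>g<2 * m. odd (X (g mod m)) \<longrightarrow> imem \<mu>' 15 g = int (cix g)) \<and> W \<le> 40 * P \<and> D \<le> 40) s \<mu>"
proof -
  let ?V = "\<lambda>i. if act i then {ICell 14 (cnt act i), ICell 15 (od i), ICell 16 (cnt act i)} else {}"
  let ?\<nu> = "\<mu>\<lparr>imem := (imem \<mu>)(14 := \<lambda>c. if c < HA then int (hc c) else imem \<mu> 14 c,
     15 := \<lambda>g. if g < 2 * m \<and> odd (X (g mod m)) then int (cix g) else imem \<mu> 15 g,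
     16 := \<lambda>c. if c < HA then int (partner c) else imem \<mu> 16 c)\<rparr>"
  have cl: "cnt act i < HA" if "i < 2 * m" "act i" for i using cnt_less[of act i "2 * m"] that by (simp add: HA_def)
  have "wp b UNIV UNIV compact (\<lambda>s' \<mu>' W D. s' = s \<and> \<mu>' = ?\<nu> \<and> W \<le> 40 * P \<and> D \<le> 40) s \<mu>"
    unfolding compact_def
  proof (rule wp_ParFor[where k = "2 * m" and V = ?V and w = 34 and \<nu> = ?\<nu>], goal_cases)
    case (3 i j)
    then show ?case using cnt_inj[of act i j] od_inj[of i j] by auto
  next
    case (4 i)
    show ?case
    proof (cases "act i")
      case False
      have "int i \<le> N" "int P + int i \<le> N" using 4 bounds(5,7,8) by linarith+
      then show ?thesis using 4 False bounds(1,6) by (simp cong: wp_weak_cong add: wp_simps baseD[OF s] a nat_add_distrib fitsI0 agree_def)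
    next
      case True
      let ?v = "vt (od i)" let ?c = "cnt act i"
      have lh: "lo ?v \<le> ?c" "?c < hi ?v"
        using vt_hc[OF cl[OF 4 True], of ?v] hc_cnt[OF 4 True] by simp_all
      have c': "imem \<mu> 5 (P + i) = int ?c" "imem \<mu> 5 (P + st ?v) = int (lo ?v)" "imem \<mu> 5 (P + en ?v) = int (hi ?v)"
        using c[of i] c[of "st ?v"] c[of "en ?v"] 4 en_le[of ?v] st_le[of ?v] by (simp_all add: lo_def hi_def)
      have par: "(int ?c - int (lo ?v)) mod 2 = 0 \<longleftrightarrow> even (?c - lo ?v)"
        using lh int_odd[of "?c - lo ?v"] by (auto simp: of_nat_diff)
      have hN: "int (hi ?v) \<le> N" "int (lo ?v) \<le> N" "0 \<le> int ?c - int (lo ?v)" "int ?c - int (lo ?v) \<le> N"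
        using hi_le[of ?v] lh cN(4) by linarith+
      have pv: "partner ?c = pair_in (lo ?v) (hi ?v) ?c" using hc_cnt[OF 4 True] by (simp add: partner_def)
      have c1: "\<not> even (?c - lo ?v) \<Longrightarrow> 1 \<le> int ?c" by (cases "?c = 0") auto
      have ppos: "\<not> even (?c - lo ?v) \<Longrightarrow> int ?c - 1 = int (?c - 1)" using c1 by (simp add: of_nat_diff)
      have m0: "0 \<le> (int ?c - int (lo ?v)) mod 2" "(int ?c - int (lo ?v)) mod 2 \<le> N" using bounds(2) by (simp, linarith)
      have odX: "odd (X (od i mod m))" using True by (simp add: act_def)
      have iN: "int i \<le> N" "int P + int i \<le> N" using 4 bounds(5,7,8) by linarith+
      have nt: "nat (int P + int i) = P + i" "nat (int P + int (st ?v)) = P + st ?v" "nat (int P + int (en ?v)) = P + en ?v" by simp_all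
      note cNi = cN(2,3)[OF cl[OF 4 True]]
      have ft: "fits b (int ?c - int (lo ?v))" "fits b 0" "fits b 1" "fits b (1 + int ?c)" "fits b (int ?c + 1)"
        using hN(3,4) cNi bounds(1) by (auto intro!: fitsI0)
      note [simp] = baseD[OF s] staticD(4)[OF st 4] staticD(5-7)[OF st od_less[OF 4]] a[OF 4] True c' nt
        sizes(1)[OF 4] sizes(2)[OF od_less[OF 4]] sizes(4-7) iN bounds(1,2,6) cNi hN m0 4 cl[OF 4 True]
        hc_cnt[OF 4 True] cix_od[OF 4] od_less[OF 4] odX ft
      consider "even (?c - lo ?v)" "?c + 1 < hi ?v" | "even (?c - lo ?v)" "\<not> ?c + 1 < hi ?v" | "\<not> even (?c - lo ?v)" by blast
      then show ?thesis
      proof cases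
        case 1
        have "int ?c + 1 < int (hi ?v)" using 1(2) by linarith
        moreover have "partner ?c = Suc ?c" using 1 by (simp add: pv pair_in_def)
        ultimately show ?thesis using 1(1) by (simp cong: wp_weak_cong add: wp_simps fitsI0 agree_def par add.commute)
      next
        case 2
        have "\<not> int ?c + 1 < int (hi ?v)" using 2(2) by linarith
        moreover have "partner ?c = ?c" using 2 by (simp add: pv pair_in_def)
        ultimately show ?thesis using 2(1) by (simp cong: wp_weak_cong add: wp_simps fitsI0 agree_def par)
      next
        case 3
        then have pp: "partner ?c = ?c - 1" unfolding pv pair_in_def by (rule if_not_P)
        have "int (partner ?c) = int ?c - 1" unfolding pp by (rule ppos[OF 3, symmetric])
        moreover have "fits b (int ?c - 1)" using c1[OF 3] cNi by (intro fitsI0) linarith+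
        ultimately show ?thesis using 3 by (simp cong: wp_weak_cong add: wp_simps fitsI0 agree_def par)
      qed
    qed
  next
    case 5
    have A: "\<exists>i<2 * m. act i \<and> cnt act i = c" if "c < HA" for c using ps[OF that] by blast
    have B: "\<exists>i<2 * m. act i \<and> od i = g" if "g < 2 * m" "odd (X (g mod m))" for g
      using pos[OF that(1)] that(2) by (intro exI[of _ "pos g"]) (auto simp: act_def)
    show ?case unfolding agree_def using A B by (auto split: if_splits)
  qed (use bounds P_gt in \<open>auto simp: baseD[OF s] fitsI0\<close>)
  then show ?thesis by (rule wp_mono) auto
qed

lemma wp_links:
  assumes s: "base s" "ireg s 6 = int HA"
    and a: "\<And>c. c < HA \<Longrightarrow> imem \<mu> 14 c = int (hc c)" "\<And>c. c < HA \<Longrightarrow> imem \<mu> 16 c = int (partner c)"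
    and c: "\<And>g. g < 2 * m \<Longrightarrow> odd (X (g mod m)) \<Longrightarrow> imem \<mu> 15 g = int (cix g)"
  shows "wp b UNIV UNIV links (\<lambda>s' \<mu>' W D. s' = s \<and>
     (\<forall>c<HA. imem \<mu>' 17 c = int (nx c) \<and> imem \<mu>' 18 c = int (key c)) \<and> W \<le> 20 * P \<and> D \<le> 20) s \<mu>"
proof -
  let ?\<nu> = "\<mu>\<lparr>imem := (imem \<mu>)(17 := \<lambda>c. if c < HA then int (nx c) else imem \<mu> 17 c,
     18 := \<lambda>c. if c < HA then int (key c) else imem \<mu> 18 c)\<rparr>"
  have hP: "1 + (HA + HA * 14) \<le> 20 * P" using HA_le P_gt by simp
  have "wp b UNIV UNIV links (\<lambda>s' \<mu>' W D. s' = s \<and> \<mu>' = ?\<nu> \<and> W \<le> 20 * P \<and> D \<le> 20) s \<mu>"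
    unfolding links_def
  proof (rule wp_ParFor[where k = HA and V = "\<lambda>c. {ICell 17 c, ICell 18 c}" and w = 14 and \<nu> = ?\<nu>], goal_cases)
    case (4 i)
    have o: "odd (X ((hc i + m) mod (2 * m) mod m))" using hc_odd[OF 4] other_mod[OF hc_less[OF 4]] by simp
    have oi: "imem \<mu> 15 ((hc i + m) mod (2 * m)) = int (opp i)" using c[OF _ o] m_pos by (simp add: opp_def)
    have md: "(int (hc i) + int m) mod (2 * int m) = int ((hc i + m) mod (2 * m))" by (simp add: zmod_int)
    have "(hc i + m) mod (2 * m) < 2 * m" using m_pos by simp
    then have mN: "int ((hc i + m) mod (2 * m)) \<le> N" using bounds(5) by linarith
    have hN: "int (hc i) \<le> N" "int (hc i) + int m \<le> N" using hc_less[OF 4] bounds(5,7,8) by linarith+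
    note [simp] = baseD[OF s(1)] s(2) a[OF 4] oi md mN hN cN(1,3)[OF 4] cN(3)[OF opp_props(1)[OF 4]]
       cN(3)[OF partner_props(1)[OF opp_props(1)[OF 4]]] bounds(4,5) cN(4) 4 a(2)[OF opp_props(1)[OF 4]]
    show ?case
      by (cases "stuck i") (auto cong: wp_weak_cong simp: wp_simps fitsI0 agree_def nx_def key_def stuck_def)
  next
    case (6 W D)
    then show ?case using hP by simp
  qed (use cN(4) in \<open>auto simp: s fitsI0 agree_def\<close>)
  then show ?thesis by (rule wp_mono) auto
qed

definition mn :: "nat \<Rightarrow> nat \<Rightarrow> nat" where "mn r c = Min ((\<lambda>i. key ((nx ^^ i) c)) ` {..<r})"

text \<open>The first \<open>2 * r\<close> nodes of a walk are the first \<open>r\<close> nodes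
  followed by those of the walk from the node reached after \<open>r\<close> steps.\<close>

lemma mn_double: "0 < r \<Longrightarrow> mn (2 * r) c = min (mn r c) (mn r ((nx ^^ r) c))"
proof -
  assume r: "0 < r"
  have "{..<2 * r} = {..<r} \<union> (\<lambda>i. i + r) ` {..<r}"
    by (auto simp: lessThan_atLeast0 image_add_atLeastLessThan' mult_2)
  then have "(\<lambda>i. key ((nx ^^ i) c)) ` {..<2 * r} =
      (\<lambda>i. key ((nx ^^ i) c)) ` {..<r} \<union> (\<lambda>i. key ((nx ^^ i) ((nx ^^ r) c))) ` {..<r}"
    by (simp add: image_Un image_image funpow_add)
  then show ?thesis
    unfolding mn_def using r by (simp add: Min_Un lessThan_empty_iff)
qed

lemma mn_less: assumes "0 < r" "c < HA" shows "mn r c < 2 * HA"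
proof -
  have "mn r c \<le> key ((nx ^^ 0) c)" unfolding mn_def using assms
    by (intro Min_le) (auto intro!: image_eqI[of _ _ 0])
  also have "\<dots> < 2 * HA" using assms by (simp add: key_def)
  finally show ?thesis .
qed

text \<open>Only ranks below \<open>HA\<close> take part, so the factor \<open>h\<close> of pointer
  jumping multiplies the number of odd half-edges and not \<open>P\<close>. Loop overhead is of
  order \<open>h\<close>, which is less than \<open>P\<close>. Once \<open>2 ^ k\<close> reaches
  \<open>HA\<close>, \<open>leader_eq\<close> identifies the minimum with the leader.\<close>

lemma wp_find_leaders:
  assumes s: "base s" "ireg s 6 = int HA"
    and a: "\<And>c. c < HA \<Longrightarrow> imem \<mu> 17 c = int (nx c)" "\<And>c. c < HA \<Longrightarrow> imem \<mu> 18 c = int (key c)"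
  shows "wp b UNIV UNIV find_leaders (\<lambda>s' \<mu>' W D. base s' \<and>
     (\<forall>c<HA. imem \<mu>' 18 c = int (leader c)) \<and> W \<le> 40 * h * HA + 30 * P \<and> D \<le> 60 * (h + 1)) s \<mu>"
proof -
  have kN: "int x \<le> N" if "x < 2 * HA" for x using that HA_le bounds(7,8) by linarith
  have cl: "c < 2 * HA" if "c < HA" for c using that by simp
  define K where "K = (\<lambda>k (s::regs) (\<mu>::mem) W (D::nat). k \<le> h \<and> base s \<and> ireg s 6 = int HA \<and> ireg s 7 = int (2 ^ k) \<and>
     (\<forall>c<HA. imem \<mu> 17 c = int ((nx ^^ (2 ^ k)) c) \<and> imem \<mu> 18 c = int (mn (2 ^ k) c)) \<and>
     W \<le> (40 * HA + 20) * k \<and> D \<le> 50 * k)"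
  define I where "I = (\<lambda>g (s::regs) (\<mu>::mem) W (D::nat). \<exists>k. g = h - k \<and> K k s \<mu> W D)"
  have step: "wp b UNIV UNIV (jump ;; jump_back) (\<lambda>s' \<mu>' W D. s' = s1 \<and>
      (\<forall>c<HA. imem \<mu>' 17 c = int ((nx ^^ (2 * r)) c) \<and> imem \<mu>' 18 c = int (mn (2 * r) c)) \<and>
      W \<le> 40 * HA + 4 \<and> D \<le> 40) s1 \<mu>1"
    if s1: "base s1" "ireg s1 6 = int HA" and r: "0 < r"
      and a1: "\<And>c. c < HA \<Longrightarrow> imem \<mu>1 17 c = int ((nx ^^ r) c)" "\<And>c. c < HA \<Longrightarrow> imem \<mu>1 18 c = int (mn r c)"
    for s1 \<mu>1 r
  proof -
    let ?\<mu> = "\<mu>1\<lparr>imem := (imem \<mu>1)(19 := \<lambda>c. if c < HA then int ((nx ^^ (2 * r)) c) else imem \<mu>1 19 c,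
       20 := \<lambda>c. if c < HA then int (mn (2 * r) c) else imem \<mu>1 20 c)\<rparr>"
    let ?\<nu> = "?\<mu>\<lparr>imem := (imem ?\<mu>)(17 := \<lambda>c. if c < HA then int ((nx ^^ (2 * r)) c) else imem ?\<mu> 17 c,
       18 := \<lambda>c. if c < HA then int (mn (2 * r) c) else imem ?\<mu> 18 c)\<rparr>"
    have nn: "(nx ^^ (2 * r)) c = (nx ^^ r) ((nx ^^ r) c)" for c by (simp add: mult_2 funpow_add)
    have j1: "wp b UNIV UNIV jump (\<lambda>s' \<mu>' W D. s' = s1 \<and> \<mu>' = ?\<mu> \<and> W \<le> 1 + HA * 20 \<and> D \<le> 21) s1 \<mu>1"
      unfolding jump_def
    proof (rule wp_ParFor[where k = HA and V = "\<lambda>c. {ICell 19 c, ICell 20 c}" and w = 19 and \<nu> = ?\<mu>], goal_cases)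
      case (4 i)
      note l = iter_less[OF 4, of r]
      note [simp] = s1(2) a1[OF 4] a1[OF l] cN(3)[OF 4] cN(3)[OF l] cN(3)[OF iter_less[OF 4, of "2 * r"]] 4
        kN[OF mn_less[OF r 4]] kN[OF mn_less[OF r l]]
      have "int ((nx ^^ r) ((nx ^^ r) i)) \<le> N" using cN(3)[OF iter_less[OF 4, of "2 * r"]] by (simp only: nn)
      then show ?case
        by (auto simp: wp_simps fitsI0 agree_def nn mn_double[OF r] min_def)
    qed (use cN(4) in \<open>auto simp: s1 fitsI0 agree_def\<close>)
    have j2: "wp b UNIV UNIV jump_back (\<lambda>s' \<mu>' W D. s' = s1 \<and> \<mu>' = ?\<nu> \<and> W \<le> 1 + HA * 10 \<and> D \<le> 11) s1 ?\<mu>"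
      unfolding jump_back_def
    proof (rule wp_ParFor[where k = HA and V = "\<lambda>c. {ICell 17 c, ICell 18 c}" and w = 9 and \<nu> = ?\<nu>], goal_cases)
      case (4 i)
      have "0 < 2 * r" using r by simp
      note [simp] = s1(2) cN(3)[OF 4] cN(3)[OF iter_less[OF 4, of "2 * r"]] 4 kN[OF mn_less[OF this 4]]
      show ?case by (auto simp: wp_simps fitsI0 agree_def)
    qed (use cN(4) in \<open>auto simp: s1 fitsI0 agree_def\<close>)
    show ?thesis
      unfolding wp_Seq
    proof (rule wp_mono[OF j1])
      fix s2 \<mu>2 and W2 D2 :: nat
      assume 2: "s2 = s1 \<and> \<mu>2 = ?\<mu> \<and> W2 \<le> 1 + HA * 20 \<and> D2 \<le> 21"
      then have e: "s2 = s1" "\<mu>2 = ?\<mu>" by auto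
      show "wp b UNIV UNIV jump_back (\<lambda>s' \<mu>' W D. s' = s1 \<and>
        (\<forall>c<HA. imem \<mu>' 17 c = int ((nx ^^ (2 * r)) c) \<and> imem \<mu>' 18 c = int (mn (2 * r) c)) \<and>
        W2 + W \<le> 40 * HA + 4 \<and> D2 + D \<le> 40) s2 \<mu>2"
        unfolding e by (rule wp_mono[OF j2]) (use 2 in auto)
    qed
  qed
  let ?s = "s\<lparr>ireg := (ireg s)(7 := 1)\<rparr>"
  have "wp b UNIV UNIV (While (ILess (IReg 7) (IReg 6)) (jump ;; jump_back ;; IAssign 7 (IMul (Const 2) (IReg 7))))
    (\<lambda>s' \<mu>' W D. base s' \<and> (\<forall>c<HA. imem \<mu>' 18 c = int (leader c)) \<and>
     1 + W \<le> 40 * h * HA + 30 * P \<and> 1 + D \<le> 60 * (h + 1)) ?s \<mu>"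
  proof (rule wp_While[where I = I and ?g0.0 = h], goal_cases)
    case 1
    have "mn (Suc 0) c = key c" for c by (simp add: mn_def lessThan_Suc)
    then have "K 0 ?s \<mu> 0 0" unfolding K_def using s a by (simp add: base_def)
    then show ?case unfolding I_def by (intro exI[of _ 0]) simp
  next
    case (2 g s1 \<mu>1 W D)
    then obtain k where gk: "g = h - k" and K: "K k s1 \<mu>1 W D" unfolding I_def by blast
    then have k: "k \<le> h" "base s1" "ireg s1 6 = int HA" "ireg s1 7 = int (2 ^ k)"
      and a1: "\<And>c. c < HA \<Longrightarrow> imem \<mu>1 17 c = int ((nx ^^ (2 ^ k)) c)" "\<And>c. c < HA \<Longrightarrow> imem \<mu>1 18 c = int (mn (2 ^ k) c)"
      and WD: "W \<le> (40 * HA + 20) * k" "D \<le> 50 * k" unfolding K_def by simp_all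
    have pN: "2 * int (2 ^ k) \<le> N" "int (2 ^ k) \<le> N"
    proof -
      have "(2::nat) ^ k \<le> P" unfolding P_eq using k(1) by (intro power_increasing) auto
      then have "int (2 ^ k) \<le> int P" by (simp only: of_nat_le_iff)
      then show "2 * int (2 ^ k) \<le> N" "int (2 ^ k) \<le> N" using bounds(8) by linarith+
    qed
    show ?case
    proof (cases "HA \<le> 2 ^ k")
      case True
      have "leader c = mn (2 ^ k) c" if "c < HA" for c unfolding mn_def by (rule leader_eq[OF that True])
      moreover have "\<not> int (2 ^ k) < int HA" using True by (simp only: of_nat_less_iff not_less)
      moreover have "1 + (W + 2) \<le> 40 * h * HA + 30 * P"
      proof -
        have "(40 * HA + 20) * k \<le> (40 * HA + 20) * h" using k(1) by (rule mult_le_mono2)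
        also have "\<dots> = 40 * h * HA + 20 * h" by (simp add: algebra_simps)
        finally show ?thesis using WD h_less_P P_gt by linarith
      qed
      moreover have "1 + (D + 2) \<le> 60 * (h + 1)" using WD k(1) by simp
      ultimately show ?thesis using k a1 pN cN(4) by (auto simp: fitsI0 simp del: of_nat_power)
    next
      case False
      have kh: "k < h"
      proof (rule ccontr)
        assume "\<not> k < h"
        then have "(2::nat) ^ h \<le> 2 ^ k" by (intro power_increasing) auto
        then show False using False HA_le P_gt P_eq by linarith
      qed
      have T: "int (2 ^ k) < int HA" using False by (simp only: of_nat_less_iff not_le)
      have "wp b UNIV UNIV (jump ;; jump_back) (\<lambda>s2 \<mu>2 W2 D2. ireg s2 7 = int (2 ^ k) \<and>
          I (h - Suc k) (s2\<lparr>ireg := (ireg s2)(7 := 2 * int (2 ^ k))\<rparr>) \<mu>2 (W + (2 + (W2 + 2))) (D + (2 + (D2 + 2)))) s1 \<mu>1"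
      proof (rule wp_mono[OF step[OF k(2,3) _ a1]], goal_cases)
        case (4 s2 \<mu>2 W2 D2)
        have "W2 + 4 \<le> 40 * HA + 20" "D2 + 4 \<le> 50" using 4(1) by simp_all
        then have "W + (W2 + 4) \<le> (40 * HA + 20) * Suc k" "D + (D2 + 4) \<le> 50 * Suc k"
          using loop_cost(1)[OF WD(1)] loop_cost(1)[OF WD(2)] by blast+
        then have WD': "W + (2 + (W2 + 2)) \<le> (40 * HA + 20) * Suc k" "D + (2 + (D2 + 2)) \<le> 50 * Suc k"
          by linarith+
        have "K (Suc k) (s2\<lparr>ireg := (ireg s2)(7 := 2 * int (2 ^ k))\<rparr>) \<mu>2 (W + (2 + (W2 + 2))) (D + (2 + (D2 + 2)))"
          unfolding K_def using 4(1) kh k WD' by (simp add: base_def)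
        then show ?case using 4(1) k(4) unfolding I_def by blast
      qed simp_all
      moreover have "h - Suc k < g" using gk kh by simp
      ultimately show ?thesis
        using T k pN cN(4) bounds(2)
        by (auto simp: wp_Seq wp_IAssign fitsI0 add.assoc simp del: of_nat_power elim!: wp_mono intro!: exI[of _ "h - Suc k"])
    qed
  qed
  then show ?thesis
    unfolding find_leaders_def wp_Seq wp_IAssign using bounds(1) by (simp add: fitsI0)
qed

end

context level_run
begin

lemma wp_signs:
  assumes s: "base s" and st: "static \<mu>" and X: "\<And>e. e < m \<Longrightarrow> imem \<mu> 3 e = int (X e)"
    and c: "\<And>g. g < 2 * m \<Longrightarrow> odd (X (g mod m)) \<Longrightarrow> imem \<mu> 15 g = int (cix g)"
    and l: "\<And>c. c < HA \<Longrightarrow> imem \<mu> 18 c = int (leader c)"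
  shows "wp b UNIV UNIV signs (\<lambda>s' \<mu>' W D. s' = s \<and>
     (\<forall>e<m. imem \<mu>' 21 e = (if odd (X e) \<and> col e then 1 else 0) \<and>
        rmem \<mu>' 2 (P + e) = w e * real_of_int (sgn_of True e)) \<and> W \<le> 30 * P \<and> D \<le> 30) s \<mu>"
proof -
  let ?\<nu> = "\<mu>\<lparr>imem := (imem \<mu>)(21 := \<lambda>e. if e < m then if odd (X e) \<and> col e then 1 else 0 else imem \<mu> 21 e),
     rmem := (rmem \<mu>)(2 := \<lambda>j. if P \<le> j \<and> j < P + m then w (j - P) * real_of_int (sgn_of True (j - P)) else rmem \<mu> 2 j)\<rparr>"
  have "wp b UNIV UNIV signs (\<lambda>s' \<mu>' W D. s' = s \<and> \<mu>' = ?\<nu> \<and> W \<le> 30 * P \<and> D \<le> 30) s \<mu>"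
    unfolding signs_def
  proof (rule wp_ParFor[where k = m and V = "\<lambda>i. {ICell 21 i, RCell 2 (P + i)}" and w = 24 and \<nu> = ?\<nu>], goal_cases)
    case (4 i)
    have g: "i < 2 * m" "m + i < 2 * m" using 4 by simp_all
    have iN: "int i \<le> N" "int P + int i \<le> N" "int m + int i \<le> N" using 4 bounds(4,5,7,8) by linarith+
    have XN: "int (X i) \<le> N" using X_N[OF 4] by linarith
    have nt: "nat (int P + int i) = P + i" "nat (int m + int i) = m + i" by simp_all
    have N0: "0 \<le> N" using bounds(1) by linarith
    note [simp] = baseD[OF s] staticD(3)[OF st 4] X[OF 4] iN XN nt N0 bounds(1,2,4,6) 4 int_odd
    show ?case
    proof (cases "odd (X i)")
      case False
      then show ?thesis by (simp cong: wp_weak_cong add: wp_simps fitsI0 agree_def sgn_of_def)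
    next
      case True
      have cl: "cix i < HA" "cix (m + i) < HA" using cix_less[of i] cix_less[of "m + i"] g 4 True by simp_all
      have c': "imem \<mu> 15 i = int (cix i)" "imem \<mu> 15 (m + i) = int (cix (m + i))"
        using c[of i] c[of "m + i"] g 4 True by simp_all
      have lN: "int (leader c) \<le> N" if "c < HA" for c
        using leader_le[OF that, of 0] that HA_le bounds(7,8) by (simp add: key_def split: if_splits)
      note [simp] = c' l[OF cl(1)] l[OF cl(2)] lN[OF cl(1)] lN[OF cl(2)] cN(3)[OF cl(1)] cN(3)[OF cl(2)]
      show ?thesis
        using True
        by (cases "leader (cix i) < leader (cix (m + i))")
          (simp_all cong: wp_weak_cong add: wp_simps fitsI0 agree_def sgn_of_def col_def)
    qed
  next
    case 5
    show ?case by (auto simp: agree_def ball_neq_add)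
  qed (use bounds P_gt in \<open>auto simp: baseD[OF s] fitsI0\<close>)
  then show ?thesis by (rule wp_mono) auto
qed

lemma wp_halve:
  assumes s: "base s" "ireg s 8 = (if t then 1 else 0)" and X: "\<And>e. e < m \<Longrightarrow> imem \<mu> 3 e = int (X e)"
    and c: "\<And>e. e < m \<Longrightarrow> imem \<mu> 21 e = (if odd (X e) \<and> col e then 1 else 0)"
  shows "wp b UNIV UNIV halve (\<lambda>s' \<mu>' W D. s' = s \<and> (\<forall>e<m. imem \<mu>' 3 e = int (rounded t e)) \<and>
     W \<le> 20 * P \<and> D \<le> 20) s \<mu>"
proof -
  let ?\<nu> = "\<mu>\<lparr>imem := (imem \<mu>)(3 := \<lambda>e. if e < m then int (rounded t e) else imem \<mu> 3 e)\<rparr>"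
  have "wp b UNIV UNIV halve (\<lambda>s' \<mu>' W D. s' = s \<and> \<mu>' = ?\<nu> \<and> W \<le> 20 * P \<and> D \<le> 20) s \<mu>"
    unfolding halve_def
  proof (rule wp_ParFor[where k = m and V = "\<lambda>i. {ICell 3 i}" and w = 14 and \<nu> = ?\<nu>], goal_cases)
    case (4 i)
    have iN: "int i \<le> N" "int (X i) \<le> N" "int (X i) + 1 \<le> N" "0 \<le> N" using 4 bounds(1,4) X_N[OF 4] by linarith+
    have d: "int (X i) div 2 = int (X i div 2)" "(int (X i) + 1) div 2 = int ((X i + 1) div 2)"
      by (simp_all add: zdiv_int add.commute)
    have dN: "int (X i div 2) \<le> N" "int ((X i + 1) div 2) \<le> N" using X_N[OF 4] by linarith+
    have od: "1 + int (X i div 2) \<le> N" if "odd (X i)" using that X_N[OF 4] by presburger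
    note [simp] = baseD[OF s(1)] s(2) X[OF 4] c[OF 4] iN d dN od bounds(1,2) 4 int_odd
    show ?case
      by (cases "odd (X i)"; cases "col i"; cases t)
        (simp_all cong: wp_weak_cong add: wp_simps fitsI0 agree_def rounded_def del: Suc_eq_plus1)
  next
    case 5
    show ?case by (auto simp: agree_def)
  qed (use bounds P_gt in \<open>auto simp: baseD[OF s(1)] fitsI0\<close>)
  then show ?thesis by (rule wp_mono) auto
qed

lemma wp_level:
  assumes s: "base s" and st: "static \<mu>" and X: "\<And>e. e < m \<Longrightarrow> imem \<mu> 3 e = int (X e)"
    and z: "\<And>t. 2 * m \<le> t \<Longrightarrow> t < P \<Longrightarrow> imem \<mu> 4 (P + t) = 0"
  shows "wp b UNIV UNIV level (\<lambda>s' \<mu>' W D. base s' \<and> ireg s' 5 = ireg s 5 \<and> static \<mu>' \<and>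
     (\<forall>t. 2 * m \<le> t \<and> t < P \<longrightarrow> imem \<mu>' 4 (P + t) = 0) \<and>
     (\<exists>t. (\<forall>e<m. imem \<mu>' 3 e = int (rounded t e)) \<and> 0 \<le> (\<Sum>e<m. w e * real_of_int (sgn_of t e))) \<and>
     W \<le> 300 * P + 40 * h * HA \<and> D \<le> 300 * (h + 1)) s \<mu>"
  unfolding level_def wp_Seq
proof (rule wp_mono[OF wp_odd_bits[OF s st X]], goal_cases)
  case (2 s1 \<mu>1 W1 D1)
  note A1 = 2(1)
  note sm1 = sameD[OF 2(2)[unfolded odd_bits_def]]
  have b1: "base s1" using A1 s by simp
  have p1: "imem \<mu>1 4 (P + i) = (if act i then 1 else 0)" if "i < 2 * m" for i using A1 that by simp
  have z1: "imem \<mu>1 4 (P + t) = 0" if "2 * m \<le> t" "t < P" for t using A1 z that by simp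
  have st1: "static \<mu>1" by (rule static_cong[OF st]) (rule sm1; simp)+
  have x1: "imem \<mu>1 3 = imem \<mu> 3" by (rule sm1; simp)
  show ?case
  proof (rule wp_mono[OF wp_count[OF b1 p1 z1]], goal_cases)
    case (4 s2 \<mu>2 W2 D2)
    note A2 = 4(1)
    note sm2 = sameD[OF 4(2)[unfolded iscan_def up_sweep_def down_sweep_def]]
    have b2: "base s2" using base_iscan[OF 4(2) b1] .
    have st2: "static \<mu>2" by (rule static_cong[OF st1]) (rule sm2; simp)+
    have x2: "imem \<mu>2 3 = imem \<mu>1 3" by (rule sm2; simp)
    have r2: "ireg s2 5 = ireg s1 5" by (rule sm2; simp)
    let ?s3 = "s2\<lparr>ireg := (ireg s2)(6 := int HA)\<rparr>"
    have b3: "base ?s3" using b2 by (simp add: base_def)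
    have ld: "imem \<mu>2 5 (nat (int P + 2 * int m)) = int HA"
    proof -
      have "nat (int P + 2 * int m) = P + 2 * m" by simp
      then show ?thesis using A2 by (simp add: HA_def)
    qed
    have p2: "imem \<mu>2 4 (P + i) = (if act i then 1 else 0)" if "i < 2 * m" for i
      using p1[OF that] A2 that P_gt by simp
    have c2: "imem \<mu>2 5 (P + i) = int (cnt act i)" if "i \<le> 2 * m" for i using A2 that by simp
    have z2: "imem \<mu>2 4 (P + t) = 0" if "2 * m \<le> t" "t < P" for t using A2 z1[OF that] that by simp
    have main: "wp b UNIV UNIV compact (\<lambda>s4 \<mu>4 W4 D4. wp b UNIV UNIV links (\<lambda>s5 \<mu>5 W5 D5.
        wp b UNIV UNIV find_leaders (\<lambda>s6 \<mu>6 W6 D6. wp b UNIV UNIV signs (\<lambda>s7 \<mu>7 W7 D7.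
        wp b UNIV UNIV rscan (\<lambda>s8 \<mu>8 W8 D8.
         wp b UNIV UNIV (RLoad 10 3 (IAdd (IReg 3) (IReg 1)) ;;
           Cond (RLess (RReg 10) (OfInt (Const 0))) (IAssign 8 (Const 0)) (IAssign 8 (Const 1)) ;; halve)
         (\<lambda>s' \<mu>' W D. base s' \<and> ireg s' 5 = ireg s 5 \<and> static \<mu>' \<and>
     (\<forall>t. 2 * m \<le> t \<and> t < P \<longrightarrow> imem \<mu>' 4 (P + t) = 0) \<and>
     (\<exists>t. (\<forall>e<m. imem \<mu>' 3 e = int (rounded t e)) \<and> 0 \<le> (\<Sum>e<m. w e * real_of_int (sgn_of t e))) \<and>
       W1 + (W2 + (2 + (W4 + (W5 + (W6 + (W7 + (W8 + W))))))) \<le> 300 * P + 40 * h * HA \<and>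
       D1 + (D2 + (2 + (D4 + (D5 + (D6 + (D7 + (D8 + D))))))) \<le> 300 * (h + 1)) s8 \<mu>8) s7 \<mu>7) s6 \<mu>6) s5 \<mu>5) s4 \<mu>4) ?s3 \<mu>2"
    proof (rule wp_mono[OF wp_compact[OF b3 st2 p2 c2]], goal_cases)
      case (3 s4 \<mu>4 W4 D4)
      note A4 = 3(1)
      note sm4 = sameD[OF 3(2)[unfolded compact_def]]
      have b4: "base s4" "ireg s4 6 = int HA" using A4 b3 by simp_all
      have st4: "static \<mu>4" by (rule static_cong[OF st2]) (rule sm4; simp)+
      have x4: "imem \<mu>4 3 = imem \<mu>2 3" "imem \<mu>4 4 = imem \<mu>2 4" by (rule sm4; simp)+
      show ?case
      proof (rule wp_mono[OF wp_links[OF b4, of \<mu>4]], goal_cases)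
        case (4 s5 \<mu>5 W5 D5)
        note A5 = 4(1)
        note sm5 = sameD[OF 4(2)[unfolded links_def]]
        have b5: "base s5" "ireg s5 6 = int HA" using A5 b4 by simp_all
        have st5: "static \<mu>5" by (rule static_cong[OF st4]) (rule sm5; simp)+
        have x5: "imem \<mu>5 3 = imem \<mu>4 3" "imem \<mu>5 4 = imem \<mu>4 4" "imem \<mu>5 15 = imem \<mu>4 15" by (rule sm5; simp)+
        show ?case
        proof (rule wp_mono[OF wp_find_leaders[OF b5, of \<mu>5]], goal_cases)
          case (3 s6 \<mu>6 W6 D6)
          note A6 = 3(1)
          note sm6 = sameD[OF 3(2)[unfolded find_leaders_def jump_def jump_back_def]]
          have b6: "base s6" using A6 by simp
          have st6: "static \<mu>6" by (rule static_cong[OF st5]) (rule sm6; simp)+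
          have x6: "imem \<mu>6 3 = imem \<mu>5 3" "imem \<mu>6 4 = imem \<mu>5 4" "imem \<mu>6 15 = imem \<mu>5 15" by (rule sm6; simp)+
          have r6: "ireg s6 5 = ireg s5 5" by (rule sm6; simp)
          have X6: "imem \<mu>6 3 e = int (X e)" if "e < m" for e using X[OF that] x6 x5 x4 x2 x1 by simp
          have c6: "imem \<mu>6 15 g = int (cix g)" if "g < 2 * m" "odd (X (g mod m))" for g
            using A4 that x6 x5 by simp
          show ?case
          proof (rule wp_mono[OF wp_signs[OF b6 st6 X6 c6]], goal_cases)
            case (5 s7 \<mu>7 W7 D7)
            note A7 = 5(1)
            note sm7 = sameD[OF 5(2)[unfolded signs_def]]
            have b7: "base s7" using A7 b6 by simp
            have st7: "static \<mu>7" by (rule static_cong[OF st6]) (rule sm7; simp)+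
            have x7: "imem \<mu>7 3 = imem \<mu>6 3" "imem \<mu>7 4 = imem \<mu>6 4" by (rule sm7; simp)+
            have P7: "ireg s7 3 = 2 ^ h" using baseD(4)[OF b7] unfolding P_eq by simp
            have N7: "4 * 2 ^ h \<le> N" using N_P by (simp add: P_eq)
            show ?case
            proof (rule wp_mono[OF wp_rscan[OF P7 N7]], goal_cases)
              case (1 s8 \<mu>8 W8 D8)
              note A8 = 1(1)[folded P_eq]
              note sm8 = sameD[OF 1(2)[unfolded rscan_def up_sweep_def down_sweep_def]]
              have b8: "base s8" using base_rscan[OF 1(2) b7] .
              have st8: "static \<mu>8" by (rule static_cong[OF st7]) (rule sm8; simp)+
              have x8: "imem \<mu>8 3 = imem \<mu>7 3" "imem \<mu>8 4 = imem \<mu>7 4" "imem \<mu>8 21 = imem \<mu>7 21" by (rule sm8; simp)+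
              have r8: "ireg s8 5 = ireg s7 5" by (rule sm8; simp)
              define S where "S = (\<Sum>e<m. w e * real_of_int (sgn_of True e))"
              have "rmem \<mu>8 3 (P + m) = (\<Sum>t<m. rmem \<mu>7 2 (P + t))" using A8 P_gt by simp
              also have "\<dots> = S" unfolding S_def using A7 by (intro sum.cong) auto
              finally have S: "rmem \<mu>8 3 (P + m) = S" .
              \<comment> \<open>The other colour has signed weight \<open>- S\<close>, so this
                choice always has a non-negative one.\<close>
              define t where "t = (\<not> S < 0)"
              have St: "0 \<le> (\<Sum>e<m. w e * real_of_int (sgn_of t e))"
              proof (cases t)
                case True
                then show ?thesis by (simp add: t_def S_def not_less)
              next
                case False
                then have "S < 0" "sgn_of t = (\<lambda>e. - sgn_of True e)" using sgn_of_not[of True] by (auto simp: t_def fun_eq_iff)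
                then show ?thesis by (simp add: S_def sum_negf)
              qed
              let ?s9 = "s8\<lparr>rreg := (rreg s8)(10 := S), ireg := (ireg s8)(8 := (if t then 1 else 0))\<rparr>"
              have b9: "base ?s9" "ireg ?s9 8 = (if t then 1 else 0)" using b8 by (simp_all add: base_def)
              have X8: "imem \<mu>8 3 e = int (X e)" if "e < m" for e using X6[OF that] x8 x7 by simp
              have c8: "imem \<mu>8 21 e = (if odd (X e) \<and> col e then 1 else 0)" if "e < m" for e using A7 that x8 by simp
              have fin: "wp b UNIV UNIV halve (\<lambda>s' \<mu>' W D. base s' \<and> ireg s' 5 = ireg s 5 \<and> static \<mu>' \<and>
                  (\<forall>t. 2 * m \<le> t \<and> t < P \<longrightarrow> imem \<mu>' 4 (P + t) = 0) \<and>
                  (\<exists>t. (\<forall>e<m. imem \<mu>' 3 e = int (rounded t e)) \<and> 0 \<le> (\<Sum>e<m. w e * real_of_int (sgn_of t e))) \<and>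
                  W1 + (W2 + (2 + (W4 + (W5 + (W6 + (W7 + (W8 + (10 + W)))))))) \<le> 300 * P + 40 * h * HA \<and>
                  D1 + (D2 + (2 + (D4 + (D5 + (D6 + (D7 + (D8 + (10 + D)))))))) \<le> 300 * (h + 1)) ?s9 \<mu>8"
              proof (rule wp_mono[OF wp_halve[OF b9 X8 c8]], goal_cases)
                case (3 s10 \<mu>10 W10 D10)
                note A10 = 3(1)
                note sm10 = sameD[OF 3(2)[unfolded halve_def]]
                have st10: "static \<mu>10" by (rule static_cong[OF st8]) (rule sm10; simp)+
                have x10: "imem \<mu>10 4 = imem \<mu>8 4" by (rule sm10; simp)
                have z10: "imem \<mu>10 4 (P + t) = 0" if "2 * m \<le> t" "t < P" for t
                  using z2[OF that] x10 x8 x7 x6 x5 x4 by simp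
                have r10: "ireg s10 5 = ireg s 5" using A10 A7 A5 A4 A1 r8 r6 r2 by simp
                have "W1 \<le> 12 * P" "W2 \<le> 40 * P" "W4 \<le> 40 * P" "W5 \<le> 20 * P" "W6 \<le> 40 * h * HA + 30 * P"
                  "W7 \<le> 30 * P" "W8 \<le> 40 * P" "W10 \<le> 20 * P" "1 \<le> P"
                  using A1 A2 A4 A5 A6 A7 A8 A10 P_gt by simp_all
                then have Wb: "W1 + (W2 + (2 + (W4 + (W5 + (W6 + (W7 + (W8 + (10 + W10)))))))) \<le> 300 * P + 40 * h * HA"
                  by linarith
                have "D1 \<le> 12" "D2 \<le> 40 * h + 40" "D4 \<le> 40" "D5 \<le> 20" "D6 \<le> 60 * h + 60"
                  "D7 \<le> 30" "D8 \<le> 40 * h + 40" "D10 \<le> 20"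
                  using A1 A2 A4 A5 A6 A7 A8 A10 by simp_all
                then have Db: "D1 + (D2 + (2 + (D4 + (D5 + (D6 + (D7 + (D8 + (10 + D10)))))))) \<le> 300 * (h + 1)"
                  by simp
                have "base s10" "\<forall>e<m. imem \<mu>10 3 e = int (rounded t e)" using A10 b9 by simp_all
                then show ?case using st10 z10 r10 Wb Db St by blast
              qed simp_all
              have nt: "nat (int P + int m) = P + m" by simp
              have pm: "int P + int m \<le> N" using bounds(7,8) by linarith
              show ?case
              proof (cases "S < 0")
                case True
                then have t: "\<not> t" by (simp add: t_def)
                show ?thesis
                  unfolding wp_Seq wp_RLoad wp_Cond wp_IAssign
                  using b8 bounds(1,4,6) pm S True
                  by (simp add: baseD[OF b8] nt fitsI0)
                    (rule wp_mono[OF fin[unfolded if_not_P[OF t]]]; auto)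
              next
                case False
                then have t: "t" by (simp add: t_def)
                show ?thesis
                  unfolding wp_Seq wp_RLoad wp_Cond wp_IAssign
                  using b8 bounds(1,4,6) pm S False
                  by (simp add: baseD[OF b8] nt fitsI0)
                    (rule wp_mono[OF fin[unfolded if_P[OF t]]]; auto)
              qed
            qed
          qed (use A6 in simp_all)
        qed (use A5 in simp_all)
      qed (use A4 in simp_all)
    qed simp_all
    have nt: "nat (int P + 2 * int m) = P + 2 * m" by simp
    have f: "int P + 2 * int m \<le> N" using bounds(7,8) by linarith
    show ?case
      unfolding wp_ILoad using b2 f bounds(5,6) ld main[unfolded wp_Seq] unfolding add.assoc
      by (simp add: baseD[OF b2] fitsI0)
  qed simp_all
qed simp_all

end

section \<open>All halvings: invariant and amortised cost\<close>

definition round_loop :: cmd where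
  "round_loop = While (ILess (Const 1) (IReg 5)) (level ;; IAssign 5 (IDiv (IReg 5) (Const 2)))"

context sorted_run
begin

text \<open>\<open>c\<close> halvings remain. The vector divided by \<open>2 ^ c\<close> has loads
  at most 1 and at least the initial relative weight; an edge has an even value as long as
  \<open>c\<close> exceeds \<open>sc e\<close>. The work is amortised: besides
  \<open>310 * P\<close> per halving, the decrease of the budget pays \<open>40 * h\<close> for each
  odd half-edge.\<close>

definition rounding_state :: "(nat \<Rightarrow> nat) \<Rightarrow> nat \<Rightarrow> regs \<Rightarrow> mem \<Rightarrow> nat \<Rightarrow> nat \<Rightarrow> bool" where
  "rounding_state X0 c s \<mu> W D \<longleftrightarrow> c \<le> J \<and> base s \<and> ireg s 5 = int (2 ^ c) \<and> static \<mu> \<and>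
     (\<forall>t. 2 * m \<le> t \<and> t < P \<longrightarrow> imem \<mu> 4 (P + t) = 0) \<and>
     (\<exists>X. (\<forall>e<m. imem \<mu> 3 e = int (X e) \<and> 2 ^ (c - sc e) dvd X e) \<and> (\<forall>v. load X v \<le> 2 ^ c) \<and>
        2 ^ c * (\<Sum>e<m. w e * real (X0 e)) \<le> 2 ^ J * (\<Sum>e<m. w e * real (X e))) \<and>
     W + 310 * P * c + 40 * h * budget q (2 ^ c) \<le> 310 * P * J + 40 * h * budget q (2 ^ J) \<and>
     D + 310 * (h + 1) * c \<le> 310 * (h + 1) * J"

lemma round_level:
  assumes "rounding_state X0 (Suc c) s \<mu> W D"
  shows "wp b UNIV UNIV level (\<lambda>s' \<mu>' W' D'.
     rounding_state X0 c (s'\<lparr>ireg := (ireg s')(5 := int (2 ^ c))\<rparr>) \<mu>' (W + (W' + 10)) (D + (D' + 10)) \<and>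
     ireg s' 5 = int (2 ^ Suc c)) s \<mu>"
proof -
  note A = assms[unfolded rounding_state_def]
  have s: "base s" and st: "static \<mu>" and r: "ireg s 5 = int (2 ^ Suc c)" and cJ: "Suc c \<le> J"
    and z: "\<And>t. 2 * m \<le> t \<Longrightarrow> t < P \<Longrightarrow> imem \<mu> 4 (P + t) = 0"
    and Wc: "W + 310 * P * Suc c + 40 * h * budget q (2 ^ Suc c) \<le> 310 * P * J + 40 * h * budget q (2 ^ J)"
    and Dc: "D + 310 * (h + 1) * Suc c \<le> 310 * (h + 1) * J"
    using A by blast+
  obtain X where X: "\<And>e. e < m \<Longrightarrow> imem \<mu> 3 e = int (X e)" "\<And>e. e < m \<Longrightarrow> 2 ^ (Suc c - sc e) dvd X e"
    and ld: "\<And>v. load X v \<le> 2 ^ Suc c"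
    and wt: "2 ^ Suc c * (\<Sum>e<m. w e * real (X0 e)) \<le> 2 ^ J * (\<Sum>e<m. w e * real (X e))"
    using A by blast
  have XJ: "X e \<le> 2 ^ J" if "e < m" for e
  proof -
    have "e \<in> halves (vt e)" using that by (simp add: halves_def)
    then have "X (e mod m) \<le> load X (vt e)"
      unfolding load_def by (intro member_le_sum) auto
    moreover have "(2::nat) ^ Suc c \<le> 2 ^ J" using cJ by (intro power_increasing) auto
    ultimately show ?thesis using ld[of "vt e"] that by simp
  qed
  interpret L: level_run n m vt b N q h P od st en w X
  proof unfold_locales
    fix e assume "e < m"
    then have "int (X e) \<le> int (2 ^ J)" using XJ by (simp only: of_nat_le_iff)
    moreover have "1 \<le> int (2 ^ J)" by simp
    ultimately show "int (X e) + 1 \<le> N" using JN(4) by linarith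
  qed
  \<comment> \<open>An odd value is compatible with the divisibility only if \<open>sc e\<close> is
    at least \<open>Suc c\<close>, and then an end of large degree comes from
    \<open>sc_witness\<close>.\<close>
  have odd_deg: "\<exists>g. g < 2 * m \<and> g mod m = e \<and> 2 * 2 ^ c \<le> 2 * q * deg (vt g)" if e: "e < m" "odd (X e)" for e
  proof -
    have "\<not> sc e < Suc c"
    proof
      assume "sc e < Suc c"
      then have "2 dvd (2::nat) ^ (Suc c - sc e)" by simp
      then show False using X(2)[OF e(1)] e(2) dvd_trans by blast
    qed
    then have "(2::nat) ^ Suc c \<le> 2 ^ sc e" by (intro power_increasing) auto
    then show ?thesis using sc_witness[OF e(1)] by fastforce
  qed
  have bud: "L.HA + budget q (2 ^ c) \<le> budget q (2 ^ Suc c)"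
    using odd_card_le[of X "2 ^ c" q] ld odd_deg unfolding L.sum_act by simp
  show ?thesis
  proof (rule wp_mono[OF L.wp_level[OF s st X(1) z]], goal_cases)
    case (4 s' \<mu>' W' D')
    note B = 4(1)
    obtain t where t: "\<And>e. e < m \<Longrightarrow> imem \<mu>' 3 e = int (L.rounded t e)"
      "0 \<le> (\<Sum>e<m. w e * real_of_int (L.sgn_of t e))" using B by blast
    \<comment> \<open>If \<open>sc e < c\<close>, the value is even and halving it is exact, so one
      factor 2 is used up; otherwise the required divisor is 1.\<close>
    have dv: "2 ^ (c - sc e) dvd L.rounded t e" if e: "e < m" for e
    proof (cases "sc e < c")
      case True
      then have 1: "Suc c - sc e = Suc (c - sc e)" by simp
      then have "2 * 2 ^ (c - sc e) dvd X e" using X(2)[OF e] by simp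
      then obtain k where k: "X e = 2 * 2 ^ (c - sc e) * k" by blast
      then have "L.rounded t e = 2 ^ (c - sc e) * k" by (simp add: L.rounded_def)
      then show ?thesis by simp
    qed simp
    have ld': "load (L.rounded t) v \<le> 2 ^ c" for v using L.load_rounded[of v "2 ^ c" t] ld[of v] by simp
    have "2 ^ J * (\<Sum>e<m. w e * real (X e)) \<le> 2 ^ J * (2 * (\<Sum>e<m. w e * real (L.rounded t e)))"
      using L.weight_rounded[of w t] t(2) by (intro mult_left_mono) auto
    then have "2 ^ J * (\<Sum>e<m. w e * real (X e)) \<le> 2 * (2 ^ J * (\<Sum>e<m. w e * real (L.rounded t e)))"
      by (simp only: mult.left_commute)
    moreover have "2 * (2 ^ c * (\<Sum>e<m. w e * real (X0 e))) \<le> 2 ^ J * (\<Sum>e<m. w e * real (X e))"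
      using wt by (simp only: power_Suc mult.assoc)
    ultimately have wt': "2 ^ c * (\<Sum>e<m. w e * real (X0 e)) \<le> 2 ^ J * (\<Sum>e<m. w e * real (L.rounded t e))"
      by linarith
    have "W' \<le> 300 * P + 40 * h * L.HA" "D' \<le> 300 * (h + 1)" "1 \<le> P" using B P_gt by simp_all
    moreover have "40 * h * L.HA + 40 * h * budget q (2 ^ c) \<le> 40 * h * budget q (2 ^ Suc c)"
      using mult_le_mono2[OF bud, of "40 * h"] by (simp only: distrib_left)
    ultimately have Wc': "W + (W' + 10) + 310 * P * c + 40 * h * budget q (2 ^ c) \<le> 310 * P * J + 40 * h * budget q (2 ^ J)"
      and Dc': "D + (D' + 10) + 310 * (h + 1) * c \<le> 310 * (h + 1) * J"
      using Wc Dc by (simp_all add: distrib_right distrib_left)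
    have bs: "base (s'\<lparr>ireg := (ireg s')(5 := int (2 ^ c))\<rparr>)" using B by (simp add: base_def)
    have "ireg s' 5 = int (2 ^ Suc c)" "static \<mu>'" "\<forall>t. 2 * m \<le> t \<and> t < P \<longrightarrow> imem \<mu>' 4 (P + t) = 0"
      using B r by metis+
    then show ?case
      unfolding rounding_state_def using bs cJ t(1) dv ld' wt' Wc' Dc'
      by (auto intro!: exI[of _ "L.rounded t"] simp del: of_nat_power)
  qed simp_all
qed

lemma wp_round_loop:
  assumes s: "base s" "ireg s 5 = int (2 ^ J)" and st: "static \<mu>"
    and z: "\<And>t. 2 * m \<le> t \<Longrightarrow> t < P \<Longrightarrow> imem \<mu> 4 (P + t) = 0"
    and X: "\<And>e. e < m \<Longrightarrow> imem \<mu> 3 e = int (X e)" "\<And>e. e < m \<Longrightarrow> 2 ^ (J - sc e) dvd X e"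
      "\<And>v. load X v \<le> 2 ^ J"
  shows "wp b UNIV UNIV round_loop (\<lambda>s' \<mu>' W D.
     (\<exists>Y. (\<forall>e<m. imem \<mu>' 3 e = int (Y e)) \<and> (\<forall>v. load Y v \<le> 1) \<and>
        (\<Sum>e<m. w e * real (X e)) \<le> 2 ^ J * (\<Sum>e<m. w e * real (Y e))) \<and>
     W \<le> 310 * P * J + 640 * h * q * m + 2 \<and> D \<le> 310 * (h + 1) * J + 2) s \<mu>"
  unfolding round_loop_def
proof (rule wp_While[where ?g0.0 = J and I = "\<lambda>c (s::regs) (\<mu>::mem) W (D::nat). rounding_state X c s \<mu> W D"], goal_cases)
  case 1
  show ?case unfolding rounding_state_def using assms by (auto intro!: exI[of _ X] simp del: of_nat_power)
next
  case (2 c s1 \<mu>1 W D)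
  note R = 2(1)
  note A = R[unfolded rounding_state_def]
  have r: "ireg s1 5 = int (2 ^ c)" "c \<le> J" using A by blast+
  have N1: "1 \<le> N" "2 \<le> N" using bounds by blast+
  have f: "fits b (1::int)" using N1 by (simp add: fitsI0)
  have "int (2 ^ c) \<le> int (2 ^ J)" using r(2) by (simp only: of_nat_le_iff) (intro power_increasing, auto)
  then have cN: "int (2 ^ c) \<le> N" using JN(3) by linarith
  show ?case
  proof (cases c)
    case 0
    have "budget q (2 ^ J) \<le> 16 * q * m" by (rule budget_le)
    then have "40 * h * budget q (2 ^ J) \<le> 40 * h * (16 * q * m)" by (intro mult_left_mono) auto
    also have "\<dots> = 640 * h * q * m" by simp
    finally have bd: "40 * h * budget q (2 ^ J) \<le> 640 * h * q * m" .
    have "W \<le> 310 * P * J + 40 * h * budget q (2 ^ J)" "D \<le> 310 * (h + 1) * J" using A 0 by simp_all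
    then have "W + 2 \<le> 310 * P * J + 640 * h * q * m + 2" "D + 2 \<le> 310 * (h + 1) * J + 2"
      using bd by linarith+
    moreover obtain Y where "\<And>e. e < m \<Longrightarrow> imem \<mu>1 3 e = int (Y e)" "\<And>v. load Y v \<le> 1"
        "(\<Sum>e<m. w e * real (X e)) \<le> 2 ^ J * (\<Sum>e<m. w e * real (Y e))"
      using A 0 by auto
    ultimately show ?thesis using r f 0 by auto
  next
    case (Suc c')
    have "wp b UNIV UNIV level (\<lambda>s' \<mu>' W' D'.
       rounding_state X c' (s'\<lparr>ireg := (ireg s')(5 := int (2 ^ c'))\<rparr>) \<mu>' (W + (2 + (W' + 2))) (D + (2 + (D' + 2))) \<and>
       ireg s' 5 = int (2 ^ Suc c')) s1 \<mu>1"
    proof (rule wp_mono[OF round_level[OF R[unfolded Suc]]], goal_cases)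
      case (1 s' \<mu>' W' D')
      have R': "rounding_state X c' (s'\<lparr>ireg := (ireg s')(5 := int (2 ^ c'))\<rparr>) \<mu>' (W + (W' + 10)) (D + (D' + 10))"
        using 1 by blast
      have "rounding_state X c' (s'\<lparr>ireg := (ireg s')(5 := int (2 ^ c'))\<rparr>) \<mu>' (W + (2 + (W' + 2))) (D + (2 + (D' + 2)))"
        using R' unfolding rounding_state_def by (elim conjE) (intro conjI; (assumption | linarith))
      then show ?case using 1 by blast
    qed
    then have lev: "wp b UNIV UNIV (level ;; IAssign 5 (IDiv (IReg 5) (Const 2))) (\<lambda>s' \<mu>' W' D'.
       rounding_state X c' s' \<mu>' (W + (2 + W')) (D + (2 + D'))) s1 \<mu>1"
      unfolding wp_Seq
    proof (rule wp_mono, goal_cases)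
      case (1 s' \<mu>' W' D')
      have v: "ireg s' 5 = int (2 ^ Suc c')" using 1 by blast
      have "int (2 ^ c') \<le> int (2 ^ Suc c')" by (simp only: of_nat_le_iff) simp
      moreover have "int (2 ^ Suc c') \<le> N" using cN unfolding Suc .
      ultimately have "int (2 ^ c') \<le> N" by linarith
      then have f': "fits b (int (2 ^ Suc c'))" "fits b (int (2 ^ c'))" "fits b (2::int)"
        using cN Suc N1 by (simp_all add: fitsI0 del: of_nat_power)
      have d: "int (2 ^ Suc c') div 2 = int (2 ^ c')" by simp
      show ?case unfolding wp_IAssign using 1 f'
        by (simp add: v d del: of_nat_power power_Suc)
    qed
    have "(1::int) \<le> 2 ^ c'" by simp
    then have "(1::int) < 2 * 2 ^ c'" by linarith
    then have "1 < int (2 ^ c)" using Suc by simp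
    then show ?thesis using r f cN Suc lev
      by (simp add: fitsI0 del: of_nat_power power_Suc) (rule wp_mono[OF lev]; auto)
  qed
qed

end

section \<open>Assembly of the phases and the approximation ratio\<close>

definition sizes :: cmd where
  "sizes = IAssign 2 (IAdd (IReg 1) (IReg 1)) ;; IAssign 3 (Const 1) ;; IAssign 4 (Const 0) ;;
     While (BNot (ILess (IReg 2) (IReg 3)))
       (IAssign 3 (IMul (Const 2) (IReg 3)) ;; IAssign 4 (IAdd (IReg 4) (Const 1)))"

definition core :: "nat \<Rightarrow> cmd" where
  "core q = load_weights ;; rscan ;; RLoad 10 3 (IAdd (IReg 3) (IReg 1)) ;; classify q ;; make_keys q ;;
     sort_halves ;; segments ;; mwu q ;; cap q ;; discretize q ;; round_loop"

context half_edges
begin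

lemma matching_idx_singleton: "e < m \<Longrightarrow> matching_idx {e}"
  by (simp add: matching_idx_def)

lemma finite_matchings: "finite {B. matching_idx B}"
  by (rule finite_subset[of _ "Pow {..<m}"]) (auto simp: matching_idx_def)

lemma obtain_max_matching:
  fixes u :: "nat \<Rightarrow> real"
  obtains B where "matching_idx B" "\<And>B'. matching_idx B' \<Longrightarrow> sum u B' \<le> sum u B"
proof -
  have ne: "{B. matching_idx B} \<noteq> {}" by (auto simp: matching_idx_def intro: exI[of _ "{}"])
  have "Max (sum u ` {B. matching_idx B}) \<in> sum u ` {B. matching_idx B}"
    using finite_matchings ne by (intro Max_in) auto
  then obtain B where B: "matching_idx B" "sum u B = Max (sum u ` {B. matching_idx B})" by auto
  have "sum u B' \<le> sum u B" if "matching_idx B'" for B'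
    unfolding B(2) using finite_matchings that by (intro Max_ge) auto
  with B(1) show ?thesis by (rule that)
qed

text \<open>The product \<open>(1 - x) * (1 - 3 * x) * (1 - x)\<close> exceeds
  \<open>1 - 5 * x\<close> by \<open>x * x * (7 - 3 * x)\<close>.\<close>

lemma approximation_factors:
  fixes x V A :: real
  assumes "0 \<le> x" "6 * x \<le> 1" "0 \<le> V" "(1 - x) * V \<le> A"
  shows "(1 - 5 * x) * V \<le> (1 - x) * (1 - 3 * x) * A"
proof -
  have "0 \<le> x * x * (7 - 3 * x)" using assms by (intro mult_nonneg_nonneg) auto
  then have "1 - 5 * x \<le> (1 - x) * (1 - 3 * x) * (1 - x)" by (simp add: algebra_simps)
  then have "(1 - 5 * x) * V \<le> (1 - x) * (1 - 3 * x) * (1 - x) * V"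
    using assms by (intro mult_right_mono)
  also have "\<dots> = (1 - x) * (1 - 3 * x) * ((1 - x) * V)" by simp
  also have "\<dots> \<le> (1 - x) * (1 - 3 * x) * A" using assms by (intro mult_left_mono mult_nonneg_nonneg) auto
  finally show ?thesis .
qed

text \<open>Five losses are the factors of \<open>uY\<close> together with the one from rounding the
  weights. The sixth is due to raised weights: each is at most
  \<open>sum w {..<m} / (q * m * m)\<close>, and as every edge alone is a matching, the total weight
  is at most \<open>m\<close> times the optimum, so all of them together gain at most
  \<open>1 / q\<close> of the optimum.\<close>

lemma approximation_chain:
  fixes w u :: "nat \<Rightarrow> real" and q :: nat
  assumes q: "6 \<le> q" and w: "\<And>e. e < m \<Longrightarrow> 0 < w e"
    and u: "\<And>e. e < m \<Longrightarrow> (1 - 1 / q) * w e \<le> u e"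
      "\<And>e. e < m \<Longrightarrow> u e \<le> w e \<or> u e * (real q * (real m * real m)) \<le> sum w {..<m}"
    and Y: "\<And>v. load Y v \<le> (1::nat)"
    and B: "matching_idx B" "\<And>B'. matching_idx B' \<Longrightarrow> sum u B' \<le> sum u B"
    and uY: "(1 - 1 / q) * (1 - 3 / q) * sum u B \<le> (\<Sum>e<m. u e * real (Y e))"
    and A: "matching_idx A"
  shows "(1 - 6 / q) * sum w A \<le> (\<Sum>e<m. w e * real (Y e))"
proof -
  obtain V where V: "matching_idx V" "\<And>V'. matching_idx V' \<Longrightarrow> sum w V' \<le> sum w V"
    using obtain_max_matching[of w] by blast
  define x where "x = 1 / real q"
  have x: "0 < x" "6 * x \<le> 1" using q by (simp_all add: x_def field_simps)
  have Y1: "Y e \<le> 1" if "e < m" for e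
  proof -
    have "e \<in> halves (vt e)" using that by (simp add: halves_def)
    then have "Y (e mod m) \<le> load Y (vt e)" unfolding load_def by (intro member_le_sum) auto
    then show ?thesis using Y[of "vt e"] that by simp
  qed
  have wV: "w e \<le> sum w V" if "e < m" for e using V(2)[OF matching_idx_singleton[OF that]] by simp
  have V0: "0 \<le> sum w V"
    using V(1) w by (intro sum_nonneg) (force simp: matching_idx_def intro: less_imp_le)
  have m0: "0 < real m" using m_pos by simp
  have "sum w {..<m} \<le> of_nat (card {..<m}) * sum w V" using wV by (intro sum_bounded_above) auto
  then have S: "sum w {..<m} \<le> real m * sum w V" by simp
  have "u e * real (Y e) \<le> w e * real (Y e) + x * sum w V / real m" if e: "e < m" for e
  proof -
    have c: "0 \<le> x * sum w V / real m" using x V0 by simp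
    from u(2)[OF e] show ?thesis
    proof
      assume "u e \<le> w e"
      then have "u e * real (Y e) \<le> w e * real (Y e)" by (intro mult_right_mono) auto
      then show ?thesis using c by linarith
    next
      assume "u e * (real q * (real m * real m)) \<le> sum w {..<m}"
      then have "u e * (real q * (real m * real m)) \<le> real m * sum w V" using S by linarith
      then have "u e \<le> x * sum w V / real m"
        using m0 q by (simp add: x_def field_simps)
      moreover have "0 \<le> u e" using u(1)[OF e] w[OF e] x by (smt (verit) mult_nonneg_nonneg x_def)
      then have "u e * real (Y e) \<le> u e * 1" using Y1[OF e] by (intro mult_left_mono) auto
      moreover have "0 \<le> w e * real (Y e)" using w[OF e] by simp
      ultimately show ?thesis by linarith
    qed
  qed
  then have "(\<Sum>e<m. u e * real (Y e)) \<le> (\<Sum>e<m. w e * real (Y e) + x * sum w V / real m)"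
    by (intro sum_mono) auto
  also have "\<dots> = (\<Sum>e<m. w e * real (Y e)) + x * sum w V" using m0 by (simp add: sum.distrib)
  finally have 1: "(\<Sum>e<m. u e * real (Y e)) \<le> (\<Sum>e<m. w e * real (Y e)) + x * sum w V" .
  have "(1 - x) * sum w V = (\<Sum>e\<in>V. (1 - 1 / q) * w e)" by (simp add: sum_distrib_left x_def)
  also have "\<dots> \<le> sum u V" using V(1) u(1) by (intro sum_mono) (auto simp: matching_idx_def)
  also have "\<dots> \<le> sum u B" by (rule B(2)[OF V(1)])
  finally have "(1 - 5 * x) * sum w V \<le> (1 - x) * (1 - 3 * x) * sum u B"
    using x V0 by (intro approximation_factors) auto
  also have "\<dots> \<le> (\<Sum>e<m. u e * real (Y e))" using uY by (simp add: x_def)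
  finally have "(1 - 6 * x) * sum w V \<le> (\<Sum>e<m. w e * real (Y e))" using 1 by (simp add: algebra_simps)
  moreover have "(1 - 6 * x) * sum w A \<le> (1 - 6 * x) * sum w V"
    using V(2)[OF A] x by (intro mult_left_mono) auto
  ultimately show ?thesis by (simp add: x_def)
qed

end

context run
begin

lemma wp_sizes:
  assumes s: "ireg s 0 = int n" "ireg s 1 = int m"
  shows "wp b UNIV UNIV sizes (\<lambda>s' \<mu>' W D. base s' \<and> \<mu>' = \<mu> \<and> W \<le> 7 * h + 7 \<and> D \<le> 7 * h + 7) s \<mu>"
proof -
  have f: "fits b (0::int)" "fits b (1::int)" "fits b (2::int)" "fits b (int m)" "fits b (2 * int m)"
    using bounds(1,2,4,5) by (simp_all add: fitsI0)
  define I where "I = (\<lambda>g (s::regs) (\<nu>::mem) W (D::nat). \<nu> = \<mu> \<and> ireg s 0 = int n \<and> ireg s 1 = int m \<and>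
      ireg s 2 = 2 * int m \<and> g \<le> h \<and> ireg s 3 = int (2 ^ (h - g)) \<and> ireg s 4 = int (h - g) \<and>
      W \<le> 7 * (h - g) \<and> D \<le> 7 * (h - g))"
  have loop: "wp b UNIV UNIV (While (BNot (ILess (IReg 2) (IReg 3)))
       (IAssign 3 (IMul (Const 2) (IReg 3)) ;; IAssign 4 (IAdd (IReg 4) (Const 1))))
     (\<lambda>s' \<mu>' W D. base s' \<and> \<mu>' = \<mu> \<and> W \<le> 7 * h + 3 \<and> D \<le> 7 * h + 3) s1 \<mu>"
    if "ireg s1 0 = int n" "ireg s1 1 = int m" "ireg s1 2 = 2 * int m" "ireg s1 3 = 1" "ireg s1 4 = 0" for s1
  proof (rule wp_While[where I = I and ?g0.0 = h], goal_cases)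
    case 1
    show ?case using that by (simp add: I_def)
  next
    case (2 g s2 \<nu> W D)
    note A = 2(1)[unfolded I_def]
    have "(2::nat) ^ (h - g) \<le> P" unfolding P_eq by (intro power_increasing) auto
    then have pP: "int (2 ^ (h - g)) \<le> int P" by (simp only: of_nat_le_iff)
    then have pN: "int (2 ^ (h - g)) \<le> N" "2 * int (2 ^ (h - g)) \<le> N" using bounds(6,8) by linarith+
    have hN: "int (h - g) + 1 \<le> N" "int (h - g) \<le> N" using bounds(7,8) h_less_P by linarith+
    show ?case
    proof (cases g)
      case 0
      then have "2 * int m < int (2 ^ (h - g))" using bounds(7) by (simp add: P_eq)
      moreover have "base s2" unfolding base_def using A 0 by (simp add: P_eq)
      ultimately show ?thesis using A 0 f pN by (simp add: fitsI0 del: of_nat_power)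
    next
      case (Suc g')
      have "Suc g' \<le> h" using A Suc by simp
      then have hg: "h - g' = Suc (h - g)" using Suc by linarith
      have "2 * 2 ^ (h - g) \<le> P" unfolding P_eq power_Suc[symmetric] hg[symmetric] by (intro power_increasing) auto
      then have le: "2 ^ (h - g) \<le> 2 * m" using P_le by linarith
      then have "int (2 ^ (h - g)) \<le> int (2 * m)" by (simp only: of_nat_le_iff)
      then have "\<not> 2 * int m < int (2 ^ (h - g))" by simp
      moreover have "2 * int (2 ^ (h - g)) = int (2 ^ (h - g'))" unfolding hg by simp
      ultimately show ?thesis using A Suc f pN hN hg
        by (simp add: fitsI0 wp_simps I_def del: of_nat_power power_Suc)
           (auto intro!: exI[of _ g'] simp del: of_nat_power power_Suc)
    qed
  qed
  show ?thesis
    unfolding sizes_def wp_Seq wp_IAssign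
    using s f by simp (rule wp_mono[OF loop]; auto)
qed

text \<open>The summands of \<open>K\<close> stem from the classes, the sorting passes, the rounds
  of multiplicative weights, the loops of length \<open>J \<le> q + h\<close> with
  \<open>355 = 5 + 40 + 310\<close>, and the pointer jumping, which costs \<open>40 * h\<close>
  times a budget of at most \<open>16 * q * m\<close>.\<close>

lemma wp_core:
  assumes q6: "6 \<le> q" and s: "base s"
    and v: "\<And>e. e < m \<Longrightarrow> imem \<mu> 1 e = int (vt e)" "\<And>e. e < m \<Longrightarrow> imem \<mu> 2 e = int (vt (m + e))"
    and w: "\<And>e. e < m \<Longrightarrow> rmem \<mu> 0 e = w e" "\<And>e. e < m \<Longrightarrow> 0 < w e"
    and z: "\<And>i. imem \<mu> 4 i = 0" "\<And>i. imem \<mu> 11 i = 0" "\<And>i. rmem \<mu> 5 i = 0"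
    and L: "n * M \<le> 2 ^ L"
  defines "K \<equiv> 60 * M + 100 * L + 200 * (q * q * h) + 355 * (q + h) + 640 * (q * h) + 600"
  shows "wp b UNIV UNIV (core q) (\<lambda>s' \<mu>' W D.
     (\<exists>Y. (\<forall>e<m. imem \<mu>' 3 e = int (Y e)) \<and> (\<forall>v. load Y v \<le> 1) \<and>
        (\<forall>A. matching_idx A \<longrightarrow> (1 - 6 / q) * sum w A \<le> (\<Sum>e<m. w e * real (Y e)))) \<and>
     W \<le> P * K \<and> D \<le> (h + 1) * K) s \<mu>"
  unfolding core_def wp_Seq
proof (rule wp_mono[OF wp_load_weights[OF s]], goal_cases)
  case (1 s1 \<mu>1 W1 D1)
  note A1 = 1(1)
  note sm1 = sameD[OF 1(2)[unfolded load_weights_def]]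
  have b1: "base s1" using A1 s by simp
  have P1: "ireg s1 3 = 2 ^ h" using baseD(4)[OF b1] unfolding P_eq by simp
  have NP: "4 * 2 ^ h \<le> N" using N_P by (simp add: P_eq)
  have k1: "imem \<mu>1 = imem \<mu>" "rmem \<mu>1 0 = rmem \<mu> 0" "rmem \<mu>1 5 = rmem \<mu> 5"
    by (rule ext, rule sm1, simp) (rule sm1; simp)+
  show ?case
  proof (rule wp_mono[OF wp_rscan[OF P1 NP]], goal_cases)
    case (1 s2 \<mu>2 W2 D2)
    note A2 = 1(1)[folded P_eq]
    note sm2 = sameD[OF 1(2)[unfolded rscan_def up_sweep_def down_sweep_def]]
    have b2: "base s2" using base_rscan[OF 1(2) b1] .
    have k2: "imem \<mu>2 = imem \<mu>" "rmem \<mu>2 0 = rmem \<mu> 0" "rmem \<mu>2 5 = rmem \<mu> 5"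
      unfolding k1[symmetric] by (rule ext, rule sm2, simp) (rule sm2; simp)+
    define S where "S = sum w {..<m}"
    have "rmem \<mu>2 3 (P + m) = (\<Sum>t<m. rmem \<mu>1 2 (P + t))" using A2 P_gt by simp
    also have "\<dots> = S" unfolding S_def using A1 w(1) by (intro sum.cong) auto
    finally have S: "rmem \<mu>2 3 (P + m) = S" .
    let ?s3 = "s2\<lparr>rreg := (rreg s2)(10 := S)\<rparr>"
    have b3: "base ?s3" using b2 by (simp add: base_def)
    have wS: "w e \<le> S" if "e < m" for e
      unfolding S_def using that w(2) by (intro member_le_sum) (auto intro: less_imp_le)
    have S0: "0 < S" using wS[OF m_pos] w(2)[OF m_pos] by linarith
    have r3: "rreg ?s3 10 = S" by simp
    have w2: "rmem \<mu>2 0 e = w e" if "e < m" for e using w(1)[OF that] k2 by simp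
    have main: "wp b UNIV UNIV (classify q) (\<lambda>s4 \<mu>4 W4 D4. wp b UNIV UNIV (make_keys q) (\<lambda>s5 \<mu>5 W5 D5.
        wp b UNIV UNIV sort_halves (\<lambda>s6 \<mu>6 W6 D6. wp b UNIV UNIV segments (\<lambda>s7 \<mu>7 W7 D7.
        wp b UNIV UNIV (mwu q) (\<lambda>s8 \<mu>8 W8 D8. wp b UNIV UNIV (cap q) (\<lambda>s9 \<mu>9 W9 D9.
        wp b UNIV UNIV (discretize q) (\<lambda>s10 \<mu>10 W10 D10. wp b UNIV UNIV round_loop (\<lambda>s' \<mu>' W D.
     (\<exists>Y. (\<forall>e<m. imem \<mu>' 3 e = int (Y e)) \<and> (\<forall>v. load Y v \<le> 1) \<and>
        (\<forall>A. matching_idx A \<longrightarrow> (1 - 6 / q) * sum w A \<le> (\<Sum>e<m. w e * real (Y e)))) \<and>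
     W1 + (W2 + (2 + (W4 + (W5 + (W6 + (W7 + (W8 + (W9 + (W10 + W))))))))) \<le> P * K \<and>
     D1 + (D2 + (2 + (D4 + (D5 + (D6 + (D7 + (D8 + (D9 + (D10 + D))))))))) \<le> (h + 1) * K)
        s10 \<mu>10) s9 \<mu>9) s8 \<mu>8) s7 \<mu>7) s6 \<mu>6) s5 \<mu>5) s4 \<mu>4) ?s3 \<mu>2"
    proof (rule wp_mono[OF wp_classify[OF b3 r3 S0 w2 w(2) wS]], goal_cases)
      case (4 s4 \<mu>4 W4 D4)
      note A4 = 4(1)
      note sm4 = sameD[OF 4(2)[unfolded classify_def class_loop_def]]
      have b4: "base s4" using A4 b3 by simp
      have "\<forall>e. \<exists>k. e < m \<longrightarrow> k < M \<and> imem \<mu>4 6 e = int k \<and> rmem \<mu>4 1 e = S * (1 - 1 / q) ^ k" using A4 by blast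
      then obtain k where k: "\<And>e. e < m \<Longrightarrow> k e < M" "\<And>e. e < m \<Longrightarrow> imem \<mu>4 6 e = int (k e)"
        "\<And>e. e < m \<Longrightarrow> rmem \<mu>4 1 e = S * (1 - 1 / q) ^ k e" by metis
      define u where "u e = S * (1 - 1 / real q) ^ k e" for e
      have u4: "rmem \<mu>4 1 e = u e" if "e < m" for e using k(3)[OF that] by (simp add: u_def)
      have u: "(1 - 1 / q) * w e \<le> u e" "u e \<le> w e \<or> u e * (real q * (real m * real m)) \<le> sum w {..<m}"
        if "e < m" for e
        using A4 u4[OF that] that unfolding S_def[symmetric] by metis+
      have u0: "0 < u e" for e using S0 q by (simp add: u_def)
      have k4: "imem \<mu>4 1 = imem \<mu> 1" "imem \<mu>4 2 = imem \<mu> 2" "imem \<mu>4 4 = imem \<mu> 4" "imem \<mu>4 11 = imem \<mu> 11"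
        "rmem \<mu>4 5 = rmem \<mu> 5"
        unfolding k2[symmetric] by (rule sm4; simp)+
      have v4: "imem \<mu>4 1 e = int (vt e)" "imem \<mu>4 2 e = int (vt (m + e))" if "e < m" for e
        using v that k4 by simp_all
      show ?case
      proof (rule wp_mono[OF wp_make_keys[OF b4 v4 k(2,1)]], goal_cases)
        case (5 s5 \<mu>5 W5 D5)
        note A5 = 5(1)
        note sm5 = sameD[OF 5(2)[unfolded make_keys_def]]
        have b5: "base s5" and r5: "ireg s5 5 = int M" using A5 by blast+
        have k5: "rmem \<mu>5 = rmem \<mu>4" "imem \<mu>5 1 = imem \<mu>4 1" "imem \<mu>5 2 = imem \<mu>4 2" "imem \<mu>5 4 = imem \<mu>4 4" "imem \<mu>5 11 = imem \<mu>4 11"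
            by (rule ext, rule sm5, simp) (rule sm5; simp)+
        define key where "key g = vt g * M + k (g mod m)" for g
        have key5: "imem \<mu>5 7 g = int (key g)" "imem \<mu>5 8 g = int g" "imem \<mu>5 10 g = int (vt g)" if "g < 2 * m" for g
          using A5 that by (auto simp: key_def)
        have kM: "k (g mod m) < M" for g using k(1) m_pos by simp
        have key_n: "key g < n * M" if "g < 2 * m" for g
        proof -
          have "key g < (vt g + 1) * M" using kM[of g] by (simp add: key_def)
          also have "\<dots> \<le> n * M" using vt_less[OF that] by (intro mult_right_mono) auto
          finally show ?thesis .
        qed
        have key_vt: "key g div M = vt g" for g using kM[of g] by (simp add: key_def)
        have key_k: "key g mod M = k (g mod m)" for g using kM[of g] by (simp add: key_def)
        have z5: "imem \<mu>5 4 (P + t) = 0" for t using k5 k4 z(1) by simp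
        show ?case
        proof (rule wp_mono[OF wp_sort_halves[OF b5 r5 L key5(1) key_n key5(2) z5]], goal_cases)
          case (4 s6 \<mu>6 W6 D6)
          note A6 = 4(1)
          note sm6 = sameD[OF 4(2)[unfolded sort_halves_def sort_pass_def key_bits_def scatter_def copy_back_def
                iscan_def up_sweep_def down_sweep_def]]
          have b6: "base s6" using A6 by blast
          obtain od where od: "\<And>i. i < 2 * m \<Longrightarrow> imem \<mu>6 8 i = int (od i)" "bij_betw od {..<2 * m} {..<2 * m}"
            "\<And>i j. i < j \<Longrightarrow> j < 2 * m \<Longrightarrow> key (od i) \<le> key (od j)" using A6 by blast
          have k6: "rmem \<mu>6 = rmem \<mu>5" "imem \<mu>6 1 = imem \<mu>5 1" "imem \<mu>6 2 = imem \<mu>5 2" "imem \<mu>6 10 = imem \<mu>5 10" "imem \<mu>6 11 = imem \<mu>5 11"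
            by (rule ext, rule sm6, simp) (rule sm6; simp)+
          have z6: "imem \<mu>6 4 (P + t) = 0" if "2 * m \<le> t" "t < P" for t using A6 that by blast
          have mono: "vt (od i) \<le> vt (od j)" if "i < j" "j < 2 * m" for i j
            using div_le_mono[OF od(3)[OF that], of M] unfolding key_vt .
          define st en where "st = seg_start od" and "en = seg_end od"
          have so: "sorted_halves n m vt od st en"
            unfolding st_def en_def by (rule sorted_halves_seg[OF od(2) mono])
          have z11: "imem \<mu>6 11 0 = 0" "imem \<mu>6 11 (2 * m + 1) = 0" using k6 k5 k4 z(2) by simp_all
          have v6: "imem \<mu>6 10 g = int (vt g)" if "g < 2 * m" for g using key5(3)[OF that] k6 by simp
          show ?case
          proof (rule wp_mono[OF wp_segments[OF b6 so od(1) v6 z11]], goal_cases)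
            case (3 s7 \<mu>7 W7 D7)
            note A7 = 3(1)
            note sm7 = sameD[OF 3(2)[unfolded segments_def]]
            have b7: "base s7" using A7 b6 by simp
            have k7: "rmem \<mu>7 = rmem \<mu>6" "imem \<mu>7 1 = imem \<mu>6 1" "imem \<mu>7 2 = imem \<mu>6 2" "imem \<mu>7 4 = imem \<mu>6 4" "imem \<mu>7 8 = imem \<mu>6 8"
              "imem \<mu>7 10 = imem \<mu>6 10"
            by (rule ext, rule sm7, simp) (rule sm7; simp)+
            interpret so: sorted_halves n m vt od st en by (rule so)
            have sr: "sorted_run n m vt b N q h P od st en u"
            proof (unfold_locales, goal_cases)
              case (1 e)
              show ?case by (rule u0)
            next
              case (2 v i j)
              have j: "j < 2 * m" using 2 so.en_le[of v] by simp
              have vv: "vt (od i) = v" "vt (od j) = v" using so.seg[of i v] so.seg[of j v] 2 j by auto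
              have "key (od i) \<le> key (od j)" using od(3)[of i j] 2 j by (cases "i = j") auto
              then have "k (od i mod m) \<le> k (od j mod m)" unfolding key_def vv by simp
              then show ?case unfolding u_def using S0 q by (intro mult_left_mono power_decreasing) auto
            qed
            interpret sr: sorted_run n m vt b N q h P od st en u by (rule sr)
            have st7: "sr.static \<mu>7"
              unfolding sr.static_def using v4 u4 od(1) v6 A7 k7 k6 k5 by simp
            have z7: "rmem \<mu>7 5 e = 0" for e using z(3) k7 k6 k5 k4 by simp
            show ?case
            proof (rule wp_mono[OF sr.wp_mwu[OF b7 st7 z7]], goal_cases)
              case (1 s8 \<mu>8 W8 D8)
              note A8 = 1(1)
              note sm8 = sameD[OF 1(2)[unfolded mwu_def mwu_init_def mwu_step_def mwu_leaves_def mwu_truncate_def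
                    mwu_update_def rscan_def up_sweep_def down_sweep_def]]
              have b8: "base s8" and st8: "sr.static \<mu>8" and r8: "ireg s8 9 = int sr.T" using A8 by blast+
              obtain Z where Z: "\<And>e. e < m \<Longrightarrow> rmem \<mu>8 5 e = Z e" "\<And>e. e < m \<Longrightarrow> 0 \<le> Z e"
                "\<And>v. load Z v \<le> real sr.T"
                "\<And>A. matching_idx A \<Longrightarrow> (\<And>e. e < m \<Longrightarrow> u e \<le> sum u A) \<Longrightarrow>
                   real sr.T * ((1 - 3 / q) * sum u A) \<le> (\<Sum>e<m. u e * Z e)" using A8 by blast
              have k8: "imem \<mu>8 4 = imem \<mu>7 4" by (rule sm8; simp)
              show ?case
              proof (rule wp_mono[OF wp_cap[OF b8]], goal_cases)
                case (1 s9 \<mu>9 W9 D9)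
                note A9 = 1(1)
                have b9: "base s9" "ireg s9 5 = int (2 ^ J)" "ireg s9 9 = int sr.T" and mu9: "\<mu>9 = \<mu>8"
                  using A9 r8 by auto
                have st9: "sr.static \<mu>9" using st8 mu9 by simp
                have Z9: "rmem \<mu>9 5 e = Z e" if "e < m" for e using Z(1)[OF that] mu9 by simp
                show ?case
                proof (rule wp_mono[OF sr.wp_discretize[OF b9(1) st9 b9(2,3) Z9 Z(2,3)]], goal_cases)
                  case (3 s10 \<mu>10 W10 D10)
                  note A10 = 3(1)
                  note sm10 = sameD[OF 3(2)[unfolded discretize_def scale_digits_def scale_loop_def digit_loop_def]]
                  have b10: "base s10" "ireg s10 5 = int (2 ^ J)" using A10 b9 by auto
                  have st10: "sr.static \<mu>10" by (rule sr.static_cong[OF st9]) (rule sm10; simp)+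
                  have k10: "imem \<mu>10 4 = imem \<mu>9 4" by (rule sm10; simp)
                  have z10: "imem \<mu>10 4 (P + t) = 0" if "2 * m \<le> t" "t < P" for t
                    using z6[OF that] k10 mu9 k8 k7 by simp
                  obtain X where X: "\<And>e. e < m \<Longrightarrow> imem \<mu>10 3 e = int (X e)"
                    "\<And>e. e < m \<Longrightarrow> 2 ^ (J - sr.sc e) dvd X e"
                    "\<And>e. e < m \<Longrightarrow> 2 ^ J * ((1 - 1 / q) * (Z e / sr.T)) \<le> real (X e)"
                    "\<And>v. load X v \<le> 2 ^ J" using A10 by blast
                  show ?case
                  proof (rule wp_mono[OF sr.wp_round_loop[OF b10 st10 z10 X(1,2,4)]], goal_cases)
                    case (5 s' \<mu>' W D)
                    obtain Y where Y: "\<And>e. e < m \<Longrightarrow> imem \<mu>' 3 e = int (Y e)" "\<And>v. load Y v \<le> 1"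
                      "(\<Sum>e<m. u e * real (X e)) \<le> 2 ^ J * (\<Sum>e<m. u e * real (Y e))" using 5(1) by blast
                    have "(1 - 6 / q) * sum w A \<le> (\<Sum>e<m. w e * real (Y e))" if A: "matching_idx A" for A
                    proof -
                      obtain B where B: "matching_idx B" "\<And>B'. matching_idx B' \<Longrightarrow> sum u B' \<le> sum u B"
                        using obtain_max_matching[of u] by blast
                      have T0: "0 < real sr.T" using q h_pos by (simp add: sr.T_def)
                      \<comment> \<open>Every single edge is a matching, so the heaviest matching
                        meets the condition under which the bound for multiplicative weights
                        holds.\<close>
                      have uB: "u e \<le> sum u B" if "e < m" for e using B(2)[OF matching_idx_singleton[OF that]] by simp
                      have "(1 - 1 / q) * (1 - 3 / q) * sum u B
                          = (1 - 1 / q) / sr.T * (real sr.T * ((1 - 3 / q) * sum u B))" using T0 by simp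
                      also have "\<dots> \<le> (1 - 1 / q) / sr.T * (\<Sum>e<m. u e * Z e)"
                        using q T0 Z(4)[OF B(1) uB] by (intro mult_left_mono) auto
                      finally have "2 ^ J * ((1 - 1 / q) * (1 - 3 / q) * sum u B)
                          \<le> 2 ^ J * ((1 - 1 / q) / sr.T * (\<Sum>e<m. u e * Z e))" by (intro mult_left_mono) auto
                      also have "\<dots> = (\<Sum>e<m. u e * (2 ^ J * ((1 - 1 / q) * (Z e / sr.T))))"
                        by (simp add: sum_distrib_left sum_divide_distrib mult_ac)
                      also have "\<dots> \<le> (\<Sum>e<m. u e * real (X e))"
                        using X(3) u0 by (intro sum_mono mult_left_mono) (auto intro: less_imp_le)
                      also note Y(3)
                      finally have uY: "(1 - 1 / q) * (1 - 3 / q) * sum u B \<le> (\<Sum>e<m. u e * real (Y e))" by simp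
                      show ?thesis by (rule approximation_chain[OF q6 w(2) u Y(2) B uY A])
                    qed
                    moreover have "W1 + (W2 + (2 + (W4 + (W5 + (W6 + (W7 + (W8 + (W9 + (W10 + W))))))))) \<le> P * K"
                    proof -
                      have a: "W1 \<le> 10 * P" "W2 \<le> 40 * P" "2 \<le> 2 * P" "W4 \<le> P * (60 * M + 40)" "W5 \<le> 30 * P"
                        "W6 \<le> P * (100 * L + 100)" "W7 \<le> 50 * P" "W8 \<le> P * (200 * (q * q * h) + 200)"
                        "W9 \<le> 5 * J + 5" "W10 \<le> P * (40 * J + 90)"
                        using A1 A2 A4 A5 A6 A7 A8 A9 A10 5(1) P_gt by (simp_all add: algebra_simps sr.T_def)
                      have "m \<le> P" using P_gt by simp
                      then have "640 * h * q * m \<le> P * (640 * (q * h))"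
                        using mult_le_mono2[of m P "640 * h * q"] by (simp only: mult_ac)
                      moreover have "W \<le> 310 * P * J + 640 * h * q * m + 2" using 5(1) by blast
                      moreover have "310 * P * J = P * (310 * J)" by simp
                      ultimately have "W \<le> P * (310 * J) + P * (640 * (q * h)) + 2" by linarith
                      moreover have "J * 1 \<le> (q + h) * P" using J_bound(3) P_gt by (intro mult_mono) simp_all
                      moreover have "P * J \<le> P * (q + h)" using J_bound(3) by (intro mult_left_mono) auto
                      ultimately show ?thesis using a P_gt unfolding K_def by (simp add: algebra_simps)
                    qed
                    moreover have "D1 + (D2 + (2 + (D4 + (D5 + (D6 + (D7 + (D8 + (D9 + (D10 + D))))))))) \<le> (h + 1) * K"
                    proof -
                      define H where "H = h + 1"
                      have H: "1 \<le> H" by (simp add: H_def)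
                      have a: "D1 \<le> 10 * H" "D2 \<le> 40 * H" "2 \<le> 2 * H" "D4 \<le> 60 * M + 40" "D5 \<le> 30 * H"
                        "D6 \<le> H * (100 * L + 100)" "D7 \<le> 50 * H" "D8 \<le> H * (200 * (q * q * h) + 200)"
                        "D9 \<le> 5 * J + 5" "D10 \<le> 40 * J + 90" "D \<le> H * (310 * J) + 2"
                        using A1 A2 A4 A5 A6 A7 A8 A9 A10 5(1) unfolding H_def by (simp_all add: algebra_simps sr.T_def)
                      have "1 * (60 * M + 40) \<le> H * (60 * M + 40)" "1 * J \<le> H * (q + h)" "H * J \<le> H * (q + h)"
                        using H J_bound(3) by (intro mult_mono; simp)+
                      then show ?thesis using a H unfolding K_def H_def[symmetric] by (simp add: algebra_simps)
                    qed
                    ultimately show ?case using Y(1,2) by blast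
                  qed simp_all
                qed simp_all
              qed
            qed
          qed simp_all
        qed simp_all
      qed simp_all
    qed simp_all
    have nt: "nat (int P + int m) = P + m" by simp
    have pm: "int P + int m \<le> N" using bounds(7,8) by linarith
    show ?case
      unfolding wp_RLoad using b2 bounds(4,6) pm S main unfolding add.assoc
      by (simp add: baseD[OF b2] nt fitsI0)
  qed
qed

end

section \<open>The complete program on a list of edges, its word size and its cost\<close>

definition approx_mwm :: "nat \<Rightarrow> cmd" where
  "approx_mwm q = ILoad 0 0 (Const 0) ;; ILoad 1 0 (Const 1) ;;
     Cond (ILess (Const 0) (IReg 1)) (sizes ;; core q) Skip"

lemma finite_graph: "bipartite_graph n L R E \<Longrightarrow> finite E"
  unfolding bipartite_graph_def by (metis finite_Un finite_SigmaI finite_lessThan finite_subset)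

lemma obtain_max_weight_matching:
  assumes "finite E"
  obtains M where "is_matching E M" "max_matching_weight E w = matching_weight w M"
proof -
  have fin: "finite {M. is_matching E M}"
    by (rule finite_subset[of _ "Pow E"]) (auto simp: is_matching_def assms)
  moreover have "{} \<in> {M. is_matching E M}" by (simp add: is_matching_def)
  ultimately have "max_matching_weight E w \<in> matching_weight w ` {M. is_matching E M}"
    unfolding max_matching_weight_def by (intro Max_in) auto
  then show ?thesis using that by auto
qed

text \<open>In both cases the required weight is at most 0: the factor \<open>1 - \<epsilon>\<close>
  is not positive, or the optimum is 0.\<close>

lemma empty_approx:
  assumes "finite E" "\<And>e. e \<in> E \<Longrightarrow> 0 < w e" "1 \<le> \<epsilon> \<or> E = {}"
  shows "approx_max_weight_matching \<epsilon> E w {}"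
proof -
  obtain M where M: "is_matching E M" "max_matching_weight E w = matching_weight w M"
    using obtain_max_weight_matching[OF assms(1)] .
  have "0 \<le> matching_weight w M"
    unfolding matching_weight_def using M(1) assms(2) by (intro sum_nonneg) (auto simp: is_matching_def intro: less_imp_le)
  moreover have "matching_weight w M = 0" if "E = {}" using M(1) that by (auto simp: is_matching_def matching_weight_def)
  ultimately have "(1 - \<epsilon>) * max_matching_weight E w \<le> 0"
    using assms(3) M(2) by (auto simp: mult_nonpos_nonneg)
  then show ?thesis by (simp add: approx_max_weight_matching_def is_matching_def matching_weight_def)
qed

locale listed_graph =
  fixes n :: nat and L R :: "nat set" and E :: "(nat \<times> nat) set" and es :: "(nat \<times> nat) list"
  assumes graph: "bipartite_graph n L R E" and distinct: "distinct es" and set_es: "set es = E"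
    and nonempty: "es \<noteq> []"
begin

definition end_of :: "nat \<Rightarrow> nat" where
  "end_of g = (if g < length es then fst (es ! g) else snd (es ! (g - length es)))"

lemma end_of_simps [simp]: "e < length es \<Longrightarrow> end_of e = fst (es ! e)" "end_of (length es + e) = snd (es ! e)"
  by (simp_all add: end_of_def)

lemma edge_sides: "e < length es \<Longrightarrow> fst (es ! e) \<in> L \<and> snd (es ! e) \<in> R"
  using graph set_es nth_mem[of e es] unfolding bipartite_graph_def by (metis mem_Sigma_iff prod.collapse subsetD)

lemma disjoint: "L \<inter> R = {}" and vertices: "v \<in> L \<union> R \<Longrightarrow> v < n"
  using graph by (auto simp: bipartite_graph_def)

lemma half_edges: "half_edges n (length es) end_of"
proof
  show "0 < length es" using nonempty by simp
  show "end_of g < n" if "g < 2 * length es" for g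
    using that edge_sides[of g] edge_sides[of "g - length es"] vertices by (auto simp: end_of_def)
  show "end_of e \<noteq> end_of (length es + e')" if "e < length es" "e' < length es" for e e'
    using that edge_sides[of e] edge_sides[of e'] disjoint by auto
qed

sublocale half_edges n "length es" end_of by (rule half_edges)

lemma card_edges: "card E = length es"
  using distinct_card[OF distinct] set_es by simp

lemma n_ge_2: "2 \<le> n"
proof -
  have e: "fst (es ! 0) \<in> L" "snd (es ! 0) \<in> R" using edge_sides[of 0] nonempty by auto
  then have "fst (es ! 0) \<noteq> snd (es ! 0)" using disjoint by auto
  moreover have "fst (es ! 0) < n" "snd (es ! 0) < n" using e vertices by auto
  ultimately show ?thesis by linarith
qed

lemma edges_le: "length es \<le> n * n"
proof -
  have "card E \<le> card ({..<n} \<times> {..<n})"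
    using graph by (intro card_mono) (auto simp: bipartite_graph_def)
  then show ?thesis by (simp add: card_edges)
qed

text \<open>Two selected edges with a common end would put load 2 on it, so an integral vector of
  load 1 is the indicator of a matching. The guarantee for index sets carries over because listing
  the edges without repetition is injective.\<close>

lemma output_approx:
  assumes Y: "\<And>v. load Y v \<le> (1::nat)" and out: "\<And>e. e < length es \<Longrightarrow> imem \<mu> 3 e = int (Y e)"
    and w: "\<And>e. e \<in> E \<Longrightarrow> 0 < w e" and \<delta>: "\<delta> \<le> \<epsilon>"
    and opt: "\<And>A. matching_idx A \<Longrightarrow>
      (1 - \<delta>) * (\<Sum>e\<in>A. w (es ! e)) \<le> (\<Sum>e<length es. w (es ! e) * real (Y e))"
  shows "approx_max_weight_matching \<epsilon> E w (output_edges es \<mu>)"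
proof -
  let ?m = "length es"
  define I where "I = {e. e < ?m \<and> Y e = 1}"
  have one: "Y e \<le> 1" if "e < ?m" for e
  proof -
    have "e \<in> halves (end_of e)" using that by (simp add: halves_def)
    then have "Y (e mod ?m) \<le> load Y (end_of e)" unfolding load_def by (intro member_le_sum) auto
    then show ?thesis using Y[of "end_of e"] that by simp
  qed
  have out_I: "output_edges es \<mu> = (!) es ` I"
    unfolding output_edges_def I_def using out by auto
  have inj: "inj_on ((!) es) I" using distinct by (auto simp: inj_on_def I_def nth_eq_iff_index_eq)
  have conflict: "end_of g \<noteq> end_of g'" if "g < 2 * ?m" "g' < 2 * ?m" "g mod ?m \<in> I" "g' mod ?m \<in> I" "g \<noteq> g'" for g g'
  proof
    assume eq: "end_of g = end_of g'"
    have "(\<Sum>g\<in>{g, g'}. Y (g mod ?m)) \<le> load Y (end_of g)"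
      unfolding load_def using that eq by (intro sum_mono2) (auto simp: halves_def)
    then show False using that Y[of "end_of g"] by (simp add: I_def)
  qed
  have "is_matching E (output_edges es \<mu>)"
    unfolding is_matching_def out_I
  proof (intro conjI ballI impI)
    show "(!) es ` I \<subseteq> E" using set_es by (auto simp: I_def)
    fix x y assume "x \<in> (!) es ` I" "y \<in> (!) es ` I" "x \<noteq> y"
    then obtain i j where ij: "i \<in> I" "j \<in> I" "x = es ! i" "y = es ! j" "i \<noteq> j" by auto
    then have lt: "i < ?m" "j < ?m" by (simp_all add: I_def)
    have "fst x \<noteq> fst y" using conflict[of i j] ij lt by simp
    moreover have "snd x \<noteq> snd y" using conflict[of "?m + i" "?m + j"] ij lt by simp
    moreover have "fst x \<in> L" "snd x \<in> R" "fst y \<in> L" "snd y \<in> R"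
      using edge_sides[OF lt(1)] edge_sides[OF lt(2)] ij by simp_all
    ultimately show "{fst x, snd x} \<inter> {fst y, snd y} = {}" using disjoint by auto
  qed
  moreover have "(1 - \<epsilon>) * max_matching_weight E w \<le> matching_weight w (output_edges es \<mu>)"
  proof -
    obtain B where B: "is_matching E B" "max_matching_weight E w = matching_weight w B"
      using obtain_max_weight_matching[OF finite_graph[OF graph]] .
    define A where "A = {e. e < ?m \<and> es ! e \<in> B}"
    have "matching_idx A"
      unfolding matching_idx_def
    proof (intro conjI ballI impI)
      fix i j assume ij: "i \<in> A" "j \<in> A" "i \<noteq> j"
      then have "es ! i \<noteq> es ! j" using distinct by (simp add: A_def nth_eq_iff_index_eq)
      then have "{fst (es ! i), snd (es ! i)} \<inter> {fst (es ! j), snd (es ! j)} = {}"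
        using B(1) ij by (auto simp: is_matching_def A_def)
      then show "end_of i \<noteq> end_of j" "end_of (?m + i) \<noteq> end_of (?m + j)" using ij by (auto simp: A_def)
    qed (auto simp: A_def)
    note le = opt[OF this]
    have BE: "B \<subseteq> set es" using B(1) set_es by (simp add: is_matching_def)
    have "B = (!) es ` A" using BE by (auto simp: A_def in_set_conv_nth image_iff subset_iff) metis
    moreover have "inj_on ((!) es) A" using distinct by (auto simp: inj_on_def A_def nth_eq_iff_index_eq)
    ultimately have wB: "matching_weight w B = (\<Sum>e\<in>A. w (es ! e))"
      by (simp add: matching_weight_def sum.reindex)
    have "0 \<le> matching_weight w B"
      unfolding matching_weight_def using BE w set_es by (intro sum_nonneg) (auto intro: less_imp_le)
    then have "(1 - \<epsilon>) * matching_weight w B \<le> (1 - \<delta>) * matching_weight w B"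
      using \<delta> by (intro mult_right_mono) auto
    also have "\<dots> \<le> (\<Sum>e<?m. w (es ! e) * real (Y e))" using le wB by simp
    also have "\<dots> = (\<Sum>e\<in>I. w (es ! e))"
    proof -
      have "w (es ! e) * real (Y e) = (if e \<in> I then w (es ! e) else 0)" if "e < ?m" for e
        using one[OF that] that by (cases "Y e") (auto simp: I_def)
      then have "(\<Sum>e<?m. w (es ! e) * real (Y e)) = (\<Sum>e<?m. if e \<in> I then w (es ! e) else 0)"
        by (intro sum.cong) auto
      also have "\<dots> = (\<Sum>e\<in>{..<?m} \<inter> I. w (es ! e))" by (simp add: sum.inter_restrict)
      also have "{..<?m} \<inter> I = I" by (auto simp: I_def)
      finally show ?thesis .
    qed
    also have "\<dots> = matching_weight w (output_edges es \<mu>)"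
      unfolding matching_weight_def out_I using inj by (simp add: sum.reindex)
    finally show ?thesis using B(2) by simp
  qed
  ultimately show ?thesis by (simp add: approx_max_weight_matching_def)
qed

lemma obtain_size:
  obtains h where "2 * length es < 2 ^ h" "2 ^ h \<le> 4 * length es"
proof -
  define h where "h = (LEAST h. 2 * length es < 2 ^ h)"
  have 1: "2 * length es < 2 ^ h"
    unfolding h_def by (rule LeastI[of _ "2 * length es"]) simp
  obtain h' where h': "h = Suc h'" using 1 m_pos by (cases h) auto
  have "\<not> 2 * length es < 2 ^ h'" using not_less_Least[of h' "\<lambda>h. 2 * length es < 2 ^ h"] h' unfolding h_def by simp
  then have "2 ^ h \<le> 4 * length es" using h' by simp
  with 1 show ?thesis by (rule that)
qed

end

text \<open>\<open>U\<close> is 2 to the number of bits for \<open>d = 1\<close>. Expressing all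
  size bounds as powers of \<open>U\<close> reduces the choice of \<open>d\<close> to comparing
  exponents.\<close>

lemma word_bits_large:
  assumes \<epsilon>: "0 < \<epsilon>" "\<epsilon> < 1"
  obtains U :: nat where "2 ^ word_bits d n \<epsilon> = U ^ d" "n \<le> U" "4 \<le> U" "1 / \<epsilon> \<le> real U"
proof
  define l where "l = nat \<lceil>log 2 (real n + 2 + 1 / \<epsilon>)\<rceil>"
  define U :: nat where "U = 2 ^ l"
  have e: "1 < 1 / \<epsilon>" using \<epsilon> by simp
  have "log 2 (real n + 2 + 1 / \<epsilon>) \<le> real l" unfolding l_def by linarith
  then have "real n + 2 + 1 / \<epsilon> \<le> 2 powr real l"
    using e by (simp add: log_le_iff)
  then have U: "real n + 2 + 1 / \<epsilon> \<le> real U" by (simp add: U_def powr_realpow)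
  show "2 ^ word_bits d n \<epsilon> = U ^ d"
    unfolding word_bits_def U_def l_def by (simp add: power_mult[symmetric] mult.commute)
  show "n \<le> U" "1 / \<epsilon> \<le> real U" using U e by linarith+
  have "3 < U" using U e by linarith
  then show "4 \<le> U" by simp
qed

text \<open>The constants are at most \<open>U ^ 2\<close>, and \<open>q\<close>, \<open>h\<close>
  and \<open>2 ^ h\<close> at most \<open>U ^ 3\<close>, so the largest products are at most
  \<open>U ^ 11\<close>. The strict bound \<open>N < 2 ^ b\<close> then asks for one more factor,
  whence 12 as the constant of the word size.\<close>

lemma power_chain:
  fixes U :: nat
  assumes U: "4 \<le> U" and n: "n \<le> U" and m: "m \<le> n * n" and q: "q \<le> U ^ 3" and h: "2 ^ h \<le> 4 * m"
  shows "4 * 2 ^ h \<le> U ^ 11" "8 * q * q * 2 ^ h \<le> U ^ 11"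
    "2 * n * (q * (q + 2 * h + 1)) \<le> U ^ 11" "16 * q * q * h \<le> U ^ 11"
proof -
  have le: "U ^ i \<le> U ^ j" if "i \<le> j" for i j using that U by (intro power_increasing) auto
  have U2: "16 \<le> U ^ 2" using mult_mono[OF U U] by (simp add: power2_eq_square)
  have "m \<le> U * U" using m mult_mono[OF n n] by simp
  then have "4 * m \<le> U * (U * U)" using U by (intro mult_mono) auto
  then have P: "2 ^ h \<le> U ^ 3" using h by (simp add: numeral_3_eq_3)
  have "h < 2 ^ h" by simp
  then have hU: "h \<le> U ^ 3" using P by linarith
  have "4 * 2 ^ h \<le> U * U ^ 3" using U P by (intro mult_mono) auto
  also have "\<dots> = U ^ 4" by (simp add: eval_nat_numeral)
  also have "\<dots> \<le> U ^ 11" by (rule le) simp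
  finally show "4 * 2 ^ h \<le> U ^ 11" .
  have "8 * q * q * 2 ^ h \<le> U ^ 2 * U ^ 3 * U ^ 3 * U ^ 3" using U2 q P by (intro mult_mono) auto
  also have "\<dots> = U ^ 11" by (simp flip: power_add)
  finally show "8 * q * q * 2 ^ h \<le> U ^ 11" .
  have "16 * q * q * h \<le> U ^ 2 * U ^ 3 * U ^ 3 * U ^ 3" using U2 q hU by (intro mult_mono) auto
  also have "\<dots> = U ^ 11" by (simp flip: power_add)
  finally show "16 * q * q * h \<le> U ^ 11" .
  have "1 \<le> U ^ 3" using U by simp
  then have "q + 2 * h + 1 \<le> 4 * U ^ 3" using q hU by linarith
  also have "\<dots> \<le> U * U ^ 3" using U by simp
  finally have "2 * n * (q * (q + 2 * h + 1)) \<le> U * U * (U ^ 3 * (U * U ^ 3))"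
    using U n q by (intro mult_mono) auto
  also have "\<dots> = U ^ 9" by (simp add: eval_nat_numeral)
  also have "\<dots> \<le> U ^ 11" by (rule le) simp
  finally show "2 * n * (q * (q + 2 * h + 1)) \<le> U ^ 11" .
qed

lemma half_le_ln_2: "1 / 2 \<le> ln (2::real)"
proof -
  have "exp 1 \<le> (2 * 2 :: real)" using exp_le by simp
  then have "1 \<le> ln (2 * 2 :: real)" by (subst ln_ge_iff) auto
  then have "1 \<le> ln 2 + ln (2::real)" by (simp only: ln_mult_pos zero_less_numeral)
  then show ?thesis by linarith
qed

text \<open>\<open>l\<close> is the binary logarithm of \<open>n\<close> rounded up. Rounding at
  most doubles it because \<open>2 \<le> n\<close>, and passing to the natural logarithm costs
  another factor 2 by \<open>half_le_ln_2\<close>.\<close>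

lemma log_bounds:
  assumes n: "2 \<le> n" and h: "(2::nat) ^ h \<le> 4 * (n * n)"
  obtains l :: nat where "n \<le> 2 ^ l" "1 \<le> l" "real l \<le> 4 * ln n" "h \<le> 4 * l"
proof
  define l where "l = nat \<lceil>log 2 n\<rceil>"
  have lg: "1 \<le> log 2 n" using n by (simp add: le_log_iff)
  have l: "log 2 n \<le> real l" "real l < log 2 n + 1" unfolding l_def using lg by linarith+
  have "real n \<le> 2 powr l" using l(1) n by (simp add: log_le_iff)
  then have "real n \<le> real (2 ^ l)" by (simp add: powr_realpow)
  then show nl: "n \<le> 2 ^ l" by (simp only: of_nat_le_iff)
  have "1 \<le> real l" using l lg by linarith
  then show l1: "1 \<le> l" by simp
  have "2 * log 2 n \<le> 4 * ln n"
  proof -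
    have "ln n * 2 \<le> ln n * (4 * ln 2)" using n half_le_ln_2 by (intro mult_left_mono) auto
    then show ?thesis by (simp add: log_def field_simps)
  qed
  then show "real l \<le> 4 * ln n" using l lg by linarith
  have "(2::nat) ^ h \<le> 4 * (2 ^ l * 2 ^ l)"
    by (rule order_trans[OF h]) (intro mult_left_mono mult_mono nl; simp)
  also have "\<dots> = 2 ^ (2 + 2 * l)" by (simp add: power_add power_mult_distrib[symmetric] mult_2)
  finally have "h \<le> 2 + 2 * l" by (rule power_le_imp_le_exp[rotated]) simp
  then show "h \<le> 4 * l" using l1 by linarith
qed

text \<open>Every term is at most a constant times \<open>q * q * l\<close>; with
  \<open>h \<le> 4 * l\<close> these constants add up to 7553.\<close>

lemma cost_bound:
  fixes q l h :: nat
  assumes "1 \<le> q" "1 \<le> l" "h \<le> 4 * l"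
  shows "60 * (q * (q + 2 * h + 1)) + 100 * (l + 2 * q + 2 * h + 1) + 200 * (q * q * h) + 355 * (q + h) +
    640 * (q * h) + 618 \<le> 7600 * (q * q * l)"
proof -
  have q: "q \<le> q * q" using assms by simp
  have a: "1 \<le> q * q * l" "q * q \<le> q * q * l" "l \<le> q * q * l" using assms by simp_all
  have b: "q \<le> q * q * l" using q a(2) by linarith
  have "q * l \<le> q * q * l" using q by (intro mult_right_mono) auto
  moreover have "q * h \<le> 4 * (q * l)" using mult_le_mono2[OF assms(3), of q] by (simp only: mult_ac)
  moreover have "q * q * h \<le> 4 * (q * q * l)" using mult_le_mono2[OF assms(3), of "q * q"] by (simp only: mult_ac)
  ultimately have c: "q * h \<le> 4 * (q * q * l)" "q * q * h \<le> 4 * (q * q * l)" by linarith+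
  have e: "q * (q + 2 * h + 1) = q * q + 2 * (q * h) + q" by (simp add: algebra_simps)
  show ?thesis unfolding e distrib_left_numeral using a b c assms(3) by linarith
qed

context listed_graph
begin

lemma run_instance:
  assumes U: "n \<le> U" "4 \<le> U" "q \<le> U ^ 3" "2 ^ b = U ^ 12" and q: "2 \<le> q"
    and h: "2 * length es < 2 ^ h" "2 ^ h \<le> 4 * length es"
  shows "run n (length es) end_of b (int (U ^ 11)) q h (2 ^ h)"
proof -
  note le = power_chain[OF U(2,1) edges_le U(3) h(2)]
  have "U ^ 11 < U ^ 12" using U(2) by (intro power_strict_increasing) auto
  then have "int (U ^ 11) < int (2 ^ b)" unfolding U(4) by (simp only: of_nat_less_iff)
  then have lt: "int (U ^ 11) < 2 ^ b" by simp
  show ?thesis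
  proof (unfold_locales, goal_cases)
    case 1
    show ?case by (rule lt)
  next
    case 2
    show ?case by (rule q)
  next
    case 4
    show ?case by (rule h(1))
  next
    case 5
    show ?case by (rule h(2))
  next
    case 6
    show ?case using le(1) unfolding of_nat_le_iff[symmetric, where ?'a = int] by simp
  next
    case 7
    show ?case using le(2) unfolding of_nat_le_iff[symmetric, where ?'a = int] by simp
  next
    case 8
    show ?case using le(3) unfolding of_nat_le_iff[symmetric, where ?'a = int] by (simp add: algebra_simps)
  next
    case 9
    show ?case using le(4) unfolding of_nat_le_iff[symmetric, where ?'a = int] by simp
  qed simp
qed

lemma wp_approx_mwm:
  assumes \<epsilon>: "0 < \<epsilon>" "\<epsilon> < 1" and w: "\<And>e. e \<in> E \<Longrightarrow> 0 < w e"
  defines "q \<equiv> nat \<lceil>6 / \<epsilon>\<rceil>"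
  shows "wp (word_bits 12 n \<epsilon>) UNIV UNIV (approx_mwm q) (\<lambda>s' \<mu>' W D.
    approx_max_weight_matching \<epsilon> E w (output_edges es \<mu>') \<and>
    (\<exists>l. real l \<le> 4 * ln n \<and> W \<le> 4 * length es * (7600 * (q * q * l)) \<and> D \<le> 5 * l * (7600 * (q * q * l))))
    init_regs (input_mem n es w)"
proof -
  let ?m = "length es"
  let ?b = "word_bits 12 n \<epsilon>"
  let ?\<mu> = "input_mem n es w"
  obtain U :: nat where U: "2 ^ ?b = U ^ 12" "n \<le> U" "4 \<le> U" "1 / \<epsilon> \<le> real U"
    using word_bits_large[OF \<epsilon>, of 12 n] .
  have six: "6 < 6 / \<epsilon>" using \<epsilon> by (simp add: field_simps)
  have qr: "6 / \<epsilon> \<le> real q" "real q < 6 / \<epsilon> + 1" unfolding q_def using six by linarith+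
  then have "6 \<le> real q" using six by linarith
  then have q6: "6 \<le> q" by simp
  have "6 / \<epsilon> \<le> 6 * real U" using U(4) by simp
  then have "real q < real (6 * U + 1)" using qr by simp
  then have "q \<le> 6 * U" by linarith
  also have "\<dots> \<le> U ^ 2 * U"
    using mult_mono[OF U(3) U(3)] by (intro mult_right_mono) (simp_all add: power2_eq_square)
  also have "\<dots> = U ^ 3" by (simp add: eval_nat_numeral)
  finally have qU: "q \<le> U ^ 3" .
  obtain h where h: "2 * ?m < 2 ^ h" "2 ^ h \<le> 4 * ?m" using obtain_size .
  interpret run n ?m end_of ?b "int (U ^ 11)" q h "2 ^ h"
    using run_instance[OF U(2,3) qU U(1) _ h] q6 by simp
  have "2 ^ h \<le> 4 * (n * n)" using h(2) edges_le by linarith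
  then obtain l where l: "n \<le> 2 ^ l" "1 \<le> l" "real l \<le> 4 * ln n" "h \<le> 4 * l"
    using log_bounds[OF n_ge_2] by metis
  \<comment> \<open>The number of key bits: \<open>l\<close> for the vertex, and for the two factors
    of \<open>M\<close> the crude estimate \<open>x \<le> 2 ^ x\<close>, which suffices because
    other phases cost more.\<close>
  define e where "e = l + 2 * q + 2 * h + 1"
  have "n * M \<le> 2 ^ e"
  proof -
    have "q \<le> 2 ^ q" "q + 2 * h + 1 \<le> 2 ^ (q + 2 * h + 1)" by (rule less_imp_le, rule less_exp)+
    then have "n * M \<le> 2 ^ l * (2 ^ q * 2 ^ (q + 2 * h + 1))"
      unfolding M_def using l(1) by (intro mult_mono) auto
    also have "\<dots> = 2 ^ e" unfolding e_def power_add[symmetric] by (rule arg_cong) simp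
    finally show ?thesis .
  qed
  note L = this
  define K where "K = 60 * M + 100 * e + 200 * (q * q * h) + 355 * (q + h) + 640 * (q * h) + 600"
  have K: "K + 18 \<le> 7600 * (q * q * l)"
    using cost_bound[of q l h] q6 l(2,4) unfolding K_def e_def M_def by simp
  define s1 where "s1 = init_regs\<lparr>ireg := (ireg init_regs)(0 := int n, 1 := int ?m)\<rparr>"
  have s1: "ireg s1 0 = int n" "ireg s1 1 = int ?m" by (simp_all add: s1_def)
  let ?Q = "\<lambda>s' \<mu>' W D. approx_max_weight_matching \<epsilon> E w (output_edges es \<mu>') \<and> W \<le> 2 ^ h * K \<and> D \<le> (h + 1) * K"
  have core: "wp ?b UNIV UNIV (core q) ?Q s ?\<mu>" if s: "base s" for s
  proof (rule wp_mono[OF wp_core[OF q6 s, where w = "\<lambda>e. w (es ! e)" and L = e]], goal_cases)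
    case (1 e)
    then show ?case by (simp add: input_mem_def)
  next
    case (2 e)
    then show ?case by (simp add: input_mem_def)
  next
    case (3 e)
    then show ?case by (simp add: input_mem_def)
  next
    case (4 e)
    then show ?case using w[of "es ! e"] nth_mem[of e es] set_es by simp
  next
    case (5 i)
    then show ?case by (simp add: input_mem_def)
  next
    case (6 i)
    then show ?case by (simp add: input_mem_def)
  next
    case (7 i)
    then show ?case by (simp add: input_mem_def)
  next
    case 8
    then show ?case by (rule L)
  next
    case (9 s' \<mu>' W D)
    obtain Y where Y: "\<And>e. e < ?m \<Longrightarrow> imem \<mu>' 3 e = int (Y e)" "\<And>v. load Y v \<le> 1"
      "\<And>A. matching_idx A \<Longrightarrow> (1 - 6 / q) * (\<Sum>e\<in>A. w (es ! e)) \<le> (\<Sum>e<?m. w (es ! e) * real (Y e))"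
      using 9(1) by blast
    have "6 / real q \<le> \<epsilon>" using qr(1) \<epsilon> q6 by (simp add: field_simps)
    then have "approx_max_weight_matching \<epsilon> E w (output_edges es \<mu>')"
      using output_approx[of Y \<mu>' w "6 / q" \<epsilon>] Y w by blast
    then show ?case using 9(1) unfolding K_def by blast
  qed
  have run: "wp ?b UNIV UNIV (sizes ;; core q) (\<lambda>s' \<mu>' W D.
     approx_max_weight_matching \<epsilon> E w (output_edges es \<mu>') \<and>
     W + 4 \<le> 2 ^ h * (K + 18) \<and> D + 4 \<le> (h + 1) * (K + 18)) s1 ?\<mu>"
    unfolding wp_Seq
  proof (rule wp_mono[OF wp_sizes[OF s1]], goal_cases)
    case (1 s2 \<mu>2 W2 D2)
    note A2 = 1(1)
    have mu: "\<mu>2 = ?\<mu>" and b2: "base s2" using A2 by simp_all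
    show ?case unfolding mu
    proof (rule wp_mono[OF core[OF b2]], goal_cases)
      case (1 s3 \<mu>3 W3 D3)
      have "W2 \<le> 7 * h + 7" "D2 \<le> 7 * h + 7" using A2 by simp_all
      moreover have "h < 2 ^ h" "1 \<le> (2::nat) ^ h" by simp_all
      ultimately have "W2 + 4 \<le> 18 * 2 ^ h" "D2 + 4 \<le> 18 * h + 18" by linarith+
      moreover have "2 ^ h * (K + 18) = 2 ^ h * K + 18 * 2 ^ h" "(h + 1) * (K + 18) = (h + 1) * K + (18 * h + 18)"
        by (simp_all add: algebra_simps)
      moreover have "W3 \<le> 2 ^ h * K" "D3 \<le> (h + 1) * K" using 1(1) by blast+
      ultimately have "W2 + W3 + 4 \<le> 2 ^ h * (K + 18)" "D2 + D3 + 4 \<le> (h + 1) * (K + 18)" by linarith+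
      then show ?case using 1(1) by blast
    qed
  qed
  have f: "fits ?b (0::int)" "fits ?b (1::int)" "fits ?b (int ?m)" using bounds(1,4) by (simp_all add: fitsI0)
  have ld: "imem ?\<mu> 0 0 = int n" "imem ?\<mu> 0 1 = int ?m" by (simp_all add: input_mem_def)
  have "wp ?b UNIV UNIV (approx_mwm q) (\<lambda>s' \<mu>' W D.
      approx_max_weight_matching \<epsilon> E w (output_edges es \<mu>') \<and>
      W \<le> 2 ^ h * (K + 18) \<and> D \<le> (h + 1) * (K + 18)) init_regs ?\<mu>"
    unfolding approx_mwm_def wp_Seq[of _ _ _ "ILoad _ _ _"] wp_ILoad wp_Cond
    using f ld m_pos by simp (rule wp_mono[OF run[unfolded s1_def One_nat_def]]; auto)
  then show ?thesis
  proof (rule wp_mono, goal_cases)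
    case (1 s' \<mu>' W D)
    have "W \<le> 2 ^ h * (K + 18)" "D \<le> (h + 1) * (K + 18)" using 1(1) by blast+
    moreover have "2 ^ h * (K + 18) \<le> 4 * ?m * (7600 * (q * q * l))" by (rule mult_mono[OF h(2) K]) simp_all
    moreover have "(h + 1) * (K + 18) \<le> 5 * l * (7600 * (q * q * l))"
      by (rule mult_mono[OF _ K]) (use l in simp_all)
    ultimately have "W \<le> 4 * ?m * (7600 * (q * q * l)) \<and> D \<le> 5 * l * (7600 * (q * q * l))" by linarith
    then show ?case using 1(1) l(3) by blast
  qed
qed

end

lemma absorb_constant:
  fixes a c x :: real
  assumes "0 \<le> x" "c \<le> 100000000" "a \<le> c * x"
  shows "a \<le> 100000000 * (1 + x)"
proof -
  have "c * x \<le> 100000000 * x" using assms by (intro mult_right_mono)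
  then have "a \<le> 100000000 * x" using assms by linarith
  then show ?thesis unfolding distrib_left_numeral by linarith
qed

text \<open>From \<open>q \<le> 7 / \<epsilon>\<close> the square of \<open>q\<close> is at most
  \<open>49 / \<epsilon> ^ 7\<close>. For the depth, \<open>1 / 2 \<le> ln n\<close> turns the
  square of the logarithm into its cube. The resulting constants are 5958400 and 59584000, both
  below the common constant 100000000.\<close>

lemma final_cost:
  fixes q l m n :: nat and \<epsilon> :: real
  assumes \<epsilon>: "0 < \<epsilon>" "\<epsilon> < 1" and q: "q = nat \<lceil>6 / \<epsilon>\<rceil>" and l: "real l \<le> 4 * ln n" and n: "2 \<le> n"
  shows "real (4 * m * (7600 * (q * q * l))) \<le> 100000000 * (1 + real m * ln n / \<epsilon> ^ 7)"
    "real (5 * l * (7600 * (q * q * l))) \<le> 100000000 * (1 + ln n ^ 3 / \<epsilon> ^ 7)"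
proof -
  have one: "1 < 1 / \<epsilon>" using \<epsilon> by simp
  have "real q \<le> 7 / \<epsilon>" unfolding q using one by linarith
  then have "real q * real q \<le> (7 / \<epsilon>) * (7 / \<epsilon>)" using one \<epsilon> by (intro mult_mono) auto
  also have "\<dots> = 49 * (1 / \<epsilon>) ^ 2" by (simp add: power2_eq_square)
  also have "\<dots> \<le> 49 * (1 / \<epsilon>) ^ 7" using one by (intro mult_left_mono power_increasing) auto
  finally have qq: "real q * real q \<le> 49 / \<epsilon> ^ 7" by (simp add: power_divide)
  have ln: "1 / 2 \<le> ln n"
  proof -
    have "ln 2 \<le> ln (real n)" using n by (subst ln_le_cancel_iff) auto
    then show ?thesis using half_le_ln_2 by linarith
  qed
  have ql: "real q * real q * real l \<le> 49 / \<epsilon> ^ 7 * (4 * ln n)" using qq l \<epsilon> by (intro mult_mono) auto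
  have "real (4 * m * (7600 * (q * q * l))) = 30400 * real m * (real q * real q * real l)" by simp
  also have "\<dots> \<le> 30400 * real m * (49 / \<epsilon> ^ 7 * (4 * ln n))" using ql by (intro mult_left_mono) auto
  also have "\<dots> = 5958400 * (real m * ln n / \<epsilon> ^ 7)" by simp
  also have "\<dots> \<le> 100000000 * (1 + real m * ln n / \<epsilon> ^ 7)"
    by (rule absorb_constant[OF _ _ order_refl]) (use ln \<epsilon> in simp_all)
  finally show "real (4 * m * (7600 * (q * q * l))) \<le> 100000000 * (1 + real m * ln n / \<epsilon> ^ 7)" .
  have "real l * (real q * real q * real l) \<le> (4 * ln n) * (49 / \<epsilon> ^ 7 * (4 * ln n))"
    by (rule mult_mono[OF l ql]) (use ln in simp_all)
  also have "\<dots> = 784 * (ln n ^ 2 / \<epsilon> ^ 7)" by (simp add: power2_eq_square)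
  also have "\<dots> \<le> 784 * (2 * ln n ^ 3 / \<epsilon> ^ 7)"
  proof -
    have "ln n ^ 2 * (1 / 2) \<le> ln n ^ 2 * ln n" using ln by (intro mult_left_mono) auto
    then have "ln n ^ 2 \<le> 2 * ln n ^ 3" by (simp add: power2_eq_square power3_eq_cube)
    then show ?thesis using \<epsilon> by (intro mult_left_mono divide_right_mono) auto
  qed
  finally have "38000 * (real l * (real q * real q * real l)) \<le> 59584000 * (ln n ^ 3 / \<epsilon> ^ 7)" by simp
  then have "real (5 * l * (7600 * (q * q * l))) \<le> 59584000 * (ln n ^ 3 / \<epsilon> ^ 7)" by simp
  then show "real (5 * l * (7600 * (q * q * l))) \<le> 100000000 * (1 + ln n ^ 3 / \<epsilon> ^ 7)"
    by (rule absorb_constant[rotated 2]) (use ln \<epsilon> in simp_all)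
qed

text \<open>The additive 1 in the bounds pays for runs of constant cost, for which the main terms
  may vanish.\<close>

lemma trivial_cost: "30 \<le> 100000000 * (1 + real m * ln (real n) / \<epsilon> ^ 7)"
    "30 \<le> 100000000 * (1 + ln (real n) ^ 3 / \<epsilon> ^ 7)" if "0 < \<epsilon>"
proof -
  have "0 \<le> ln (real n)" by (cases n) simp_all
  then have "0 \<le> real m * ln (real n) / \<epsilon> ^ 7" "0 \<le> ln (real n) ^ 3 / \<epsilon> ^ 7" using that by simp_all
  moreover have "30 \<le> 100000000 * (1 + x)" if "0 \<le> x" for x :: real
    unfolding distrib_left_numeral using that by linarith
  ultimately show "30 \<le> 100000000 * (1 + real m * ln (real n) / \<epsilon> ^ 7)"
    "30 \<le> 100000000 * (1 + ln (real n) ^ 3 / \<epsilon> ^ 7)" by blast+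
qed

theorem theorem6:
  fixes p :: "real poly"
  shows "\<exists>(C::real) (d::nat). C > 0 \<and>
    (\<forall>\<epsilon>::real. \<epsilon> > 0 \<longrightarrow>
      (\<exists>P::cmd. \<forall>(n::nat) L R E (w :: nat \<times> nat \<Rightarrow> real).
        bipartite_graph n L R E \<and> (\<forall>e\<in>E. 0 < w e \<and> w e \<le> poly p (real n)) \<longrightarrow>
        computes_approx_mwm (word_bits d n \<epsilon>) P \<epsilon> n E w
          (C * (1 + real (card E) * ln (real n) / \<epsilon> ^ 7))
          (C * (1 + ln (real n) ^ 3 / \<epsilon> ^ 7))))"
proof (rule exI[of _ "100000000::real"], rule exI[of _ "12::nat"], intro conjI allI impI)
  fix \<epsilon> :: real assume \<epsilon>: "\<epsilon> > 0"
  \<comment> \<open>From \<open>\<epsilon> = 1\<close> on, the empty matching is good enough, and it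
    is what the unchanged memory encodes.\<close>
  define P where "P = (if \<epsilon> < 1 then approx_mwm (nat \<lceil>6 / \<epsilon>\<rceil>) else Skip)"
  have correct: "\<exists>s' \<mu>' W D Rd Wr. exec (word_bits 12 n \<epsilon>) P (init_regs, input_mem n es w) (s', \<mu>') (W, D) (Rd, Wr) \<and>
      approx_max_weight_matching \<epsilon> E w (output_edges es \<mu>') \<and>
      real W \<le> 100000000 * (1 + real (card E) * ln (real n) / \<epsilon> ^ 7) \<and>
      real D \<le> 100000000 * (1 + ln (real n) ^ 3 / \<epsilon> ^ 7)"
    if G: "bipartite_graph n L R E" and w: "\<forall>e\<in>E. 0 < w e \<and> w e \<le> poly p (real n)"
      and es: "distinct es" "set es = E" for n L R E w es
  proof -
    let ?b = "word_bits 12 n \<epsilon>"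
    note fin = finite_graph[OF G]
    have "wp ?b UNIV UNIV P (\<lambda>s' \<mu>' W D. approx_max_weight_matching \<epsilon> E w (output_edges es \<mu>') \<and>
      real W \<le> 100000000 * (1 + real (card E) * ln (real n) / \<epsilon> ^ 7) \<and>
      real D \<le> 100000000 * (1 + ln (real n) ^ 3 / \<epsilon> ^ 7)) init_regs (input_mem n es w)" (is "wp _ _ _ _ ?Q _ _")
    proof (cases "1 \<le> \<epsilon> \<or> E = {}")
      case True
      have out: "output_edges es (input_mem n es w) = {}" by (simp add: output_edges_def input_mem_def)
      have ok: "approx_max_weight_matching \<epsilon> E w (output_edges es (input_mem n es w))"
        unfolding out using fin w True by (intro empty_approx) auto
      have triv: "?Q s (input_mem n es w) W D" if "W \<le> 30" "D \<le> 30" for s :: regs and W D :: nat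
        using ok that trivial_cost(1)[OF \<epsilon>, of "card E" n] trivial_cost(2)[OF \<epsilon>, of n] by simp
      show ?thesis
      proof (cases "\<epsilon> < 1")
        case False
        then have "P = Skip" by (simp add: P_def)
        then show ?thesis unfolding \<open>P = Skip\<close> wp_Skip by (intro triv) simp_all
      next
        case lt: True
        have es0: "es = []" using True lt es by simp
        \<comment> \<open>Without edges there is no instance of \<open>run\<close> to provide word
          bounds, so that the constants 0 and 1 fit is checked directly.\<close>
        have "2 \<le> word_bits 12 n \<epsilon>"
        proof -
          obtain U :: nat where "2 ^ ?b = U ^ 12" "4 \<le> U" using word_bits_large[OF \<epsilon> lt, of 12 n] .
          then have "2 ^ 1 < (2::nat) ^ ?b" using power_mono[of 4 U 12] by simp
          then show ?thesis using power_less_imp_less_exp[of "2::nat" 1 ?b] by simp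
        qed
        then have f: "fits ?b 0" "fits ?b 1" by (simp_all add: fits_def one_less_power)
        have "imem (input_mem n es w) 0 1 = 0" by (simp add: input_mem_def es0)
        then show ?thesis using lt f unfolding P_def approx_mwm_def
          by (simp add: wp_simps del: One_nat_def) (use triv[where W = 5 and D = 5] in auto)
      qed
    next
      case False
      interpret listed_graph n L R E es by unfold_locales (use G es False in auto)
      have lt: "\<epsilon> < 1" using False by simp
      show ?thesis
        unfolding P_def if_P[OF lt]
      proof (rule wp_mono[OF wp_approx_mwm[OF \<epsilon> lt]], goal_cases)
        case (1 e)
        then show ?case using w by blast
      next
        case (2 s' \<mu>' W D)
        obtain l where l: "real l \<le> 4 * ln n" "W \<le> 4 * length es * (7600 * (nat \<lceil>6 / \<epsilon>\<rceil> * nat \<lceil>6 / \<epsilon>\<rceil> * l))"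
          "D \<le> 5 * l * (7600 * (nat \<lceil>6 / \<epsilon>\<rceil> * nat \<lceil>6 / \<epsilon>\<rceil> * l))" using 2(1) by blast
        note fc = final_cost[OF \<epsilon> lt refl l(1) n_ge_2]
        have "real W \<le> 100000000 * (1 + real (card E) * ln (real n) / \<epsilon> ^ 7)"
          using order_trans[OF _ fc(1)[of "length es"]] l(2) unfolding card_edges by (simp only: of_nat_le_iff)
        moreover have "real D \<le> 100000000 * (1 + ln (real n) ^ 3 / \<epsilon> ^ 7)"
          using order_trans[OF _ fc(2)] l(3) by (simp only: of_nat_le_iff)
        ultimately show ?case using 2(1) by blast
      qed
    qed
    then show ?thesis unfolding wp_def by blast
  qed
  show "\<exists>P::cmd. \<forall>(n::nat) L R E (w :: nat \<times> nat \<Rightarrow> real).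
        bipartite_graph n L R E \<and> (\<forall>e\<in>E. 0 < w e \<and> w e \<le> poly p (real n)) \<longrightarrow>
        computes_approx_mwm (word_bits 12 n \<epsilon>) P \<epsilon> n E w
          (100000000 * (1 + real (card E) * ln (real n) / \<epsilon> ^ 7))
          (100000000 * (1 + ln (real n) ^ 3 / \<epsilon> ^ 7))"
    unfolding computes_approx_mwm_def using correct by (intro exI[of _ P]) blast
qed simp

end
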